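(* Let $\pi:Y\to Z$ be a fibred manifold over a compact manifold $Z$ of dimension $p$, let $\boldsymbol\lambda\in\Omega^p_r(Z)$ be an $r$-th order Lagrangian, and let $S(\upsilon)=\int_Z (j_r\upsilon)^{\star}\boldsymbol\lambda$ be the Action functional on the space of smooth cross-sections $\upsilon$ of $Y$. Then for every smooth cross-section $\upsilon:Z\to Y$ and every variation $\mathfrak y\in\Gamma_\upsilon\{V_Z\}$ (a smooth lift $\mathfrak y:Z\to VY$ of $\upsilon$), the Fréchet derivative of $S$ at $\upsilon$ in the direction $\mathfrak y$ is $$\mathbf D S(\upsilon).\mathfrak y=\int_Z\Big\langle\,\big(\mathsf{is}^{-1}\circ j_r\mathfrak y\big)^{\tilde{}}\,,\,(j_r\upsilon)^{\star}\mathbf d_\pi\boldsymbol\lambda\,\Big\rangle .$$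
   Context: Everything is $C^\infty$. $\pi:Y\to Z$ is a surjective submersion. $\int_Z:\Omega^p(Z)\to\mathbb R$ is the linear functional of integration of $p$-forms over $Z$. $Y_r=J_r(Y)$ is the manifold of $r$-jets of cross-sections of $Y$, with projection $\pi_r:Y_r\to Z$; $j_r\upsilon:Z\to Y_r$ is the $r$-jet prolongation of a cross-section $\upsilon$. $V=VY=\ker T\pi$ and $V_r=V(Y_r)=\ker T\pi_r$ are the vertical tangent bundles. $V_Z$ denotes $VY$ regarded as fibred over $Z$ (through $VY\to Y\to Z$), and $\Gamma_\upsilon\{V_Z\}$ is the set of cross-sections $\mathfrak y:Z\to VY$ over $Z$ projecting onto $\upsilon$ under $\tau_Y:VY\to Y$. Semi-basic forms: $\Omega^d_r(Z)=\Gamma\{\pi_r^{-1}\wedge^dT^*Z\}$ (sections over $Y_r$ of the pulled-back bundle). A Lagrangian of order $r$ is $\boldsymbol\lambda\in\Omega^p_r(Z)$, $p=\dim Z$; equivalently a fibred morphism $\underline\lambda:Y_r\to\wedge^pT^*Z$ over $Z$. One has $(j_r\upsilon)^{\star}\boldsymbol\lambda=\underline\lambda\circ j_r\upsilon\in\Omega^p(Z)$. Fibre differential: $\mathbf d_\pi\boldsymbol\lambda\in\Gamma\{V_r^*\otimes\pi_r^{-1}\wedge^pT^*Z\}$ is defined by: if $\mathbf v\in V_r$ is tangent at $t=0$ to a curve $\sigma(t)$ lying in a single fibre of $Y_r\to Z$, then $\langle\mathbf v,\mathbf d_\pi\boldsymbol\lambda\rangle=\frac{d}{dt}(\underline\lambda\circ\sigma)(0)$.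 The pull-back $(j_r\upsilon)^{\star}\mathbf d_\pi\boldsymbol\lambda$ is the section $z\mapsto(\mathbf d_\pi\boldsymbol\lambda)(j_r\upsilon(z))$ of $(j_r\upsilon)^{-1}V_r^*\otimes\wedge^pT^*Z$. The isomorphism $\mathsf{is}:V_r\to J_r(V_Z)$: for a smooth family of cross-sections $\upsilon_t$ of $Y$ with $\upsilon_0=\upsilon$, $\mathsf{is}$ sends the tangent vector at $t=0$ to the curve $t\mapsto j_r\upsilon_t(z)$ to the jet $j_r\mathfrak y(z)$, where $\mathfrak y(z')$ is the tangent vector at $t=0$ to $t\mapsto\upsilon_t(z')$. Thus $\mathsf{is}^{-1}\circ j_r\mathfrak y:Z\to V_r$ is a vector field along $j_r\upsilon$, and $(\cdot)^{\tilde{}}$ denotes the corresponding cross-section of $(j_r\upsilon)^{-1}V_r$. $\langle\cdot,\cdot\rangle$ is the duality contraction of $V_r$ with $V_r^*$, producing here a $p$-form on $Z$. Fréchet derivative: if $\upsilon_t$ is a smooth one-parameter family of cross-sections with $\upsilon_0=\upsilon$ whose tangent vector at $t=0$ is $\mathfrak y$, then $\mathbf DS(\upsilon).\mathfrak y=\frac{d}{dt}S(\upsilon_t)|_{t=0}$. *)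

theory Defs
  imports
    "HOL-Analysis.Analysis"
    "HOL-Library.Multiset"
    "Jordan_Normal_Form.Determinant"
begin

section \<open>Smooth functions of finitely many real variables\<close>

text \<open>
  The dimension of a jet manifold depends on the order of the jets, so dimensions cannot be types.
  Euclidean space is the set of real families indexed by a finite set \<open>I\<close>, extended by zero;
  for \<open>I = {..<n}\<close> it is the topspace of the library's \<open>Euclidean_space n\<close>.
\<close>

definition coord_space :: "'i set \<Rightarrow> ('i \<Rightarrow> real) set" where
  "coord_space I = {x. \<forall>i. i \<notin> I \<longrightarrow> x i = 0}"

definition open_coord :: "'i set \<Rightarrow> ('i \<Rightarrow> real) set \<Rightarrow> bool" where
  "open_coord I S \<longleftrightarrow> openin (top_of_set (coord_space I)) S"

definition pd :: "'i \<Rightarrow> (('i \<Rightarrow> real) \<Rightarrow> real) \<Rightarrow> ('i \<Rightarrow> real) \<Rightarrow> real" where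
  "pd i f x = deriv (\<lambda>t. f (x(i := t))) (x i)"

fun pds :: "'i list \<Rightarrow> (('i \<Rightarrow> real) \<Rightarrow> real) \<Rightarrow> ('i \<Rightarrow> real) \<Rightarrow> real" where
  "pds [] f = f"
| "pds (i # is) f = pd i (pds is f)"

text \<open>All iterated partial derivatives exist and are continuous; used for open \<open>S\<close> only.\<close>

definition smooth_fun :: "'i set \<Rightarrow> ('i \<Rightarrow> real) set \<Rightarrow> (('i \<Rightarrow> real) \<Rightarrow> real) \<Rightarrow> bool" where
  "smooth_fun I S f \<longleftrightarrow>
     (\<forall>is \<in> lists I. continuous_on S (pds is f) \<and>
        (\<forall>i\<in>I. \<forall>x\<in>S. (\<lambda>t. pds is f (x(i := t))) differentiable (at (x i))))"


section \<open>Manifolds and smooth maps\<close>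

text \<open>A chart is a pair of its domain and its coordinate map.\<close>

type_synonym ('a, 'i) chart = "'a set \<times> ('a \<Rightarrow> 'i \<Rightarrow> real)"

record ('a, 'i) mfd =
  mcarrier :: "'a set"
  midx :: "'i set"
  matlas :: "('a, 'i) chart set"

abbreviation chart_inv :: "('a, 'i) chart \<Rightarrow> ('i \<Rightarrow> real) \<Rightarrow> 'a" where
  "chart_inv c \<equiv> inv_into (fst c) (snd c)"

definition is_chart :: "('a, 'i) mfd \<Rightarrow> ('a, 'i) chart \<Rightarrow> bool" where
  "is_chart M c \<longleftrightarrow>
     fst c \<subseteq> mcarrier M \<and> inj_on (snd c) (fst c) \<and> open_coord (midx M) (snd c ` fst c)"

definition smooth_transition :: "'i set \<Rightarrow> ('a, 'i) chart \<Rightarrow> ('a, 'i) chart \<Rightarrow> bool" where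
  "smooth_transition I c d \<longleftrightarrow>
     open_coord I (snd c ` (fst c \<inter> fst d)) \<and>
     (\<forall>i\<in>I. smooth_fun I (snd c ` (fst c \<inter> fst d)) (\<lambda>x. snd d (chart_inv c x) i))"

text \<open>The maximal atlas determined by \<open>matlas M\<close>.\<close>

definition charts :: "('a, 'i) mfd \<Rightarrow> ('a, 'i) chart set" where
  "charts M = {c. is_chart M c \<and>
     (\<forall>d\<in>matlas M. smooth_transition (midx M) c d \<and> smooth_transition (midx M) d c)}"

definition mtop :: "('a, 'i) mfd \<Rightarrow> 'a topology" where
  "mtop M = topology (\<lambda>S. S \<subseteq> mcarrier M \<and>
     (\<forall>c\<in>matlas M. open_coord (midx M) (snd c ` (S \<inter> fst c))))"

definition smooth_manifold :: "('a, nat) mfd \<Rightarrow> nat \<Rightarrow> bool" where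
  "smooth_manifold M n \<longleftrightarrow>
     midx M = {..<n} \<and> matlas M \<subseteq> charts M \<and> (\<Union>c\<in>matlas M. fst c) = mcarrier M \<and>
     Hausdorff_space (mtop M) \<and> second_countable (mtop M)"

text \<open>If \<open>smooth_map_on M N S f\<close> holds, then \<open>S\<close> is necessarily open in \<open>M\<close>.\<close>

definition smooth_map_on ::
  "('a, 'i) mfd \<Rightarrow> ('b, 'j) mfd \<Rightarrow> 'a set \<Rightarrow> ('a \<Rightarrow> 'b) \<Rightarrow> bool" where
  "smooth_map_on M N S f \<longleftrightarrow>
     (\<forall>x\<in>S. \<exists>c\<in>charts M. \<exists>d\<in>charts N.
        x \<in> fst c \<and> fst c \<subseteq> S \<and> f ` fst c \<subseteq> fst d \<and>
        (\<forall>j\<in>midx N. smooth_fun (midx M) (snd c ` fst c) (\<lambda>u. snd d (f (chart_inv c u)) j)))"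

definition real_mfd :: "(real, unit) mfd" where
  "real_mfd = \<lparr>mcarrier = UNIV, midx = UNIV, matlas = {(UNIV, \<lambda>t _. t)}\<rparr>"

definition prod_mfd :: "('a, 'i) mfd \<Rightarrow> ('b, 'j) mfd \<Rightarrow> ('a \<times> 'b, 'i + 'j) mfd" where
  "prod_mfd M N =
     \<lparr>mcarrier = mcarrier M \<times> mcarrier N, midx = midx M <+> midx N,
      matlas = {(fst c \<times> fst d, \<lambda>(a, b). case_sum (snd c a) (snd d b)) | c d.
                  c \<in> matlas M \<and> d \<in> matlas N}\<rparr>"


section \<open>Tangent vectors\<close>

text \<open>
  A tangent vector is its base point together with its components in every chart of the maximal
  atlas around the base point (and zero for all other arguments). The tangent space consists of the
  velocities of smooth curves, so the components transform by the Jacobian matrices.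
\<close>

type_synonym ('a, 'i) tvec = "'a \<times> (('a, 'i) chart \<Rightarrow> 'i \<Rightarrow> real)"

definition smooth_curve :: "('a, 'i) mfd \<Rightarrow> (real \<Rightarrow> 'a) \<Rightarrow> bool" where
  "smooth_curve M \<sigma> \<longleftrightarrow> (\<exists>\<epsilon>>0. smooth_map_on real_mfd M {-\<epsilon><..<\<epsilon>} \<sigma>)"

definition velocity :: "('a, 'i) mfd \<Rightarrow> (real \<Rightarrow> 'a) \<Rightarrow> ('a, 'i) tvec" where
  "velocity M \<sigma> =
     (\<sigma> 0, \<lambda>c i. if c \<in> charts M \<and> \<sigma> 0 \<in> fst c \<and> i \<in> midx M
                 then deriv (\<lambda>t. snd c (\<sigma> t) i) 0 else 0)"

definition tangent_space :: "('a, 'i) mfd \<Rightarrow> 'a \<Rightarrow> ('a, 'i) tvec set" where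
  "tangent_space M x = {velocity M \<sigma> | \<sigma>. smooth_curve M \<sigma> \<and> \<sigma> 0 = x}"

definition tvec_zero :: "'a \<Rightarrow> ('a, 'i) tvec" where
  "tvec_zero x = (x, \<lambda>c i. 0)"

text \<open>\<open>tvec_lin a v b w\<close> is \<open>a v + b w\<close> for \<open>v\<close> and \<open>w\<close> at the same base point.\<close>

definition tvec_lin ::
  "real \<Rightarrow> ('a, 'i) tvec \<Rightarrow> real \<Rightarrow> ('a, 'i) tvec \<Rightarrow> ('a, 'i) tvec" where
  "tvec_lin a v b w = (fst v, \<lambda>c i. a * snd v c i + b * snd w c i)"

definition tangent_map ::
  "('a, 'i) mfd \<Rightarrow> ('b, 'j) mfd \<Rightarrow> ('a \<Rightarrow> 'b) \<Rightarrow> ('a, 'i) tvec \<Rightarrow> ('b, 'j) tvec" where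
  "tangent_map M N f v = velocity N (f \<circ> (SOME \<sigma>. smooth_curve M \<sigma> \<and> velocity M \<sigma> = v))"

definition coord_vec :: "('a, 'i) mfd \<Rightarrow> ('a, 'i) chart \<Rightarrow> 'i \<Rightarrow> 'a \<Rightarrow> ('a, 'i) tvec" where
  "coord_vec M c i x = velocity M (\<lambda>t. chart_inv c ((snd c x)(i := snd c x i + t)))"

text \<open>The vertical tangent bundle, i.e. the kernel of the tangent map of \<open>f\<close>, as a set.\<close>

definition vertical :: "('a, 'i) mfd \<Rightarrow> ('b, 'j) mfd \<Rightarrow> ('a \<Rightarrow> 'b) \<Rightarrow> ('a, 'i) tvec set" where
  "vertical M N f =
     {v. fst v \<in> mcarrier M \<and> v \<in> tangent_space M (fst v) \<and>
         tangent_map M N f v = tvec_zero (f (fst v))}"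


section \<open>Fibred manifolds, sections and jets\<close>

definition fibred_manifold ::
  "('y, nat) mfd \<Rightarrow> ('z, nat) mfd \<Rightarrow> ('y \<Rightarrow> 'z) \<Rightarrow> bool" where
  "fibred_manifold Y Z \<pi> \<longleftrightarrow>
     (\<exists>m. smooth_manifold Y m) \<and> (\<exists>n. smooth_manifold Z n) \<and>
     smooth_map_on Y Z (mcarrier Y) \<pi> \<and> \<pi> ` mcarrier Y = mcarrier Z \<and>
     (\<forall>y\<in>mcarrier Y. tangent_map Y Z \<pi> ` tangent_space Y y = tangent_space Z (\<pi> y))"

text \<open>A cross-section is determined by its values on \<open>mcarrier Z\<close>; other values are irrelevant.\<close>

definition cross_section ::
  "('y, 'i) mfd \<Rightarrow> ('z, 'j) mfd \<Rightarrow> ('y \<Rightarrow> 'z) \<Rightarrow> ('z \<Rightarrow> 'y) \<Rightarrow> bool" where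
  "cross_section Y Z \<pi> s \<longleftrightarrow>
     smooth_map_on Z Y (mcarrier Z) s \<and> (\<forall>z\<in>mcarrier Z. \<pi> (s z) = z)"

definition local_section ::
  "('y, 'i) mfd \<Rightarrow> ('z, 'j) mfd \<Rightarrow> ('y \<Rightarrow> 'z) \<Rightarrow> 'z \<Rightarrow> ('z \<Rightarrow> 'y) \<Rightarrow> bool" where
  "local_section Y Z \<pi> z s \<longleftrightarrow>
     (\<exists>W. openin (mtop Z) W \<and> z \<in> W \<and> smooth_map_on Z Y W s \<and> (\<forall>z'\<in>W. \<pi> (s z') = z'))"

definition same_jet ::
  "('y, 'i) mfd \<Rightarrow> ('z, 'j) mfd \<Rightarrow> nat \<Rightarrow> 'z \<Rightarrow> ('z \<Rightarrow> 'y) \<Rightarrow> ('z \<Rightarrow> 'y) \<Rightarrow> bool" where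
  "same_jet Y Z r z s s' \<longleftrightarrow>
     s z = s' z \<and>
     (\<forall>c\<in>charts Z. \<forall>d\<in>charts Y. z \<in> fst c \<longrightarrow> s z \<in> fst d \<longrightarrow>
        (\<forall>is\<in>lists (midx Z). \<forall>i\<in>midx Y. length is \<le> r \<longrightarrow>
           pds is (\<lambda>x. snd d (s (chart_inv c x)) i) (snd c z) =
           pds is (\<lambda>x. snd d (s' (chart_inv c x)) i) (snd c z)))"

text \<open>A jet is its source together with the class of all local sections that represent it.\<close>

type_synonym ('z, 'y) jet = "'z \<times> ('z \<Rightarrow> 'y) set"

definition jet ::
  "('y, 'i) mfd \<Rightarrow> ('z, 'j) mfd \<Rightarrow> ('y \<Rightarrow> 'z) \<Rightarrow> nat \<Rightarrow> ('z \<Rightarrow> 'y) \<Rightarrow> 'z \<Rightarrow> ('z, 'y) jet" where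
  "jet Y Z \<pi> r s z = (z, {s'. local_section Y Z \<pi> z s' \<and> same_jet Y Z r z s s'})"

abbreviation (input) jet_rep :: "('z, 'y) jet \<Rightarrow> 'z \<Rightarrow> 'y" where
  "jet_rep w \<equiv> (SOME s. s \<in> snd w)"

definition fibred_charts ::
  "('y, nat) mfd \<Rightarrow> ('z, nat) mfd \<Rightarrow> ('y \<Rightarrow> 'z) \<Rightarrow> (('z, nat) chart \<times> ('y, nat) chart) set" where
  "fibred_charts Y Z \<pi> =
     {(c, d). c \<in> charts Z \<and> d \<in> charts Y \<and> \<pi> ` fst d \<subseteq> fst c \<and>
        (\<forall>y\<in>fst d. \<forall>i\<in>midx Z. snd d y i = snd c (\<pi> y) i)}"

text \<open>
  The manifold \<open>J\<^sub>r(Y)\<close>. The coordinates induced by fibred charts are the base coordinates and, for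
  every fibre coordinate \<open>a\<close> and multi-index \<open>\<alpha>\<close> of order at most \<open>r\<close> (a multiset of base indices),
  the derivative \<open>\<partial>\<^sup>\<alpha>\<close> of the \<open>a\<close>-th component of a representative. The projection \<open>\<pi>\<^sub>r\<close> is \<open>fst\<close>.
\<close>

definition jet_idx ::
  "('y, nat) mfd \<Rightarrow> ('z, nat) mfd \<Rightarrow> nat \<Rightarrow> (nat + nat \<times> nat multiset) set" where
  "jet_idx Y Z r =
     midx Z <+> ((midx Y - midx Z) \<times> {\<alpha>. set_mset \<alpha> \<subseteq> midx Z \<and> size \<alpha> \<le> r})"

definition jet_carrier ::
  "('y, nat) mfd \<Rightarrow> ('z, nat) mfd \<Rightarrow> ('y \<Rightarrow> 'z) \<Rightarrow> nat \<Rightarrow> ('z, 'y) jet set" where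
  "jet_carrier Y Z \<pi> r = {jet Y Z \<pi> r s z | s z. z \<in> mcarrier Z \<and> local_section Y Z \<pi> z s}"

definition jet_chart ::
  "('y, nat) mfd \<Rightarrow> ('z, nat) mfd \<Rightarrow> ('y \<Rightarrow> 'z) \<Rightarrow> nat \<Rightarrow> ('z, nat) chart \<Rightarrow> ('y, nat) chart \<Rightarrow>
   (('z, 'y) jet, nat + nat \<times> nat multiset) chart" where
  "jet_chart Y Z \<pi> r c d =
     ({w \<in> jet_carrier Y Z \<pi> r. fst w \<in> fst c \<and> jet_rep w (fst w) \<in> fst d},
      \<lambda>w k. if k \<in> jet_idx Y Z r
            then (case k of
                    Inl i \<Rightarrow> snd c (fst w) i
                  | Inr (a, \<alpha>) \<Rightarrow>
                      pds (sorted_list_of_multiset \<alpha>)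
                        (\<lambda>x. snd d (jet_rep w (chart_inv c x)) a) (snd c (fst w)))
            else 0)"

definition jet_mfd ::
  "('y, nat) mfd \<Rightarrow> ('z, nat) mfd \<Rightarrow> ('y \<Rightarrow> 'z) \<Rightarrow> nat \<Rightarrow>
   (('z, 'y) jet, nat + nat \<times> nat multiset) mfd" where
  "jet_mfd Y Z \<pi> r =
     \<lparr>mcarrier = jet_carrier Y Z \<pi> r, midx = jet_idx Y Z r,
      matlas = {jet_chart Y Z \<pi> r c d | c d. (c, d) \<in> fibred_charts Y Z \<pi>}\<rparr>"

text \<open>The vertical bundle \<open>V_r\<close> of the jet manifold.\<close>

definition jet_vertical ::
  "('y, nat) mfd \<Rightarrow> ('z, nat) mfd \<Rightarrow> ('y \<Rightarrow> 'z) \<Rightarrow> nat \<Rightarrow>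
   (('z, 'y) jet, nat + nat \<times> nat multiset) tvec set" where
  "jet_vertical Y Z \<pi> r = vertical (jet_mfd Y Z \<pi> r) Z fst"

text \<open>
  The manifold \<open>VY\<close>, with coordinates induced by fibred charts: the coordinates of the base point
  and the fibre components of the vector. Over \<open>Z\<close> it is fibred by \<open>\<pi> \<circ> fst\<close>.
\<close>

definition vert_mfd ::
  "('y, nat) mfd \<Rightarrow> ('z, nat) mfd \<Rightarrow> ('y \<Rightarrow> 'z) \<Rightarrow> (('y, nat) tvec, nat + nat) mfd" where
  "vert_mfd Y Z \<pi> =
     \<lparr>mcarrier = vertical Y Z \<pi>, midx = midx Y <+> (midx Y - midx Z),
      matlas = {({v \<in> vertical Y Z \<pi>. fst v \<in> fst d},
                 \<lambda>v. case_sum (snd d (fst v))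
                      (\<lambda>a. if a \<in> midx Y - midx Z then snd v d a else 0)) | c d.
                  (c, d) \<in> fibred_charts Y Z \<pi>}\<rparr>"

text \<open>The set \<open>\<Gamma>\<^sub>\<upsilon>{V_Z}\<close> of variations of \<open>\<upsilon>\<close>.\<close>

definition variation ::
  "('y, nat) mfd \<Rightarrow> ('z, nat) mfd \<Rightarrow> ('y \<Rightarrow> 'z) \<Rightarrow> ('z \<Rightarrow> 'y) \<Rightarrow> ('z \<Rightarrow> ('y, nat) tvec) \<Rightarrow> bool" where
  "variation Y Z \<pi> \<upsilon> \<eta> \<longleftrightarrow>
     smooth_map_on Z (vert_mfd Y Z \<pi>) (mcarrier Z) \<eta> \<and> (\<forall>z\<in>mcarrier Z. fst (\<eta> z) = \<upsilon> z)"

definition smooth_family_on ::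
  "('y, nat) mfd \<Rightarrow> ('z, nat) mfd \<Rightarrow> ('y \<Rightarrow> 'z) \<Rightarrow> 'z set \<Rightarrow> (real \<Rightarrow> 'z \<Rightarrow> 'y) \<Rightarrow> bool" where
  "smooth_family_on Y Z \<pi> W \<Upsilon> \<longleftrightarrow>
     (\<exists>\<epsilon>>0. smooth_map_on (prod_mfd real_mfd Z) Y ({-\<epsilon><..<\<epsilon>} \<times> W) (\<lambda>(t, z). \<Upsilon> t z) \<and>
            (\<forall>t\<in>{-\<epsilon><..<\<epsilon>}. \<forall>z\<in>W. \<pi> (\<Upsilon> t z) = z))"

text \<open>
  The isomorphism \<open>is : V_r \<rightarrow> J\<^sub>r(V_Z)\<close>. Jets are represented by local sections, so families of
  local sections are used; the result does not depend on the choice of the family.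
\<close>

definition jet_is ::
  "('y, nat) mfd \<Rightarrow> ('z, nat) mfd \<Rightarrow> ('y \<Rightarrow> 'z) \<Rightarrow> nat \<Rightarrow>
   (('z, 'y) jet, nat + nat \<times> nat multiset) tvec \<Rightarrow> ('z, ('y, nat) tvec) jet" where
  "jet_is Y Z \<pi> r v =
     (SOME \<xi>. \<exists>\<Upsilon> z W. openin (mtop Z) W \<and> z \<in> W \<and> smooth_family_on Y Z \<pi> W \<Upsilon> \<and>
        v = velocity (jet_mfd Y Z \<pi> r) (\<lambda>t. jet Y Z \<pi> r (\<Upsilon> t) z) \<and>
        \<xi> = jet (vert_mfd Y Z \<pi>) Z (\<pi> \<circ> fst) r (\<lambda>z'. velocity Y (\<lambda>t. \<Upsilon> t z')) z)"

definition jet_is_inv ::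
  "('y, nat) mfd \<Rightarrow> ('z, nat) mfd \<Rightarrow> ('y \<Rightarrow> 'z) \<Rightarrow> nat \<Rightarrow>
   ('z, ('y, nat) tvec) jet \<Rightarrow> (('z, 'y) jet, nat + nat \<times> nat multiset) tvec" where
  "jet_is_inv Y Z \<pi> r = inv_into (jet_vertical Y Z \<pi> r) (jet_is Y Z \<pi> r)"


section \<open>Differential forms, Lagrangians and integration\<close>

text \<open>
  A \<open>d\<close>-form at a point takes the list of its \<open>d\<close> arguments; outside lists of \<open>d\<close> vectors of the
  tangent space \<open>T\<close> its value is fixed to be zero.
\<close>

type_synonym ('a, 'i) cform = "('a, 'i) tvec list \<Rightarrow> real"

definition alt_forms :: "nat \<Rightarrow> ('a, 'i) tvec set \<Rightarrow> ('a, 'i) cform set" where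
  "alt_forms d T =
     {\<omega>. (\<forall>vs. \<not> (length vs = d \<and> set vs \<subseteq> T) \<longrightarrow> \<omega> vs = 0) \<and>
         (\<forall>vs i v w a b. length vs = d \<and> set vs \<subseteq> T \<and> i < d \<and> v \<in> T \<and> w \<in> T \<longrightarrow>
            \<omega> (vs[i := tvec_lin a v b w]) = a * \<omega> (vs[i := v]) + b * \<omega> (vs[i := w])) \<and>
         (\<forall>vs i j. length vs = d \<and> set vs \<subseteq> T \<and> i < j \<and> j < d \<and> vs ! i = vs ! j \<longrightarrow> \<omega> vs = 0)}"

text \<open>The set \<open>\<Omega>\<^sup>d\<^sub>r(Z)\<close>; smoothness means that the components in the coordinate frames are smooth.\<close>

definition semibasic_forms ::
  "('y, nat) mfd \<Rightarrow> ('z, nat) mfd \<Rightarrow> ('y \<Rightarrow> 'z) \<Rightarrow> nat \<Rightarrow> nat \<Rightarrow>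
   (('z, 'y) jet \<Rightarrow> ('z, nat) cform) set" where
  "semibasic_forms Y Z \<pi> r d =
     {L. (\<forall>w\<in>jet_carrier Y Z \<pi> r. L w \<in> alt_forms d (tangent_space Z (fst w))) \<and>
         (\<forall>c\<in>charts Z. \<forall>is\<in>lists (midx Z). length is = d \<longrightarrow>
            smooth_map_on (jet_mfd Y Z \<pi> r) real_mfd
              {w \<in> jet_carrier Y Z \<pi> r. fst w \<in> fst c}
              (\<lambda>w. L w (map (\<lambda>i. coord_vec Z c i (fst w)) is)))}"

definition fibre_diff ::
  "('y, nat) mfd \<Rightarrow> ('z, nat) mfd \<Rightarrow> ('y \<Rightarrow> 'z) \<Rightarrow> nat \<Rightarrow> (('z, 'y) jet \<Rightarrow> ('z, nat) cform) \<Rightarrow>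
   ('z, 'y) jet \<Rightarrow> (('z, 'y) jet, nat + nat \<times> nat multiset) tvec \<Rightarrow> ('z, nat) cform" where
  "fibre_diff Y Z \<pi> r L w v =
     (if v \<in> jet_vertical Y Z \<pi> r \<and> fst v = w
      then let \<sigma> = (SOME \<sigma>. smooth_curve (jet_mfd Y Z \<pi> r) \<sigma> \<and>
                             velocity (jet_mfd Y Z \<pi> r) \<sigma> = v \<and> (\<forall>t. fst (\<sigma> t) = fst w))
           in (\<lambda>vs. deriv (\<lambda>t. L (\<sigma> t) vs) 0)
      else (\<lambda>vs. 0))"

definition oriented_atlas :: "('z, nat) mfd \<Rightarrow> ('z, nat) chart set \<Rightarrow> bool" where
  "oriented_atlas Z A \<longleftrightarrow>
     A \<subseteq> charts Z \<and> (\<Union>c\<in>A. fst c) = mcarrier Z \<and>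
     (\<forall>c\<in>A. \<forall>d\<in>A. \<forall>x \<in> snd c ` (fst c \<inter> fst d).
        Determinant.det (Matrix.mat (card (midx Z)) (card (midx Z))
          (\<lambda>(i, j). pd j (\<lambda>u. snd d (chart_inv c u) i) x)) > 0)"

text \<open>A smooth partition of unity subordinate to charts \<open>c 0, \<dots>, c (n - 1)\<close> of \<open>A\<close>.\<close>

definition partition_of_unity ::
  "('z, nat) mfd \<Rightarrow> ('z, nat) chart set \<Rightarrow> nat \<Rightarrow> (nat \<Rightarrow> ('z, nat) chart) \<Rightarrow>
   (nat \<Rightarrow> 'z \<Rightarrow> real) \<Rightarrow> bool" where
  "partition_of_unity Z A n c \<rho> \<longleftrightarrow>
     (\<forall>k<n. c k \<in> A \<and> smooth_map_on Z real_mfd (mcarrier Z) (\<rho> k) \<and>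
        (\<forall>z\<in>mcarrier Z. 0 \<le> \<rho> k z) \<and>
        mtop Z closure_of {z \<in> mcarrier Z. \<rho> k z \<noteq> 0} \<subseteq> fst (c k)) \<and>
     (\<forall>z\<in>mcarrier Z. (\<Sum>k<n. \<rho> k z) = 1)"

text \<open>
  The Lebesgue integral over \<open>snd c ` fst c\<close> of the component of \<open>\<rho> \<omega>\<close> in the chart \<open>c\<close>. Points of
  the product measure are undefined, rather than zero, off the index set.
\<close>

definition chart_integral ::
  "('z, nat) mfd \<Rightarrow> ('z, nat) chart \<Rightarrow> ('z \<Rightarrow> real) \<Rightarrow> ('z \<Rightarrow> ('z, nat) cform) \<Rightarrow> real" where
  "chart_integral Z c \<rho> \<omega> =
     (LINT x|Pi\<^sub>M (midx Z) (\<lambda>_. lborel).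
        (let u = (\<lambda>i. if i \<in> midx Z then x i else 0); z = chart_inv c u
         in if u \<in> snd c ` fst c
            then \<rho> z * \<omega> z (map (\<lambda>i. coord_vec Z c i z) (sorted_list_of_set (midx Z)))
            else 0))"

text \<open>
  Integration of top-degree forms over a compact manifold oriented by \<open>A\<close>; by the change of variables
  formula the value does not depend on the chosen partition of unity.
\<close>

definition form_integral ::
  "('z, nat) mfd \<Rightarrow> ('z, nat) chart set \<Rightarrow> ('z \<Rightarrow> ('z, nat) cform) \<Rightarrow> real" where
  "form_integral Z A \<omega> =
     (let (n, c, \<rho>) = (SOME (n, c, \<rho>). partition_of_unity Z A n c \<rho>)
      in \<Sum>k<n. chart_integral Z (c k) (\<rho> k) \<omega>)"


section \<open>The action functional and its derivative\<close>

definition action ::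
  "('y, nat) mfd \<Rightarrow> ('z, nat) mfd \<Rightarrow> ('y \<Rightarrow> 'z) \<Rightarrow> nat \<Rightarrow> ('z, nat) chart set \<Rightarrow>
   (('z, 'y) jet \<Rightarrow> ('z, nat) cform) \<Rightarrow> ('z \<Rightarrow> 'y) \<Rightarrow> real" where
  "action Y Z \<pi> r A L \<upsilon> = form_integral Z A (\<lambda>z. L (jet Y Z \<pi> r \<upsilon> z))"

definition family_tangent_to ::
  "('y, nat) mfd \<Rightarrow> ('z, nat) mfd \<Rightarrow> ('y \<Rightarrow> 'z) \<Rightarrow> ('z \<Rightarrow> 'y) \<Rightarrow> ('z \<Rightarrow> ('y, nat) tvec) \<Rightarrow>
   (real \<Rightarrow> 'z \<Rightarrow> 'y) \<Rightarrow> bool" where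
  "family_tangent_to Y Z \<pi> \<upsilon> \<eta> \<Upsilon> \<longleftrightarrow>
     smooth_family_on Y Z \<pi> (mcarrier Z) \<Upsilon> \<and>
     (\<forall>z\<in>mcarrier Z. \<Upsilon> 0 z = \<upsilon> z \<and> velocity Y (\<lambda>t. \<Upsilon> t z) = \<eta> z)"

text \<open>
  \<open>DS(\<upsilon>).\<eta> = D\<close>: every smooth family through \<open>\<upsilon>\<close> with tangent \<open>\<eta>\<close> yields the derivative \<open>D\<close>.
  Such families are required to exist, so that \<open>D\<close> is unique.
\<close>

definition has_frechet_derivative_along ::
  "('y, nat) mfd \<Rightarrow> ('z, nat) mfd \<Rightarrow> ('y \<Rightarrow> 'z) \<Rightarrow> (('z \<Rightarrow> 'y) \<Rightarrow> real) \<Rightarrow> ('z \<Rightarrow> 'y) \<Rightarrow>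
   ('z \<Rightarrow> ('y, nat) tvec) \<Rightarrow> real \<Rightarrow> bool" where
  "has_frechet_derivative_along Y Z \<pi> S \<upsilon> \<eta> D \<longleftrightarrow>
     (\<exists>\<Upsilon>. family_tangent_to Y Z \<pi> \<upsilon> \<eta> \<Upsilon>) \<and>
     (\<forall>\<Upsilon>. family_tangent_to Y Z \<pi> \<upsilon> \<eta> \<Upsilon> \<longrightarrow>
        ((\<lambda>t. S (\<Upsilon> t)) has_real_derivative D) (at 0))"

end

theory Submission
  imports Defs
begin

text \<open>
  A smooth family \<open>\<Upsilon>\<^sub>t\<close> of sections gives a smooth family of jets. Since derivatives in time and along the
  base commute, the velocity of \<open>t \<mapsto> j\<^sub>r\<Upsilon>\<^sub>t(z)\<close> has the derivatives of the components of \<open>\<eta>\<close> as its components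
  in the coordinates induced by a fibred chart; hence it is the vector that \<open>is\<close> maps to \<open>j\<^sub>r\<eta>(z)\<close>, and the
  time derivative of the Lagrangian along the family is the fibre differential applied to this vector. A
  partition of unity and the compactness of \<open>Z\<close> reduce the derivative of the action to differentiation
  under finitely many integrals whose integrands are bounded and supported in a fixed cube.

  A family tangent to \<open>\<eta>\<close> is built chart by chart: for a partition of unity \<open>\<rho>\<^sub>0, \<dots>, \<rho>\<^sub>n\<^sub>-\<^sub>1\<close> whose supports lie
  in fibred charts around the section, \<open>t \<rho>\<^sub>k \<eta>\<close> is added successively to the fibre coordinates, and the
  velocities sum up to \<open>\<eta>\<close>.
\<close>

subsection \<open>Open sets and partial derivatives in coordinate spaces\<close>

text \<open>Smoothness is defined through one-variable derivatives along the axes, for families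
  whose index set depends on the order of the jets. The chain rule, the symmetry of mixed
  derivatives and the implicit function behind fibred charts are therefore all drawn from
  one-variable mean and intermediate values, one coordinate at a time. A second obstacle is choice:
  \<open>tangent_map\<close>, \<open>jet_is\<close>, \<open>fibre_diff\<close> and the
  representatives in \<open>jet_chart\<close> rest on \<open>SOME\<close>, so for each of them the
  outcome has to be shown to depend only on a velocity or on a jet. The partition of unity is
  different: \<open>form_integral\<close> picks it without looking at the form, so one and the same
  partition serves for all times and for the derivative. Finally \<open>jet_is_inv\<close> is an
  \<open>inv_into\<close>, which inverts \<open>jet_is\<close> only where that map is injective.
  Injectivity is reduced to families by showing that every vertical jet vector is the velocity of a
  family of sections; Taylor polynomials in a fibred chart supply such families, and they also
  describe the inverses of the jet charts.\<close>

lemma open_coord_iff: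
  assumes "finite I"
  shows "open_coord I S \<longleftrightarrow> S \<subseteq> coord_space I \<and>
    (\<forall>x\<in>S. \<exists>e>0. \<forall>y\<in>coord_space I. (\<forall>i\<in>I. \<bar>y i - x i\<bar> < e) \<longrightarrow> y \<in> S)"
proof
  assume "open_coord I S"
  then obtain T where T: "open T" "S = coord_space I \<inter> T"
    by (auto simp: open_coord_def openin_open)
  have "\<exists>e>0. \<forall>y\<in>coord_space I. (\<forall>i\<in>I. \<bar>y i - x i\<bar> < e) \<longrightarrow> y \<in> S" if "x \<in> S" for x
  proof -
    \<comment> \<open>Functions carry the product topology, so \<open>T\<close> contains an open box
      around \<open>x\<close>. Only its finitely many sides indexed by \<open>I\<close> matter:
      every point of \<open>coord_space I\<close> has the same zero coordinates as \<open>x\<close>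
      elsewhere.\<close>
    have "openin (product_topology (\<lambda>i. euclidean) UNIV) T" "x \<in> T"
      using T that by (auto simp: open_fun_def)
    from product_topology_open_contains_basis[OF this] obtain X where
      X: "x \<in> (\<Pi>\<^sub>E i\<in>UNIV. X i)" "\<And>i. open (X i)" "(\<Pi>\<^sub>E i\<in>UNIV. X i) \<subseteq> T" by auto
    have "\<forall>i. \<exists>e>0. \<forall>s. \<bar>s - x i\<bar> < e \<longrightarrow> s \<in> X i"
    proof
      fix i
      have "x i \<in> X i" using X(1) by auto
      with X(2)[of i] obtain e where "e > 0" "ball (x i) e \<subseteq> X i" by (meson openE)
      then show "\<exists>e>0. \<forall>s. \<bar>s - x i\<bar> < e \<longrightarrow> s \<in> X i"
        by (intro exI[of _ e]) (auto simp: subset_eq dist_real_def abs_minus_commute)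
    qed
    then obtain e where e: "\<And>i. e i > 0" "\<And>i s. \<bar>s - x i\<bar> < e i \<Longrightarrow> s \<in> X i" by metis
    \<comment> \<open>The inserted 1 keeps \<open>Min\<close> meaningful when \<open>I\<close> is
      empty.\<close>
    have "y \<in> S" if y: "y \<in> coord_space I" "\<forall>i\<in>I. \<bar>y i - x i\<bar> < Min (insert 1 (e ` I))" for y
    proof -
      have "y i \<in> X i" for i
      proof (cases "i \<in> I")
        case True
        have "Min (insert 1 (e ` I)) \<le> e i" using True assms by (intro Min_le) auto
        then show ?thesis using y(2) True e(2)[of "y i" i] by fastforce
      next
        case False
        then show ?thesis using y(1) \<open>x \<in> S\<close> T(2) X(1) by (auto simp: coord_space_def PiE_iff) metis
      qed
      then show ?thesis using X(3) y(1) T(2) by (auto simp: PiE_iff)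
    qed
    moreover have "Min (insert 1 (e ` I)) > 0" using assms e(1) by (subst Min_gr_iff) auto
    ultimately show ?thesis by blast
  qed
  then show "S \<subseteq> coord_space I \<and>
    (\<forall>x\<in>S. \<exists>e>0. \<forall>y\<in>coord_space I. (\<forall>i\<in>I. \<bar>y i - x i\<bar> < e) \<longrightarrow> y \<in> S)" using T by auto
next
  assume R: "S \<subseteq> coord_space I \<and>
    (\<forall>x\<in>S. \<exists>e>0. \<forall>y\<in>coord_space I. (\<forall>i\<in>I. \<bar>y i - x i\<bar> < e) \<longrightarrow> y \<in> S)"
  then obtain e where e: "\<And>x. x \<in> S \<Longrightarrow> e x > 0"
    "\<And>x y. x \<in> S \<Longrightarrow> y \<in> coord_space I \<Longrightarrow> (\<forall>i\<in>I. \<bar>y i - x i\<bar> < e x) \<Longrightarrow> y \<in> S" by metis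
  define T where "T = (\<Union>x\<in>S. \<Inter>i\<in>I. {y. \<bar>y i - x i\<bar> < e x})"
  have "open {y::'a \<Rightarrow> real. \<bar>y i - x i\<bar> < e x}" for x i
    by (intro open_Collect_less continuous_intros continuous_on_product_coordinates)
  then have "open T" unfolding T_def using assms by (intro open_UN open_INT ballI) auto
  moreover have "x \<in> S \<longleftrightarrow> x \<in> coord_space I \<and> x \<in> T" for x
  proof
    assume "x \<in> S"
    then show "x \<in> coord_space I \<and> x \<in> T" using R e(1) by (auto simp: T_def intro!: bexI[of _ x])
  qed (auto simp: T_def intro: e(2))
  then have "S = coord_space I \<inter> T" by blast
  ultimately show "open_coord I S" unfolding open_coord_def openin_open by blast
qed

lemma open_coordD:
  assumes "open_coord I S" "finite I" "x \<in> S"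
  obtains e where "e > 0" "\<And>y. y \<in> coord_space I \<Longrightarrow> (\<And>i. i \<in> I \<Longrightarrow> \<bar>y i - x i\<bar> < e) \<Longrightarrow> y \<in> S"
  using assms open_coord_iff[OF assms(2), of S] by metis

lemma open_coord_subset: "open_coord I S \<Longrightarrow> S \<subseteq> coord_space I"
  by (auto simp: open_coord_def openin_open)

lemma open_coord_Int: "open_coord I S \<Longrightarrow> open_coord I T \<Longrightarrow> open_coord I (S \<inter> T)"
  by (auto simp: open_coord_def)

lemma open_coord_locally:
  assumes "\<And>x. x \<in> S \<Longrightarrow> \<exists>T. open_coord I T \<and> x \<in> T \<and> T \<subseteq> S"
  shows "open_coord I S"
  unfolding open_coord_def using assms
  by (subst openin_subopen) (auto simp: open_coord_def)

lemma open_coord_preimage: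
  assumes "open_coord I S" "continuous_on S g" "open_coord J T" "g ` S \<subseteq> coord_space J"
  shows "open_coord I {x\<in>S. g x \<in> T}"
proof -
  obtain U where U: "open U" "T = coord_space J \<inter> U"
    using assms(3) by (auto simp: open_coord_def openin_open)
  have "openin (top_of_set S) (S \<inter> g -` U)"
    using continuous_openin_preimage_gen[OF assms(2) U(1)] .
  then have "openin (top_of_set (coord_space I)) (S \<inter> g -` U)"
    using assms(1) unfolding open_coord_def by (metis openin_trans)
  moreover have "S \<inter> g -` U = {x\<in>S. g x \<in> T}" using U assms(4) by auto
  ultimately show ?thesis by (simp add: open_coord_def)
qed

lemma fun_upd_in_coord_space: "x \<in> coord_space I \<Longrightarrow> i \<in> I \<Longrightarrow> x(i := t) \<in> coord_space I"
  by (auto simp: coord_space_def)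

text \<open>Continuity into a function space is tested coordinatewise, and the coordinates outside
  \<open>J\<close> are constantly zero.\<close>

lemma continuous_on_into_coord_space:
  assumes "\<And>j. j \<in> J \<Longrightarrow> continuous_on S (\<lambda>x. g x j)" "g ` S \<subseteq> coord_space J"
  shows "continuous_on S g"
proof (rule continuous_on_coordinatewise_then_product)
  fix j
  show "continuous_on S (\<lambda>x. g x j)"
  proof (cases "j \<in> J")
    case False
    then have "continuous_on S (\<lambda>x. g x j) \<longleftrightarrow> continuous_on S (\<lambda>x. 0::real)"
      using assms(2) by (intro continuous_on_cong) (auto simp: coord_space_def)
    then show ?thesis by simp
  qed (use assms in auto)
qed

lemma eventually_fun_upd_in_open_coord:
  assumes "open_coord I S" "finite I" "x \<in> S" "i \<in> I"
  shows "eventually (\<lambda>t. x(i := t) \<in> S) (nhds (x i))"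
proof -
  obtain e where e: "e > 0" "\<And>y. y \<in> coord_space I \<Longrightarrow> (\<And>i. i \<in> I \<Longrightarrow> \<bar>y i - x i\<bar> < e) \<Longrightarrow> y \<in> S"
    using open_coordD[OF assms(1-3)] by metis
  have "x(i := t) \<in> S" if "dist t (x i) < e" for t
    by (rule e(2)) (use that assms e(1) open_coord_subset[OF assms(1)]
        in \<open>auto simp: dist_real_def intro!: fun_upd_in_coord_space\<close>)
  then show ?thesis using e(1) by (auto simp: eventually_nhds_metric)
qed

text \<open>\<open>pd\<close> is a \<open>deriv\<close> and has some value even where nothing is
  differentiable. Stating existence and value together lets the differentiation rules be
  chained.\<close>

definition has_pd :: "'i \<Rightarrow> (('i \<Rightarrow> real) \<Rightarrow> real) \<Rightarrow> real \<Rightarrow> ('i \<Rightarrow> real) \<Rightarrow> bool" where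
  "has_pd i f D x \<longleftrightarrow> ((\<lambda>t. f (x(i := t))) has_real_derivative D) (at (x i))"

lemma pd_eqI: "has_pd i f D x \<Longrightarrow> pd i f x = D"
  by (auto simp: has_pd_def pd_def intro: DERIV_imp_deriv)

lemma has_pd_pd_iff: "has_pd i f (pd i f x) x \<longleftrightarrow> (\<lambda>t. f (x(i := t))) differentiable (at (x i))"
  by (simp add: has_pd_def pd_def DERIV_deriv_iff_real_differentiable)

lemma has_pd_cong:
  assumes "open_coord I S" "finite I" "x \<in> S" "i \<in> I" "\<And>y. y \<in> S \<Longrightarrow> f y = g y"
  shows "has_pd i f D x \<longleftrightarrow> has_pd i g D x"
proof -
  have "eventually (\<lambda>t. f (x(i := t)) = g (x(i := t))) (nhds (x i))"
    by (rule eventually_mono[OF eventually_fun_upd_in_open_coord[OF assms(1-4)]]) (use assms(5) in auto)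
  then show ?thesis unfolding has_pd_def by (intro DERIV_cong_ev) auto
qed

lemma pd_cong:
  assumes "open_coord I S" "finite I" "x \<in> S" "i \<in> I" "\<And>y. y \<in> S \<Longrightarrow> f y = g y"
  shows "pd i f x = pd i g x"
proof -
  have "eventually (\<lambda>t. f (x(i := t)) = g (x(i := t))) (nhds (x i))"
    by (rule eventually_mono[OF eventually_fun_upd_in_open_coord[OF assms(1-4)]]) (use assms(5) in auto)
  then show ?thesis unfolding pd_def by (intro deriv_cong_ev) auto
qed

lemma pds_cong:
  assumes "open_coord I S" "finite I" "x \<in> S" "is \<in> lists I" "\<And>y. y \<in> S \<Longrightarrow> f y = g y"
  shows "pds is f x = pds is g x"
  using assms(3,4)
proof (induction "is" arbitrary: x)
  case (Cons i "is")
  then show ?case using pd_cong[OF assms(1,2), of x i "pds is f" "pds is g"] by auto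
qed (use assms in auto)

lemma pds_append: "pds (is @ js) f = pds is (pds js f)"
  by (induction "is") auto


subsection \<open>Functions of class \<open>C\<^sup>k\<close>\<close>

text \<open>\<open>smooth_fun\<close> speaks about lists of derivatives of one fixed function,
  whereas the derivatives of products and composites are sums of products of other functions. The
  recursion on the order, with the function free to change, is what makes inductions for such
  operations possible.\<close>

fun Ck :: "nat \<Rightarrow> 'i set \<Rightarrow> ('i \<Rightarrow> real) set \<Rightarrow> (('i \<Rightarrow> real) \<Rightarrow> real) \<Rightarrow> bool" where
  "Ck 0 I S f = continuous_on S f"
| "Ck (Suc k) I S f = (continuous_on S f \<and>
     (\<forall>i\<in>I. (\<forall>x\<in>S. has_pd i f (pd i f x) x) \<and> Ck k I S (pd i f)))"

lemma Ck_imp_continuous: "Ck k I S f \<Longrightarrow> continuous_on S f"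
  by (cases k) auto

lemma Ck_SucD: "Ck (Suc k) I S f \<Longrightarrow> Ck k I S f"
  by (induction k arbitrary: f) auto

lemma smooth_fun_iff_Ck: "smooth_fun I S f \<longleftrightarrow> (\<forall>k. Ck k I S f)"
proof
  assume "smooth_fun I S f"
  \<comment> \<open>Generalised to all iterated derivatives, because each step of \<open>Ck\<close>
    passes from \<open>pds is f\<close> to \<open>pds (i # is) f\<close>.\<close>
  then have "Ck k I S (pds is f)" if "is \<in> lists I" for k "is"
    using that
  proof (induction k arbitrary: "is")
    case 0
    then show ?case by (auto simp: smooth_fun_def)
  next
    case (Suc k)
    have "Ck k I S (pd i (pds is f))" if "i \<in> I" for i
      using Suc(1)[of "i # is"] that Suc(2,3) by simp
    then show ?case using Suc(2,3) by (simp add: smooth_fun_def has_pd_pd_iff)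
  qed
  from this[of "[]"] show "\<forall>k. Ck k I S f" by simp
next
  assume R: "\<forall>k. Ck k I S f"
  have "\<forall>k. Ck k I S (pds is f)" if "is \<in> lists I" for "is"
    using that
  proof (induction "is")
    case (Cons i "is")
    then show ?case by (metis Ck.simps(2) Cons_in_lists_iff pds.simps(2))
  qed (use R in simp)
  then have "\<forall>is\<in>lists I. \<forall>i\<in>I. \<forall>x\<in>S. has_pd i (pds is f) (pd i (pds is f) x) x"
    by (metis Ck.simps(2))
  then show "smooth_fun I S f" unfolding smooth_fun_def has_pd_pd_iff[symmetric]
    by (metis \<open>\<And>is. is \<in> lists I \<Longrightarrow> \<forall>k. Ck k I S (pds is f)\<close> Ck.simps(1))
qed

lemma Ck_subset: "Ck k I S f \<Longrightarrow> T \<subseteq> S \<Longrightarrow> Ck k I T f"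
  by (induction k arbitrary: f) (auto intro: continuous_on_subset)

lemma smooth_fun_subset: "smooth_fun I S f \<Longrightarrow> T \<subseteq> S \<Longrightarrow> smooth_fun I T f"
  by (auto simp: smooth_fun_iff_Ck intro: Ck_subset)

lemma smooth_fun_continuous: "smooth_fun I S f \<Longrightarrow> continuous_on S f"
  by (metis smooth_fun_iff_Ck Ck.simps(1))

lemma smooth_fun_pd: "smooth_fun I S f \<Longrightarrow> i \<in> I \<Longrightarrow> smooth_fun I S (pd i f)"
  by (metis smooth_fun_iff_Ck Ck.simps(2))

lemma smooth_fun_pds: "smooth_fun I S f \<Longrightarrow> is \<in> lists I \<Longrightarrow> smooth_fun I S (pds is f)"
  by (induction "is") (auto intro: smooth_fun_pd)

lemma smooth_fun_has_pd: "smooth_fun I S f \<Longrightarrow> i \<in> I \<Longrightarrow> x \<in> S \<Longrightarrow> has_pd i f (pd i f x) x"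
  by (metis smooth_fun_iff_Ck Ck.simps(2))

section \<open>Differentiation rules and closure of smooth functions under algebraic
  operations\<close>

lemma has_pd_add: "has_pd i f D x \<Longrightarrow> has_pd i g E x \<Longrightarrow> has_pd i (\<lambda>x. f x + g x) (D + E) x"
  unfolding has_pd_def by (rule DERIV_add)

lemma has_pd_mult:
  "has_pd i f D x \<Longrightarrow> has_pd i g E x \<Longrightarrow> has_pd i (\<lambda>x. f x * g x) (D * g x + f x * E) x"
  unfolding has_pd_def by (auto intro!: derivative_eq_intros)

lemma has_pd_const: "has_pd i (\<lambda>x. a) 0 x"
  unfolding has_pd_def by (auto intro!: derivative_eq_intros)

lemma has_pd_proj: "has_pd i (\<lambda>x. x j) (if i = j then 1 else 0) x"
  unfolding has_pd_def by (auto intro!: derivative_eq_intros)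

lemma has_pd_sum:
  "(\<And>a. a \<in> A \<Longrightarrow> has_pd i (f a) (D a) x) \<Longrightarrow> has_pd i (\<lambda>x. \<Sum>a\<in>A. f a x) (\<Sum>a\<in>A. D a) x"
  unfolding has_pd_def by (rule DERIV_sum)

lemma has_pd_inverse:
  "has_pd i f D x \<Longrightarrow> f x \<noteq> 0 \<Longrightarrow> has_pd i (\<lambda>x. inverse (f x)) (- D * (inverse (f x) * inverse (f x))) x"
  unfolding has_pd_def using DERIV_inverse'[of "\<lambda>t. f (x(i := t))" D "x i" UNIV] by (simp add: mult_ac)

context
  fixes I :: "'i set" and S :: "('i \<Rightarrow> real) set"
  assumes fin: "finite I" and op: "open_coord I S"
begin

text \<open>Openness of \<open>S\<close> enters because \<open>pd\<close> at a point of
  \<open>S\<close> depends on the function along a short segment around it, which has to stay in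
  \<open>S\<close>.\<close>

lemma Ck_cong: "(\<And>x. x \<in> S \<Longrightarrow> f x = g x) \<Longrightarrow> Ck k I S f \<longleftrightarrow> Ck k I S g"
proof (induction k arbitrary: f g)
  case 0
  then show ?case unfolding Ck.simps by (intro continuous_on_cong refl)
next
  case (Suc k)
  have pe: "pd i f x = pd i g x" if "i \<in> I" "x \<in> S" for i x
    by (rule pd_cong[OF op fin that(2,1)]) (rule Suc(2))
  have "has_pd i f (pd i f x) x \<longleftrightarrow> has_pd i g (pd i g x) x" if "i \<in> I" "x \<in> S" for i x
    unfolding pe[OF that] by (rule has_pd_cong[OF op fin that(2,1)]) (rule Suc(2))
  moreover have "continuous_on S f = continuous_on S g"
    by (rule continuous_on_cong[OF refl]) (rule Suc(2))
  moreover have "Ck k I S (pd i f) \<longleftrightarrow> Ck k I S (pd i g)" if "i \<in> I" for i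
    by (rule Suc(1)) (rule pe[OF that])
  ultimately show ?case unfolding Ck.simps by blast
qed

lemma smooth_fun_cong: "(\<And>x. x \<in> S \<Longrightarrow> f x = g x) \<Longrightarrow> smooth_fun I S f \<longleftrightarrow> smooth_fun I S g"
  by (auto simp: smooth_fun_iff_Ck Ck_cong[of f g])

text \<open>Allows any formula \<open>g i\<close> for the derivative in place of the literal
  \<open>pd i f\<close>; on the open set \<open>S\<close> the two are interchangeable.\<close>

lemma Ck_SucI:
  assumes "continuous_on S f" "\<And>i x. i \<in> I \<Longrightarrow> x \<in> S \<Longrightarrow> has_pd i f (g i x) x"
    "\<And>i. i \<in> I \<Longrightarrow> Ck k I S (g i)"
  shows "Ck (Suc k) I S f"
proof -
  have pe: "pd i f x = g i x" if "i \<in> I" "x \<in> S" for i x using assms(2) that pd_eqI by metis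
  then have "Ck k I S (pd i f)" if "i \<in> I" for i
    using that assms(3)[OF that] Ck_cong[of "pd i f" "g i"] by auto
  then show ?thesis using assms pe by auto
qed

lemma Ck_const: "Ck k I S (\<lambda>x. a)"
proof (induction k arbitrary: a)
  case (Suc k)
  show ?case by (rule Ck_SucI[of _ "\<lambda>i x. 0"]) (auto simp: has_pd_const Suc)
qed auto

lemma Ck_proj: "Ck k I S (\<lambda>x. x j)"
proof (cases k)
  case (Suc k)
  show ?thesis unfolding Suc
    by (rule Ck_SucI[of _ "\<lambda>i x. if i = j then 1 else 0"])
      (auto simp: has_pd_proj Ck_const intro: continuous_on_subset[OF continuous_on_product_coordinates])
qed (auto intro: continuous_on_subset[OF continuous_on_product_coordinates])

lemma Ck_add: "Ck k I S f \<Longrightarrow> Ck k I S g \<Longrightarrow> Ck k I S (\<lambda>x. f x + g x)"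
proof (induction k arbitrary: f g)
  case (Suc k)
  have "continuous_on S (\<lambda>x. f x + g x)" using Suc(2,3) by (intro continuous_intros) auto
  then show ?case using Suc by (intro Ck_SucI[of _ "\<lambda>i x. pd i f x + pd i g x"] has_pd_add) auto
qed (auto intro: continuous_on_add)

lemma Ck_sum: "(\<And>a. a \<in> A \<Longrightarrow> Ck k I S (f a)) \<Longrightarrow> Ck k I S (\<lambda>x. \<Sum>a\<in>A. f a x)"
  by (induction A rule: infinite_finite_induct) (auto intro: Ck_add Ck_const)

lemma Ck_mult: "Ck k I S f \<Longrightarrow> Ck k I S g \<Longrightarrow> Ck k I S (\<lambda>x. f x * g x)"
proof (induction k arbitrary: f g)
  case (Suc k)
  have "Ck k I S f" "Ck k I S g" using Suc(2,3) Ck_SucD by blast+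
  then have "Ck k I S (\<lambda>x. pd i f x * g x + f x * pd i g x)" if "i \<in> I" for i
    using Suc that by (intro Ck_add Suc(1)) auto
  moreover have "continuous_on S (\<lambda>x. f x * g x)" using Suc(2,3) by (intro continuous_intros) auto
  ultimately show ?case using Suc(2,3)
    by (intro Ck_SucI[of _ "\<lambda>i x. pd i f x * g x + f x * pd i g x"] has_pd_mult) auto
qed (auto intro: continuous_on_mult)

text \<open>The derivative of the reciprocal is a product of \<open>pd i f\<close> with two copies
  of the reciprocal itself, which is of class \<open>Ck k\<close> by induction.\<close>

lemma Ck_inverse: "Ck k I S f \<Longrightarrow> (\<And>x. x \<in> S \<Longrightarrow> f x \<noteq> 0) \<Longrightarrow> Ck k I S (\<lambda>x. inverse (f x))"
proof (induction k)
  case (Suc k)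
  then have "Ck k I S f" using Ck_SucD by blast
  then have k: "Ck k I S (\<lambda>x. inverse (f x))" using Suc by auto
  have m: "Ck k I S (\<lambda>x. - pd i f x)" if "i \<in> I" for i
    using Ck_mult[OF Ck_const[of k "-1"], of "pd i f"] Suc(2) that by simp
  have "continuous_on S (\<lambda>x. inverse (f x))"
    using Suc(2,3) by (intro continuous_on_inverse) auto
  then show ?case using Suc(2,3)
    by (intro Ck_SucI[of _ "\<lambda>i x. - pd i f x * (inverse (f x) * inverse (f x))"]
        has_pd_inverse Ck_mult m k) auto
qed (auto intro!: continuous_on_inverse)

lemma smooth_fun_const: "smooth_fun I S (\<lambda>x. a)"
  by (simp add: smooth_fun_iff_Ck Ck_const)

lemma smooth_fun_proj: "smooth_fun I S (\<lambda>x. x j)"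
  by (simp add: smooth_fun_iff_Ck Ck_proj)

lemma smooth_fun_add: "smooth_fun I S f \<Longrightarrow> smooth_fun I S g \<Longrightarrow> smooth_fun I S (\<lambda>x. f x + g x)"
  by (simp add: smooth_fun_iff_Ck Ck_add)

lemma smooth_fun_mult: "smooth_fun I S f \<Longrightarrow> smooth_fun I S g \<Longrightarrow> smooth_fun I S (\<lambda>x. f x * g x)"
  by (simp add: smooth_fun_iff_Ck Ck_mult)

lemma smooth_fun_diff:
  assumes "smooth_fun I S f" "smooth_fun I S g"
  shows "smooth_fun I S (\<lambda>x. f x - g x)"
  using smooth_fun_add[OF assms(1) smooth_fun_mult[OF smooth_fun_const[of "-1"] assms(2)]] by simp

lemma smooth_fun_sum:
  "(\<And>a. a \<in> A \<Longrightarrow> smooth_fun I S (f a)) \<Longrightarrow> smooth_fun I S (\<lambda>x. \<Sum>a\<in>A. f a x)"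
  by (simp add: smooth_fun_iff_Ck Ck_sum)

lemma smooth_fun_prod:
  "(\<And>a. a \<in> A \<Longrightarrow> smooth_fun I S (f a)) \<Longrightarrow> smooth_fun I S (\<lambda>x. \<Prod>a\<in>A. f a x)"
  by (induction A rule: infinite_finite_induct) (auto intro: smooth_fun_const smooth_fun_mult)

lemma smooth_fun_power: "smooth_fun I S f \<Longrightarrow> smooth_fun I S (\<lambda>x. f x ^ n)"
  by (induction n) (auto intro: smooth_fun_const smooth_fun_mult)

lemma smooth_fun_inverse:
  "smooth_fun I S f \<Longrightarrow> (\<And>x. x \<in> S \<Longrightarrow> f x \<noteq> 0) \<Longrightarrow> smooth_fun I S (\<lambda>x. inverse (f x))"
  by (simp add: smooth_fun_iff_Ck Ck_inverse)

end

lemmas smooth_fun_intros = smooth_fun_const smooth_fun_proj smooth_fun_add smooth_fun_mult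
  smooth_fun_diff smooth_fun_sum smooth_fun_prod smooth_fun_power

lemma smooth_fun_divide:
  assumes "finite I" "open_coord I S" "smooth_fun I S f" "smooth_fun I S g" "\<And>x. x \<in> S \<Longrightarrow> g x \<noteq> 0"
  shows "smooth_fun I S (\<lambda>x. f x / g x)"
  unfolding divide_inverse using assms by (intro smooth_fun_mult smooth_fun_inverse)

text \<open>\<open>has_pd\<close> at a point does not mention a domain, so only the continuity
  clauses need an argument: a relatively open \<open>T\<close> is a neighbourhood of its points
  within \<open>S\<close>.\<close>

lemma Ck_locally:
  assumes "\<And>x. x \<in> S \<Longrightarrow> \<exists>T. open_coord I T \<and> x \<in> T \<and> T \<subseteq> S \<and> Ck k I T f" "S \<subseteq> coord_space I"
  shows "Ck k I S f"
  using assms(1)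
proof (induction k arbitrary: f)
  have cont: "continuous_on S f"
    if *: "\<And>x. x \<in> S \<Longrightarrow> \<exists>T. open_coord I T \<and> x \<in> T \<and> T \<subseteq> S \<and> continuous_on T f" for f
  proof (unfold continuous_on_def, intro ballI)
    fix x assume "x \<in> S"
    then obtain T where T: "open_coord I T" "x \<in> T" "T \<subseteq> S" "continuous_on T f" using * by blast
    obtain U where U: "open U" "T = coord_space I \<inter> U"
      using T(1) by (auto simp: open_coord_def openin_open)
    have "at x within S = at x within T"
      by (rule at_within_nhd[of x U]) (use U T assms(2) in auto)
    then show "(f \<longlongrightarrow> f x) (at x within S)" using T by (auto simp: continuous_on_def)
  qed
  {
    case 0
    then show ?case using cont[of f] by simp
  next
    case (Suc k)
    have "Ck k I S (pd i f)" if "i \<in> I" for i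
      by (rule Suc(1)) (use Suc(2) that in fastforce)
    moreover have "has_pd i f (pd i f x) x" if "i \<in> I" "x \<in> S" for i x
      using Suc(2)[OF that(2)] that by auto
    moreover have "continuous_on S f" using Suc(2) by (intro cont) (meson Ck_imp_continuous)
    ultimately show ?case by auto
  }
qed

lemma smooth_fun_locally:
  assumes "\<And>x. x \<in> S \<Longrightarrow> \<exists>T. open_coord I T \<and> x \<in> T \<and> T \<subseteq> S \<and> smooth_fun I T f" "S \<subseteq> coord_space I"
  shows "smooth_fun I S f"
  unfolding smooth_fun_iff_Ck
proof
  fix k show "Ck k I S f"
    by (rule Ck_locally[OF _ assms(2)]) (use assms(1) in \<open>auto simp: smooth_fun_iff_Ck\<close>, blast)
qed

subsection \<open>The chain rule\<close>

text \<open>The increment of a coordinate may have either sign or vanish, hence unordered endpoints;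
  the intermediate point may then be an endpoint.\<close>

lemma MVT_unordered:
  fixes g :: "real \<Rightarrow> real"
  assumes "\<And>t. min a b \<le> t \<Longrightarrow> t \<le> max a b \<Longrightarrow> (g has_real_derivative g' t) (at t)"
  shows "\<exists>\<xi>. min a b \<le> \<xi> \<and> \<xi> \<le> max a b \<and> g b - g a = g' \<xi> * (b - a)"
proof (cases a b rule: linorder_cases)
  case less
  have "\<exists>z. a < z \<and> z < b \<and> g b - g a = (b - a) * g' z"
    by (rule MVT2[OF less]) (use less in \<open>auto intro!: assms\<close>)
  then obtain z where "a < z" "z < b" "g b - g a = (b - a) * g' z" by blast
  then show ?thesis using less by (intro exI[of _ z]) (auto simp: mult.commute)
next
  case greater
  have "\<exists>z. b < z \<and> z < a \<and> g a - g b = (a - b) * g' z"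
    by (rule MVT2[OF greater]) (use greater in \<open>auto intro!: assms\<close>)
  then obtain z where "b < z" "z < a" "g a - g b = (a - b) * g' z" by blast
  then show ?thesis using greater by (intro exI[of _ z]) (auto simp: algebra_simps)
qed auto

lemma continuous_on_open_coordD:
  assumes "continuous_on T g" "open_coord J T" "finite J" "x \<in> T" "0 < (\<epsilon>::real)"
  obtains \<delta> where "\<delta> > 0"
    "\<And>y. y \<in> coord_space J \<Longrightarrow> (\<And>i. i \<in> J \<Longrightarrow> \<bar>y i - x i\<bar> < \<delta>) \<Longrightarrow> y \<in> T \<and> \<bar>g y - g x\<bar> < \<epsilon>"
proof -
  have "openin (top_of_set T) (T \<inter> g -` {g x - \<epsilon><..<g x + \<epsilon>})"
    using assms(1) by (intro continuous_openin_preimage_gen) auto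
  then have "open_coord J (T \<inter> g -` {g x - \<epsilon><..<g x + \<epsilon>})"
    using assms(2) unfolding open_coord_def by (metis openin_trans)
  moreover have "x \<in> T \<inter> g -` {g x - \<epsilon><..<g x + \<epsilon>}" using assms(4,5) by auto
  ultimately obtain \<delta> where "\<delta> > 0" and \<delta>: "\<And>y. y \<in> coord_space J \<Longrightarrow> (\<And>i. i \<in> J \<Longrightarrow> \<bar>y i - x i\<bar> < \<delta>) \<Longrightarrow>
      y \<in> T \<inter> g -` {g x - \<epsilon><..<g x + \<epsilon>}"
    using open_coordD[OF _ assms(3)] by metis
  have "y \<in> T \<and> \<bar>g y - g x\<bar> < \<epsilon>" if "y \<in> coord_space J" "\<And>i. i \<in> J \<Longrightarrow> \<bar>y i - x i\<bar> < \<delta>" for y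
    using \<delta>[OF that] by (simp add: abs_less_iff)
  then show thesis using \<open>\<delta> > 0\<close> by (rule that[rotated])
qed

text \<open>The way from \<open>x\<close> to \<open>y\<close> is split into moves along single axes,
  with the mean value theorem applied to each. The intermediate points are no farther from
  \<open>x\<close> than \<open>y\<close> in any coordinate, which keeps them in \<open>T\<close> and
  lets them converge to \<open>x\<close> together with \<open>y\<close>.\<close>

lemma increment_expansion:
  assumes "finite J" "open_coord J T" "x \<in> T"
    and pd: "\<And>j y. j \<in> J \<Longrightarrow> y \<in> T \<Longrightarrow> has_pd j f (D j y) y"
  shows "\<exists>e P. e > 0 \<and> (\<forall>y\<in>coord_space J. (\<forall>j\<in>J. \<bar>y j - x j\<bar> < e) \<longrightarrow>
       f y - f x = (\<Sum>j\<in>J. P y j * (y j - x j)) \<and>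
       (\<forall>j\<in>J. \<exists>\<xi>\<in>T. (\<forall>i\<in>J. \<bar>\<xi> i - x i\<bar> \<le> \<bar>y i - x i\<bar>) \<and> P y j = D j \<xi>))"
proof -
  obtain e where e: "e > 0" "\<And>y. y \<in> coord_space J \<Longrightarrow> (\<And>i. i \<in> J \<Longrightarrow> \<bar>y i - x i\<bar> < e) \<Longrightarrow> y \<in> T"
    using open_coordD[OF assms(2,1,3)] by metis
  have xc: "x \<in> coord_space J" using assms open_coord_subset by blast
  have main: "\<exists>P. f y - f x = (\<Sum>j\<in>J. P j * (y j - x j)) \<and>
       (\<forall>j\<in>J. \<exists>\<xi>\<in>T. (\<forall>i\<in>J. \<bar>\<xi> i - x i\<bar> \<le> \<bar>y i - x i\<bar>) \<and> P j = D j \<xi>)"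
    if y: "y \<in> coord_space J" "\<And>j. j \<in> J \<Longrightarrow> \<bar>y j - x j\<bar> < e" for y
  proof -
    \<comment> \<open>The coordinates in \<open>A\<close> have already been moved to their values in
      \<open>y\<close>; the induction moves one more.\<close>
    define w where "w A = (\<lambda>i. if i \<in> A then y i else x i)" for A
    have "\<exists>P. f (w A) - f x = (\<Sum>j\<in>A. P j * (y j - x j)) \<and>
       (\<forall>j\<in>A. \<exists>\<xi>\<in>T. (\<forall>i\<in>J. \<bar>\<xi> i - x i\<bar> \<le> \<bar>y i - x i\<bar>) \<and> P j = D j \<xi>)" if "finite A" "A \<subseteq> J" for A
      using that
    proof (induction A)
      case empty
      have "w {} = x" by (auto simp: w_def)
      then show ?case by simp
    next
      case (insert j A)
      then obtain P where P: "f (w A) - f x = (\<Sum>j\<in>A. P j * (y j - x j))"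
        "\<forall>j\<in>A. \<exists>\<xi>\<in>T. (\<forall>i\<in>J. \<bar>\<xi> i - x i\<bar> \<le> \<bar>y i - x i\<bar>) \<and> P j = D j \<xi>" by auto
      have box: "(w A)(j := t) \<in> T \<and> (\<forall>i\<in>J. \<bar>((w A)(j := t)) i - x i\<bar> \<le> \<bar>y i - x i\<bar>)"
        if "min (x j) (y j) \<le> t" "t \<le> max (x j) (y j)" for t
      proof
        show *: "\<forall>i\<in>J. \<bar>((w A)(j := t)) i - x i\<bar> \<le> \<bar>y i - x i\<bar>"
          using that by (auto simp: w_def)
        have "(w A)(j := t) \<in> coord_space J"
          using y(1) xc insert(4) by (auto simp: coord_space_def w_def)
        then show "(w A)(j := t) \<in> T" using * y(2) by (intro e(2)) (blast intro: le_less_trans)+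
      qed
      have "\<exists>\<xi>. min (x j) (y j) \<le> \<xi> \<and> \<xi> \<le> max (x j) (y j) \<and>
          f ((w A)(j := y j)) - f ((w A)(j := x j)) = D j ((w A)(j := \<xi>)) * (y j - x j)"
      proof (rule MVT_unordered)
        fix t assume "min (x j) (y j) \<le> t" "t \<le> max (x j) (y j)"
        then have "has_pd j f (D j ((w A)(j := t))) ((w A)(j := t))" using box insert(4) pd by auto
        then show "((\<lambda>a. f ((w A)(j := a))) has_real_derivative D j ((w A)(j := t))) (at t)"
          by (simp add: has_pd_def)
      qed
      then obtain t where t: "min (x j) (y j) \<le> t" "t \<le> max (x j) (y j)"
        "f ((w A)(j := y j)) - f ((w A)(j := x j)) = D j ((w A)(j := t)) * (y j - x j)" by blast
      have *: "(w A)(j := y j) = w (insert j A)" "(w A)(j := x j) = w A" using insert(2) by (auto simp: w_def)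
      have "f (w (insert j A)) - f x = (\<Sum>k\<in>insert j A. (P(j := D j ((w A)(j := t)))) k * (y k - x k))"
      proof -
        have "(\<Sum>k\<in>A. (P(j := D j ((w A)(j := t)))) k * (y k - x k)) = (\<Sum>k\<in>A. P k * (y k - x k))"
          by (rule sum.cong[OF refl]) (use insert(2) in auto)
        with t(3) P(1) insert(1,2) show ?thesis
          unfolding * by simp
      qed
      moreover have "\<forall>k\<in>insert j A. \<exists>\<xi>\<in>T. (\<forall>i\<in>J. \<bar>\<xi> i - x i\<bar> \<le> \<bar>y i - x i\<bar>) \<and> (P(j := D j ((w A)(j := t)))) k = D k \<xi>"
      proof
        fix k assume "k \<in> insert j A"
        then show "\<exists>\<xi>\<in>T. (\<forall>i\<in>J. \<bar>\<xi> i - x i\<bar> \<le> \<bar>y i - x i\<bar>) \<and> (P(j := D j ((w A)(j := t)))) k = D k \<xi>"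
          using P(2) box[OF t(1,2)] insert(2) by (cases "k = j") (auto simp del: fun_upd_apply simp: fun_upd_same fun_upd_other)
      qed
      ultimately show ?case by blast
    qed
    from this[OF assms(1) order_refl] have "\<exists>P. f (w J) - f x = (\<Sum>j\<in>J. P j * (y j - x j)) \<and>
       (\<forall>j\<in>J. \<exists>\<xi>\<in>T. (\<forall>i\<in>J. \<bar>\<xi> i - x i\<bar> \<le> \<bar>y i - x i\<bar>) \<and> P j = D j \<xi>)" .
    moreover have "w J = y" using y(1) xc by (auto simp: w_def coord_space_def)
    ultimately show ?thesis by simp
  qed
  \<comment> \<open>Fixes one choice of coefficients for each \<open>y\<close>, so that limits of
    \<open>P y j\<close> along a curve make sense.\<close>
  define P where "P y = (SOME P. f y - f x = (\<Sum>j\<in>J. P j * (y j - x j)) \<and>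
       (\<forall>j\<in>J. \<exists>\<xi>\<in>T. (\<forall>i\<in>J. \<bar>\<xi> i - x i\<bar> \<le> \<bar>y i - x i\<bar>) \<and> P j = D j \<xi>))" for y
  have "f y - f x = (\<Sum>j\<in>J. P y j * (y j - x j)) \<and>
       (\<forall>j\<in>J. \<exists>\<xi>\<in>T. (\<forall>i\<in>J. \<bar>\<xi> i - x i\<bar> \<le> \<bar>y i - x i\<bar>) \<and> P y j = D j \<xi>)"
    if "y \<in> coord_space J" "\<And>j. j \<in> J \<Longrightarrow> \<bar>y j - x j\<bar> < e" for y
    using someI_ex[OF main[OF that]] unfolding P_def .
  then show ?thesis using e(1) by (intro exI[of _ e] exI[of _ P] conjI ballI impI) auto
qed

text \<open>After division of the increment expansion by \<open>t - t0\<close>, the coefficients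
  converge by continuity of the \<open>D j\<close> and the quotients by differentiability of the
  components of the curve.\<close>

lemma chain_rule_curve:
  assumes "finite J" "open_coord J T" "\<gamma> t0 \<in> T"
    and pd: "\<And>j y. j \<in> J \<Longrightarrow> y \<in> T \<Longrightarrow> has_pd j f (D j y) y"
    and cont: "\<And>j. j \<in> J \<Longrightarrow> continuous_on T (D j)"
    and ev: "eventually (\<lambda>t. \<gamma> t \<in> coord_space J) (at t0)"
    and der: "\<And>j. j \<in> J \<Longrightarrow> ((\<lambda>t. \<gamma> t j) has_real_derivative \<gamma>' j) (at t0)"
  shows "((\<lambda>t. f (\<gamma> t)) has_real_derivative (\<Sum>j\<in>J. D j (\<gamma> t0) * \<gamma>' j)) (at t0)"
proof -
  obtain e P where e: "e > 0" and P: "\<forall>y\<in>coord_space J. (\<forall>j\<in>J. \<bar>y j - \<gamma> t0 j\<bar> < e) \<longrightarrow>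
       f y - f (\<gamma> t0) = (\<Sum>j\<in>J. P y j * (y j - \<gamma> t0 j)) \<and>
       (\<forall>j\<in>J. \<exists>\<xi>\<in>T. (\<forall>i\<in>J. \<bar>\<xi> i - \<gamma> t0 i\<bar> \<le> \<bar>y i - \<gamma> t0 i\<bar>) \<and> P y j = D j \<xi>)"
    using increment_expansion[where J=J and D=D and x="\<gamma> t0" and f=f, OF assms(1-3) pd] by blast
  have near: "eventually (\<lambda>t. \<gamma> t \<in> coord_space J \<and> (\<forall>j\<in>J. \<bar>\<gamma> t j - \<gamma> t0 j\<bar> < \<delta>)) (at t0)" if "\<delta> > 0" for \<delta>
  proof (rule eventually_conj[OF ev])
    have "eventually (\<lambda>t. \<bar>\<gamma> t j - \<gamma> t0 j\<bar> < \<delta>) (at t0)" if "j \<in> J" for j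
    proof -
      have "((\<lambda>t. \<gamma> t j) \<longlongrightarrow> \<gamma> t0 j) (at t0)" using DERIV_isCont[OF der[OF that]] by (simp add: isCont_def)
      from tendstoD[OF this \<open>\<delta> > 0\<close>] show ?thesis by (simp add: dist_real_def)
    qed
    then show "eventually (\<lambda>t. \<forall>j\<in>J. \<bar>\<gamma> t j - \<gamma> t0 j\<bar> < \<delta>) (at t0)"
      using assms(1) by (simp add: eventually_ball_finite)
  qed
  have lim: "((\<lambda>t. P (\<gamma> t) j) \<longlongrightarrow> D j (\<gamma> t0)) (at t0)" if j: "j \<in> J" for j
  proof (rule tendstoI)
    fix \<epsilon> :: real assume "\<epsilon> > 0"
    then obtain \<delta> where \<delta>: "\<delta> > 0" "\<And>y. y \<in> coord_space J \<Longrightarrow> (\<And>i. i \<in> J \<Longrightarrow> \<bar>y i - \<gamma> t0 i\<bar> < \<delta>) \<Longrightarrow> y \<in> T \<and> \<bar>D j y - D j (\<gamma> t0)\<bar> < \<epsilon>"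
      using continuous_on_open_coordD[OF cont[OF j] assms(2,1,3)] by metis
    show "eventually (\<lambda>t. dist (P (\<gamma> t) j) (D j (\<gamma> t0)) < \<epsilon>) (at t0)"
    proof (rule eventually_mono[OF eventually_conj[OF near[OF \<delta>(1)] near[OF e]]], elim conjE)
      fix t assume t: "\<gamma> t \<in> coord_space J" "\<forall>j\<in>J. \<bar>\<gamma> t j - \<gamma> t0 j\<bar> < \<delta>" "\<forall>j\<in>J. \<bar>\<gamma> t j - \<gamma> t0 j\<bar> < e"
      obtain \<xi> where \<xi>: "\<xi> \<in> T" "\<forall>i\<in>J. \<bar>\<xi> i - \<gamma> t0 i\<bar> \<le> \<bar>\<gamma> t i - \<gamma> t0 i\<bar>" "P (\<gamma> t) j = D j \<xi>"
        using P[rule_format, of "\<gamma> t"] t j by blast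
      have "\<bar>D j \<xi> - D j (\<gamma> t0)\<bar> < \<epsilon>"
        using \<delta>(2)[of \<xi>] \<xi> t(2) open_coord_subset[OF assms(2)] by (meson le_less_trans subsetD)
      then show "dist (P (\<gamma> t) j) (D j (\<gamma> t0)) < \<epsilon>" using \<xi> by (simp add: dist_real_def)
    qed
  qed
  have "((\<lambda>t. \<Sum>j\<in>J. P (\<gamma> t) j * ((\<gamma> t j - \<gamma> t0 j) / (t - t0))) \<longlongrightarrow> (\<Sum>j\<in>J. D j (\<gamma> t0) * \<gamma>' j)) (at t0)"
    by (intro tendsto_sum tendsto_mult lim) (use der in \<open>auto simp: has_field_derivative_iff\<close>)
  moreover have "eventually (\<lambda>t. (\<Sum>j\<in>J. P (\<gamma> t) j * ((\<gamma> t j - \<gamma> t0 j) / (t - t0))) = (f (\<gamma> t) - f (\<gamma> t0)) / (t - t0)) (at t0)"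
    by (rule eventually_mono[OF near[OF e]]) (use P in \<open>auto simp: sum_divide_distrib\<close>)
  ultimately show ?thesis unfolding has_field_derivative_iff by (rule Lim_transform_eventually)
qed

lemma smooth_fun_chain_curve:
  assumes "smooth_fun J T f" "finite J" "open_coord J T" "\<gamma> t0 \<in> T"
    and ev: "eventually (\<lambda>t. \<gamma> t \<in> coord_space J) (at t0)"
    and der: "\<And>j. j \<in> J \<Longrightarrow> ((\<lambda>t. \<gamma> t j) has_real_derivative \<gamma>' j) (at t0)"
  shows "((\<lambda>t. f (\<gamma> t)) has_real_derivative (\<Sum>j\<in>J. pd j f (\<gamma> t0) * \<gamma>' j)) (at t0)"
  by (rule chain_rule_curve[OF assms(2,3,4) _ _ ev der])
    (use assms(1) in \<open>auto intro: smooth_fun_has_pd smooth_fun_continuous smooth_fun_pd\<close>)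

lemma has_pd_compose:
  assumes "finite I" "finite J" "open_coord I S" "open_coord J T" "g ` S \<subseteq> T" "x \<in> S" "i \<in> I"
    and "\<And>j y. j \<in> J \<Longrightarrow> y \<in> T \<Longrightarrow> has_pd j f (pd j f y) y"
    and "\<And>j. j \<in> J \<Longrightarrow> continuous_on T (pd j f)"
    and "\<And>j. j \<in> J \<Longrightarrow> has_pd i (\<lambda>x. g x j) (D j) x"
  shows "has_pd i (\<lambda>x. f (g x)) (\<Sum>j\<in>J. pd j f (g x) * D j) x"
proof -
  have "eventually (\<lambda>t. x(i := t) \<in> S) (nhds (x i))"
    by (rule eventually_fun_upd_in_open_coord[OF assms(3,1,6,7)])
  then have "eventually (\<lambda>t. g (x(i := t)) \<in> coord_space J) (at (x i))"
    unfolding eventually_at_filter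
    by eventually_elim (use assms(5) open_coord_subset[OF assms(4)] in auto)
  from chain_rule_curve[OF assms(2,4) _ assms(8,9) this, of D] assms(5,6,10)
  show ?thesis by (auto simp: has_pd_def)
qed

text \<open>The chain rule turns a derivative of the composite into products of
  \<open>pd j f\<close> along \<open>g\<close>, to which the induction hypothesis applies since
  \<open>f\<close> is arbitrary, with derivatives of \<open>g\<close>, which have the right class by
  assumption.\<close>

lemma Ck_compose:
  assumes "finite I" "finite J" "open_coord I S" "open_coord J T" "g ` S \<subseteq> T"
    and "\<And>j. j \<in> J \<Longrightarrow> Ck k I S (\<lambda>x. g x j)" "Ck k J T f"
  shows "Ck k I S (\<lambda>x. f (g x))"
  using assms(6,7)
proof (induction k arbitrary: f)
  have cont: "continuous_on S (\<lambda>x. f (g x))"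
    if "continuous_on T f" "\<And>j. j \<in> J \<Longrightarrow> continuous_on S (\<lambda>x. g x j)" for f
  proof -
    have "g ` S \<subseteq> coord_space J" using assms(5) open_coord_subset[OF assms(4)] by (rule subset_trans)
    with that(2) have "continuous_on S g" by (rule continuous_on_into_coord_space)
    from continuous_on_compose2[OF that(1) this assms(5)] show ?thesis .
  qed
  {
    case 0
    then show ?case using cont[of f] by auto
  next
    case (Suc k)
    have k: "Ck k I S (\<lambda>x. g x j)" if "j \<in> J" for j using Suc(2)[OF that] Ck_SucD by blast
    show ?case
    proof (rule Ck_SucI[OF assms(1,3), of _ "\<lambda>i x. \<Sum>j\<in>J. pd j f (g x) * pd i (\<lambda>x. g x j) x"])
      show "continuous_on S (\<lambda>x. f (g x))"
        by (rule cont[OF Ck_imp_continuous[OF Suc(3)] Ck_imp_continuous[OF Suc(2)]])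
      show "has_pd i (\<lambda>x. f (g x)) (\<Sum>j\<in>J. pd j f (g x) * pd i (\<lambda>x. g x j) x) x" if "i \<in> I" "x \<in> S" for i x
      proof (rule has_pd_compose[OF assms(1-5) that(2,1)])
        show "has_pd i (\<lambda>x. g x j) (pd i (\<lambda>x. g x j) x) x" if "j \<in> J" for j
          using Suc(2)[OF that] \<open>i \<in> I\<close> \<open>x \<in> S\<close> by simp
        show "has_pd j f (pd j f y) y" if "j \<in> J" "y \<in> T" for j y using Suc(3) that by simp
        show "continuous_on T (pd j f)" if "j \<in> J" for j
          using Suc(3) that by (intro Ck_imp_continuous[of k J]) simp
      qed
      show "Ck k I S (\<lambda>x. \<Sum>j\<in>J. pd j f (g x) * pd i (\<lambda>x. g x j) x)" if "i \<in> I" for i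
      proof (rule Ck_sum[OF assms(1,3)])
        fix j assume "j \<in> J"
        have "Ck k J T (pd j f)" using Suc(3) \<open>j \<in> J\<close> by simp
        then have "Ck k I S (\<lambda>x. pd j f (g x))" by (rule Suc(1)[OF k, rotated])
        moreover have "Ck k I S (pd i (\<lambda>x. g x j))" using Suc(2)[OF \<open>j \<in> J\<close>] \<open>i \<in> I\<close> by simp
        ultimately show "Ck k I S (\<lambda>x. pd j f (g x) * pd i (\<lambda>x. g x j) x)" by (rule Ck_mult[OF assms(1,3)])
      qed
    qed
  }
qed

lemma smooth_fun_compose:
  assumes "finite I" "finite J" "open_coord I S" "open_coord J T" "g ` S \<subseteq> T"
    and "\<And>j. j \<in> J \<Longrightarrow> smooth_fun I S (\<lambda>x. g x j)" "smooth_fun J T f"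
  shows "smooth_fun I S (\<lambda>x. f (g x))"
  unfolding smooth_fun_iff_Ck
proof
  fix k show "Ck k I S (\<lambda>x. f (g x))"
    by (rule Ck_compose[OF assms(1-5)]) (use assms(6,7) smooth_fun_iff_Ck in blast)+
qed

lemma pd_compose:
  assumes "finite I" "finite J" "open_coord I S" "open_coord J T" "g ` S \<subseteq> T"
    and "\<And>j. j \<in> J \<Longrightarrow> smooth_fun I S (\<lambda>x. g x j)" "smooth_fun J T f" "x \<in> S" "i \<in> I"
  shows "pd i (\<lambda>x. f (g x)) x = (\<Sum>j\<in>J. pd j f (g x) * pd i (\<lambda>x. g x j) x)"
  by (rule pd_eqI[OF has_pd_compose[OF assms(1-5,8,9)]])
    (use assms in \<open>auto intro: smooth_fun_has_pd smooth_fun_continuous smooth_fun_pd\<close>)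


subsection \<open>Symmetry of iterated partial derivatives\<close>

text \<open>The second difference of \<open>F\<close> over a small square of side \<open>h\<close>
  is evaluated by two mean values, once in each order. This gives \<open>h\<close> squared times
  \<open>Fab\<close> at one point of the square and times \<open>Fba\<close> at another; continuity
  carries both values to the corner.\<close>

lemma mixed_partials_eq:
  fixes F :: "real \<Rightarrow> real \<Rightarrow> real"
  assumes "e > 0"
    and Fa: "\<And>a b. \<bar>a - a0\<bar> < e \<Longrightarrow> \<bar>b - b0\<bar> < e \<Longrightarrow> ((\<lambda>a. F a b) has_real_derivative Fa a b) (at a)"
    and Fb: "\<And>a b. \<bar>a - a0\<bar> < e \<Longrightarrow> \<bar>b - b0\<bar> < e \<Longrightarrow> ((\<lambda>b. F a b) has_real_derivative Fb a b) (at b)"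
    and Fab: "\<And>a b. \<bar>a - a0\<bar> < e \<Longrightarrow> \<bar>b - b0\<bar> < e \<Longrightarrow> ((\<lambda>b. Fa a b) has_real_derivative Fab a b) (at b)"
    and Fba: "\<And>a b. \<bar>a - a0\<bar> < e \<Longrightarrow> \<bar>b - b0\<bar> < e \<Longrightarrow> ((\<lambda>a. Fb a b) has_real_derivative Fba a b) (at a)"
    and cab: "\<And>\<epsilon>. \<epsilon> > 0 \<Longrightarrow> \<exists>\<delta>>0. \<forall>a b. \<bar>a - a0\<bar> < \<delta> \<longrightarrow> \<bar>b - b0\<bar> < \<delta> \<longrightarrow> \<bar>Fab a b - Fab a0 b0\<bar> < \<epsilon>"
    and cba: "\<And>\<epsilon>. \<epsilon> > 0 \<Longrightarrow> \<exists>\<delta>>0. \<forall>a b. \<bar>a - a0\<bar> < \<delta> \<longrightarrow> \<bar>b - b0\<bar> < \<delta> \<longrightarrow> \<bar>Fba a b - Fba a0 b0\<bar> < \<epsilon>"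
  shows "Fab a0 b0 = Fba a0 b0"
proof (rule ccontr)
  assume neq: "Fab a0 b0 \<noteq> Fba a0 b0"
  \<comment> \<open>Half the supposed gap: no number is closer than this to both values.\<close>
  define \<epsilon> where "\<epsilon> = \<bar>Fab a0 b0 - Fba a0 b0\<bar> / 2"
  have "\<epsilon> > 0" using neq by (simp add: \<epsilon>_def)
  obtain \<delta>1 where d1: "\<delta>1 > 0" "\<And>a b. \<bar>a - a0\<bar> < \<delta>1 \<Longrightarrow> \<bar>b - b0\<bar> < \<delta>1 \<Longrightarrow> \<bar>Fab a b - Fab a0 b0\<bar> < \<epsilon>"
    using cab[OF \<open>\<epsilon> > 0\<close>] by blast
  obtain \<delta>2 where d2: "\<delta>2 > 0" "\<And>a b. \<bar>a - a0\<bar> < \<delta>2 \<Longrightarrow> \<bar>b - b0\<bar> < \<delta>2 \<Longrightarrow> \<bar>Fba a b - Fba a0 b0\<bar> < \<epsilon>"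
    using cba[OF \<open>\<epsilon> > 0\<close>] by blast
  define h where "h = Min {e, \<delta>1, \<delta>2} / 2"
  have h: "h > 0" "h < e" "h < \<delta>1" "h < \<delta>2" using \<open>e > 0\<close> d1(1) d2(1) by (auto simp: h_def min_def)
  define \<Delta> where "\<Delta> = F (a0 + h) (b0 + h) - F (a0 + h) b0 - F a0 (b0 + h) + F a0 b0"
  obtain \<xi> where \<xi>: "a0 < \<xi>" "\<xi> < a0 + h" "\<Delta> = h * (Fa \<xi> (b0 + h) - Fa \<xi> b0)"
  proof -
    have "\<exists>\<xi>. a0 < \<xi> \<and> \<xi> < a0 + h \<and> (\<lambda>a. F a (b0 + h) - F a b0) (a0 + h) - (\<lambda>a. F a (b0 + h) - F a b0) a0
       = (a0 + h - a0) * (Fa \<xi> (b0 + h) - Fa \<xi> b0)"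
      by (rule MVT2) (use h in \<open>auto intro!: DERIV_diff Fa\<close>)
    then show thesis using that by (auto simp: \<Delta>_def algebra_simps)
  qed
  obtain \<eta> where \<eta>: "b0 < \<eta>" "\<eta> < b0 + h" "Fa \<xi> (b0 + h) - Fa \<xi> b0 = h * Fab \<xi> \<eta>"
  proof -
    have "\<exists>\<eta>. b0 < \<eta> \<and> \<eta> < b0 + h \<and> Fa \<xi> (b0 + h) - Fa \<xi> b0 = (b0 + h - b0) * Fab \<xi> \<eta>"
      by (rule MVT2) (use h \<xi> in \<open>auto intro!: Fab\<close>)
    then show thesis using that by auto
  qed
  obtain \<eta>' where \<eta>': "b0 < \<eta>'" "\<eta>' < b0 + h" "\<Delta> = h * (Fb (a0 + h) \<eta>' - Fb a0 \<eta>')"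
  proof -
    have "\<exists>\<eta>'. b0 < \<eta>' \<and> \<eta>' < b0 + h \<and> (\<lambda>b. F (a0 + h) b - F a0 b) (b0 + h) - (\<lambda>b. F (a0 + h) b - F a0 b) b0
       = (b0 + h - b0) * (Fb (a0 + h) \<eta>' - Fb a0 \<eta>')"
      by (rule MVT2) (use h in \<open>auto intro!: DERIV_diff Fb\<close>)
    then show thesis using that by (auto simp: \<Delta>_def algebra_simps)
  qed
  obtain \<xi>' where \<xi>': "a0 < \<xi>'" "\<xi>' < a0 + h" "Fb (a0 + h) \<eta>' - Fb a0 \<eta>' = h * Fba \<xi>' \<eta>'"
  proof -
    have "\<exists>\<xi>'. a0 < \<xi>' \<and> \<xi>' < a0 + h \<and> Fb (a0 + h) \<eta>' - Fb a0 \<eta>' = (a0 + h - a0) * Fba \<xi>' \<eta>'"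
      by (rule MVT2) (use h \<eta>' in \<open>auto intro!: Fba\<close>)
    then show thesis using that by auto
  qed
  have "Fab \<xi> \<eta> = Fba \<xi>' \<eta>'" using \<xi>(3) \<eta>(3) \<xi>'(3) \<eta>'(3) h(1) by simp
  moreover have "\<bar>Fab \<xi> \<eta> - Fab a0 b0\<bar> < \<epsilon>" by (rule d1(2)) (use \<xi> \<eta> h in auto)
  moreover have "\<bar>Fba \<xi>' \<eta>' - Fba a0 b0\<bar> < \<epsilon>" by (rule d2(2)) (use \<xi>' \<eta>' h in auto)
  ultimately show False unfolding \<epsilon>_def by (simp add: abs_if split: if_splits)
qed

text \<open>All coordinates but \<open>i\<close> and \<open>j\<close> are frozen, which leaves a
  function of two real variables near the point.\<close>

lemma pd_commute:
  assumes "finite I" "open_coord I S" "smooth_fun I S f" "x \<in> S" "i \<in> I" "j \<in> I"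
  shows "pd i (pd j f) x = pd j (pd i f) x"
proof (cases "i = j")
  case False
  obtain e where e: "e > 0" "\<And>y. y \<in> coord_space I \<Longrightarrow> (\<And>i. i \<in> I \<Longrightarrow> \<bar>y i - x i\<bar> < e) \<Longrightarrow> y \<in> S"
    using open_coordD[OF assms(2,1,4)] by metis
  have xc: "x \<in> coord_space I" using assms open_coord_subset by blast
  have xS: "x(i := a, j := b) \<in> S" if "\<bar>a - x i\<bar> < e" "\<bar>b - x j\<bar> < e" for a b
  proof (rule e(2))
    show "x(i := a, j := b) \<in> coord_space I" using xc assms(5,6) by (auto simp: coord_space_def)
    show "\<bar>(x(i := a, j := b)) k - x k\<bar> < e" for k using that e(1) by (auto simp: fun_upd_def)
  qed
  have cont: "\<exists>\<delta>>0. \<forall>a b. \<bar>a - x i\<bar> < \<delta> \<longrightarrow> \<bar>b - x j\<bar> < \<delta> \<longrightarrow>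
      \<bar>g (x(i := a, j := b)) - g (x(i := x i, j := x j))\<bar> < \<epsilon>"
    if c: "continuous_on S g" "\<epsilon> > 0" for g :: "('a \<Rightarrow> real) \<Rightarrow> real" and \<epsilon>
  proof -
    obtain \<delta> where d: "\<delta> > 0" "\<And>y. y \<in> coord_space I \<Longrightarrow> (\<And>i. i \<in> I \<Longrightarrow> \<bar>y i - x i\<bar> < \<delta>) \<Longrightarrow> y \<in> S \<and> \<bar>g y - g x\<bar> < \<epsilon>"
      using continuous_on_open_coordD[OF c(1) assms(2,1,4) c(2)] by metis
    have "\<bar>g (x(i := a, j := b)) - g x\<bar> < \<epsilon>" if "\<bar>a - x i\<bar> < \<delta>" "\<bar>b - x j\<bar> < \<delta>" for a b
    proof -
      have "x(i := a, j := b) \<in> coord_space I" using xc assms(5,6) by (auto simp: coord_space_def)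
      moreover have "\<bar>(x(i := a, j := b)) k - x k\<bar> < \<delta>" for k using that d(1) by (auto simp: fun_upd_def)
      ultimately show ?thesis using d(2) by blast
    qed
    then show ?thesis using d(1) by auto
  qed
  have D: "has_pd k g (pd k g (x(i := a, j := b))) (x(i := a, j := b))"
    if "\<bar>a - x i\<bar> < e" "\<bar>b - x j\<bar> < e" "smooth_fun I S g" "k \<in> I" for g k a b
    using smooth_fun_has_pd[OF that(3,4) xS[OF that(1,2)]] .
  have up: "(x(i := a, j := b))(i := s) = x(i := s, j := b)" for a b s using False by auto
  have Di: "((\<lambda>a. g (x(i := a, j := b))) has_real_derivative pd i g (x(i := a, j := b))) (at a)"
    if "\<bar>a - x i\<bar> < e" "\<bar>b - x j\<bar> < e" "smooth_fun I S g" for g a b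
    using D[OF that assms(5)] False unfolding has_pd_def up by simp
  have Dj: "((\<lambda>b. g (x(i := a, j := b))) has_real_derivative pd j g (x(i := a, j := b))) (at b)"
    if "\<bar>a - x i\<bar> < e" "\<bar>b - x j\<bar> < e" "smooth_fun I S g" for g a b
    using D[OF that assms(6)] unfolding has_pd_def by simp
  have "pd j (pd i f) (x(i := x i, j := x j)) = pd i (pd j f) (x(i := x i, j := x j))"
    by (rule mixed_partials_eq[of e "x i" "x j" "\<lambda>a b. f (x(i := a, j := b))"
          "\<lambda>a b. pd i f (x(i := a, j := b))" "\<lambda>a b. pd j f (x(i := a, j := b))"])
      (assumption | rule e(1) Di[of _ _ f] Dj[of _ _ f] Dj[of _ _ "pd i f"] Di[of _ _ "pd j f"]
        cont[of "pd j (pd i f)"] cont[of "pd i (pd j f)"] smooth_fun_continuous smooth_fun_pd assms(3,5,6))+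
  then show ?thesis by simp
qed simp

lemma pds_move_to_front:
  assumes "finite I" "open_coord I S" "smooth_fun I S f" "x \<in> S" "set xs \<subseteq> I" "i \<in> I" "set ys \<subseteq> I"
  shows "pds (xs @ i # ys) f x = pds (i # xs @ ys) f x"
  using assms(4,5)
proof (induction xs arbitrary: x)
  case (Cons a xs)
  have "pd a (pds (xs @ i # ys) f) x = pd a (pds (i # xs @ ys) f) x"
    by (rule pd_cong[OF assms(2,1) Cons(2)]) (use Cons in auto)
  also have "\<dots> = pd i (pd a (pds (xs @ ys) f)) x"
    using Cons assms by (simp, intro pd_commute[OF assms(1,2)] smooth_fun_pds) auto
  finally show ?case by simp
qed auto

text \<open>This is what permits jet coordinates to be indexed by multisets. It is also the
  commutation of time and base derivatives, time being one more index.\<close>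

lemma pds_mset_cong:
  assumes "finite I" "open_coord I S" "smooth_fun I S f" "x \<in> S" "set xs \<subseteq> I" "mset xs = mset ys"
  shows "pds xs f x = pds ys f x"
  using assms(4-6)
proof (induction xs arbitrary: ys x)
  case (Cons a xs)
  then have "a \<in> set ys" by (metis list.set_intros(1) mset_eq_setD)
  then obtain us vs where ys: "ys = us @ a # vs" by (meson split_list)
  then have m: "mset xs = mset (us @ vs)" using Cons(4) by simp
  have "set ys \<subseteq> I" using Cons(3,4) mset_eq_setD by metis
  then have "pds ys f x = pd a (pds (us @ vs) f) x"
    unfolding ys using pds_move_to_front[OF assms(1-3) Cons(2), of us a vs] by auto
  also have "\<dots> = pd a (pds xs f) x"
  proof (rule pd_cong[OF assms(2,1) Cons(2)])
    show "a \<in> I" using Cons(3) by simp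
    show "pds (us @ vs) f y = pds xs f y" if "y \<in> S" for y
      using Cons(1)[OF that _ m] Cons(3) by simp
  qed
  finally show ?case by simp
qed auto

lemma smooth_fun_congI:
  assumes "finite I" "open_coord I S" "smooth_fun I S f" "\<And>x. x \<in> S \<Longrightarrow> f x = g x"
  shows "smooth_fun I S g"
  using smooth_fun_cong[OF assms(1,2,4)] assms(3) by simp

subsection \<open>Charts and smooth maps\<close>

text \<open>
  Without separation and countability axioms, products, jet manifolds and vertical bundles qualify without
  further topological arguments.
\<close>

definition premanifold :: "('a, 'i) mfd \<Rightarrow> bool" where
  "premanifold M \<longleftrightarrow>
     finite (midx M) \<and> matlas M \<subseteq> charts M \<and> (\<Union>c\<in>matlas M. fst c) = mcarrier M"

text \<open>In contrast to \<open>smooth_map_on\<close>, the set \<open>U\<close> is not tied to the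
  domain of \<open>c\<close>, so that composition and restriction do not call for new
  charts.\<close>

definition smooth_in_charts ::
  "'i set \<Rightarrow> 'j set \<Rightarrow> ('a, 'i) chart \<Rightarrow> ('b, 'j) chart \<Rightarrow> 'a set \<Rightarrow> ('a \<Rightarrow> 'b) \<Rightarrow> bool" where
  "smooth_in_charts I J c d U f \<longleftrightarrow>
     U \<subseteq> fst c \<and> f ` U \<subseteq> fst d \<and> open_coord I (snd c ` U) \<and>
     (\<forall>j\<in>J. smooth_fun I (snd c ` U) (\<lambda>u. snd d (f (chart_inv c u)) j))"

lemma chart_subset: "c \<in> charts M \<Longrightarrow> fst c \<subseteq> mcarrier M"
  by (auto simp: charts_def is_chart_def)

lemma chart_inj: "c \<in> charts M \<Longrightarrow> inj_on (snd c) (fst c)"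
  by (auto simp: charts_def is_chart_def)

lemma chart_open: "c \<in> charts M \<Longrightarrow> open_coord (midx M) (snd c ` fst c)"
  by (auto simp: charts_def is_chart_def)

lemma chart_coord: "c \<in> charts M \<Longrightarrow> x \<in> fst c \<Longrightarrow> snd c x \<in> coord_space (midx M)"
  using open_coord_subset[OF chart_open] by blast

lemma chart_inv_chart: "c \<in> charts M \<Longrightarrow> x \<in> fst c \<Longrightarrow> chart_inv c (snd c x) = x"
  by (rule inv_into_f_f[OF chart_inj])

lemma chart_chart_inv: "u \<in> snd c ` fst c \<Longrightarrow> snd c (chart_inv c u) = u"
  by (rule f_inv_into_f)

lemma chart_inv_in: "u \<in> snd c ` fst c \<Longrightarrow> chart_inv c u \<in> fst c"
  by (rule inv_into_into)

lemma premanifold_finite: "premanifold M \<Longrightarrow> finite (midx M)"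
  by (simp add: premanifold_def)

lemma premanifold_atlas: "premanifold M \<Longrightarrow> c \<in> matlas M \<Longrightarrow> c \<in> charts M"
  by (auto simp: premanifold_def)

lemma premanifold_cover:
  assumes "premanifold M" "x \<in> mcarrier M"
  obtains c where "c \<in> matlas M" "c \<in> charts M" "x \<in> fst c"
  using assms unfolding premanifold_def by blast

text \<open>Of the charts only injectivity and the ambient coordinate space are assumed, not
  membership in an atlas. Hence the lemma also applies to a pair that is yet to be recognised as a
  chart.\<close>

lemma smooth_in_charts_compose:
  assumes fg: "smooth_in_charts I J c d U f" "smooth_in_charts J K d e V g"
    and fin: "finite I" "finite J"
    and inj: "inj_on (snd c) (fst c)" "inj_on (snd d) (fst d)"
    and d: "snd d ` fst d \<subseteq> coord_space J"
  shows "smooth_in_charts I K c e {x\<in>U. f x \<in> V} (g \<circ> f)"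
proof -
  define G where "G u = snd d (f (chart_inv c u))" for u
  have U: "U \<subseteq> fst c" "f ` U \<subseteq> fst d" "open_coord I (snd c ` U)"
    and fs: "\<And>j. j \<in> J \<Longrightarrow> smooth_fun I (snd c ` U) (\<lambda>u. G u j)"
    using fg(1) by (auto simp: smooth_in_charts_def G_def)
  have V: "V \<subseteq> fst d" "g ` V \<subseteq> fst e" "open_coord J (snd d ` V)"
    and gs: "\<And>k. k \<in> K \<Longrightarrow> smooth_fun J (snd d ` V) (\<lambda>v. snd e (g (chart_inv d v)) k)"
    using fg(2) by (auto simp: smooth_in_charts_def)
  have ci: "chart_inv c (snd c x) = x" if "x \<in> U" for x using inj(1) U(1) that by auto
  have di: "chart_inv d (snd d y) = y" if "y \<in> fst d" for y using inj(2) that by auto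
  have Gc: "G ` (snd c ` U) \<subseteq> coord_space J"
  proof (rule image_subsetI)
    fix u assume "u \<in> snd c ` U"
    then obtain x where "x \<in> U" "u = snd c x" by blast
    moreover from this have "f x \<in> fst d" using U(2) by blast
    ultimately show "G u \<in> coord_space J" unfolding G_def using d ci[of x] by auto
  qed
  have cont: "continuous_on (snd c ` U) G"
    by (rule continuous_on_into_coord_space[OF smooth_fun_continuous[OF fs] Gc])
  have eq: "snd c ` {x\<in>U. f x \<in> V} = {u \<in> snd c ` U. G u \<in> snd d ` V}"
  proof -
    have "snd d (f x) \<in> snd d ` V \<longleftrightarrow> f x \<in> V" if "x \<in> U" for x
      by (rule inj_on_image_mem_iff[OF inj(2) _ V(1)]) (use U(2) that in blast)
    then have "G (snd c x) \<in> snd d ` V \<longleftrightarrow> f x \<in> V" if "x \<in> U" for x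
      using that by (simp add: G_def ci)
    then show ?thesis by blast
  qed
  have op: "open_coord I (snd c ` {x\<in>U. f x \<in> V})"
    unfolding eq by (rule open_coord_preimage[OF U(3) cont V(3) Gc])
  have "smooth_fun I (snd c ` {x\<in>U. f x \<in> V}) (\<lambda>u. snd e ((g \<circ> f) (chart_inv c u)) k)" if "k \<in> K" for k
  proof -
    have "smooth_fun I (snd c ` {x\<in>U. f x \<in> V}) (\<lambda>u. snd e (g (chart_inv d (G u))) k)"
    proof (rule smooth_fun_compose[OF fin op V(3) _ _ gs[OF that]])
      show "G ` snd c ` {x \<in> U. f x \<in> V} \<subseteq> snd d ` V" using eq by auto
      show "smooth_fun I (snd c ` {x \<in> U. f x \<in> V}) (\<lambda>x. G x j)" if "j \<in> J" for j
        by (rule smooth_fun_subset[OF fs[OF that]]) blast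
    qed
    moreover have "snd e (g (chart_inv d (G u))) k = snd e ((g \<circ> f) (chart_inv c u)) k"
      if "u \<in> snd c ` {x\<in>U. f x \<in> V}" for u
    proof -
      from that obtain x where "x \<in> U" "u = snd c x" by blast
      moreover from this have "f x \<in> fst d" using U(2) by blast
      ultimately show ?thesis unfolding G_def o_def using ci[of x] di[of "f x"] by simp
    qed
    ultimately show ?thesis by (rule smooth_fun_congI[OF fin(1) op])
  qed
  then show ?thesis unfolding smooth_in_charts_def using U(1) V(2) op by auto
qed

lemma smooth_in_charts_locally:
  assumes "\<And>x. x \<in> U \<Longrightarrow> \<exists>V. x \<in> V \<and> V \<subseteq> U \<and> smooth_in_charts I J c d V f"
  shows "smooth_in_charts I J c d U f"
proof -
  have op: "open_coord I (snd c ` U)"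
  proof (rule open_coord_locally)
    fix u assume "u \<in> snd c ` U"
    then obtain x where x: "x \<in> U" "u = snd c x" by auto
    obtain V where "x \<in> V" "V \<subseteq> U" "smooth_in_charts I J c d V f" using assms[OF x(1)] by blast
    then show "\<exists>T. open_coord I T \<and> u \<in> T \<and> T \<subseteq> snd c ` U"
      using x by (intro exI[of _ "snd c ` V"]) (auto simp: smooth_in_charts_def)
  qed
  have "smooth_fun I (snd c ` U) (\<lambda>u. snd d (f (chart_inv c u)) j)" if "j \<in> J" for j
  proof (rule smooth_fun_locally[OF _ open_coord_subset[OF op]])
    fix u assume "u \<in> snd c ` U"
    then obtain x where x: "x \<in> U" "u = snd c x" by auto
    obtain V where "x \<in> V" "V \<subseteq> U" "smooth_in_charts I J c d V f" using assms[OF x(1)] by blast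
    then show "\<exists>T. open_coord I T \<and> u \<in> T \<and> T \<subseteq> snd c ` U \<and> smooth_fun I T (\<lambda>u. snd d (f (chart_inv c u)) j)"
      using x that by (intro exI[of _ "snd c ` V"]) (auto simp: smooth_in_charts_def)
  qed
  moreover have "U \<subseteq> fst c" "f ` U \<subseteq> fst d"
    using assms unfolding smooth_in_charts_def by blast+
  ultimately show ?thesis using op by (auto simp: smooth_in_charts_def)
qed

lemma smooth_in_charts_cong:
  assumes "finite I" "inj_on (snd c) (fst c)" "\<And>x. x \<in> U \<Longrightarrow> f x = g x" "smooth_in_charts I J c d U f"
  shows "smooth_in_charts I J c d U g"
proof -
  have U: "U \<subseteq> fst c" "open_coord I (snd c ` U)" using assms(4) by (auto simp: smooth_in_charts_def)
  have fg: "f (chart_inv c u) = g (chart_inv c u)" if "u \<in> snd c ` U" for u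
  proof -
    from that obtain x where "x \<in> U" "u = snd c x" by blast
    then show ?thesis using assms(3)[of x] inv_into_f_f[OF assms(2), of x] U(1) by auto
  qed
  have "smooth_fun I (snd c ` U) (\<lambda>u. snd d (g (chart_inv c u)) j)" if "j \<in> J" for j
  proof (rule smooth_fun_congI[OF assms(1) U(2)])
    show "smooth_fun I (snd c ` U) (\<lambda>u. snd d (f (chart_inv c u)) j)"
      using assms(4) that by (simp add: smooth_in_charts_def)
  qed (simp only: fg)
  moreover have "g ` U = f ` U" using assms(3) by (auto simp: image_iff)
  ultimately show ?thesis using assms(4) by (simp add: smooth_in_charts_def)
qed

lemma smooth_transition_iff:
  "smooth_transition I c d \<longleftrightarrow> smooth_in_charts I I c d (fst c \<inter> fst d) id"
  by (auto simp: smooth_transition_def smooth_in_charts_def)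

lemma smooth_in_charts_id:
  assumes "finite I" "inj_on (snd c) (fst c)" "U \<subseteq> fst c" "open_coord I (snd c ` U)"
  shows "smooth_in_charts I I c c U id"
proof -
  have "snd c (chart_inv c u) = u" if "u \<in> snd c ` U" for u
    using that assms(3) by (intro f_inv_into_f) blast
  then have "smooth_fun I (snd c ` U) (\<lambda>u. snd c (id (chart_inv c u)) i)" for i
    by (intro smooth_fun_congI[OF assms(1,4) smooth_fun_proj[OF assms(1,4), of i]]) simp
  then show ?thesis using assms by (auto simp: smooth_in_charts_def)
qed

text \<open>By definition the elements of \<open>charts M\<close> are compatible with the given
  atlas only. Near a common point the transition between two of them factors through an atlas chart
  around that point.\<close>

lemma charts_transition:
  assumes M: "premanifold M" and c: "c \<in> charts M" and d: "d \<in> charts M"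
  shows "smooth_in_charts (midx M) (midx M) c d (fst c \<inter> fst d) id"
proof (rule smooth_in_charts_locally)
  fix x assume x: "x \<in> fst c \<inter> fst d"
  then obtain e where e: "e \<in> matlas M" "e \<in> charts M" "x \<in> fst e"
    using premanifold_cover[OF M] chart_subset[OF c] by blast
  have fin: "finite (midx M)" using M by (rule premanifold_finite)
  have "smooth_in_charts (midx M) (midx M) c e (fst c \<inter> fst e) id"
    "smooth_in_charts (midx M) (midx M) e d (fst e \<inter> fst d) id"
    using c d e(1) by (auto simp: charts_def smooth_transition_iff)
  from smooth_in_charts_compose[OF this fin fin chart_inj[OF c] chart_inj[OF e(2)] open_coord_subset[OF chart_open[OF e(2)]]]
  have "smooth_in_charts (midx M) (midx M) c d (fst c \<inter> fst e \<inter> fst d) id"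
    by (simp add: Int_def conj_ac)
  then show "\<exists>V. x \<in> V \<and> V \<subseteq> fst c \<inter> fst d \<and> smooth_in_charts (midx M) (midx M) c d V id"
    using x e(3) by (intro exI[of _ "fst c \<inter> fst e \<inter> fst d"]) auto
qed

section \<open>Restriction of charts and criteria for smooth maps\<close>

lemma restrict_chart_inv:
  assumes "inj_on f A" "U \<subseteq> A" "u \<in> f ` U"
  shows "inv_into U f u = inv_into A f u"
proof -
  obtain x where "x \<in> U" "u = f x" using assms(3) by blast
  then show ?thesis
    using inv_into_f_f[OF assms(1), of x] inv_into_f_f[OF inj_on_subset[OF assms(1,2)], of x] assms(2) by auto
qed

text \<open>The identity on \<open>U\<close> is smooth from \<open>c\<close> to itself; composing it
  with the transitions of \<open>c\<close> on either side gives those of the restriction.\<close>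

lemma restrict_chart:
  assumes M: "premanifold M" and c: "c \<in> charts M" and U: "U \<subseteq> fst c" "open_coord (midx M) (snd c ` U)"
  shows "(U, snd c) \<in> charts M"
proof -
  let ?I = "midx M"
  have fin: "finite ?I" using M by (rule premanifold_finite)
  have inv: "inv_into U (snd c) u = chart_inv c u" if "u \<in> snd c ` U" for u
    using restrict_chart_inv[OF chart_inj[OF c] U(1) that] .
  have cU: "smooth_in_charts ?I ?I c c U id"
    by (rule smooth_in_charts_id[OF fin chart_inj[OF c] U])
  have "smooth_transition ?I (U, snd c) d \<and> smooth_transition ?I d (U, snd c)" if d: "d \<in> matlas M" for d
  proof
    have d': "d \<in> charts M" using premanifold_atlas[OF M d] .
    have "smooth_in_charts ?I ?I c d {x \<in> U. id x \<in> fst c \<inter> fst d} (id \<circ> id)"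
      by (rule smooth_in_charts_compose[OF cU charts_transition[OF M c d'] fin fin chart_inj[OF c] chart_inj[OF c]
            open_coord_subset[OF chart_open[OF c]]])
    moreover have "{x \<in> U. id x \<in> fst c \<inter> fst d} = U \<inter> fst d" using U by auto
    ultimately have *: "smooth_in_charts ?I ?I c d (U \<inter> fst d) id" by simp
    have "smooth_fun ?I (snd c ` (U \<inter> fst d)) (\<lambda>u. snd d (chart_inv (U, snd c) u) i)" if "i \<in> ?I" for i
    proof -
      have op: "open_coord ?I (snd c ` (U \<inter> fst d))" using * by (simp add: smooth_in_charts_def)
      have "smooth_fun ?I (snd c ` (U \<inter> fst d)) (\<lambda>u. snd d (chart_inv c u) i)"
        using * that by (simp add: smooth_in_charts_def)
      moreover have "snd d (chart_inv c u) i = snd d (chart_inv (U, snd c) u) i" if "u \<in> snd c ` (U \<inter> fst d)" for u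
      proof -
        have "u \<in> snd c ` U" using that by blast
        from inv[OF this] show ?thesis by simp
      qed
      ultimately show ?thesis by (rule smooth_fun_congI[OF fin op])
    qed
    then show "smooth_transition ?I (U, snd c) d"
      using * by (simp add: smooth_in_charts_def smooth_transition_def)
    have "smooth_in_charts ?I ?I d c {x \<in> fst d \<inter> fst c. id x \<in> U} (id \<circ> id)"
      by (rule smooth_in_charts_compose[OF charts_transition[OF M d' c] cU fin fin chart_inj[OF d'] chart_inj[OF c]
            open_coord_subset[OF chart_open[OF c]]])
    moreover have "{x \<in> fst d \<inter> fst c. id x \<in> U} = fst d \<inter> U" using U by auto
    ultimately show "smooth_transition ?I d (U, snd c)"
      by (simp add: smooth_in_charts_def smooth_transition_def)
  qed
  moreover have "is_chart M (U, snd c)"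
    using U chart_inj[OF c] chart_subset[OF c] by (auto simp: is_chart_def intro: inj_on_subset)
  ultimately show ?thesis by (simp add: charts_def)
qed

text \<open>A chart can be shrunk to any open part of its domain, so the full chart domains demanded
  by the definition may be traded for open sets \<open>U\<close>.\<close>

lemma smooth_map_on_iff:
  assumes M: "premanifold M"
  shows "smooth_map_on M N S f \<longleftrightarrow>
    (\<forall>x\<in>S. \<exists>c\<in>charts M. \<exists>d\<in>charts N. \<exists>U. x \<in> U \<and> U \<subseteq> S \<and> smooth_in_charts (midx M) (midx N) c d U f)"
    (is "?L \<longleftrightarrow> ?R")
proof
  assume L: ?L
  show ?R
  proof
    fix x assume "x \<in> S"
    then obtain c d where cd: "c \<in> charts M" "d \<in> charts N" "x \<in> fst c" "fst c \<subseteq> S" "f ` fst c \<subseteq> fst d"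
      "\<forall>j\<in>midx N. smooth_fun (midx M) (snd c ` fst c) (\<lambda>u. snd d (f (chart_inv c u)) j)"
      using L unfolding smooth_map_on_def by blast
    then have "smooth_in_charts (midx M) (midx N) c d (fst c) f"
      using chart_open[OF cd(1)] by (simp add: smooth_in_charts_def)
    then show "\<exists>c\<in>charts M. \<exists>d\<in>charts N. \<exists>U. x \<in> U \<and> U \<subseteq> S \<and> smooth_in_charts (midx M) (midx N) c d U f"
      using cd by blast
  qed
next
  assume R: ?R
  show ?L unfolding smooth_map_on_def
  proof
    fix x assume "x \<in> S"
    then obtain c d U where cd: "c \<in> charts M" "d \<in> charts N" "x \<in> U" "U \<subseteq> S"
      and s: "smooth_in_charts (midx M) (midx N) c d U f" using R by blast
    have U: "U \<subseteq> fst c" "open_coord (midx M) (snd c ` U)" "f ` U \<subseteq> fst d" using s by (auto simp: smooth_in_charts_def)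
    have fin: "finite (midx M)" using M by (rule premanifold_finite)
    have inv: "inv_into U (snd c) u = chart_inv c u" if "u \<in> snd c ` U" for u
      using restrict_chart_inv[OF chart_inj[OF cd(1)] U(1) that] .
    have "smooth_fun (midx M) (snd c ` U) (\<lambda>u. snd d (f (chart_inv (U, snd c) u)) j)" if "j \<in> midx N" for j
    proof (rule smooth_fun_congI[OF fin U(2)])
      show "smooth_fun (midx M) (snd c ` U) (\<lambda>u. snd d (f (chart_inv c u)) j)"
        using s that by (simp add: smooth_in_charts_def)
    qed (simp only: inv fst_conv snd_conv)
    then show "\<exists>c\<in>charts M. \<exists>d\<in>charts N.
           x \<in> fst c \<and> fst c \<subseteq> S \<and> f ` fst c \<subseteq> fst d \<and>
           (\<forall>j\<in>midx N. smooth_fun (midx M) (snd c ` fst c) (\<lambda>u. snd d (f (chart_inv c u)) j))"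
      using cd U by (intro bexI[OF _ restrict_chart[OF M cd(1) U(1,2)]] bexI[OF _ cd(2)]) simp
  qed
qed

text \<open>The definition provides one suitable pair of charts at each point; inserting transitions
  at source and target carries smoothness to every pair.\<close>

lemma smooth_map_on_in_charts:
  assumes M: "premanifold M" and N: "premanifold N" and f: "smooth_map_on M N S f"
    and c: "c \<in> charts M" and d: "d \<in> charts N"
  shows "smooth_in_charts (midx M) (midx N) c d {x \<in> fst c \<inter> S. f x \<in> fst d} f"
proof (rule smooth_in_charts_locally)
  fix x assume x: "x \<in> {x \<in> fst c \<inter> S. f x \<in> fst d}"
  then obtain c' d' U where cd: "c' \<in> charts M" "d' \<in> charts N" "x \<in> U" "U \<subseteq> S"
    and s: "smooth_in_charts (midx M) (midx N) c' d' U f"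
    using f unfolding smooth_map_on_iff[OF M] by blast
  have U: "U \<subseteq> fst c'" "f ` U \<subseteq> fst d'" using s by (auto simp: smooth_in_charts_def)
  note fin = premanifold_finite[OF M] premanifold_finite[OF N]
  note coord = open_coord_subset[OF chart_open]
  have "smooth_in_charts (midx M) (midx N) c d' {x \<in> fst c \<inter> fst c'. id x \<in> U} (f \<circ> id)"
    by (rule smooth_in_charts_compose[OF charts_transition[OF M c cd(1)] s fin(1,1) chart_inj[OF c] chart_inj[OF cd(1)] coord[OF cd(1)]])
  from smooth_in_charts_compose[OF this charts_transition[OF N cd(2) d] fin chart_inj[OF c] chart_inj[OF cd(2)] coord[OF cd(2)]]
  have "smooth_in_charts (midx M) (midx N) c d
      {x \<in> {x \<in> fst c \<inter> fst c'. id x \<in> U}. (f \<circ> id) x \<in> fst d' \<inter> fst d} f" by simp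
  then show "\<exists>V. x \<in> V \<and> V \<subseteq> {x \<in> fst c \<inter> S. f x \<in> fst d} \<and> smooth_in_charts (midx M) (midx N) c d V f"
    using x cd U by (intro exI[of _ "{x \<in> {x \<in> fst c \<inter> fst c'. id x \<in> U}. (f \<circ> id) x \<in> fst d' \<inter> fst d}"]) auto
qed

lemma smooth_map_on_cong:
  assumes M: "premanifold M" and "\<And>x. x \<in> S \<Longrightarrow> f x = g x" and f: "smooth_map_on M N S f"
  shows "smooth_map_on M N S g"
  unfolding smooth_map_on_iff[OF M]
proof
  fix x assume "x \<in> S"
  then obtain c d U where cd: "c \<in> charts M" "d \<in> charts N" "x \<in> U" "U \<subseteq> S"
    and s: "smooth_in_charts (midx M) (midx N) c d U f"
    using f unfolding smooth_map_on_iff[OF M] by blast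
  have "smooth_in_charts (midx M) (midx N) c d U g"
    by (rule smooth_in_charts_cong[OF premanifold_finite[OF M] chart_inj[OF cd(1)] _ s]) (use assms(2) cd(4) in blast)
  then show "\<exists>c\<in>charts M. \<exists>d\<in>charts N. \<exists>U. x \<in> U \<and> U \<subseteq> S \<and> smooth_in_charts (midx M) (midx N) c d U g"
    using cd by blast
qed

lemma smooth_map_on_locally:
  assumes "\<And>x. x \<in> S \<Longrightarrow> \<exists>T. x \<in> T \<and> T \<subseteq> S \<and> smooth_map_on M N T f"
  shows "smooth_map_on M N S f"
  unfolding smooth_map_on_def
proof
  fix x assume "x \<in> S"
  then obtain T where T: "x \<in> T" "T \<subseteq> S" "smooth_map_on M N T f" using assms by blast
  then obtain c d where "c \<in> charts M" "d \<in> charts N" "x \<in> fst c \<and> fst c \<subseteq> T \<and> f ` fst c \<subseteq> fst d \<and>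
        (\<forall>j\<in>midx N. smooth_fun (midx M) (snd c ` fst c) (\<lambda>u. snd d (f (chart_inv c u)) j))"
    unfolding smooth_map_on_def by blast
  with T(2) show "\<exists>c\<in>charts M. \<exists>d\<in>charts N. x \<in> fst c \<and> fst c \<subseteq> S \<and> f ` fst c \<subseteq> fst d \<and>
        (\<forall>j\<in>midx N. smooth_fun (midx M) (snd c ` fst c) (\<lambda>u. snd d (f (chart_inv c u)) j))"
    by (intro bexI[of _ c] bexI[of _ d]) auto
qed

text \<open>Since smoothness on a set entails its openness, this also yields open preimages, by
  taking the identity of an open set for \<open>g\<close>.\<close>

lemma smooth_map_on_preimage_compose:
  assumes M: "premanifold M" and N: "premanifold N" and P: "premanifold P"
    and f: "smooth_map_on M N S f" and g: "smooth_map_on N P T g"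
  shows "smooth_map_on M P {x\<in>S. f x \<in> T} (g \<circ> f)"
  unfolding smooth_map_on_iff[OF M]
proof
  fix x assume "x \<in> {x\<in>S. f x \<in> T}"
  then have x: "x \<in> S" "f x \<in> T" by auto
  obtain c d U where cd: "c \<in> charts M" "d \<in> charts N" "x \<in> U" "U \<subseteq> S"
    and s: "smooth_in_charts (midx M) (midx N) c d U f"
    using f x(1) unfolding smooth_map_on_iff[OF M] by blast
  obtain d' e V where de: "d' \<in> charts N" "e \<in> charts P" "f x \<in> V" "V \<subseteq> T"
    and t: "smooth_in_charts (midx N) (midx P) d' e V g"
    using g x(2) unfolding smooth_map_on_iff[OF N] by blast
  have UV: "U \<subseteq> fst c" "f ` U \<subseteq> fst d" "V \<subseteq> fst d'" "g ` V \<subseteq> fst e"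
    using s t by (auto simp: smooth_in_charts_def)
  have *: "smooth_in_charts (midx N) (midx P) d e {y \<in> fst d \<inter> T. g y \<in> fst e} g"
    by (rule smooth_map_on_in_charts[OF N P g cd(2) de(2)])
  have "smooth_in_charts (midx M) (midx P) c e {x\<in>U. f x \<in> {y \<in> fst d \<inter> T. g y \<in> fst e}} (g \<circ> f)"
    by (rule smooth_in_charts_compose[OF s * premanifold_finite[OF M] premanifold_finite[OF N]
          chart_inj[OF cd(1)] chart_inj[OF cd(2)] open_coord_subset[OF chart_open[OF cd(2)]]])
  then show "\<exists>c\<in>charts M. \<exists>d\<in>charts P. \<exists>U. x \<in> U \<and> U \<subseteq> {x\<in>S. f x \<in> T} \<and>
      smooth_in_charts (midx M) (midx P) c d U (g \<circ> f)"
    using x cd de UV by (intro bexI[OF _ cd(1)] bexI[OF _ de(2)]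
        exI[of _ "{x\<in>U. f x \<in> {y \<in> fst d \<inter> T. g y \<in> fst e}}"]) auto
qed

lemma smooth_map_on_compose:
  assumes "premanifold M" "premanifold N" "premanifold P"
    and "smooth_map_on M N S f" "smooth_map_on N P T g" "f ` S \<subseteq> T"
  shows "smooth_map_on M P S (g \<circ> f)"
proof -
  have "{x\<in>S. f x \<in> T} = S" using assms(6) by auto
  then show ?thesis using smooth_map_on_preimage_compose[OF assms(1-5)] by simp
qed

subsection \<open>The manifold topology\<close>

text \<open>Injectivity of the charts makes their images commute with intersections.\<close>

lemma istopology_mtop:
  assumes "\<And>c. c \<in> matlas M \<Longrightarrow> inj_on (snd c) (fst c)"
  shows "istopology (\<lambda>S. S \<subseteq> mcarrier M \<and> (\<forall>c\<in>matlas M. open_coord (midx M) (snd c ` (S \<inter> fst c))))"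
  unfolding istopology_def
proof (intro conjI allI impI ballI)
  fix S T assume S: "S \<subseteq> mcarrier M \<and> (\<forall>c\<in>matlas M. open_coord (midx M) (snd c ` (S \<inter> fst c)))"
    and T: "T \<subseteq> mcarrier M \<and> (\<forall>c\<in>matlas M. open_coord (midx M) (snd c ` (T \<inter> fst c)))"
  then show "S \<inter> T \<subseteq> mcarrier M" by auto
  fix c assume c: "c \<in> matlas M"
  have "snd c ` (S \<inter> T \<inter> fst c) = snd c ` (S \<inter> fst c) \<inter> snd c ` (T \<inter> fst c)"
    using assms[OF c] by (auto simp: inj_on_def)
  then show "open_coord (midx M) (snd c ` (S \<inter> T \<inter> fst c))"
    using S T c open_coord_Int by metis
next
  fix K assume K: "\<forall>S\<in>K. S \<subseteq> mcarrier M \<and> (\<forall>c\<in>matlas M. open_coord (midx M) (snd c ` (S \<inter> fst c)))"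
  then show "\<Union>K \<subseteq> mcarrier M" by auto
  fix c assume c: "c \<in> matlas M"
  show "open_coord (midx M) (snd c ` (\<Union>K \<inter> fst c))"
  proof (rule open_coord_locally)
    fix x assume "x \<in> snd c ` (\<Union>K \<inter> fst c)"
    then obtain S where S: "S \<in> K" "x \<in> snd c ` (S \<inter> fst c)" by auto
    then show "\<exists>T. open_coord (midx M) T \<and> x \<in> T \<and> T \<subseteq> snd c ` (\<Union>K \<inter> fst c)"
      using K c by (intro exI[of _ "snd c ` (S \<inter> fst c)"]) auto
  qed
qed

lemma openin_mtop_atlas:
  assumes "premanifold M"
  shows "openin (mtop M) S \<longleftrightarrow>
    S \<subseteq> mcarrier M \<and> (\<forall>c\<in>matlas M. open_coord (midx M) (snd c ` (S \<inter> fst c)))"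
proof -
  have inj: "inj_on (snd c) (fst c)" if "c \<in> matlas M" for c
    using chart_inj[OF premanifold_atlas[OF assms that]] .
  have "openin (mtop M) = (\<lambda>S. S \<subseteq> mcarrier M \<and>
      (\<forall>c\<in>matlas M. open_coord (midx M) (snd c ` (S \<inter> fst c))))"
    unfolding mtop_def by (rule topology_inverse'[OF istopology_mtop[OF inj]])
  then show ?thesis by simp
qed

text \<open>Openness is read off from smoothness of the identity on the set:
  \<open>smooth_in_charts\<close> contains openness of the coordinate image, so the composition
  lemma transports it from atlas charts to all charts.\<close>

lemma openin_mtop_chart:
  assumes M: "premanifold M" and S: "openin (mtop M) S" and c: "c \<in> charts M"
  shows "open_coord (midx M) (snd c ` (S \<inter> fst c))"
proof -
  have fin: "finite (midx M)" using M by (rule premanifold_finite)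
  have "smooth_in_charts (midx M) (midx M) c c (S \<inter> fst c) id"
  proof (rule smooth_in_charts_locally)
    fix x assume x: "x \<in> S \<inter> fst c"
    then obtain e where e: "e \<in> matlas M" "e \<in> charts M" "x \<in> fst e"
      using premanifold_cover[OF M] chart_subset[OF c] by blast
    have "open_coord (midx M) (snd e ` (S \<inter> fst e))" using S e(1) openin_mtop_atlas[OF M] by blast
    then have "smooth_in_charts (midx M) (midx M) e e (S \<inter> fst e) id"
      by (intro smooth_in_charts_id[OF fin chart_inj[OF e(2)]]) auto
    from smooth_in_charts_compose[OF this charts_transition[OF M e(2) c] fin fin chart_inj[OF e(2)] chart_inj[OF e(2)]
        open_coord_subset[OF chart_open[OF e(2)]]]
    have "smooth_in_charts (midx M) (midx M) e c (S \<inter> fst e \<inter> fst c) id"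
      by (simp add: Int_def conj_ac)
    from smooth_in_charts_compose[OF charts_transition[OF M c e(2)] this fin fin chart_inj[OF c] chart_inj[OF e(2)]
        open_coord_subset[OF chart_open[OF e(2)]]]
    have "smooth_in_charts (midx M) (midx M) c c (fst c \<inter> fst e \<inter> S) id"
      by (simp add: Int_def conj_ac)
    then show "\<exists>V. x \<in> V \<and> V \<subseteq> S \<inter> fst c \<and> smooth_in_charts (midx M) (midx M) c c V id"
      using x e(3) by (intro exI[of _ "fst c \<inter> fst e \<inter> S"]) auto
  qed
  then show ?thesis by (simp add: smooth_in_charts_def)
qed

lemma openin_mtop_in_chart:
  assumes M: "premanifold M" and c: "c \<in> charts M" and U: "U \<subseteq> fst c" "open_coord (midx M) (snd c ` U)"
  shows "openin (mtop M) U"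
  unfolding openin_mtop_atlas[OF M]
proof (intro conjI ballI)
  show "U \<subseteq> mcarrier M" using U chart_subset[OF c] by blast
  fix d assume d: "d \<in> matlas M"
  have fin: "finite (midx M)" using M by (rule premanifold_finite)
  have "smooth_in_charts (midx M) (midx M) d c {x \<in> fst d \<inter> fst c. id x \<in> U} (id \<circ> id)"
    by (rule smooth_in_charts_compose[OF charts_transition[OF M premanifold_atlas[OF M d] c]
          smooth_in_charts_id[OF fin chart_inj[OF c] U] fin fin
          chart_inj[OF premanifold_atlas[OF M d]] chart_inj[OF c] open_coord_subset[OF chart_open[OF c]]])
  moreover have "{x \<in> fst d \<inter> fst c. id x \<in> U} = U \<inter> fst d" using U by auto
  ultimately show "open_coord (midx M) (snd d ` (U \<inter> fst d))" by (simp add: smooth_in_charts_def)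
qed

lemma openin_chart: "premanifold M \<Longrightarrow> c \<in> charts M \<Longrightarrow> openin (mtop M) (fst c)"
  by (rule openin_mtop_in_chart) (auto intro: chart_open)

lemma topspace_mtop: "premanifold M \<Longrightarrow> topspace (mtop M) = mcarrier M"
proof
  assume M: "premanifold M"
  show "topspace (mtop M) \<subseteq> mcarrier M"
    using openin_topspace[of "mtop M"] unfolding openin_mtop_atlas[OF M] by blast
  show "mcarrier M \<subseteq> topspace (mtop M)"
  proof
    fix x assume "x \<in> mcarrier M"
    then obtain c where "c \<in> charts M" "x \<in> fst c" using premanifold_cover[OF M] by blast
    then show "x \<in> topspace (mtop M)" using openin_subset[OF openin_chart[OF M]] by blast
  qed
qed

lemma openin_mcarrier: "premanifold M \<Longrightarrow> openin (mtop M) (mcarrier M)"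
  using openin_topspace[of "mtop M"] topspace_mtop by metis

lemma smooth_in_charts_openin:
  "premanifold M \<Longrightarrow> c \<in> charts M \<Longrightarrow> smooth_in_charts (midx M) J c d U f \<Longrightarrow> openin (mtop M) U"
  by (rule openin_mtop_in_chart) (auto simp: smooth_in_charts_def)

lemma smooth_in_charts_chart:
  assumes "premanifold M" "c \<in> charts M" "openin (mtop M) U" "U \<subseteq> fst c"
  shows "smooth_in_charts (midx M) (midx M) c c U id"
  using smooth_in_charts_id[OF premanifold_finite[OF assms(1)] chart_inj[OF assms(2)] assms(4)]
    openin_mtop_chart[OF assms(1,3,2)] assms(4) by (simp add: Int_absorb2)

lemma smooth_map_on_id:
  assumes M: "premanifold M" and S: "openin (mtop M) S"
  shows "smooth_map_on M M S id"
  unfolding smooth_map_on_iff[OF M]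
proof
  fix x assume x: "x \<in> S"
  then have "x \<in> mcarrier M" using S openin_mtop_atlas[OF M] by blast
  then obtain c where c: "c \<in> charts M" "x \<in> fst c"
    using premanifold_cover[OF M] by blast
  have "smooth_in_charts (midx M) (midx M) c c (S \<inter> fst c) id"
    by (rule smooth_in_charts_chart[OF M c(1) openin_Int[OF S openin_chart[OF M c(1)]]]) simp
  then show "\<exists>c\<in>charts M. \<exists>d\<in>charts M. \<exists>U. x \<in> U \<and> U \<subseteq> S \<and> smooth_in_charts (midx M) (midx M) c d U id"
    using c x by blast
qed

lemma smooth_map_on_openin:
  assumes M: "premanifold M" and f: "smooth_map_on M N S f"
  shows "openin (mtop M) S"
proof (subst openin_subopen, intro ballI)
  fix x assume "x \<in> S"
  then obtain c d U where U: "c \<in> charts M" "x \<in> U" "U \<subseteq> S" "smooth_in_charts (midx M) (midx N) c d U f"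
    using f unfolding smooth_map_on_iff[OF M] by blast
  from smooth_in_charts_openin[OF M U(1,4)] U(2,3)
  show "\<exists>T. openin (mtop M) T \<and> x \<in> T \<and> T \<subseteq> S" by blast
qed

lemma smooth_map_on_preimage:
  assumes "premanifold M" "premanifold N" "smooth_map_on M N S f" "openin (mtop N) T"
  shows "openin (mtop M) {x\<in>S. f x \<in> T}"
  by (rule smooth_map_on_openin[OF assms(1)
        smooth_map_on_preimage_compose[OF assms(1,2,2,3) smooth_map_on_id[OF assms(2,4)]]])

lemma smooth_map_on_subset:
  assumes "premanifold M" "premanifold N" "smooth_map_on M N S f" "openin (mtop M) T" "T \<subseteq> S"
  shows "smooth_map_on M N T f"
  using smooth_map_on_compose[OF assms(1,1,2) smooth_map_on_id[OF assms(1,4)] assms(3)] assms(5) by simp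

subsection \<open>Products and the real line\<close>

abbreviation real_chart :: "(real, unit) chart" where "real_chart \<equiv> (UNIV, \<lambda>t _. t)"

lemma real_chart_image: "(\<lambda>t (_::unit). t) ` S = {u. u () \<in> S}"
  by (auto simp: image_iff intro!: ext bexI)

lemma real_chart_inv: "chart_inv real_chart u = u ()"
proof -
  have "u = (\<lambda>_. u ())" by auto
  then have "chart_inv real_chart u = inv_into UNIV (\<lambda>t (_::unit). t) ((\<lambda>t (_::unit). t) (u ()))" by simp
  also have "\<dots> = u ()" by (rule inv_into_f_f) (auto simp: inj_on_def fun_eq_iff)
  finally show ?thesis .
qed

lemma coord_space_UNIV: "coord_space UNIV = UNIV"
  by (auto simp: coord_space_def)

lemma open_coord_real: "open S \<Longrightarrow> open_coord UNIV {u::unit \<Rightarrow> real. u () \<in> S}"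
  by (simp add: open_coord_def coord_space_UNIV)
    (rule open_vimage[of S "\<lambda>u. u ()", unfolded vimage_def], auto intro: continuous_on_product_coordinates)

lemma real_chart_charts: "real_chart \<in> charts real_mfd"
proof -
  have "smooth_transition UNIV real_chart real_chart"
    unfolding smooth_transition_iff
    by (rule smooth_in_charts_id) (auto simp: inj_on_def fun_eq_iff real_chart_image intro: open_coord_real[of UNIV, simplified])
  then show ?thesis
    by (auto simp: charts_def real_mfd_def is_chart_def inj_on_def fun_eq_iff real_chart_image
        intro: open_coord_real[of UNIV, simplified])
qed

lemma midx_real [simp]: "midx real_mfd = UNIV" and mcarrier_real [simp]: "mcarrier real_mfd = UNIV"
  and matlas_real [simp]: "matlas real_mfd = {real_chart}"
  by (auto simp: real_mfd_def)

lemma premanifold_real: "premanifold real_mfd"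
  using real_chart_charts by (auto simp: premanifold_def)

lemma openin_mtop_real: "open S \<Longrightarrow> openin (mtop real_mfd) S"
  by (rule openin_mtop_in_chart[OF premanifold_real real_chart_charts])
    (auto simp: real_chart_image intro: open_coord_real)

section \<open>Product charts\<close>

definition prod_chart :: "('a, 'i) chart \<Rightarrow> ('b, 'j) chart \<Rightarrow> ('a \<times> 'b, 'i + 'j) chart" where
  "prod_chart c d = (fst c \<times> fst d, \<lambda>(a, b). case_sum (snd c a) (snd d b))"

lemma fst_prod_chart [simp]: "fst (prod_chart c d) = fst c \<times> fst d"
  and snd_prod_chart [simp]: "snd (prod_chart c d) (a, b) = case_sum (snd c a) (snd d b)"
  by (auto simp: prod_chart_def)

lemma mcarrier_prod [simp]: "mcarrier (prod_mfd M N) = mcarrier M \<times> mcarrier N"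
  and midx_prod [simp]: "midx (prod_mfd M N) = midx M <+> midx N"
  and matlas_prod: "matlas (prod_mfd M N) = {prod_chart c d | c d. c \<in> matlas M \<and> d \<in> matlas N}"
  by (auto simp: prod_mfd_def prod_chart_def)

lemma case_sum_comp: "case_sum (w \<circ> Inl) (w \<circ> Inr) = w"
  by (auto simp: fun_eq_iff split: sum.split)

lemma case_sum_eq_iff: "case_sum a b = case_sum a' b' \<longleftrightarrow> a = a' \<and> b = b'"
proof
  assume *: "case_sum a b = case_sum a' b'"
  have "a i = a' i" "b j = b' j" for i j
    using fun_cong[OF *, of "Inl i"] fun_cong[OF *, of "Inr j"] by auto
  then show "a = a' \<and> b = b'" by auto
qed auto

lemma inj_on_prod_chart:
  "inj_on (snd c) (fst c) \<Longrightarrow> inj_on (snd d) (fst d) \<Longrightarrow> inj_on (snd (prod_chart c d)) (fst (prod_chart c d))"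
  by (auto simp: inj_on_def case_sum_eq_iff)

lemma prod_chart_image: "snd (prod_chart c d) ` (U \<times> V) = {w. w \<circ> Inl \<in> snd c ` U \<and> w \<circ> Inr \<in> snd d ` V}"
proof (intro Set.set_eqI iffI)
  fix w assume "w \<in> snd (prod_chart c d) ` (U \<times> V)"
  then obtain a b where "a \<in> U" "b \<in> V" "w = case_sum (snd c a) (snd d b)" by auto
  moreover from this(3) have "w \<circ> Inl = snd c a" "w \<circ> Inr = snd d b" by (auto simp: fun_eq_iff)
  ultimately show "w \<in> {w. w \<circ> Inl \<in> snd c ` U \<and> w \<circ> Inr \<in> snd d ` V}" by simp
next
  fix w assume "w \<in> {w. w \<circ> Inl \<in> snd c ` U \<and> w \<circ> Inr \<in> snd d ` V}"
  then obtain a b where ab: "a \<in> U" "b \<in> V" "w \<circ> Inl = snd c a" "w \<circ> Inr = snd d b" by blast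
  have "w = snd (prod_chart c d) (a, b)" using case_sum_comp[of w] ab by simp
  then show "w \<in> snd (prod_chart c d) ` (U \<times> V)" using ab by blast
qed

lemma prod_chart_inv:
  assumes "inj_on (snd c) (fst c)" "inj_on (snd d) (fst d)"
    "w \<in> snd (prod_chart c d) ` (fst c \<times> fst d)"
  shows "chart_inv (prod_chart c d) w = (chart_inv c (w \<circ> Inl), chart_inv d (w \<circ> Inr))"
proof -
  obtain a b where ab: "a \<in> fst c" "b \<in> fst d" "w = case_sum (snd c a) (snd d b)" using assms(3) by auto
  have "chart_inv (prod_chart c d) (snd (prod_chart c d) (a, b)) = (a, b)"
    by (rule inv_into_f_f[OF inj_on_prod_chart[OF assms(1,2)]]) (use ab in auto)
  moreover have "w \<circ> Inl = snd c a" "w \<circ> Inr = snd d b" using ab by (auto simp: fun_eq_iff)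
  ultimately show ?thesis using ab assms(1,2) by auto
qed

lemma coord_space_Plus: "w \<in> coord_space (I <+> J) \<longleftrightarrow> w \<circ> Inl \<in> coord_space I \<and> w \<circ> Inr \<in> coord_space J"
  by (auto simp: coord_space_def) (metis sum.exhaust InlI InrI Inl_inject Inr_inject Inl_Inr_False PlusE)

lemma continuous_on_comp_coord: "continuous_on S (\<lambda>w::'a \<Rightarrow> real. w \<circ> h)"
  by (rule continuous_on_coordinatewise_then_product)
    (auto intro: continuous_on_subset[OF continuous_on_product_coordinates])

lemma open_coord_Plus:
  assumes "open_coord I S" "open_coord J T"
  shows "open_coord (I <+> J) {w. w \<circ> Inl \<in> S \<and> w \<circ> Inr \<in> T}"
proof -
  have top: "open_coord (I <+> J) (coord_space (I <+> J))" by (simp add: open_coord_def)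
  have "open_coord (I <+> J) {w \<in> coord_space (I <+> J). w \<circ> Inl \<in> S}"
    by (rule open_coord_preimage[OF top continuous_on_comp_coord assms(1)]) (auto simp: coord_space_Plus)
  moreover have "open_coord (I <+> J) {w \<in> coord_space (I <+> J). w \<circ> Inr \<in> T}"
    by (rule open_coord_preimage[OF top continuous_on_comp_coord assms(2)]) (auto simp: coord_space_Plus)
  ultimately have "open_coord (I <+> J) ({w \<in> coord_space (I <+> J). w \<circ> Inl \<in> S} \<inter> {w \<in> coord_space (I <+> J). w \<circ> Inr \<in> T})"
    by (rule open_coord_Int)
  moreover have "{w \<in> coord_space (I <+> J). w \<circ> Inl \<in> S} \<inter> {w \<in> coord_space (I <+> J). w \<circ> Inr \<in> T} = {w. w \<circ> Inl \<in> S \<and> w \<circ> Inr \<in> T}"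
    using open_coord_subset[OF assms(1)] open_coord_subset[OF assms(2)] by (auto simp: coord_space_Plus)
  ultimately show ?thesis by simp
qed

text \<open>With \<open>h = Inl\<close> or \<open>h = Inr\<close>, a function of one factor is
  regarded as a function on the product.\<close>

lemma smooth_fun_reindex:
  assumes "finite I" "finite K" "open_coord I S" "open_coord K T" "smooth_fun I S f"
    and "\<And>w. w \<in> T \<Longrightarrow> w \<circ> h \<in> S"
  shows "smooth_fun K T (\<lambda>w. f (w \<circ> h))"
  by (rule smooth_fun_compose[OF assms(2,1,4,3) _ _ assms(5)])
    (use assms in \<open>auto simp: o_def intro: smooth_fun_proj\<close>)

lemma smooth_in_charts_prod:
  assumes f: "smooth_in_charts I I' c c' U f" and g: "smooth_in_charts J J' d d' V g"
    and fin: "finite I" "finite J"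
    and inj: "inj_on (snd c) (fst c)" "inj_on (snd d) (fst d)"
  shows "smooth_in_charts (I <+> J) (I' <+> J') (prod_chart c d) (prod_chart c' d') (U \<times> V) (map_prod f g)"
proof -
  have U: "U \<subseteq> fst c" "f ` U \<subseteq> fst c'" "open_coord I (snd c ` U)"
    and V: "V \<subseteq> fst d" "g ` V \<subseteq> fst d'" "open_coord J (snd d ` V)"
    using f g by (auto simp: smooth_in_charts_def)
  let ?S = "snd (prod_chart c d) ` (U \<times> V)"
  have finP: "finite (I <+> J)" using fin by simp
  have op: "open_coord (I <+> J) ?S"
    unfolding prod_chart_image by (rule open_coord_Plus[OF U(3) V(3)])
  have inv: "chart_inv (prod_chart c d) w = (chart_inv c (w \<circ> Inl), chart_inv d (w \<circ> Inr))" if "w \<in> ?S" for w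
    by (rule prod_chart_inv[OF inj]) (use that U V in blast)
  have "smooth_fun (I <+> J) ?S (\<lambda>w. snd (prod_chart c' d') (map_prod f g (chart_inv (prod_chart c d) w)) k)"
    if "k \<in> I' <+> J'" for k
  proof (cases k)
    case (Inl i)
    then have "smooth_fun (I <+> J) ?S (\<lambda>w. snd c' (f (chart_inv c (w \<circ> Inl))) i)"
      using f that by (intro smooth_fun_reindex[OF fin(1) finP U(3) op]) (auto simp: smooth_in_charts_def prod_chart_image)
    then show ?thesis by (rule iffD1[OF smooth_fun_cong[OF finP op], rotated]) (simp only: inv Inl map_prod_simp snd_prod_chart sum.case)
  next
    case (Inr i)
    then have "smooth_fun (I <+> J) ?S (\<lambda>w. snd d' (g (chart_inv d (w \<circ> Inr))) i)"
      using g that by (intro smooth_fun_reindex[OF fin(2) finP V(3) op]) (auto simp: smooth_in_charts_def prod_chart_image)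
    then show ?thesis by (rule iffD1[OF smooth_fun_cong[OF finP op], rotated]) (simp only: inv Inr map_prod_simp snd_prod_chart sum.case)
  qed
  then show ?thesis using U V op by (auto simp: smooth_in_charts_def)
qed

lemma prod_chart_charts:
  assumes M: "premanifold M" and N: "premanifold N" and c: "c \<in> charts M" and d: "d \<in> charts N"
  shows "prod_chart c d \<in> charts (prod_mfd M N)"
proof -
  have "smooth_transition (midx M <+> midx N) (prod_chart c d) (prod_chart c' d')"
    if "c \<in> charts M" "c' \<in> charts M" "d \<in> charts N" "d' \<in> charts N" for c c' d d'
  proof -
    have "smooth_in_charts (midx M <+> midx N) (midx M <+> midx N) (prod_chart c d) (prod_chart c' d')
        ((fst c \<inter> fst c') \<times> (fst d \<inter> fst d')) (map_prod id id)"
      by (intro smooth_in_charts_prod charts_transition M N that chart_inj[OF that(1)] chart_inj[OF that(3)] premanifold_finite)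
    then show ?thesis unfolding smooth_transition_iff by (simp add: Times_Int_Times map_prod.id)
  qed
  note tr = this
  have "\<forall>e\<in>matlas (prod_mfd M N). smooth_transition (midx (prod_mfd M N)) (prod_chart c d) e \<and>
      smooth_transition (midx (prod_mfd M N)) e (prod_chart c d)"
  proof
    fix e assume "e \<in> matlas (prod_mfd M N)"
    then obtain c' d' where e: "e = prod_chart c' d'" "c' \<in> charts M" "d' \<in> charts N"
      unfolding matlas_prod using premanifold_atlas[OF M] premanifold_atlas[OF N] by blast
    show "smooth_transition (midx (prod_mfd M N)) (prod_chart c d) e \<and>
      smooth_transition (midx (prod_mfd M N)) e (prod_chart c d)"
      unfolding e(1) midx_prod using tr c d e(2,3) by simp
  qed
  moreover have "is_chart (prod_mfd M N) (prod_chart c d)"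
    unfolding is_chart_def using chart_subset[OF c] chart_subset[OF d] inj_on_prod_chart[OF chart_inj[OF c] chart_inj[OF d]]
      open_coord_Plus[OF chart_open[OF c] chart_open[OF d]] prod_chart_image[of c d "fst c" "fst d"] by auto
  ultimately show ?thesis by (simp add: charts_def)
qed

lemma premanifold_prod:
  assumes M: "premanifold M" and N: "premanifold N"
  shows "premanifold (prod_mfd M N)"
proof -
  have "(\<Union>c\<in>matlas (prod_mfd M N). fst c) = mcarrier (prod_mfd M N)"
  proof (intro Set.set_eqI iffI)
    fix x assume "x \<in> (\<Union>c\<in>matlas (prod_mfd M N). fst c)"
    then obtain e where "e \<in> matlas (prod_mfd M N)" and xe: "x \<in> fst e" by blast
    then obtain c d where c: "c \<in> matlas M" and d: "d \<in> matlas N" and e: "e = prod_chart c d"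
      unfolding matlas_prod by blast
    show "x \<in> mcarrier (prod_mfd M N)"
      using xe chart_subset[OF premanifold_atlas[OF M c]] chart_subset[OF premanifold_atlas[OF N d]]
      unfolding e fst_prod_chart mcarrier_prod by blast
  next
    fix x assume "x \<in> mcarrier (prod_mfd M N)"
    then obtain a b where x: "x = (a, b)" "a \<in> mcarrier M" "b \<in> mcarrier N" by auto
    obtain c where c: "c \<in> matlas M" "a \<in> fst c" using premanifold_cover[OF M x(2)] by blast
    obtain d where d: "d \<in> matlas N" "b \<in> fst d" using premanifold_cover[OF N x(3)] by blast
    show "x \<in> (\<Union>c\<in>matlas (prod_mfd M N). fst c)"
      by (rule UN_I[of "prod_chart c d"]) (use c d x matlas_prod in \<open>blast | simp\<close>)+
  qed
  moreover have "matlas (prod_mfd M N) \<subseteq> charts (prod_mfd M N)"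
    using prod_chart_charts[OF M N] premanifold_atlas[OF M] premanifold_atlas[OF N] by (auto simp: matlas_prod)
  ultimately show ?thesis using M N by (simp add: premanifold_def)
qed

lemma openin_mtop_prod:
  assumes M: "premanifold M" and N: "premanifold N" and S: "openin (mtop M) S" and T: "openin (mtop N) T"
  shows "openin (mtop (prod_mfd M N)) (S \<times> T)"
proof (subst openin_subopen, intro ballI)
  fix x assume x: "x \<in> S \<times> T"
  obtain a b where ab: "x = (a, b)" by force
  have "a \<in> mcarrier M" using S x ab unfolding openin_mtop_atlas[OF M] by blast
  then obtain c where c: "c \<in> charts M" "a \<in> fst c" using premanifold_cover[OF M] by blast
  have "b \<in> mcarrier N" using T x ab unfolding openin_mtop_atlas[OF N] by blast
  then obtain d where d: "d \<in> charts N" "b \<in> fst d" using premanifold_cover[OF N] by blast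
  have "openin (mtop (prod_mfd M N)) ((S \<inter> fst c) \<times> (T \<inter> fst d))"
    by (rule openin_mtop_in_chart[OF premanifold_prod[OF M N] prod_chart_charts[OF M N c(1) d(1)]])
      (auto simp: prod_chart_image intro: open_coord_Plus openin_mtop_chart[OF M S c(1)] openin_mtop_chart[OF N T d(1)])
  then show "\<exists>U. openin (mtop (prod_mfd M N)) U \<and> x \<in> U \<and> U \<subseteq> S \<times> T"
    using x ab c d by (intro exI[of _ "(S \<inter> fst c) \<times> (T \<inter> fst d)"]) auto
qed

subsection \<open>Curves and tangent vectors\<close>

lemma DERIV_eventually_cong:
  assumes "(f has_real_derivative D) (at x)" "eventually (\<lambda>t. f t = g t) (nhds x)"
  shows "(g has_real_derivative D) (at x)"
  using DERIV_cong_ev[OF refl assms(2) refl] assms(1) by simp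

lemma unit_fun_upd: "(f::unit \<Rightarrow> 'a)(() := s) = (\<lambda>_. s)"
  by auto

lemma open_coord_unit_interval:
  assumes "open_coord UNIV S" "(\<lambda>_::unit. a) \<in> S"
  obtains e where "e > 0" "\<And>t. \<bar>t - a\<bar> < e \<Longrightarrow> (\<lambda>_. t) \<in> S"
proof -
  obtain e where "e > 0" and e: "\<And>y. y \<in> coord_space UNIV \<Longrightarrow> (\<And>i. i \<in> UNIV \<Longrightarrow> \<bar>y i - a\<bar> < e) \<Longrightarrow> y \<in> S"
    using open_coordD[OF assms(1) finite assms(2)] by metis
  then show thesis using that[OF \<open>e > 0\<close>] by (simp add: coord_space_UNIV)
qed

text \<open>An open set of times containing 0 contains a symmetric interval, so preimages of open
  sets may serve as domains of curves.\<close>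

lemma smooth_curve_iff:
  assumes M: "premanifold M"
  shows "smooth_curve M \<sigma> \<longleftrightarrow> (\<exists>U. smooth_map_on real_mfd M U \<sigma> \<and> 0 \<in> U)"
proof
  assume "smooth_curve M \<sigma>"
  then obtain \<epsilon> where "\<epsilon> > 0" "smooth_map_on real_mfd M {-\<epsilon><..<\<epsilon>} \<sigma>" by (auto simp: smooth_curve_def)
  then show "\<exists>U. smooth_map_on real_mfd M U \<sigma> \<and> 0 \<in> U" by (intro exI[of _ "{-\<epsilon><..<\<epsilon>}"]) auto
next
  assume "\<exists>U. smooth_map_on real_mfd M U \<sigma> \<and> 0 \<in> U"
  then obtain U where U: "smooth_map_on real_mfd M U \<sigma>" "0 \<in> U" by blast
  have "open_coord UNIV {u::unit \<Rightarrow> real. u () \<in> U}"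
    using openin_mtop_chart[OF premanifold_real smooth_map_on_openin[OF premanifold_real U(1)] real_chart_charts]
    by (simp add: real_chart_image)
  then obtain e where e: "e > 0" "\<And>t. \<bar>t - 0\<bar> < e \<Longrightarrow> (\<lambda>_::unit. t) \<in> {u. u () \<in> U}"
    by (rule open_coord_unit_interval[of _ 0]) (use U in auto)
  then have "{-e<..<e} \<subseteq> U" by auto
  then have "smooth_map_on real_mfd M {-e<..<e} \<sigma>"
    by (intro smooth_map_on_subset[OF premanifold_real M U(1) openin_mtop_real]) auto
  then show "smooth_curve M \<sigma>" using e(1) by (auto simp: smooth_curve_def)
qed

lemma smooth_curve_compose:
  assumes "premanifold M" "premanifold N" "smooth_curve M \<sigma>" "smooth_map_on M N S f" "\<sigma> 0 \<in> S"
  shows "smooth_curve N (f \<circ> \<sigma>)"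
proof -
  obtain U where U: "smooth_map_on real_mfd M U \<sigma>" "0 \<in> U"
    using assms(3) smooth_curve_iff[OF assms(1)] by blast
  show ?thesis unfolding smooth_curve_iff[OF assms(2)]
    using smooth_map_on_preimage_compose[OF premanifold_real assms(1,2) U(1) assms(4)] U(2) assms(5)
    by (intro exI[of _ "{t \<in> U. \<sigma> t \<in> S}"]) simp
qed

lemma smooth_curve_in_mcarrier:
  assumes "premanifold M" "smooth_curve M \<sigma>"
  shows "\<sigma> 0 \<in> mcarrier M"
proof -
  obtain U where U: "smooth_map_on real_mfd M U \<sigma>" "0 \<in> U"
    using assms(2) smooth_curve_iff[OF assms(1)] by blast
  then obtain d where "d \<in> charts M" "\<sigma> 0 \<in> fst d" unfolding smooth_map_on_def by blast
  then show ?thesis using chart_subset by blast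
qed

lemma smooth_curve_chart:
  assumes M: "premanifold M" and \<sigma>: "smooth_curve M \<sigma>" and c: "c \<in> charts M" "\<sigma> 0 \<in> fst c"
  shows smooth_curve_eventually: "eventually (\<lambda>t. \<sigma> t \<in> fst c) (nhds 0)"
    and smooth_curve_derivative:
      "i \<in> midx M \<Longrightarrow> ((\<lambda>t. snd c (\<sigma> t) i) has_real_derivative snd (velocity M \<sigma>) c i) (at 0)"
proof -
  obtain U where U: "smooth_map_on real_mfd M U \<sigma>" "0 \<in> U"
    using \<sigma> smooth_curve_iff[OF M] by blast
  define V where "V = {u::unit \<Rightarrow> real. u () \<in> U \<and> \<sigma> (u ()) \<in> fst c}"
  have "smooth_in_charts UNIV (midx M) real_chart c {t \<in> fst real_chart \<inter> U. \<sigma> t \<in> fst c} \<sigma>"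
    using smooth_map_on_in_charts[OF premanifold_real M U(1) real_chart_charts c(1)] by simp
  then have V: "open_coord UNIV V"
    and s: "\<And>i. i \<in> midx M \<Longrightarrow> smooth_fun UNIV V (\<lambda>u. snd c (\<sigma> (chart_inv real_chart u)) i)"
    unfolding smooth_in_charts_def snd_conv real_chart_image V_def by auto
  have V0: "(\<lambda>_. 0) \<in> V" using U(2) c(2) by (simp add: V_def)
  obtain e where e: "e > 0" "\<And>t. \<bar>t - 0\<bar> < e \<Longrightarrow> (\<lambda>_::unit. t) \<in> V"
    using open_coord_unit_interval[OF V V0] by metis
  then show "eventually (\<lambda>t. \<sigma> t \<in> fst c) (nhds 0)"
    by (auto simp: eventually_nhds_metric dist_real_def V_def)
  assume i: "i \<in> midx M"
  have "has_pd () (\<lambda>u. snd c (\<sigma> (chart_inv real_chart u)) i) (pd () (\<lambda>u. snd c (\<sigma> (chart_inv real_chart u)) i) (\<lambda>_. 0)) (\<lambda>_. 0)"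
    by (rule smooth_fun_has_pd[OF s[OF i] _ V0]) simp
  then have "((\<lambda>t. snd c (\<sigma> t) i) has_real_derivative (pd () (\<lambda>u. snd c (\<sigma> (chart_inv real_chart u)) i) (\<lambda>_. 0))) (at 0)"
    unfolding has_pd_def unit_fun_upd real_chart_inv .
  moreover from DERIV_imp_deriv[OF this] have
    "snd (velocity M \<sigma>) c i = pd () (\<lambda>u. snd c (\<sigma> (chart_inv real_chart u)) i) (\<lambda>_. 0)"
    using c i by (simp add: velocity_def)
  ultimately show "((\<lambda>t. snd c (\<sigma> t) i) has_real_derivative snd (velocity M \<sigma>) c i) (at 0)" by simp
qed

lemma smooth_curveI:
  assumes M: "premanifold M" and c: "c \<in> charts M" and "\<epsilon> > 0"
    and \<gamma>: "\<And>t. \<bar>t\<bar> < \<epsilon> \<Longrightarrow> \<gamma> t \<in> snd c ` fst c"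
    and s: "\<And>i. i \<in> midx M \<Longrightarrow> smooth_fun UNIV {u::unit \<Rightarrow> real. \<bar>u ()\<bar> < \<epsilon>} (\<lambda>u. \<gamma> (u ()) i)"
  shows "smooth_curve M (\<lambda>t. chart_inv c (\<gamma> t))"
proof -
  let ?U = "{t. \<bar>t\<bar> < \<epsilon>}"
  have op: "open_coord UNIV {u::unit \<Rightarrow> real. \<bar>u ()\<bar> < \<epsilon>}"
  proof -
    have "open ?U" by (intro open_Collect_less continuous_intros)
    from open_coord_real[OF this] show ?thesis by simp
  qed
  have "smooth_in_charts UNIV (midx M) real_chart c ?U (\<lambda>t. chart_inv c (\<gamma> t))"
    unfolding smooth_in_charts_def snd_conv real_chart_image fst_conv
  proof (intro conjI ballI)
    show "(\<lambda>t. chart_inv c (\<gamma> t)) ` ?U \<subseteq> fst c" using chart_inv_in[OF \<gamma>] by blast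
    show "open_coord UNIV {u::unit \<Rightarrow> real. u () \<in> ?U}" using op by simp
    fix i assume i: "i \<in> midx M"
    have "smooth_fun UNIV {u. \<bar>u ()\<bar> < \<epsilon>} (\<lambda>u. snd c (chart_inv c (\<gamma> (u ()))) i)"
      by (rule smooth_fun_congI[OF _ op s[OF i]]) (simp_all add: chart_chart_inv[OF \<gamma>])
    then show "smooth_fun UNIV {u. u () \<in> ?U} (\<lambda>u. snd c (chart_inv c (\<gamma> (inv_into UNIV (\<lambda>t _. t) u))) i)"
      using real_chart_inv by simp
  qed simp
  then have "smooth_map_on real_mfd M ?U (\<lambda>t. chart_inv c (\<gamma> t))"
    unfolding smooth_map_on_iff[OF premanifold_real] midx_real
    by (intro ballI bexI[OF _ real_chart_charts] bexI[OF _ c] exI[of _ ?U] conjI) simp_all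
  then show ?thesis unfolding smooth_curve_iff[OF M] using \<open>\<epsilon> > 0\<close> by (intro exI[of _ ?U]) simp
qed

text \<open>A straight line in a chart realises any prescribed components as a velocity.\<close>

lemma coordinate_line:
  assumes M: "premanifold M" and c: "c \<in> charts M" "x \<in> fst c" and w: "w \<in> coord_space (midx M)"
  shows "smooth_curve M (\<lambda>t. chart_inv c (\<lambda>i. snd c x i + t * w i))"
    and "chart_inv c (\<lambda>i. snd c x i + 0 * w i) = x"
    and "i \<in> midx M \<Longrightarrow> snd (velocity M (\<lambda>t. chart_inv c (\<lambda>i. snd c x i + t * w i))) c i = w i"
    and "eventually (\<lambda>t. (\<lambda>i. snd c x i + t * w i) \<in> snd c ` fst c) (nhds 0)"
proof -
  have fin: "finite (midx M)" using M by (rule premanifold_finite)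
  have xc: "snd c x \<in> snd c ` fst c" using c by blast
  obtain e where e: "e > 0" "\<And>y. y \<in> coord_space (midx M) \<Longrightarrow> (\<And>i. i \<in> midx M \<Longrightarrow> \<bar>y i - snd c x i\<bar> < e) \<Longrightarrow> y \<in> snd c ` fst c"
    using open_coordD[OF chart_open[OF c(1)] fin xc] by metis
  \<comment> \<open>Larger than every component of \<open>w\<close>, and positive even if
    \<open>w\<close> vanishes; for times below \<open>e / B\<close> each coordinate moves by less
    than \<open>e\<close>.\<close>
  define B where "B = 1 + (\<Sum>i\<in>midx M. \<bar>w i\<bar>)"
  have "0 \<le> (\<Sum>i\<in>midx M. \<bar>w i\<bar>)" by (rule sum_nonneg) simp
  then have "B > 0" unfolding B_def by linarith
  have wB: "\<bar>w i\<bar> < B" if "i \<in> midx M" for i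
    using member_le_sum[of i "midx M" "\<lambda>i. \<bar>w i\<bar>"] that fin by (simp add: B_def)
  have img: "(\<lambda>i. snd c x i + t * w i) \<in> snd c ` fst c" if t: "\<bar>t\<bar> < e / B" for t
  proof (rule e(2))
    show "(\<lambda>i. snd c x i + t * w i) \<in> coord_space (midx M)"
      using w chart_coord[OF c] by (auto simp: coord_space_def)
    fix i assume "i \<in> midx M"
    have "\<bar>t * w i\<bar> \<le> \<bar>t\<bar> * B" unfolding abs_mult using wB[OF \<open>i \<in> midx M\<close>] by (intro mult_left_mono) auto
    also have "\<dots> < e" using t \<open>B > 0\<close> by (simp add: field_simps)
    finally show "\<bar>snd c x i + t * w i - snd c x i\<bar> < e" by simp
  qed
  have pos: "e / B > 0" using e(1) \<open>B > 0\<close> by simp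
  have op: "open_coord UNIV {u::unit \<Rightarrow> real. \<bar>u ()\<bar> < e / B}"
  proof -
    have "open {t::real. \<bar>t\<bar> < e / B}" by (intro open_Collect_less continuous_intros)
    from open_coord_real[OF this] show ?thesis by simp
  qed
  show sc: "smooth_curve M (\<lambda>t. chart_inv c (\<lambda>i. snd c x i + t * w i))"
    by (rule smooth_curveI[OF M c(1) pos img]) (auto intro!: smooth_fun_intros[OF finite op])
  show x0: "chart_inv c (\<lambda>i. snd c x i + 0 * w i) = x" using chart_inv_chart[OF c] by simp
  show ev: "eventually (\<lambda>t. (\<lambda>i. snd c x i + t * w i) \<in> snd c ` fst c) (nhds 0)"
    using img pos by (auto simp: eventually_nhds_metric dist_real_def)
  assume i: "i \<in> midx M"
  have "((\<lambda>t. snd c (chart_inv c (\<lambda>i. snd c x i + t * w i)) i) has_real_derivative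
      snd (velocity M (\<lambda>t. chart_inv c (\<lambda>i. snd c x i + t * w i))) c i) (at 0)"
    by (rule smooth_curve_derivative[OF M sc c(1) _ i]) (simp add: chart_inv_chart[OF c] c)
  moreover have "((\<lambda>t. snd c (chart_inv c (\<lambda>i. snd c x i + t * w i)) i) has_real_derivative w i) (at 0)"
  proof -
    have "((\<lambda>t. snd c x i + t * w i) has_real_derivative w i) (at 0)" by (auto intro!: derivative_eq_intros)
    moreover have "eventually (\<lambda>t. snd c x i + t * w i = snd c (chart_inv c (\<lambda>i. snd c x i + t * w i)) i) (nhds 0)"
      by (rule eventually_mono[OF ev]) (simp only: chart_chart_inv)
    ultimately show ?thesis by (rule DERIV_eventually_cong)
  qed
  ultimately show "snd (velocity M (\<lambda>t. chart_inv c (\<lambda>i. snd c x i + t * w i))) c i = w i" by (rule DERIV_unique)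
qed

lemma velocity_compose:
  assumes M: "premanifold M" and N: "premanifold N" and \<sigma>: "smooth_curve M \<sigma>"
    and f: "smooth_map_on M N S f" "\<sigma> 0 \<in> S"
    and c: "c \<in> charts M" "\<sigma> 0 \<in> fst c" and d: "d \<in> charts N" "f (\<sigma> 0) \<in> fst d" and j: "j \<in> midx N"
  shows "snd (velocity N (f \<circ> \<sigma>)) d j =
    (\<Sum>i\<in>midx M. pd i (\<lambda>u. snd d (f (chart_inv c u)) j) (snd c (\<sigma> 0)) * snd (velocity M \<sigma>) c i)"
proof -
  let ?T = "snd c ` {x \<in> fst c \<inter> S. f x \<in> fst d}"
  have T: "open_coord (midx M) ?T" "smooth_fun (midx M) ?T (\<lambda>u. snd d (f (chart_inv c u)) j)"
    using smooth_map_on_in_charts[OF M N f(1) c(1) d(1)] j by (auto simp: smooth_in_charts_def)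
  have ev: "eventually (\<lambda>t. \<sigma> t \<in> fst c) (nhds 0)"
    by (rule smooth_curve_eventually[OF M \<sigma> c])
  have "((\<lambda>t. snd d (f (chart_inv c (snd c (\<sigma> t)))) j) has_real_derivative
    (\<Sum>i\<in>midx M. pd i (\<lambda>u. snd d (f (chart_inv c u)) j) (snd c (\<sigma> 0)) * snd (velocity M \<sigma>) c i)) (at 0)"
  proof (rule smooth_fun_chain_curve[where \<gamma> = "\<lambda>t. snd c (\<sigma> t)", OF T(2) premanifold_finite[OF M] T(1)])
    show "snd c (\<sigma> 0) \<in> ?T" using c f d by blast
    show "\<forall>\<^sub>F t in at 0. snd c (\<sigma> t) \<in> coord_space (midx M)"
      using ev chart_coord[OF c(1)] by (auto simp: eventually_at_filter elim: eventually_mono)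
  qed (rule smooth_curve_derivative[OF M \<sigma> c])
  moreover have "eventually (\<lambda>t. snd d (f (chart_inv c (snd c (\<sigma> t)))) j = snd d ((f \<circ> \<sigma>) t) j) (nhds 0)"
    by (rule eventually_mono[OF ev]) (simp add: chart_inv_chart[OF c(1)])
  ultimately have "((\<lambda>t. snd d ((f \<circ> \<sigma>) t) j) has_real_derivative
    (\<Sum>i\<in>midx M. pd i (\<lambda>u. snd d (f (chart_inv c u)) j) (snd c (\<sigma> 0)) * snd (velocity M \<sigma>) c i)) (at 0)"
    by (rule DERIV_eventually_cong)
  moreover have "((\<lambda>t. snd d ((f \<circ> \<sigma>) t) j) has_real_derivative snd (velocity N (f \<circ> \<sigma>)) d j) (at 0)"
    by (rule smooth_curve_derivative[OF N smooth_curve_compose[OF M N \<sigma> f] d(1) _ j]) (use d in simp)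
  ultimately show ?thesis using DERIV_unique by blast
qed

lemma velocity_transform:
  assumes M: "premanifold M" and \<sigma>: "smooth_curve M \<sigma>"
    and c: "c \<in> charts M" "\<sigma> 0 \<in> fst c" and d: "d \<in> charts M" "\<sigma> 0 \<in> fst d" and j: "j \<in> midx M"
  shows "snd (velocity M \<sigma>) d j =
    (\<Sum>i\<in>midx M. pd i (\<lambda>u. snd d (chart_inv c u) j) (snd c (\<sigma> 0)) * snd (velocity M \<sigma>) c i)"
  using velocity_compose[OF M M \<sigma> smooth_map_on_id[OF M openin_mcarrier[OF M]] _ c d(1) _ j] d(2) chart_subset[OF c(1)] c(2)
  by auto

section \<open>Linear relations between tangent vectors\<close>

lemma snd_velocity_outside:
  "\<not> (c \<in> charts M \<and> \<sigma> 0 \<in> fst c \<and> i \<in> midx M) \<Longrightarrow> snd (velocity M \<sigma>) c i = 0"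
  by (auto simp: velocity_def)

lemma fst_velocity [simp]: "fst (velocity M \<sigma>) = \<sigma> 0"
  by (simp add: velocity_def)

text \<open>A linear relation between the components in one chart passes to every other chart,
  because the Jacobian coefficients in \<open>velocity_transform\<close> depend on the base point
  only. Outside the relevant charts and indices all components are zero by convention.\<close>

lemma velocity_lin:
  assumes M: "premanifold M" and \<sigma>: "smooth_curve M \<sigma>" "smooth_curve M \<sigma>1" "smooth_curve M \<sigma>2"
    and base: "\<sigma>1 0 = \<sigma> 0" "\<sigma>2 0 = \<sigma> 0" and c: "c \<in> charts M" "\<sigma> 0 \<in> fst c"
    and lin: "\<And>i. i \<in> midx M \<Longrightarrow>
      snd (velocity M \<sigma>) c i = a * snd (velocity M \<sigma>1) c i + b * snd (velocity M \<sigma>2) c i"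
  shows "velocity M \<sigma> = tvec_lin a (velocity M \<sigma>1) b (velocity M \<sigma>2)"
proof -
  have "snd (velocity M \<sigma>) d j = a * snd (velocity M \<sigma>1) d j + b * snd (velocity M \<sigma>2) d j" for d j
  proof (cases "d \<in> charts M \<and> \<sigma> 0 \<in> fst d \<and> j \<in> midx M")
    case True
    then have d: "d \<in> charts M" "\<sigma> 0 \<in> fst d" "j \<in> midx M" by auto
    have t1: "snd (velocity M \<sigma>1) d j =
        (\<Sum>i\<in>midx M. pd i (\<lambda>u. snd d (chart_inv c u) j) (snd c (\<sigma> 0)) * snd (velocity M \<sigma>1) c i)"
      using velocity_transform[OF M \<sigma>(2) c(1) _ d(1) _ d(3)] c d base by simp
    have t2: "snd (velocity M \<sigma>2) d j =
        (\<Sum>i\<in>midx M. pd i (\<lambda>u. snd d (chart_inv c u) j) (snd c (\<sigma> 0)) * snd (velocity M \<sigma>2) c i)"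
      using velocity_transform[OF M \<sigma>(3) c(1) _ d(1) _ d(3)] c d base by simp
    show ?thesis unfolding velocity_transform[OF M \<sigma>(1) c d] t1 t2 sum_distrib_left sum.distrib[symmetric]
      by (rule sum.cong[OF refl]) (simp add: lin algebra_simps)
  next
    case False
    then show ?thesis using snd_velocity_outside[of d M \<sigma> j] snd_velocity_outside[of d M \<sigma>1 j]
        snd_velocity_outside[of d M \<sigma>2 j] base by auto
  qed
  then show ?thesis unfolding tvec_lin_def using base by (intro prod_eqI ext) simp_all
qed

lemma velocity_eqI:
  assumes M: "premanifold M" and \<sigma>: "smooth_curve M \<sigma>" "smooth_curve M \<sigma>'"
    and base: "\<sigma>' 0 = \<sigma> 0" and c: "c \<in> charts M" "\<sigma> 0 \<in> fst c"
    and eq: "\<And>i. i \<in> midx M \<Longrightarrow> snd (velocity M \<sigma>) c i = snd (velocity M \<sigma>') c i"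
  shows "velocity M \<sigma> = velocity M \<sigma>'"
proof -
  have "velocity M \<sigma> = tvec_lin 1 (velocity M \<sigma>') 0 (velocity M \<sigma>')"
    by (rule velocity_lin[OF M \<sigma> \<sigma>(2) base base c]) (simp add: eq)
  then show ?thesis using base by (simp add: tvec_lin_def prod_eq_iff)
qed

text \<open>By the chain rule the velocity of the image curve involves the original curve only
  through its base point and velocity. This makes \<open>tangent_map\<close> independent of the
  curve it picks.\<close>

lemma velocity_compose_cong:
  assumes M: "premanifold M" and N: "premanifold N" and \<sigma>: "smooth_curve M \<sigma>" "smooth_curve M \<sigma>'"
    and eq: "velocity M \<sigma> = velocity M \<sigma>'" and f: "smooth_map_on M N S f" "\<sigma> 0 \<in> S"
  shows "velocity N (f \<circ> \<sigma>) = velocity N (f \<circ> \<sigma>')"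
proof -
  have base: "\<sigma>' 0 = \<sigma> 0" using arg_cong[OF eq, of fst] by simp
  obtain c where c: "c \<in> charts M" "\<sigma> 0 \<in> fst c"
    using premanifold_cover[OF M smooth_curve_in_mcarrier[OF M \<sigma>(1)]] by blast
  have s: "smooth_curve N (f \<circ> \<sigma>)" "smooth_curve N (f \<circ> \<sigma>')"
    using smooth_curve_compose[OF M N _ f(1)] \<sigma> f(2) base by simp_all
  obtain d where d: "d \<in> charts N" "f (\<sigma> 0) \<in> fst d"
    using premanifold_cover[OF N smooth_curve_in_mcarrier[OF N s(1)]] unfolding comp_def by blast
  show ?thesis
  proof (rule velocity_eqI[OF N s _ d(1)])
    fix j assume j: "j \<in> midx N"
    have "snd (velocity N (f \<circ> \<sigma>')) d j =
      (\<Sum>i\<in>midx M. pd i (\<lambda>u. snd d (f (chart_inv c u)) j) (snd c (\<sigma>' 0)) * snd (velocity M \<sigma>') c i)"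
      by (rule velocity_compose[OF M N \<sigma>(2) f(1) _ c(1) _ d(1) _ j]) (use base f c d in simp_all)
    then show "snd (velocity N (f \<circ> \<sigma>)) d j = snd (velocity N (f \<circ> \<sigma>')) d j"
      using velocity_compose[OF M N \<sigma>(1) f c d j] eq base by simp
  qed (use base d in simp_all)
qed

lemma tangent_map_velocity:
  assumes M: "premanifold M" and N: "premanifold N" and \<sigma>: "smooth_curve M \<sigma>"
    and f: "smooth_map_on M N S f" "\<sigma> 0 \<in> S"
  shows "tangent_map M N f (velocity M \<sigma>) = velocity N (f \<circ> \<sigma>)"
proof -
  define \<sigma>' where "\<sigma>' = (SOME \<sigma>'. smooth_curve M \<sigma>' \<and> velocity M \<sigma>' = velocity M \<sigma>)"
  have "smooth_curve M \<sigma>' \<and> velocity M \<sigma>' = velocity M \<sigma>"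
    unfolding \<sigma>'_def by (rule someI[of _ \<sigma>]) (simp add: \<sigma>)
  then have \<sigma>': "smooth_curve M \<sigma>'" "velocity M \<sigma> = velocity M \<sigma>'" by simp_all
  have "velocity N (f \<circ> \<sigma>) = velocity N (f \<circ> \<sigma>')"
    by (rule velocity_compose_cong[OF M N \<sigma> \<sigma>' f])
  then show ?thesis unfolding tangent_map_def \<sigma>'_def by simp
qed

text \<open>The real-valued case, from which the independence of \<open>fibre_diff\<close> from its
  chosen curve is obtained.\<close>

lemma deriv_compose_cong:
  assumes M: "premanifold M" and \<sigma>: "smooth_curve M \<sigma>" "smooth_curve M \<sigma>'"
    and eq: "velocity M \<sigma> = velocity M \<sigma>'" and f: "smooth_map_on M real_mfd S f" "\<sigma> 0 \<in> S"
  shows "deriv (\<lambda>t. f (\<sigma> t)) 0 = deriv (\<lambda>t. f (\<sigma>' t)) 0"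
proof -
  have "snd (velocity real_mfd (f \<circ> \<sigma>)) real_chart () = snd (velocity real_mfd (f \<circ> \<sigma>')) real_chart ()"
    using velocity_compose_cong[OF M premanifold_real \<sigma> eq f] by simp
  then show ?thesis using real_chart_charts by (simp add: velocity_def)
qed

subsection \<open>Submersions and fibred charts\<close>

text \<open>Serves for points that move along a path known only to be continuous: the implicit
  function is differentiated by means of this expansion, and there the chain rule for curves would
  presuppose what is to be shown.\<close>

lemma increment_expansion_eps:
  assumes J: "finite J" and T: "open_coord J T" and x: "x \<in> T"
    and pd: "\<And>j y. j \<in> J \<Longrightarrow> y \<in> T \<Longrightarrow> has_pd j f (D j y) y"
    and cont: "\<And>j. j \<in> J \<Longrightarrow> continuous_on T (D j)"
  shows "\<exists>P. \<forall>\<epsilon>>0. \<exists>\<delta>>0. \<forall>y\<in>coord_space J. (\<forall>j\<in>J. \<bar>y j - x j\<bar> < \<delta>) \<longrightarrow>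
    f y - f x = (\<Sum>j\<in>J. P y j * (y j - x j)) \<and> (\<forall>j\<in>J. \<bar>P y j - D j x\<bar> < \<epsilon>)"
proof -
  obtain e P where e: "e > 0" and P: "\<forall>y\<in>coord_space J. (\<forall>j\<in>J. \<bar>y j - x j\<bar> < e) \<longrightarrow>
       f y - f x = (\<Sum>j\<in>J. P y j * (y j - x j)) \<and>
       (\<forall>j\<in>J. \<exists>\<xi>\<in>T. (\<forall>i\<in>J. \<bar>\<xi> i - x i\<bar> \<le> \<bar>y i - x i\<bar>) \<and> P y j = D j \<xi>)"
    using increment_expansion[where J=J and D=D and x=x and f=f, OF J T x pd] by blast
  have "\<exists>\<delta>>0. \<forall>y\<in>coord_space J. (\<forall>j\<in>J. \<bar>y j - x j\<bar> < \<delta>) \<longrightarrow>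
    f y - f x = (\<Sum>j\<in>J. P y j * (y j - x j)) \<and> (\<forall>j\<in>J. \<bar>P y j - D j x\<bar> < \<epsilon>)" if \<epsilon>: "\<epsilon> > 0" for \<epsilon>
  proof -
    have "\<forall>j. \<exists>\<delta>>0. j \<in> J \<longrightarrow> (\<forall>y\<in>coord_space J. (\<forall>i\<in>J. \<bar>y i - x i\<bar> < \<delta>) \<longrightarrow> \<bar>D j y - D j x\<bar> < \<epsilon>)"
    proof
      fix j
      show "\<exists>\<delta>>0. j \<in> J \<longrightarrow> (\<forall>y\<in>coord_space J. (\<forall>i\<in>J. \<bar>y i - x i\<bar> < \<delta>) \<longrightarrow> \<bar>D j y - D j x\<bar> < \<epsilon>)"
      proof (cases "j \<in> J")
        case True
        obtain \<delta> where "\<delta> > 0" "\<And>y. y \<in> coord_space J \<Longrightarrow> (\<And>i. i \<in> J \<Longrightarrow> \<bar>y i - x i\<bar> < \<delta>) \<Longrightarrow> y \<in> T \<and> \<bar>D j y - D j x\<bar> < \<epsilon>"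
          using continuous_on_open_coordD[OF cont[OF True] T J x \<epsilon>] by metis
        then show ?thesis by blast
      qed (auto intro: exI[of _ 1])
    qed
    then obtain \<delta> where \<delta>: "\<And>j. \<delta> j > (0::real)"
      "\<And>j y. j \<in> J \<Longrightarrow> y \<in> coord_space J \<Longrightarrow> (\<forall>i\<in>J. \<bar>y i - x i\<bar> < \<delta> j) \<Longrightarrow> \<bar>D j y - D j x\<bar> < \<epsilon>" by metis
    define \<delta>0 where "\<delta>0 = Min (insert e (\<delta> ` J))"
    have \<delta>0: "\<delta>0 > 0" "\<delta>0 \<le> e" "\<And>j. j \<in> J \<Longrightarrow> \<delta>0 \<le> \<delta> j"
      unfolding \<delta>0_def using J e \<delta>(1) by (auto intro!: Min_le)
    show ?thesis
    proof (intro exI[of _ \<delta>0] conjI ballI impI)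
      fix y assume y: "y \<in> coord_space J" "\<forall>j\<in>J. \<bar>y j - x j\<bar> < \<delta>0"
      then have ye: "\<forall>j\<in>J. \<bar>y j - x j\<bar> < e" using \<delta>0(2) by fastforce
      note Py = P[rule_format, OF y(1) ye[rule_format]]
      then show "f y - f x = (\<Sum>j\<in>J. P y j * (y j - x j))" by blast
      fix j assume j: "j \<in> J"
      then obtain \<xi> where \<xi>: "\<xi> \<in> T" "\<forall>i\<in>J. \<bar>\<xi> i - x i\<bar> \<le> \<bar>y i - x i\<bar>" "P y j = D j \<xi>" using Py by blast
      have "\<xi> \<in> coord_space J" using \<xi>(1) open_coord_subset[OF T] by blast
      moreover have "\<forall>i\<in>J. \<bar>\<xi> i - x i\<bar> < \<delta> j" using \<xi>(2) y(2) \<delta>0(3)[OF j] by fastforce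
      ultimately show "\<bar>P y j - D j x\<bar> < \<epsilon>" using \<delta>(2)[OF j] \<xi>(3) by simp
    qed (rule \<delta>0(1))
  qed
  then show ?thesis by blast
qed

lemma open_coord_box: "finite I \<Longrightarrow> open_coord I {u \<in> coord_space I. \<forall>i\<in>I. \<bar>u i - a i\<bar> < (e::real)}"
proof -
  assume I: "finite I"
  have "open {u::'a \<Rightarrow> real. \<bar>u i - a i\<bar> < e}" for i
    by (intro open_Collect_less continuous_intros continuous_on_product_coordinates)
  then have "open (\<Inter>i\<in>I. {u. \<bar>u i - a i\<bar> < e})" using I by (intro open_INT) auto
  moreover have "{u \<in> coord_space I. \<forall>i\<in>I. \<bar>u i - a i\<bar> < e} = coord_space I \<inter> (\<Inter>i\<in>I. {u. \<bar>u i - a i\<bar> < e})" by auto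
  ultimately show ?thesis unfolding open_coord_def openin_open by blast
qed

lemma continuous_on_open_coordI:
  fixes T :: "('i \<Rightarrow> real) set" and g :: "('i \<Rightarrow> real) \<Rightarrow> real"
  assumes J: "finite J"
    and "\<And>x \<epsilon>. x \<in> T \<Longrightarrow> \<epsilon> > (0::real) \<Longrightarrow> \<exists>\<delta>>0. \<forall>y\<in>T. (\<forall>i\<in>J. \<bar>y i - x i\<bar> < \<delta>) \<longrightarrow> \<bar>g y - g x\<bar> < \<epsilon>"
  shows "continuous_on T g"
  unfolding continuous_on_def
proof (intro ballI tendstoI)
  fix x \<epsilon> assume "x \<in> T" "(0::real) < \<epsilon>"
  then obtain \<delta> where \<delta>: "\<delta> > 0" "\<forall>y\<in>T. (\<forall>i\<in>J. \<bar>y i - x i\<bar> < \<delta>) \<longrightarrow> \<bar>g y - g x\<bar> < \<epsilon>" using assms(2) by blast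
  have "open {u::'i \<Rightarrow> real. \<bar>u i - x i\<bar> < \<delta>}" for i
    by (intro open_Collect_less continuous_intros continuous_on_product_coordinates)
  then have "open (\<Inter>i\<in>J. {u. \<bar>u i - x i\<bar> < \<delta>})" using J by (intro open_INT) auto
  then show "eventually (\<lambda>y. dist (g y) (g x) < \<epsilon>) (at x within T)"
    unfolding eventually_at_topological using \<delta>
    by (intro exI[of _ "\<Inter>i\<in>J. {u. \<bar>u i - x i\<bar> < \<delta>}"]) (auto simp: dist_real_def)
qed

text \<open>The implicit function theorem for one equation, as local invertibility of \<open>u \<mapsto> u(j := h u)\<close>.\<close>

lemma replace_coordinate:
  assumes I: "finite I" and S: "open_coord I S" and h: "smooth_fun I S h" and u0: "u0 \<in> S"
    and j: "j \<in> I" and nz: "pd j h u0 \<noteq> 0"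
  obtains B T \<theta> where "open_coord I B" "u0 \<in> B" "B \<subseteq> S" "open_coord I T" "smooth_fun I T \<theta>"
    "\<And>u. u \<in> B \<Longrightarrow> u(j := h u) \<in> T \<and> \<theta> (u(j := h u)) = u j"
    "\<And>w. w \<in> T \<Longrightarrow> w(j := \<theta> w) \<in> B \<and> h (w(j := \<theta> w)) = w j"
proof -
  \<comment> \<open>Multiplication by this sign makes \<open>h\<close> increase in coordinate
    \<open>j\<close>, whatever the sign of its derivative at \<open>u0\<close>.\<close>
  define s where "s = sgn (pd j h u0)"
  have s: "s \<noteq> 0" "s * pd j h u0 = \<bar>pd j h u0\<bar>" "\<bar>s\<bar> = 1" using nz by (auto simp: s_def sgn_if)
  have u0c: "u0 \<in> coord_space I" using u0 open_coord_subset[OF S] by blast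
  obtain e where e: "e > 0" and e': "\<And>y. y \<in> coord_space I \<Longrightarrow> (\<And>i. i \<in> I \<Longrightarrow> \<bar>y i - u0 i\<bar> < e) \<Longrightarrow>
      y \<in> S \<and> \<bar>pd j h y - pd j h u0\<bar> < \<bar>pd j h u0\<bar>"
    using continuous_on_open_coordD[OF smooth_fun_continuous[OF smooth_fun_pd[OF h j]] S I u0, of "\<bar>pd j h u0\<bar>"] nz
    by (metis zero_less_abs_iff)
  \<comment> \<open>A cube on which \<open>pd j h\<close> differs from its value at
    \<open>u0\<close> by less than the modulus of that value, and so keeps its sign.\<close>
  define B where "B = {u \<in> coord_space I. \<forall>i\<in>I. \<bar>u i - u0 i\<bar> < e}"
  have Bop: "open_coord I B" unfolding B_def by (rule open_coord_box[OF I])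
  have BS: "B \<subseteq> S" using e' by (auto simp: B_def)
  have u0B: "u0 \<in> B" using u0c e by (simp add: B_def)
  have pos: "s * pd j h y > 0" if "y \<in> B" for y
  proof -
    have "\<bar>pd j h y - pd j h u0\<bar> < \<bar>pd j h u0\<bar>" using that e' by (auto simp: B_def)
    then have "\<bar>s * pd j h y - s * pd j h u0\<bar> < \<bar>pd j h u0\<bar>"
      unfolding right_diff_distrib[symmetric] abs_mult s(3) by simp
    then show ?thesis unfolding s(2) by linarith
  qed
  have hpd: "has_pd i h (pd i h y) y" if "i \<in> I" "y \<in> B" for i y
    using smooth_fun_has_pd[OF h that(1)] that(2) BS by blast
  have cpd: "continuous_on B (pd i h)" if "i \<in> I" for i
    using continuous_on_subset[OF smooth_fun_continuous[OF smooth_fun_pd[OF h that]] BS] .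
  have hder: "((\<lambda>t. s * h (u(j := t))) has_real_derivative s * pd j h (u(j := t))) (at t)" if "u(j := t) \<in> B" for u t
    using hpd[OF j that] unfolding has_pd_def by (intro DERIV_cmult) simp
  have Bupd: "u(j := t) \<in> B" if "u(j := a) \<in> B" "\<bar>t - u0 j\<bar> < e" for u t a
    using that j by (auto simp: B_def coord_space_def)
  have Bj: "\<bar>t - u0 j\<bar> < e" if "u(j := t) \<in> B" for u t
    using that j unfolding B_def by fastforce
  have mono: "s * h (u(j := t1)) < s * h (u(j := t2))" if "u(j := t1) \<in> B" "u(j := t2) \<in> B" "t1 < t2" for u t1 t2
  proof (rule DERIV_pos_imp_increasing[OF that(3)])
    fix t assume "t1 \<le> t" "t \<le> t2"
    then have "u(j := t) \<in> B" using Bj[OF that(1)] Bj[OF that(2)] by (intro Bupd[OF that(1)]) linarith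
    then show "\<exists>y. ((\<lambda>t. s * h (u(j := t))) has_real_derivative y) (at t) \<and> y > 0"
      using hder pos by blast
  qed
  have uniq: "t1 = t2" if "u(j := t1) \<in> B" "u(j := t2) \<in> B" "h (u(j := t1)) = h (u(j := t2))" for u t1 t2
    using mono[OF that(1,2)] mono[OF that(2,1)] that(3) by (cases t1 t2 rule: linorder_cases) auto
  \<comment> \<open>The image of \<open>B\<close> under the map, written as solvability for one
    unknown \<open>t\<close>; by \<open>uniq\<close> the solution is determined.\<close>
  define T where "T = {w \<in> coord_space I. \<exists>t. w(j := t) \<in> B \<and> h (w(j := t)) = w j}"
  define \<theta> where "\<theta> w = (SOME t. w(j := t) \<in> B \<and> h (w(j := t)) = w j)" for w
  have T\<theta>: "w(j := \<theta> w) \<in> B \<and> h (w(j := \<theta> w)) = w j" if "w \<in> T" for w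
    unfolding \<theta>_def by (rule someI_ex) (use that in \<open>unfold T_def, blast\<close>)
  have \<theta>eq: "\<theta> w = t" if "w \<in> T" "w(j := t) \<in> B" "h (w(j := t)) = w j" for w t
    by (rule uniq[of w]) (use T\<theta>[OF that(1)] that in simp_all)
  have B\<theta>: "u(j := h u) \<in> T \<and> \<theta> (u(j := h u)) = u j" if "u \<in> B" for u
  proof -
    have uu: "(u(j := h u))(j := u j) = u" by simp
    have "u(j := h u) \<in> coord_space I" using that j by (auto simp: B_def coord_space_def)
    then have "u(j := h u) \<in> T" unfolding T_def using uu that by (metis (mono_tags, lifting) fun_upd_same mem_Collect_eq)
    then show ?thesis using \<theta>eq[of "u(j := h u)" "u j"] that by simp
  qed
  \<comment> \<open>Values of \<open>h\<close> just below and just above the solution for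
    \<open>w0\<close> still bracket \<open>w j\<close> for nearby \<open>w\<close>, so the
    intermediate value theorem gives a solution nearby. Openness of \<open>T\<close> and continuity
    of \<open>\<theta>\<close> both follow from this.\<close>
  have K: "\<exists>\<delta>>0. \<forall>w\<in>coord_space I. (\<forall>i\<in>I. \<bar>w i - w0 i\<bar> < \<delta>) \<longrightarrow>
      (\<exists>t. \<bar>t - \<theta> w0\<bar> < \<epsilon> \<and> w(j := t) \<in> B \<and> h (w(j := t)) = w j)" if w0: "w0 \<in> T" and \<epsilon>: "\<epsilon> > 0" for w0 \<epsilon>
  proof -
    define t0 where "t0 = \<theta> w0"
    have t0: "w0(j := t0) \<in> B" "h (w0(j := t0)) = w0 j" using T\<theta>[OF w0] by (auto simp: t0_def)
    \<comment> \<open>Small enough both for the required closeness and for the two bracketing points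
      to stay inside the cube \<open>B\<close>.\<close>
    define \<eta> where "\<eta> = min \<epsilon> (e - \<bar>t0 - u0 j\<bar>) / 2"
    have \<eta>: "\<eta> > 0" "\<eta> < \<epsilon>" "\<bar>t0 - u0 j\<bar> + \<eta> < e"
      using \<epsilon> Bj[OF t0(1)] by (auto simp: \<eta>_def min_def field_simps)
    have b1: "w0(j := t0 - \<eta>) \<in> B" and b2: "w0(j := t0 + \<eta>) \<in> B"
      by (rule Bupd[OF t0(1)], use \<eta> in linarith)+
    have m1: "s * h (w0(j := t0 - \<eta>)) < s * w0 j" using mono[OF b1 t0(1)] \<eta>(1) t0(2) by simp
    have m2: "s * w0 j < s * h (w0(j := t0 + \<eta>))" using mono[OF t0(1) b2] \<eta>(1) t0(2) by simp
    \<comment> \<open>Half of the smaller gap on the two sides: \<open>h\<close> at a bracketing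
      point and the target \<open>w j\<close> may each shift by less than \<open>g\<close> without
      changing their order.\<close>
    define g where "g = min (s * w0 j - s * h (w0(j := t0 - \<eta>))) (s * h (w0(j := t0 + \<eta>)) - s * w0 j) / 2"
    have g: "g > 0" using m1 m2 by (simp add: g_def)
    have hc: "continuous_on B h" using continuous_on_subset[OF smooth_fun_continuous[OF h] BS] .
    obtain \<delta>1 where d1: "\<delta>1 > 0" and d1': "\<And>y. y \<in> coord_space I \<Longrightarrow> (\<And>i. i \<in> I \<Longrightarrow> \<bar>y i - (w0(j := t0 - \<eta>)) i\<bar> < \<delta>1) \<Longrightarrow>
        y \<in> B \<and> \<bar>h y - h (w0(j := t0 - \<eta>))\<bar> < g"
      using continuous_on_open_coordD[OF hc Bop I b1 g] by metis
    obtain \<delta>2 where d2: "\<delta>2 > 0" and d2': "\<And>y. y \<in> coord_space I \<Longrightarrow> (\<And>i. i \<in> I \<Longrightarrow> \<bar>y i - (w0(j := t0 + \<eta>)) i\<bar> < \<delta>2) \<Longrightarrow>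
        y \<in> B \<and> \<bar>h y - h (w0(j := t0 + \<eta>))\<bar> < g"
      using continuous_on_open_coordD[OF hc Bop I b2 g] by metis
    define \<delta> where "\<delta> = min g (min \<delta>1 \<delta>2)"
    have \<delta>: "\<delta> > 0" "\<delta> \<le> g" "\<delta> \<le> \<delta>1" "\<delta> \<le> \<delta>2" using g d1 d2 by (auto simp: \<delta>_def)
    have "\<exists>t. \<bar>t - \<theta> w0\<bar> < \<epsilon> \<and> w(j := t) \<in> B \<and> h (w(j := t)) = w j"
      if w: "w \<in> coord_space I" "\<forall>i\<in>I. \<bar>w i - w0 i\<bar> < \<delta>" for w
    proof -
      have wc: "w(j := t) \<in> coord_space I" for t using w(1) j by (rule fun_upd_in_coord_space)
      have near: "\<bar>(w(j := t)) i - (w0(j := t)) i\<bar> < \<delta>'" if "i \<in> I" "\<delta> \<le> \<delta>'" for i t \<delta>'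
      proof -
        have "\<bar>w i - w0 i\<bar> < \<delta>'" using w(2) that by fastforce
        then show ?thesis using \<delta>(1) that(2) by (cases "i = j") simp_all
      qed
      have c1: "w(j := t0 - \<eta>) \<in> B \<and> \<bar>h (w(j := t0 - \<eta>)) - h (w0(j := t0 - \<eta>))\<bar> < g"
        by (rule d1'[OF wc]) (rule near[OF _ \<delta>(3)])
      have c2: "w(j := t0 + \<eta>) \<in> B \<and> \<bar>h (w(j := t0 + \<eta>)) - h (w0(j := t0 + \<eta>))\<bar> < g"
        by (rule d2'[OF wc]) (rule near[OF _ \<delta>(4)])
      have sd: "\<bar>s * a - s * b\<bar> = \<bar>a - b\<bar>" for a b
        unfolding right_diff_distrib[symmetric] abs_mult s(3) by simp
      have wj: "\<bar>s * w j - s * w0 j\<bar> < g" unfolding sd using w(2) j \<delta>(2) by fastforce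
      have g1: "s * w0 j - s * h (w0(j := t0 - \<eta>)) \<ge> 2 * g" "s * h (w0(j := t0 + \<eta>)) - s * w0 j \<ge> 2 * g"
        by (auto simp: g_def)
      have i1: "s * h (w(j := t0 - \<eta>)) \<le> s * w j"
        using c1 wj g1 sd[of "h (w(j := t0 - \<eta>))" "h (w0(j := t0 - \<eta>))"] by linarith
      have i2: "s * w j \<le> s * h (w(j := t0 + \<eta>))"
        using c2 wj g1 sd[of "h (w(j := t0 + \<eta>))" "h (w0(j := t0 + \<eta>))"] by linarith
      have inB: "w(j := t) \<in> B" if "t0 - \<eta> \<le> t" "t \<le> t0 + \<eta>" for t
        by (rule Bupd[of w "t0 - \<eta>"]) (use c1 that \<eta>(3) in \<open>auto simp: abs_if split: if_splits\<close>)
      have "\<exists>t\<ge>t0 - \<eta>. t \<le> t0 + \<eta> \<and> s * h (w(j := t)) = s * w j"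
      proof (rule IVT[where f = "\<lambda>t. s * h (w(j := t))", OF i1 i2])
        show "\<forall>t. t0 - \<eta> \<le> t \<and> t \<le> t0 + \<eta> \<longrightarrow> isCont (\<lambda>t. s * h (w(j := t))) t"
          by (intro allI impI, elim conjE) (rule DERIV_isCont[OF hder[OF inB]])
      qed (use \<eta>(1) in simp)
      then obtain t where t: "t0 - \<eta> \<le> t" "t \<le> t0 + \<eta>" "h (w(j := t)) = w j" using s(1) by auto
      moreover have "\<bar>t - t0\<bar> < \<epsilon>" using t \<eta>(2) by linarith
      ultimately show ?thesis using inB unfolding t0_def by blast
    qed
    then show ?thesis using \<delta>(1) by blast
  qed
  have Top: "open_coord I T"
    unfolding open_coord_iff[OF I]
  proof (intro conjI ballI)
    show "T \<subseteq> coord_space I" by (auto simp: T_def)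
    fix w0 assume "w0 \<in> T"
    then have "\<exists>\<delta>>0. \<forall>w\<in>coord_space I. (\<forall>i\<in>I. \<bar>w i - w0 i\<bar> < \<delta>) \<longrightarrow>
      (\<exists>t. \<bar>t - \<theta> w0\<bar> < 1 \<and> w(j := t) \<in> B \<and> h (w(j := t)) = w j)" by (rule K) simp
    then show "\<exists>e>0. \<forall>y\<in>coord_space I. (\<forall>i\<in>I. \<bar>y i - w0 i\<bar> < e) \<longrightarrow> y \<in> T"
      unfolding T_def by (elim exE conjE) (rule_tac x = \<delta> in exI, simp, blast)
  qed
  have \<theta>near: "\<exists>\<delta>>0. \<forall>w\<in>T. (\<forall>i\<in>I. \<bar>w i - w0 i\<bar> < \<delta>) \<longrightarrow> \<bar>\<theta> w - \<theta> w0\<bar> < \<epsilon>" if w0: "w0 \<in> T" and \<epsilon>: "\<epsilon> > 0" for w0 \<epsilon>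
  proof -
    obtain \<delta> where d: "\<delta> > 0" "\<forall>w\<in>coord_space I. (\<forall>i\<in>I. \<bar>w i - w0 i\<bar> < \<delta>) \<longrightarrow>
      (\<exists>t. \<bar>t - \<theta> w0\<bar> < \<epsilon> \<and> w(j := t) \<in> B \<and> h (w(j := t)) = w j)" using K[OF w0 \<epsilon>] by blast
    have "\<bar>\<theta> w - \<theta> w0\<bar> < \<epsilon>" if w: "w \<in> T" "\<forall>i\<in>I. \<bar>w i - w0 i\<bar> < \<delta>" for w
    proof -
      have "w \<in> coord_space I" using w(1) by (simp add: T_def)
      then obtain t where "\<bar>t - \<theta> w0\<bar> < \<epsilon>" "w(j := t) \<in> B" "h (w(j := t)) = w j" using d(2) w(2) by blast
      then show ?thesis using \<theta>eq[OF w(1)] by simp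
    qed
    then show ?thesis using d(1) by blast
  qed
  have \<theta>cont: "continuous_on T \<theta>" by (rule continuous_on_open_coordI[OF I \<theta>near])
  \<comment> \<open>The derivative found by differentiating the identity
    \<open>h (w(j := \<theta> w)) = w j\<close> in coordinate \<open>i\<close>. For
    \<open>i = j\<close> the right-hand side contributes 1 and the explicit variable is
    overwritten.\<close>
  define G where "G i w = (if i = j then 1 else - pd i h (w(j := \<theta> w))) / pd j h (w(j := \<theta> w))" for i w
  have pjnz: "pd j h y \<noteq> 0" if "y \<in> B" for y using pos[OF that] by auto
  have der: "has_pd i \<theta> (G i w) w" if i: "i \<in> I" and w: "w \<in> T" for i w
  proof -
    define x where "x = w(j := \<theta> w)"
    have xB: "x \<in> B" "h x = w j" using T\<theta>[OF w] by (auto simp: x_def)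
    define \<gamma> where "\<gamma> t = (w(i := t))(j := \<theta> (w(i := t)))" for t
    obtain P where P: "\<forall>\<epsilon>>0. \<exists>\<delta>>0. \<forall>y\<in>coord_space I. (\<forall>k\<in>I. \<bar>y k - x k\<bar> < \<delta>) \<longrightarrow>
        h y - h x = (\<Sum>k\<in>I. P y k * (y k - x k)) \<and> (\<forall>k\<in>I. \<bar>P y k - pd k h x\<bar> < \<epsilon>)"
      using increment_expansion_eps[where f=h and D="\<lambda>k. pd k h", OF I Bop xB(1) hpd cpd] by blast
    have evT: "eventually (\<lambda>t. w(i := t) \<in> T) (at (w i))"
      using eventually_fun_upd_in_open_coord[OF Top I w i] by (auto simp: eventually_at_filter elim: eventually_mono)
    have evx: "eventually (\<lambda>t. w(i := t) \<in> T \<and> \<gamma> t \<in> coord_space I \<and> (\<forall>k\<in>I. \<bar>\<gamma> t k - x k\<bar> < \<delta>)) (at (w i))" if \<delta>: "\<delta> > 0" for \<delta>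
    proof -
      obtain \<delta>' where d: "\<delta>' > 0" "\<forall>w'\<in>T. (\<forall>k\<in>I. \<bar>w' k - w k\<bar> < \<delta>') \<longrightarrow> \<bar>\<theta> w' - \<theta> w\<bar> < \<delta>" using \<theta>near[OF w \<delta>] by blast
      have "eventually (\<lambda>t. \<bar>t - w i\<bar> < min \<delta> \<delta>') (at (w i))"
        using \<delta> d(1) by (auto simp: eventually_at dist_real_def intro!: exI[of _ "min \<delta> \<delta>'"])
      with evT show ?thesis
      proof eventually_elim
        fix t assume t: "w(i := t) \<in> T" "\<bar>t - w i\<bar> < min \<delta> \<delta>'"
        have "\<forall>k\<in>I. \<bar>(w(i := t)) k - w k\<bar> < \<delta>'" using t(2) d(1) by auto
        then have th: "\<bar>\<theta> (w(i := t)) - \<theta> w\<bar> < \<delta>" using d(2) t(1) by blast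
        have "\<gamma> t \<in> coord_space I" using T\<theta>[OF t(1)] by (auto simp: \<gamma>_def B_def)
        moreover have "\<bar>\<gamma> t k - x k\<bar> < \<delta>" for k using th t(2) \<delta> by (auto simp: \<gamma>_def x_def)
        ultimately show "w(i := t) \<in> T \<and> \<gamma> t \<in> coord_space I \<and> (\<forall>k\<in>I. \<bar>\<gamma> t k - x k\<bar> < \<delta>)" using t(1) by blast
      qed
    qed
    have lim: "((\<lambda>t. P (\<gamma> t) k) \<longlongrightarrow> pd k h x) (at (w i))" if k: "k \<in> I" for k
    proof (rule tendstoI)
      fix \<epsilon> :: real assume "\<epsilon> > 0"
      then obtain \<delta> where d: "\<delta> > 0" "\<forall>y\<in>coord_space I. (\<forall>k\<in>I. \<bar>y k - x k\<bar> < \<delta>) \<longrightarrow>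
        h y - h x = (\<Sum>k\<in>I. P y k * (y k - x k)) \<and> (\<forall>k\<in>I. \<bar>P y k - pd k h x\<bar> < \<epsilon>)" using P by blast
      show "eventually (\<lambda>t. dist (P (\<gamma> t) k) (pd k h x) < \<epsilon>) (at (w i))"
        using evx[OF d(1)] by eventually_elim (use d(2) k in \<open>auto simp: dist_real_def\<close>)
    qed
    obtain \<delta>1 where d1: "\<delta>1 > 0" "\<forall>y\<in>coord_space I. (\<forall>k\<in>I. \<bar>y k - x k\<bar> < \<delta>1) \<longrightarrow>
        h y - h x = (\<Sum>k\<in>I. P y k * (y k - x k)) \<and> (\<forall>k\<in>I. \<bar>P y k - pd k h x\<bar> < \<bar>pd j h x\<bar>)"
      using P[THEN spec, of "\<bar>pd j h x\<bar>"] pjnz[OF xB(1)] by auto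
    have "((\<lambda>t. (if i = j then 1 else - P (\<gamma> t) i) / P (\<gamma> t) j) \<longlongrightarrow> G i w) (at (w i))"
      unfolding G_def x_def[symmetric] using pjnz[OF xB(1)] lim[OF i] lim[OF j]
      by (cases "i = j") (auto intro!: tendsto_divide tendsto_minus tendsto_const)
    moreover have "eventually (\<lambda>t. (if i = j then 1 else - P (\<gamma> t) i) / P (\<gamma> t) j = (\<theta> (w(i := t)) - \<theta> w) / (t - w i)) (at (w i))"
      using evx[OF d1(1)] eventually_at_filter[of "\<lambda>t. t \<noteq> w i" "w i" UNIV, simplified]
    proof (eventually_elim)
      fix t assume t: "w(i := t) \<in> T \<and> \<gamma> t \<in> coord_space I \<and> (\<forall>k\<in>I. \<bar>\<gamma> t k - x k\<bar> < \<delta>1)" and ne: "t \<noteq> w i"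
      have ex: "h (\<gamma> t) - h x = (\<Sum>k\<in>I. P (\<gamma> t) k * (\<gamma> t k - x k))" "\<bar>P (\<gamma> t) j - pd j h x\<bar> < \<bar>pd j h x\<bar>"
        using d1(2) t j by blast+
      have Pj: "P (\<gamma> t) j \<noteq> 0" using ex(2) by auto
      have h\<gamma>: "h (\<gamma> t) = (w(i := t)) j" using T\<theta>[of "w(i := t)"] t unfolding \<gamma>_def by blast
      \<comment> \<open>Only coordinates \<open>i\<close> and \<open>j\<close> change along
        \<open>\<gamma>\<close>.\<close>
      have "(\<Sum>k\<in>I. P (\<gamma> t) k * (\<gamma> t k - x k)) = (\<Sum>k\<in>{i,j}. P (\<gamma> t) k * (\<gamma> t k - x k))"
        by (rule sum.mono_neutral_right[OF I]) (use i j in \<open>auto simp: \<gamma>_def x_def\<close>)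
      then have eq: "(w(i := t)) j - w j = (\<Sum>k\<in>{i,j}. P (\<gamma> t) k * (\<gamma> t k - x k))" using ex(1) h\<gamma> xB(2) by simp
      show "(if i = j then 1 else - P (\<gamma> t) i) / P (\<gamma> t) j = (\<theta> (w(i := t)) - \<theta> w) / (t - w i)"
      proof (cases "i = j")
        case True
        then have "t - w i = P (\<gamma> t) j * (\<theta> (w(i := t)) - \<theta> w)" using eq by (simp add: \<gamma>_def x_def)
        then show ?thesis using Pj ne True by (simp add: field_simps)
      next
        case False
        then have "0 = P (\<gamma> t) i * (t - w i) + P (\<gamma> t) j * (\<theta> (w(i := t)) - \<theta> w)" using eq by (simp add: \<gamma>_def x_def)
        then have "- P (\<gamma> t) i * (t - w i) = (\<theta> (w(i := t)) - \<theta> w) * P (\<gamma> t) j" by (simp add: algebra_simps)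
        moreover have "t - w i \<noteq> 0" using ne by simp
        ultimately have "- P (\<gamma> t) i / P (\<gamma> t) j = (\<theta> (w(i := t)) - \<theta> w) / (t - w i)"
          using frac_eq_eq[OF Pj, of "t - w i" "- P (\<gamma> t) i" "\<theta> (w(i := t)) - \<theta> w"] by blast
        then show ?thesis using False by simp
      qed
    qed
    ultimately have "((\<lambda>t. (\<theta> (w(i := t)) - \<theta> w) / (t - w i)) \<longlongrightarrow> G i w) (at (w i))" by (rule Lim_transform_eventually)
    then show ?thesis unfolding has_pd_def has_field_derivative_iff by simp
  qed
  \<comment> \<open>Bootstrapping: the derivatives \<open>G i\<close> are built from derivatives of
    \<open>h\<close> along \<open>\<theta>\<close>, so class \<open>k\<close> of
    \<open>\<theta>\<close> gives class \<open>k + 1\<close>; continuity starts the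
    induction.\<close>
  have "Ck k I T \<theta>" for k
  proof (induction k)
    case (Suc k)
    have up: "Ck k I T (\<lambda>w. (w(j := \<theta> w)) l)" if "l \<in> I" for l
      using Suc Ck_proj[OF I Top, of k l] by (cases "l = j") simp_all
    have im: "(\<lambda>w. w(j := \<theta> w)) ` T \<subseteq> B" using T\<theta> by blast
    have co: "Ck k I T (\<lambda>w. pd i h (w(j := \<theta> w)))" if "i \<in> I" for i
      by (rule Ck_compose[OF I I Top Bop im up])
        (use Ck_subset[OF _ BS] smooth_fun_pd[OF h that] in \<open>simp_all add: smooth_fun_iff_Ck\<close>)
    have inv: "Ck k I T (\<lambda>w. inverse (pd j h (w(j := \<theta> w))))"
      by (rule Ck_inverse[OF I Top co[OF j]]) (use pjnz T\<theta> in blast)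
    have "Ck k I T (G i)" if i: "i \<in> I" for i
    proof (cases "i = j")
      case True
      then show ?thesis using inv by (simp add: G_def[abs_def] divide_inverse)
    next
      case False
      have "Ck k I T (\<lambda>w. (-1) * (pd i h (w(j := \<theta> w)) * inverse (pd j h (w(j := \<theta> w)))))"
        by (intro Ck_mult Ck_const I Top co i inv)
      then show ?thesis using False by (simp add: G_def[abs_def] divide_inverse)
    qed
    then show ?case by (intro Ck_SucI[OF I Top \<theta>cont der])
  qed (simp add: \<theta>cont)
  then have "smooth_fun I T \<theta>" by (simp add: smooth_fun_iff_Ck)
  then show thesis by (rule that[of B T \<theta>, OF Bop u0B BS Top _ B\<theta> T\<theta>])
qed

text \<open>The maximal atlas is closed under changes of coordinates. Both \<open>\<Phi>\<close> and
  its inverse \<open>\<Theta>\<close> are assumed smooth because compatibility is required in both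
  directions.\<close>

lemma chart_diffeo:
  assumes M: "premanifold M" and d: "d \<in> charts M" and V: "V \<subseteq> fst d" "open_coord (midx M) (snd d ` V)"
    and T: "open_coord (midx M) T"
    and \<Phi>: "\<And>u. u \<in> snd d ` V \<Longrightarrow> \<Phi> u \<in> T \<and> \<Theta> (\<Phi> u) = u" "\<And>i. i \<in> midx M \<Longrightarrow> smooth_fun (midx M) (snd d ` V) (\<lambda>u. \<Phi> u i)"
    and \<Theta>: "\<And>w. w \<in> T \<Longrightarrow> \<Theta> w \<in> snd d ` V \<and> \<Phi> (\<Theta> w) = w" "\<And>i. i \<in> midx M \<Longrightarrow> smooth_fun (midx M) T (\<lambda>w. \<Theta> w i)"
  shows "(V, \<Phi> \<circ> snd d) \<in> charts M"
proof -
  let ?I = "midx M" and ?d = "(V, \<Phi> \<circ> snd d)"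
  have fin: "finite ?I" using M by (rule premanifold_finite)
  have img: "(\<Phi> \<circ> snd d) ` V = T"
  proof
    show "(\<Phi> \<circ> snd d) ` V \<subseteq> T" using \<Phi>(1) by auto
    show "T \<subseteq> (\<Phi> \<circ> snd d) ` V"
    proof
      fix w assume w: "w \<in> T"
      then obtain x where "x \<in> V" "\<Theta> w = snd d x" using \<Theta>(1) by blast
      then have "w = (\<Phi> \<circ> snd d) x" using \<Theta>(1)[OF w] by simp
      then show "w \<in> (\<Phi> \<circ> snd d) ` V" using \<open>x \<in> V\<close> by blast
    qed
  qed
  have injV: "inj_on (snd d) V" using chart_inj[OF d] V(1) by (rule inj_on_subset)
  have inj: "inj_on (\<Phi> \<circ> snd d) V"
  proof (rule comp_inj_on[OF injV])
    show "inj_on \<Phi> (snd d ` V)" by (rule inj_on_inverseI[of _ \<Theta>]) (use \<Phi>(1) in blast)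
  qed
  have inv: "snd d (inv_into V (\<Phi> \<circ> snd d) w) = \<Theta> w" if w: "w \<in> T" for w
  proof -
    obtain x where x: "x \<in> V" "w = \<Phi> (snd d x)" using w img by auto
    then have "inv_into V (\<Phi> \<circ> snd d) w = x" using inv_into_f_f[OF inj x(1)] by simp
    then show ?thesis using \<Phi>(1) x by auto
  qed
  have opT: "open_coord ?I (snd ?d ` V)" unfolding snd_conv img by (rule T)
  have to: "smooth_in_charts ?I ?I ?d d V id"
    unfolding smooth_in_charts_def
  proof (intro conjI ballI opT)
    fix i assume "i \<in> ?I"
    have "smooth_fun ?I T (\<lambda>w. snd d (inv_into V (\<Phi> \<circ> snd d) w) i)"
      by (rule smooth_fun_congI[OF fin T \<Theta>(2)[OF \<open>i \<in> ?I\<close>]]) (simp add: inv)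
    then show "smooth_fun ?I (snd ?d ` V) (\<lambda>u. snd d (id (chart_inv ?d u)) i)"
      unfolding snd_conv fst_conv img by simp
  qed (use V in auto)
  have "snd d (chart_inv d u) = u" if "u \<in> snd d ` V" for u
    using that V(1) by (intro chart_chart_inv) blast
  then have "smooth_fun ?I (snd d ` V) (\<lambda>u. \<Phi> (snd d (chart_inv d u)) i)" if "i \<in> ?I" for i
    by (intro smooth_fun_congI[OF fin V(2) \<Phi>(2)[OF that]]) simp
  then have fro: "smooth_in_charts ?I ?I d ?d V id"
    using V by (simp add: smooth_in_charts_def)
  have "smooth_transition ?I ?d e \<and> smooth_transition ?I e ?d" if e: "e \<in> matlas M" for e
  proof
    have e': "e \<in> charts M" using premanifold_atlas[OF M e] .
    have "smooth_in_charts ?I ?I ?d e {x \<in> V. id x \<in> fst d \<inter> fst e} (id \<circ> id)"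
      by (rule smooth_in_charts_compose[OF to charts_transition[OF M d e'] fin fin _ chart_inj[OF d] open_coord_subset[OF chart_open[OF d]]])
        (use inj in simp)
    moreover have "{x \<in> V. id x \<in> fst d \<inter> fst e} = V \<inter> fst e" using V by auto
    ultimately show "smooth_transition ?I ?d e" unfolding smooth_transition_iff by simp
    have "smooth_in_charts ?I ?I e ?d {x \<in> fst e \<inter> fst d. id x \<in> V} (id \<circ> id)"
      by (rule smooth_in_charts_compose[OF charts_transition[OF M e' d] fro fin fin chart_inj[OF e'] chart_inj[OF d]
            open_coord_subset[OF chart_open[OF d]]])
    moreover have "{x \<in> fst e \<inter> fst d. id x \<in> V} = fst e \<inter> V" using V by auto
    ultimately show "smooth_transition ?I e ?d" unfolding smooth_transition_iff by simp
  qed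
  moreover have "is_chart M ?d"
    unfolding is_chart_def using V chart_subset[OF d] inj opT by auto
  ultimately show ?thesis by (simp add: charts_def)
qed

section \<open>The submersion theorem\<close>

lemma smooth_manifold_premanifold:
  assumes "smooth_manifold M n"
  shows "premanifold M" "midx M = {..<n}" "Hausdorff_space (mtop M)"
  using assms by (auto simp: smooth_manifold_def premanifold_def)

text \<open>One step of the submersion theorem: one more coordinate of the total space is replaced by a base coordinate.\<close>

lemma fibred_chart_step:
  assumes Y: "premanifold Y" "midx Y = {..<m}" and Z: "premanifold Z" "midx Z = {..<n}"
    and \<pi>: "smooth_map_on Y Z (mcarrier Y) \<pi>"
    and sub: "tangent_map Y Z \<pi> ` tangent_space Y y = tangent_space Z (\<pi> y)"
    and c: "c \<in> charts Z" and d: "d \<in> charts Y" "y \<in> fst d" "\<pi> ` fst d \<subseteq> fst c"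
    and k: "k < n" and base: "\<And>y' i. y' \<in> fst d \<Longrightarrow> i < k \<Longrightarrow> snd d y' i = snd c (\<pi> y') i"
  shows "k < m \<and> (\<exists>d'\<in>charts Y. y \<in> fst d' \<and> \<pi> ` fst d' \<subseteq> fst c \<and>
    (\<forall>y'\<in>fst d'. \<forall>i<Suc k. snd d' y' i = snd c (\<pi> y') i))"
proof -
  let ?I = "midx Y"
  define h where "h u = snd c (\<pi> (chart_inv d u)) k" for u
  have fin: "finite ?I" using Y(1) by (rule premanifold_finite)
  have dom: "{x \<in> fst d \<inter> mcarrier Y. \<pi> x \<in> fst c} = fst d" using d(3) chart_subset[OF d(1)] by auto
  have h: "smooth_fun ?I (snd d ` fst d) h"
    using smooth_map_on_in_charts[OF Y(1) Z(1) \<pi> d(1) c] k Z(2) unfolding dom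
    by (simp add: smooth_in_charts_def h_def[abs_def])
  have y: "y \<in> mcarrier Y" "\<pi> y \<in> fst c" using d chart_subset[OF d(1)] by auto
  \<comment> \<open>If the \<open>k\<close>-th base coordinate had zero derivative in all
    coordinates not yet fixed, a vector over \<open>y\<close> lifting the \<open>k\<close>-th
    coordinate direction of \<open>Z\<close> could not exist, against surjectivity of the tangent
    map.\<close>
  have "\<exists>j\<in>?I. \<not> j < k \<and> pd j h (snd d y) \<noteq> 0"
  proof (rule ccontr)
    assume neg: "\<not> ?thesis"
    define w :: "nat \<Rightarrow> real" where "w = (\<lambda>i. if i = k then 1 else 0)"
    have w: "w \<in> coord_space (midx Z)" using k Z(2) by (auto simp: w_def coord_space_def)
    define \<tau> where "\<tau> = (\<lambda>t. chart_inv c (\<lambda>i. snd c (\<pi> y) i + t * w i))"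
    have \<tau>: "smooth_curve Z \<tau>" "\<tau> 0 = \<pi> y" "\<And>i. i \<in> midx Z \<Longrightarrow> snd (velocity Z \<tau>) c i = w i"
      unfolding \<tau>_def using coordinate_line[OF Z(1) c y(2) w] by blast+
    have "velocity Z \<tau> \<in> tangent_space Z (\<pi> y)" using \<tau> by (auto simp: tangent_space_def)
    then obtain v where v: "v \<in> tangent_space Y y" "tangent_map Y Z \<pi> v = velocity Z \<tau>"
      unfolding sub[symmetric] by auto
    then obtain \<sigma> where \<sigma>: "v = velocity Y \<sigma>" "smooth_curve Y \<sigma>" "\<sigma> 0 = y" by (auto simp: tangent_space_def)
    have \<sigma>0: "\<sigma> 0 \<in> mcarrier Y" "\<sigma> 0 \<in> fst d" "\<pi> (\<sigma> 0) \<in> fst c" using \<sigma>(3) y d by auto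
    have vel: "velocity Z (\<pi> \<circ> \<sigma>) = velocity Z \<tau>"
      using tangent_map_velocity[OF Y(1) Z(1) \<sigma>(2) \<pi> \<sigma>0(1)] v(2) \<sigma>(1) by simp
    \<comment> \<open>The first \<open>k\<close> coordinates already are base coordinates, so these
      components of a lift are those of the unit vector \<open>w\<close>, namely zero.\<close>
    have low: "snd (velocity Y \<sigma>) d j = 0" if j: "j < k" "j \<in> ?I" for j
    proof -
      have ev: "eventually (\<lambda>t. \<sigma> t \<in> fst d) (nhds 0)" by (rule smooth_curve_eventually[OF Y(1) \<sigma>(2) d(1) \<sigma>0(2)])
      have "((\<lambda>t. snd d (\<sigma> t) j) has_real_derivative snd (velocity Y \<sigma>) d j) (at 0)"
        by (rule smooth_curve_derivative[OF Y(1) \<sigma>(2) d(1) \<sigma>0(2) j(2)])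
      moreover have "eventually (\<lambda>t. snd d (\<sigma> t) j = snd c ((\<pi> \<circ> \<sigma>) t) j) (nhds 0)"
        by (rule eventually_mono[OF ev]) (simp add: base j)
      ultimately have "((\<lambda>t. snd c ((\<pi> \<circ> \<sigma>) t) j) has_real_derivative snd (velocity Y \<sigma>) d j) (at 0)"
        by (rule DERIV_eventually_cong)
      moreover have "((\<lambda>t. snd c ((\<pi> \<circ> \<sigma>) t) j) has_real_derivative snd (velocity Z (\<pi> \<circ> \<sigma>)) c j) (at 0)"
        by (rule smooth_curve_derivative[OF Z(1) smooth_curve_compose[OF Y(1) Z(1) \<sigma>(2) \<pi> \<sigma>0(1)] c])
          (use \<sigma>0 j k Z(2) in simp_all)
      ultimately have "snd (velocity Y \<sigma>) d j = snd (velocity Z (\<pi> \<circ> \<sigma>)) c j" by (rule DERIV_unique)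
      also have "\<dots> = w j" unfolding vel using j k Z(2) by (intro \<tau>(3)) simp
      finally show ?thesis using j by (simp add: w_def)
    qed
    have "1 = snd (velocity Z (\<pi> \<circ> \<sigma>)) c k" unfolding vel using k Z(2) by (simp add: \<tau>(3) w_def)
    also have "\<dots> = (\<Sum>i\<in>?I. pd i h (snd d (\<sigma> 0)) * snd (velocity Y \<sigma>) d i)"
      unfolding h_def[abs_def] by (rule velocity_compose[OF Y(1) Z(1) \<sigma>(2) \<pi> \<sigma>0(1) d(1) \<sigma>0(2) c \<sigma>0(3)]) (use k Z(2) in simp)
    also have "\<dots> = 0"
    proof (rule sum.neutral, intro ballI)
      fix i assume "i \<in> ?I"
      then show "pd i h (snd d (\<sigma> 0)) * snd (velocity Y \<sigma>) d i = 0"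
        using neg low[of i] \<sigma>(3) by (cases "i < k") auto
    qed
    finally show False by simp
  qed
  then obtain j where j: "j \<in> ?I" "\<not> j < k" "pd j h (snd d y) \<noteq> 0" by blast
  have km: "k < m" using j Y(2) by simp
  then have kI: "k \<in> ?I" using Y(2) by simp
  have dy: "snd d y \<in> snd d ` fst d" using d(2) by blast
  obtain B T \<theta> where B: "open_coord ?I B" "snd d y \<in> B" "B \<subseteq> snd d ` fst d" and T: "open_coord ?I T" "smooth_fun ?I T \<theta>"
    and B\<theta>: "\<And>u. u \<in> B \<Longrightarrow> u(j := h u) \<in> T \<and> \<theta> (u(j := h u)) = u j"
    and T\<theta>: "\<And>w. w \<in> T \<Longrightarrow> w(j := \<theta> w) \<in> B \<and> h (w(j := \<theta> w)) = w j"
    using replace_coordinate[OF fin chart_open[OF d(1)] h dy j(1,3)] by metis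
  define V where "V = {x \<in> fst d. snd d x \<in> B}"
  have V: "V \<subseteq> fst d" "snd d ` V = B" using B(3) by (auto simp: V_def)
  define d1 where "d1 = (V, (\<lambda>u. u(j := h u)) \<circ> snd d)"
  have d1: "d1 \<in> charts Y"
    unfolding d1_def
  proof (rule chart_diffeo[OF Y(1) d(1) V(1) _ T(1), unfolded V(2), where \<Theta> = "\<lambda>w. w(j := \<theta> w)"])
    show "open_coord ?I B" by (rule B(1))
    show "u(j := h u) \<in> T \<and> (u(j := h u))(j := \<theta> (u(j := h u))) = u" if "u \<in> B" for u using B\<theta>[OF that] by simp
    show "w(j := \<theta> w) \<in> B \<and> (w(j := \<theta> w))(j := h (w(j := \<theta> w))) = w" if "w \<in> T" for w using T\<theta>[OF that] by simp
    show "smooth_fun ?I B (\<lambda>u. (u(j := h u)) i)" for i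
      using smooth_fun_subset[OF h B(3)] smooth_fun_proj[OF fin B(1), of i] by (cases "i = j") simp_all
    show "smooth_fun ?I T (\<lambda>w. (w(j := \<theta> w)) i)" for i
      using T(2) smooth_fun_proj[OF fin T(1), of i] by (cases "i = j") simp_all
  qed
  have fd1: "fst d1 = V" by (simp add: d1_def)
  \<comment> \<open>\<open>replace_coordinate\<close> leaves the base coordinate at position
    \<open>j\<close>; the swap brings it to position \<open>k\<close>. Since \<open>j\<close> is not
    below \<open>k\<close>, the positions settled before are not touched.\<close>
  define sw where "sw u = (\<lambda>i. if i = j then u k else if i = k then u j else u i)" for u :: "nat \<Rightarrow> real"
  have swsw: "sw (sw u) = u" for u by (auto simp: sw_def fun_eq_iff)
  have swc: "sw u \<in> coord_space ?I" if "u \<in> coord_space ?I" for u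
    using that j(1) kI by (auto simp: sw_def coord_space_def)
  define S1 where "S1 = snd d1 ` V"
  have S1: "open_coord ?I S1" using chart_open[OF d1] by (simp add: S1_def fd1)
  have S1c: "S1 \<subseteq> coord_space ?I" using open_coord_subset[OF S1] .
  have top: "open_coord ?I (coord_space ?I)" by (simp add: open_coord_def)
  have swcont: "continuous_on (coord_space ?I) sw"
  proof (rule continuous_on_coordinatewise_then_product)
    fix i
    have p: "continuous_on (coord_space ?I) (\<lambda>u::nat \<Rightarrow> real. u l)" for l
      by (rule continuous_on_subset[OF continuous_on_product_coordinates]) simp
    show "continuous_on (coord_space ?I) (\<lambda>u. sw u i)"
      unfolding sw_def by (cases "i = j"; cases "i = k") (simp_all add: p)
  qed
  define T1 where "T1 = {w \<in> coord_space ?I. sw w \<in> S1}"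
  have T1: "open_coord ?I T1"
    unfolding T1_def by (rule open_coord_preimage[OF top swcont S1]) (use swc in blast)
  define d2 where "d2 = (V, sw \<circ> snd d1)"
  have sws: "smooth_fun ?I R (\<lambda>u. sw u i)" if "open_coord ?I R" for R i
    unfolding sw_def by (cases "i = j"; cases "i = k") (simp_all add: smooth_fun_proj[OF fin that])
  have d2: "d2 \<in> charts Y"
    unfolding d2_def
  proof (rule chart_diffeo[OF Y(1) d1 _ _ T1, where \<Theta> = sw])
    show "sw u \<in> T1 \<and> sw (sw u) = u" if "u \<in> snd d1 ` V" for u
      using that swsw swc S1c unfolding S1_def[symmetric] by (auto simp: T1_def)
    show "sw w \<in> snd d1 ` V \<and> sw (sw w) = w" if "w \<in> T1" for w
      using that swsw unfolding S1_def[symmetric] by (simp add: T1_def)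
    show "V \<subseteq> fst d1" by (simp add: fd1)
    show "open_coord ?I (snd d1 ` V)" using S1 unfolding S1_def .
    show "smooth_fun ?I (snd d1 ` V) (\<lambda>u. sw u i)" for i using sws[OF S1] unfolding S1_def .
  qed (rule sws[OF T1])
  have "snd d2 y' i = snd c (\<pi> y') i" if y': "y' \<in> fst d2" and i: "i < Suc k" for y' i
  proof -
    have y'd: "y' \<in> fst d" using y' V(1) by (auto simp: d2_def)
    show ?thesis
    proof (cases "i = k")
      case True
      have "snd d2 y' k = (snd d1 y') j" by (simp add: d2_def sw_def)
      also have "\<dots> = h (snd d y')" by (simp add: d1_def)
      also have "\<dots> = snd c (\<pi> y') k" using chart_inv_chart[OF d(1) y'd] by (simp add: h_def)
      finally show ?thesis using True by simp
    next
      case False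
      then have "i < k" "i \<noteq> j" using i j(2) by auto
      then show ?thesis using base[OF y'd] False by (simp add: d2_def d1_def sw_def)
    qed
  qed
  moreover have "y \<in> fst d2" "\<pi> ` fst d2 \<subseteq> fst c" using d(2,3) B(2) V(1) by (auto simp: d2_def V_def)
  ultimately show ?thesis using km d2 by blast
qed

text \<open>One application of \<open>fibred_chart_step\<close> for each base coordinate, starting
  from a chart restricted to the preimage of \<open>c\<close>. The inclusion of index sets comes
  along, since each step finds room for one more base index among those of \<open>Y\<close>.\<close>

lemma fibred_chart_exists:
  assumes F: "fibred_manifold Y Z \<pi>" and y: "y \<in> mcarrier Y" and c: "c \<in> charts Z" "\<pi> y \<in> fst c"
  shows "midx Z \<subseteq> midx Y" "\<exists>d. (c, d) \<in> fibred_charts Y Z \<pi> \<and> y \<in> fst d"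
proof -
  obtain m n where mn: "smooth_manifold Y m" "smooth_manifold Z n" using F by (auto simp: fibred_manifold_def)
  note Y = smooth_manifold_premanifold(1,2)[OF mn(1)] and Z = smooth_manifold_premanifold(1,2)[OF mn(2)]
  have \<pi>: "smooth_map_on Y Z (mcarrier Y) \<pi>"
    and sub: "tangent_map Y Z \<pi> ` tangent_space Y y = tangent_space Z (\<pi> y)"
    using F y by (auto simp: fibred_manifold_def)
  have ind: "k \<le> n \<Longrightarrow> k \<le> m \<and> (\<exists>d\<in>charts Y. y \<in> fst d \<and> \<pi> ` fst d \<subseteq> fst c \<and>
    (\<forall>y'\<in>fst d. \<forall>i<k. snd d y' i = snd c (\<pi> y') i))" for k
  proof (induction k)
    case 0
    obtain d where d: "d \<in> charts Y" "y \<in> fst d" using premanifold_cover[OF Y(1) y] by blast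
    define V where "V = {x \<in> fst d \<inter> mcarrier Y. \<pi> x \<in> fst c}"
    have V: "V \<subseteq> fst d" "open_coord (midx Y) (snd d ` V)"
      using smooth_map_on_in_charts[OF Y(1) Z(1) \<pi> d(1) c(1)] by (auto simp: smooth_in_charts_def V_def)
    show ?case using restrict_chart[OF Y(1) d(1) V] d(2) y c(2)
      by (intro conjI bexI[of _ "(V, snd d)"]) (auto simp: V_def)
  next
    case (Suc k)
    then have "\<exists>d\<in>charts Y. y \<in> fst d \<and> \<pi> ` fst d \<subseteq> fst c \<and>
      (\<forall>y'\<in>fst d. \<forall>i<k. snd d y' i = snd c (\<pi> y') i)" by simp
    then obtain d where d: "d \<in> charts Y" "y \<in> fst d" "\<pi> ` fst d \<subseteq> fst c"
      "\<forall>y'\<in>fst d. \<forall>i<k. snd d y' i = snd c (\<pi> y') i" by blast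
    have "k < n" using Suc(2) by simp
    from fibred_chart_step[OF Y Z \<pi> sub c(1) d(1-3) this d(4)[rule_format]]
    show ?case by (auto simp only: Suc_le_eq)
  qed
  from ind[of n] obtain d where "n \<le> m" and d: "d \<in> charts Y" "y \<in> fst d" "\<pi> ` fst d \<subseteq> fst c"
    "\<forall>y'\<in>fst d. \<forall>i<n. snd d y' i = snd c (\<pi> y') i" by blast
  then have "(c, d) \<in> fibred_charts Y Z \<pi>"
    unfolding fibred_charts_def using Z(2) c(1) by simp
  then show "\<exists>d. (c, d) \<in> fibred_charts Y Z \<pi> \<and> y \<in> fst d" using d(2) by blast
  show "midx Z \<subseteq> midx Y" using Y(2) Z(2) \<open>n \<le> m\<close> by auto
qed

subsection \<open>Equality of partial derivatives up to a given order\<close>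

definition jet_eq :: "'i set \<Rightarrow> nat \<Rightarrow> ('i \<Rightarrow> real) \<Rightarrow> (('i \<Rightarrow> real) \<Rightarrow> real) \<Rightarrow> (('i \<Rightarrow> real) \<Rightarrow> real) \<Rightarrow> bool" where
  "jet_eq I r x f g \<longleftrightarrow> (\<forall>is\<in>lists I. length is \<le> r \<longrightarrow> pds is f x = pds is g x)"

lemma jet_eq_0: "jet_eq I 0 x f g \<longleftrightarrow> f x = g x"
  by (auto simp: jet_eq_def)

text \<open>The innermost derivative, the last entry of the list, is split off. Agreement to order
  \<open>r + 1\<close> thereby becomes agreement to order \<open>r\<close> for other functions,
  which suits an induction on \<open>r\<close>.\<close>

lemma jet_eq_Suc: "jet_eq I (Suc r) x f g \<longleftrightarrow> f x = g x \<and> (\<forall>i\<in>I. jet_eq I r x (pd i f) (pd i g))"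
proof
  assume *: "jet_eq I (Suc r) x f g"
  have "pds is (pd i f) x = pds is (pd i g) x" if "is \<in> lists I" "length is \<le> r" "i \<in> I" for "is" i
  proof -
    have "is @ [i] \<in> lists I" "length (is @ [i]) \<le> Suc r" using that by auto
    then have "pds (is @ [i]) f x = pds (is @ [i]) g x" using * unfolding jet_eq_def by blast
    then show ?thesis by (simp add: pds_append)
  qed
  moreover have "pds [] f x = pds [] g x" using *[unfolded jet_eq_def, rule_format, of "[]"] by simp
  ultimately show "f x = g x \<and> (\<forall>i\<in>I. jet_eq I r x (pd i f) (pd i g))" by (simp add: jet_eq_def)
next
  assume *: "f x = g x \<and> (\<forall>i\<in>I. jet_eq I r x (pd i f) (pd i g))"
  have "pds is f x = pds is g x" if "is \<in> lists I" "length is \<le> Suc r" for "is"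
  proof (cases "is" rule: rev_exhaust)
    case (snoc js i)
    then have "js \<in> lists I" "length js \<le> r" "i \<in> I" using that by auto
    then have "pds js (pd i f) x = pds js (pd i g) x" using * unfolding jet_eq_def by blast
    then show ?thesis unfolding snoc pds_append by simp
  qed (use * in simp)
  then show "jet_eq I (Suc r) x f g" by (simp add: jet_eq_def)
qed

lemma jet_eq_mono: "jet_eq I r x f g \<Longrightarrow> r' \<le> r \<Longrightarrow> jet_eq I r' x f g"
  by (auto simp: jet_eq_def)

lemma jet_eq_value: "jet_eq I r x f g \<Longrightarrow> f x = g x"
  using jet_eq_mono[of I r x f g 0] by (simp add: jet_eq_0)

lemma jet_eq_cong:
  assumes "finite I" "open_coord I S" "x \<in> S" "jet_eq I r x f g"
    "\<And>u. u \<in> S \<Longrightarrow> f u = f' u" "\<And>u. u \<in> S \<Longrightarrow> g u = g' u"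
  shows "jet_eq I r x f' g'"
  unfolding jet_eq_def
proof (intro ballI impI)
  fix "is" assume *: "is \<in> lists I" "length is \<le> r"
  have "pds is f x = pds is f' x" "pds is g x = pds is g' x"
    by (rule pds_cong[OF assms(2,1,3) *(1)]; use assms(5,6) in simp)+
  then show "pds is f' x = pds is g' x" using assms(4) * by (simp add: jet_eq_def)
qed

context
  fixes I :: "'i set" and S :: "('i \<Rightarrow> real) set" and x :: "'i \<Rightarrow> real"
  assumes fin: "finite I" and op: "open_coord I S" and x: "x \<in> S"
begin

lemma jet_eq_add:
  "smooth_fun I S f \<Longrightarrow> smooth_fun I S f' \<Longrightarrow> smooth_fun I S g \<Longrightarrow> smooth_fun I S g' \<Longrightarrow>
   jet_eq I r x f f' \<Longrightarrow> jet_eq I r x g g' \<Longrightarrow> jet_eq I r x (\<lambda>u. f u + g u) (\<lambda>u. f' u + g' u)"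
proof (induction r arbitrary: f f' g g')
  case 0
  then show ?case by (simp add: jet_eq_0)
next
  case (Suc r)
  have "jet_eq I r x (pd i (\<lambda>u. f u + g u)) (pd i (\<lambda>u. f' u + g' u))" if i: "i \<in> I" for i
  proof (rule jet_eq_cong[OF fin op x Suc(1)])
    show "jet_eq I r x (pd i f) (pd i f')" "jet_eq I r x (pd i g) (pd i g')"
      using Suc(6,7) i by (simp_all add: jet_eq_Suc)
    show "pd i f u + pd i g u = pd i (\<lambda>u. f u + g u) u" if "u \<in> S" for u
      using pd_eqI[OF has_pd_add[OF smooth_fun_has_pd[OF Suc(2) i that] smooth_fun_has_pd[OF Suc(4) i that]]] by simp
    show "pd i f' u + pd i g' u = pd i (\<lambda>u. f' u + g' u) u" if "u \<in> S" for u
      using pd_eqI[OF has_pd_add[OF smooth_fun_has_pd[OF Suc(3) i that] smooth_fun_has_pd[OF Suc(5) i that]]] by simp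
  qed (intro smooth_fun_pd Suc(2-5) i)+
  then show ?case using Suc(6,7) by (simp add: jet_eq_Suc)
qed

text \<open>The product rule is used once per order; the induction on \<open>r\<close> takes the
  place of the explicit formula for higher derivatives of a product.\<close>

lemma jet_eq_mult:
  "smooth_fun I S f \<Longrightarrow> smooth_fun I S f' \<Longrightarrow> smooth_fun I S g \<Longrightarrow> smooth_fun I S g' \<Longrightarrow>
   jet_eq I r x f f' \<Longrightarrow> jet_eq I r x g g' \<Longrightarrow> jet_eq I r x (\<lambda>u. f u * g u) (\<lambda>u. f' u * g' u)"
proof (induction r arbitrary: f f' g g')
  case 0
  then show ?case by (simp add: jet_eq_0)
next
  case (Suc r)
  have m: "jet_eq I r x f f'" "jet_eq I r x g g'" using Suc(6,7) jet_eq_mono[of I "Suc r"] by simp_all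
  have "jet_eq I r x (pd i (\<lambda>u. f u * g u)) (pd i (\<lambda>u. f' u * g' u))" if i: "i \<in> I" for i
  proof (rule jet_eq_cong[OF fin op x jet_eq_add])
    have p: "jet_eq I r x (pd i f) (pd i f')" "jet_eq I r x (pd i g) (pd i g')"
      using Suc(6,7) i by (simp_all add: jet_eq_Suc)
    show "jet_eq I r x (\<lambda>u. pd i f u * g u) (\<lambda>u. pd i f' u * g' u)"
      by (rule Suc(1)[OF smooth_fun_pd[OF Suc(2) i] smooth_fun_pd[OF Suc(3) i] Suc(4,5) p(1) m(2)])
    show "jet_eq I r x (\<lambda>u. f u * pd i g u) (\<lambda>u. f' u * pd i g' u)"
      by (rule Suc(1)[OF Suc(2,3) smooth_fun_pd[OF Suc(4) i] smooth_fun_pd[OF Suc(5) i] m(1) p(2)])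
    show "pd i f u * g u + f u * pd i g u = pd i (\<lambda>u. f u * g u) u" if "u \<in> S" for u
      using pd_eqI[OF has_pd_mult[OF smooth_fun_has_pd[OF Suc(2) i that] smooth_fun_has_pd[OF Suc(4) i that]]] by simp
    show "pd i f' u * g' u + f' u * pd i g' u = pd i (\<lambda>u. f' u * g' u) u" if "u \<in> S" for u
      using pd_eqI[OF has_pd_mult[OF smooth_fun_has_pd[OF Suc(3) i that] smooth_fun_has_pd[OF Suc(5) i that]]] by simp
  qed (intro smooth_fun_mult[OF fin op] smooth_fun_pd Suc(2-5) i)+
  then show ?case using Suc(6,7) by (simp add: jet_eq_Suc)
qed

lemma jet_eq_sum:
  "finite A \<Longrightarrow> (\<And>a. a \<in> A \<Longrightarrow> smooth_fun I S (f a)) \<Longrightarrow> (\<And>a. a \<in> A \<Longrightarrow> smooth_fun I S (g a)) \<Longrightarrow>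
   (\<And>a. a \<in> A \<Longrightarrow> jet_eq I r x (f a) (g a)) \<Longrightarrow> jet_eq I r x (\<lambda>u. \<Sum>a\<in>A. f a u) (\<lambda>u. \<Sum>a\<in>A. g a u)"
proof (induction A rule: finite_induct)
  case empty
  then show ?case by (simp add: jet_eq_def)
next
  case (insert a A)
  have "jet_eq I r x (\<lambda>u. f a u + (\<Sum>a\<in>A. f a u)) (\<lambda>u. g a u + (\<Sum>a\<in>A. g a u))"
  proof (rule jet_eq_add)
    show "jet_eq I r x (\<lambda>u. \<Sum>a\<in>A. f a u) (\<lambda>u. \<Sum>a\<in>A. g a u)"
      by (rule insert(3)) (rule insert(4-6), simp)+
    show "smooth_fun I S (\<lambda>u. \<Sum>a\<in>A. f a u)" "smooth_fun I S (\<lambda>u. \<Sum>a\<in>A. g a u)"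
      by (rule smooth_fun_sum[OF fin op], rule insert(4,5), simp)+
  qed (rule insert(4-6), simp)+
  then show ?case using insert(1,2) by simp
qed

text \<open>Covers a change of chart in the target. By the chain rule a first derivative of
  \<open>F\<close> along \<open>f\<close> is a sum of products whose factors agree to order
  \<open>r\<close>: the outer ones by induction applied to \<open>pd j F\<close>, the inner ones by
  assumption.\<close>

lemma jet_eq_outer:
  assumes J: "finite J" "open_coord J T" and f: "f ` S \<subseteq> T" "g ` S \<subseteq> T"
    and fs: "\<And>j. j \<in> J \<Longrightarrow> smooth_fun I S (\<lambda>u. f u j)" and gs: "\<And>j. j \<in> J \<Longrightarrow> smooth_fun I S (\<lambda>u. g u j)"
  shows "smooth_fun J T F \<Longrightarrow> (\<And>j. j \<in> J \<Longrightarrow> jet_eq I r x (\<lambda>u. f u j) (\<lambda>u. g u j)) \<Longrightarrow>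
    jet_eq I r x (\<lambda>u. F (f u)) (\<lambda>u. F (g u))"
proof (induction r arbitrary: F)
  have fg: "f x = g x" if "\<And>j. j \<in> J \<Longrightarrow> jet_eq I r x (\<lambda>u. f u j) (\<lambda>u. g u j)" for r
  proof
    fix j
    have "f x \<in> coord_space J" "g x \<in> coord_space J" using f x open_coord_subset[OF J(2)] by blast+
    then show "f x j = g x j" using jet_eq_value[OF that[of j]] by (cases "j \<in> J") (auto simp: coord_space_def)
  qed
  {
    case 0
    from fg[OF 0(2)] show ?case by (simp add: jet_eq_0)
  next
    case (Suc r)
    have m: "jet_eq I r x (\<lambda>u. f u j) (\<lambda>u. g u j)" if "j \<in> J" for j
      using jet_eq_mono[OF Suc(3)[OF that], of r] by simp
    have "jet_eq I r x (pd i (\<lambda>u. F (f u))) (pd i (\<lambda>u. F (g u)))" if i: "i \<in> I" for i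
    proof (rule jet_eq_cong[OF fin op x jet_eq_sum[OF J(1)]])
      have c1: "smooth_fun I S (\<lambda>u. pd j F (f u))" if "j \<in> J" for j
        by (rule smooth_fun_compose[OF fin J(1) op J(2) f(1) fs smooth_fun_pd[OF Suc(2) that]])
      have c2: "smooth_fun I S (\<lambda>u. pd j F (g u))" if "j \<in> J" for j
        by (rule smooth_fun_compose[OF fin J(1) op J(2) f(2) gs smooth_fun_pd[OF Suc(2) that]])
      show "smooth_fun I S (\<lambda>u. pd j F (f u) * pd i (\<lambda>u. f u j) u)" if "j \<in> J" for j
        by (rule smooth_fun_mult[OF fin op c1[OF that] smooth_fun_pd[OF fs[OF that] i]])
      show "smooth_fun I S (\<lambda>u. pd j F (g u) * pd i (\<lambda>u. g u j) u)" if "j \<in> J" for j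
        by (rule smooth_fun_mult[OF fin op c2[OF that] smooth_fun_pd[OF gs[OF that] i]])
      show "jet_eq I r x (\<lambda>u. pd j F (f u) * pd i (\<lambda>u. f u j) u) (\<lambda>u. pd j F (g u) * pd i (\<lambda>u. g u j) u)" if j: "j \<in> J" for j
      proof (rule jet_eq_mult[OF c1[OF j] c2[OF j] smooth_fun_pd[OF fs[OF j] i] smooth_fun_pd[OF gs[OF j] i]])
        show "jet_eq I r x (\<lambda>u. pd j F (f u)) (\<lambda>u. pd j F (g u))"
          by (rule Suc(1)[OF smooth_fun_pd[OF Suc(2) j] m])
        show "jet_eq I r x (pd i (\<lambda>u. f u j)) (pd i (\<lambda>u. g u j))"
          using Suc(3)[OF j] i by (simp add: jet_eq_Suc)
      qed
      show "(\<Sum>j\<in>J. pd j F (f u) * pd i (\<lambda>u. f u j) u) = pd i (\<lambda>u. F (f u)) u" if "u \<in> S" for u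
        by (rule pd_compose[OF fin J(1) op J(2) f(1) fs Suc(2) that i, symmetric])
      show "(\<Sum>j\<in>J. pd j F (g u) * pd i (\<lambda>u. g u j) u) = pd i (\<lambda>u. F (g u)) u" if "u \<in> S" for u
        by (rule pd_compose[OF fin J(1) op J(2) f(2) gs Suc(2) that i, symmetric])
    qed
    moreover have "F (f x) = F (g x)" using fg[OF Suc(3)] by simp
    ultimately show ?case by (simp add: jet_eq_Suc)
  }
qed

text \<open>Covers a change of chart in the source: here the inner map is common to both sides, and
  the assumption is passed on to the derivatives of the outer functions.\<close>

lemma jet_eq_inner:
  assumes J: "finite J" "open_coord J T" and \<phi>: "\<phi> ` S \<subseteq> T"
    and \<phi>s: "\<And>j. j \<in> J \<Longrightarrow> smooth_fun I S (\<lambda>u. \<phi> u j)"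
  shows "smooth_fun J T f \<Longrightarrow> smooth_fun J T g \<Longrightarrow> jet_eq J r (\<phi> x) f g \<Longrightarrow>
    jet_eq I r x (\<lambda>u. f (\<phi> u)) (\<lambda>u. g (\<phi> u))"
proof (induction r arbitrary: f g)
  case 0
  then show ?case by (simp add: jet_eq_0)
next
  case (Suc r)
  have "jet_eq I r x (pd i (\<lambda>u. f (\<phi> u))) (pd i (\<lambda>u. g (\<phi> u)))" if i: "i \<in> I" for i
  proof (rule jet_eq_cong[OF fin op x jet_eq_sum[OF J(1)]])
    have c: "smooth_fun I S (\<lambda>u. pd j h (\<phi> u))" if "j \<in> J" "smooth_fun J T h" for j h
      by (rule smooth_fun_compose[OF fin J(1) op J(2) \<phi> \<phi>s smooth_fun_pd[OF that(2,1)]])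
    have p: "smooth_fun I S (pd i (\<lambda>u. \<phi> u j))" if "j \<in> J" for j
      by (rule smooth_fun_pd[OF \<phi>s[OF that] i])
    show "smooth_fun I S (\<lambda>u. pd j f (\<phi> u) * pd i (\<lambda>u. \<phi> u j) u)" if "j \<in> J" for j
      by (rule smooth_fun_mult[OF fin op c[OF that Suc(2)] p[OF that]])
    show "smooth_fun I S (\<lambda>u. pd j g (\<phi> u) * pd i (\<lambda>u. \<phi> u j) u)" if "j \<in> J" for j
      by (rule smooth_fun_mult[OF fin op c[OF that Suc(3)] p[OF that]])
    show "jet_eq I r x (\<lambda>u. pd j f (\<phi> u) * pd i (\<lambda>u. \<phi> u j) u) (\<lambda>u. pd j g (\<phi> u) * pd i (\<lambda>u. \<phi> u j) u)" if j: "j \<in> J" for j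
    proof (rule jet_eq_mult[OF c[OF j Suc(2)] c[OF j Suc(3)] p[OF j] p[OF j]])
      show "jet_eq I r x (\<lambda>u. pd j f (\<phi> u)) (\<lambda>u. pd j g (\<phi> u))"
        by (rule Suc(1)[OF smooth_fun_pd[OF Suc(2) j] smooth_fun_pd[OF Suc(3) j]]) (use Suc(4) j in \<open>simp add: jet_eq_Suc\<close>)
    qed (simp add: jet_eq_def)
    show "(\<Sum>j\<in>J. pd j f (\<phi> u) * pd i (\<lambda>u. \<phi> u j) u) = pd i (\<lambda>u. f (\<phi> u)) u" if "u \<in> S" for u
      by (rule pd_compose[OF fin J(1) op J(2) \<phi> \<phi>s Suc(2) that i, symmetric])
    show "(\<Sum>j\<in>J. pd j g (\<phi> u) * pd i (\<lambda>u. \<phi> u j) u) = pd i (\<lambda>u. g (\<phi> u)) u" if "u \<in> S" for u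
      by (rule pd_compose[OF fin J(1) op J(2) \<phi> \<phi>s Suc(3) that i, symmetric])
  qed
  then show ?case using Suc(4) by (simp add: jet_eq_Suc)
qed

end


subsection \<open>Jets of maps between manifolds\<close>

lemma same_jet_iff:
  "same_jet N Z r z s s' \<longleftrightarrow> s z = s' z \<and> (\<forall>c\<in>charts Z. \<forall>d\<in>charts N. z \<in> fst c \<longrightarrow> s z \<in> fst d \<longrightarrow>
    (\<forall>i\<in>midx N. jet_eq (midx Z) r (snd c z) (\<lambda>x. snd d (s (chart_inv c x)) i) (\<lambda>x. snd d (s' (chart_inv c x)) i)))"
  unfolding same_jet_def jet_eq_def by blast

lemma same_jet_sym: "same_jet N Z r z s s' \<Longrightarrow> same_jet N Z r z s' s"
  unfolding same_jet_def by simp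

lemma same_jet_trans: "same_jet N Z r z s s' \<Longrightarrow> same_jet N Z r z s' s'' \<Longrightarrow> same_jet N Z r z s s''"
  unfolding same_jet_def by simp

lemma same_jet_refl: "same_jet N Z r z s s"
  unfolding same_jet_def by simp

lemma same_jet_locally_eq:
  assumes Z: "premanifold Z" and W: "openin (mtop Z) W" "z \<in> W" and eq: "\<And>z'. z' \<in> W \<Longrightarrow> s z' = s' z'"
  shows "same_jet N Z r z s s'"
  unfolding same_jet_iff
proof (intro conjI ballI impI)
  show "s z = s' z" using W eq by blast
  fix c d i assume c: "c \<in> charts Z" "z \<in> fst c"
  show "jet_eq (midx Z) r (snd c z) (\<lambda>x. snd d (s (chart_inv c x)) i) (\<lambda>x. snd d (s' (chart_inv c x)) i)"
  proof (rule jet_eq_cong[OF premanifold_finite[OF Z] openin_mtop_chart[OF Z W(1) c(1)]])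
    show "snd c z \<in> snd c ` (W \<inter> fst c)" using c W by blast
    show "jet_eq (midx Z) r (snd c z) (\<lambda>x. snd d (s (chart_inv c x)) i) (\<lambda>x. snd d (s (chart_inv c x)) i)"
      by (simp add: jet_eq_def)
    show "snd d (s (chart_inv c u)) i = snd d (s' (chart_inv c u)) i" if "u \<in> snd c ` (W \<inter> fst c)" for u
    proof -
      from that obtain x where "x \<in> W" "x \<in> fst c" "u = snd c x" by blast
      then show ?thesis using chart_inv_chart[OF c(1)] eq by simp
    qed
  qed simp
qed

text \<open>\<open>same_jet\<close> quantifies over all charts, but agreement in one pair is enough:
  \<open>jet_eq_outer\<close> changes the chart of the target and \<open>jet_eq_inner\<close> that
  of the source.\<close>

lemma same_jet_chartI:
  assumes Z: "premanifold Z" and N: "premanifold N"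
    and s: "smooth_map_on Z N W s" "z \<in> W" and s': "smooth_map_on Z N W' s'" "z \<in> W'" and eq: "s z = s' z"
    and c0: "c0 \<in> charts Z" "z \<in> fst c0" and d0: "d0 \<in> charts N" "s z \<in> fst d0"
    and je: "\<And>i. i \<in> midx N \<Longrightarrow>
      jet_eq (midx Z) r (snd c0 z) (\<lambda>x. snd d0 (s (chart_inv c0 x)) i) (\<lambda>x. snd d0 (s' (chart_inv c0 x)) i)"
  shows "same_jet N Z r z s s'"
  unfolding same_jet_iff
proof (intro conjI ballI impI eq)
  let ?I = "midx Z" and ?J = "midx N"
  fix c d i assume c: "c \<in> charts Z" and d: "d \<in> charts N" and zc: "z \<in> fst c" and zd: "s z \<in> fst d" and i: "i \<in> ?J"
  note finI = premanifold_finite[OF Z] and finJ = premanifold_finite[OF N]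
  \<comment> \<open>Points near \<open>z\<close> at which all four charts can be used for both
    maps.\<close>
  define U where "U = {x \<in> W. s x \<in> fst d0 \<inter> fst d} \<inter> {x \<in> W'. s' x \<in> fst d0 \<inter> fst d} \<inter> (fst c0 \<inter> fst c)"
  have dd: "openin (mtop N) (fst d0 \<inter> fst d)" by (intro openin_Int openin_chart N d0(1) d)
  have U: "openin (mtop Z) U"
    unfolding U_def by (intro openin_Int smooth_map_on_preimage[OF Z N] s(1) s'(1) dd openin_chart Z c c0(1))
  have zU: "z \<in> U" using s s' eq c0 d0 zc zd by (simp add: U_def)
  define S0 where "S0 = snd c0 ` U"
  define S1 where "S1 = snd c ` U"
  define T where "T = snd d0 ` (fst d0 \<inter> fst d)"
  have S0: "open_coord ?I S0" and S1: "open_coord ?I S1"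
  proof -
    have "U \<inter> fst c0 = U" "U \<inter> fst c = U" by (auto simp: U_def)
    then show "open_coord ?I S0" "open_coord ?I S1"
      using openin_mtop_chart[OF Z U c0(1)] openin_mtop_chart[OF Z U c] by (simp_all add: S0_def S1_def)
  qed
  have tr: "smooth_in_charts ?J ?J d0 d (fst d0 \<inter> fst d) id" by (rule charts_transition[OF N d0(1) d])
  have T: "open_coord ?J T" using tr by (simp add: smooth_in_charts_def T_def)
  have inv0: "chart_inv c0 (snd c0 x) = x" if "x \<in> U" for x using that by (intro chart_inv_chart[OF c0(1)]) (simp add: U_def)
  have inv: "chart_inv c (snd c x) = x" if "x \<in> U" for x using that by (intro chart_inv_chart[OF c]) (simp add: U_def)
  define F where "F = (\<lambda>v. snd d (chart_inv d0 v) i)"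
  have F: "smooth_fun ?J T F" using tr i by (simp add: smooth_in_charts_def T_def F_def)
  have rep: "smooth_fun ?I S0 (\<lambda>x. snd d0 (q (chart_inv c0 x)) j)" if "smooth_map_on Z N V q" "U \<subseteq> {x \<in> fst c0 \<inter> V. q x \<in> fst d0}" "j \<in> ?J" for q V j
  proof -
    have "smooth_fun ?I (snd c0 ` {x \<in> fst c0 \<inter> V. q x \<in> fst d0}) (\<lambda>x. snd d0 (q (chart_inv c0 x)) j)"
      using smooth_map_on_in_charts[OF Z N that(1) c0(1) d0(1)] that(3) by (simp add: smooth_in_charts_def)
    then show ?thesis unfolding S0_def using that(2) by (rule smooth_fun_subset[OF _ image_mono])
  qed
  have rs: "smooth_fun ?I S0 (\<lambda>x. snd d0 (s (chart_inv c0 x)) j)" if "j \<in> ?J" for j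
    by (rule rep[OF s(1) _ that]) (auto simp: U_def)
  have rs': "smooth_fun ?I S0 (\<lambda>x. snd d0 (s' (chart_inv c0 x)) j)" if "j \<in> ?J" for j
    by (rule rep[OF s'(1) _ that]) (auto simp: U_def)
  have imT: "(\<lambda>x. snd d0 (q (chart_inv c0 x))) ` S0 \<subseteq> T" if "\<And>x. x \<in> U \<Longrightarrow> q x \<in> fst d0 \<inter> fst d" for q
    using that inv0 by (auto simp: S0_def T_def)
  have im1: "(\<lambda>x. snd d0 (s (chart_inv c0 x))) ` S0 \<subseteq> T" and im2: "(\<lambda>x. snd d0 (s' (chart_inv c0 x))) ` S0 \<subseteq> T"
    by (rule imT, simp add: U_def)+
  have z0: "snd c0 z \<in> S0" "snd c z \<in> S1" using zU by (auto simp: S0_def S1_def)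
  have je1: "jet_eq ?I r (snd c0 z) (\<lambda>x. F (snd d0 (s (chart_inv c0 x)))) (\<lambda>x. F (snd d0 (s' (chart_inv c0 x))))"
    by (rule jet_eq_outer[where f = "\<lambda>x. snd d0 (s (chart_inv c0 x))" and g = "\<lambda>x. snd d0 (s' (chart_inv c0 x))",
          OF finI S0 z0(1) finJ T im1 im2 rs rs' F je])
  define \<phi> where "\<phi> u = snd c0 (chart_inv c u)" for u
  have \<phi>s: "smooth_fun ?I S1 (\<lambda>u. \<phi> u j)" if "j \<in> ?I" for j
  proof -
    have "smooth_fun ?I (snd c ` (fst c \<inter> fst c0)) (\<lambda>u. snd c0 (id (chart_inv c u)) j)"
      using charts_transition[OF Z c c0(1)] that by (simp add: smooth_in_charts_def)
    moreover have "S1 \<subseteq> snd c ` (fst c \<inter> fst c0)" unfolding S1_def U_def by (rule image_mono) auto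
    ultimately show ?thesis unfolding \<phi>_def id_apply by (rule smooth_fun_subset)
  qed
  have \<phi>im: "\<phi> ` S1 \<subseteq> S0" using inv by (auto simp: \<phi>_def S1_def S0_def)
  have \<phi>z: "\<phi> (snd c z) = snd c0 z" using inv[OF zU] by (simp add: \<phi>_def)
  have F1: "smooth_fun ?I S0 (\<lambda>x. F (snd d0 (s (chart_inv c0 x))))"
    by (rule smooth_fun_compose[OF finI finJ S0 T im1 rs F])
  have F2: "smooth_fun ?I S0 (\<lambda>x. F (snd d0 (s' (chart_inv c0 x))))"
    by (rule smooth_fun_compose[OF finI finJ S0 T im2 rs' F])
  have je2: "jet_eq ?I r (snd c z) (\<lambda>u. F (snd d0 (s (chart_inv c0 (\<phi> u))))) (\<lambda>u. F (snd d0 (s' (chart_inv c0 (\<phi> u)))))"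
    by (rule jet_eq_inner[where \<phi> = \<phi>, OF finI S1 z0(2) finI S0 \<phi>im \<phi>s F1 F2]) (simp_all only: \<phi>z je1)
  have val: "F (snd d0 (q (chart_inv c0 (\<phi> u)))) = snd d (q (chart_inv c u)) i"
    if "u \<in> S1" "\<And>x. x \<in> U \<Longrightarrow> q x \<in> fst d0 \<inter> fst d" for u q
  proof -
    from that(1) obtain x where x: "x \<in> U" "u = snd c x" by (auto simp: S1_def)
    have "q x \<in> fst d0" using that(2)[OF x(1)] by simp
    then show ?thesis using x inv[OF x(1)] inv0[OF x(1)] chart_inv_chart[OF d0(1)] by (simp add: \<phi>_def F_def)
  qed
  show "jet_eq ?I r (snd c z) (\<lambda>x. snd d (s (chart_inv c x)) i) (\<lambda>x. snd d (s' (chart_inv c x)) i)"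
  proof (rule jet_eq_cong[OF finI S1 z0(2) je2])
    fix u assume u: "u \<in> S1"
    show "F (snd d0 (s (chart_inv c0 (\<phi> u)))) = snd d (s (chart_inv c u)) i" using val[OF u, of s] by (simp add: U_def)
    show "F (snd d0 (s' (chart_inv c0 (\<phi> u)))) = snd d (s' (chart_inv c u)) i" using val[OF u, of s'] by (simp add: U_def)
  qed
qed

lemma jet_eqI:
  assumes "same_jet N Z r z s s'"
  shows "jet N Z p r s z = jet N Z p r s' z"
proof -
  have "same_jet N Z r z s s'' \<longleftrightarrow> same_jet N Z r z s' s''" for s''
    using same_jet_trans[OF assms, of s''] same_jet_trans[OF same_jet_sym[OF assms], of s''] by blast
  then show ?thesis by (simp add: jet_def)
qed

text \<open>The class of \<open>s'\<close> contains \<open>s'\<close> itself because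
  \<open>s'\<close> is a local section; without such a member equality of classes would carry no
  information.\<close>

lemma jet_eqD:
  assumes "jet N Z p r s z = jet N Z p r s' z'" "local_section N Z p z' s'"
  shows "z = z'" "same_jet N Z r z s s'"
proof -
  show "z = z'" using assms(1) by (simp add: jet_def)
  have "s' \<in> snd (jet N Z p r s' z')" using assms(2) same_jet_refl by (simp add: jet_def)
  then show "same_jet N Z r z s s'" unfolding assms(1)[symmetric] by (simp add: jet_def)
qed

lemma fst_jet [simp]: "fst (jet N Z p r s z) = z"
  by (simp add: jet_def)

lemma jet_rep_jet:
  assumes "local_section N Z p z s"
  shows "local_section N Z p z (jet_rep (jet N Z p r s z))" "same_jet N Z r z s (jet_rep (jet N Z p r s z))"
proof -
  have "s \<in> snd (jet N Z p r s z)" using assms same_jet_refl by (simp add: jet_def)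
  from someI[of "\<lambda>s'. s' \<in> snd (jet N Z p r s z)", OF this]
  have "jet_rep (jet N Z p r s z) \<in> snd (jet N Z p r s z)" .
  then show "local_section N Z p z (jet_rep (jet N Z p r s z))" "same_jet N Z r z s (jet_rep (jet N Z p r s z))"
    by (simp_all add: jet_def)
qed


subsection \<open>Taylor monomials\<close>

text \<open>The monomial for the multi-index \<open>\<alpha>\<close> centred at \<open>x\<close>.
  Division by the factorials lets differentiation lower \<open>\<alpha>\<close> without producing
  factors.\<close>

definition taylor_mono :: "'i set \<Rightarrow> 'i multiset \<Rightarrow> ('i \<Rightarrow> real) \<Rightarrow> ('i \<Rightarrow> real) \<Rightarrow> real" where
  "taylor_mono I \<alpha> x u = (\<Prod>i\<in>I. (u i - x i) ^ count \<alpha> i / fact (count \<alpha> i))"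

lemma has_pd_taylor_mono:
  assumes "finite I" "i \<in> I"
  shows "has_pd i (taylor_mono I \<alpha> x) (if i \<in># \<alpha> then taylor_mono I (\<alpha> - {#i#}) x u else 0) u"
proof -
  define R where "R = (\<Prod>k\<in>I - {i}. (u k - x k) ^ count \<alpha> k / fact (count \<alpha> k))"
  have R: "taylor_mono I \<alpha> x (u(i := t)) = (t - x i) ^ count \<alpha> i / fact (count \<alpha> i) * R" for t
  proof -
    have "(\<Prod>k\<in>I - {i}. ((u(i := t)) k - x k) ^ count \<alpha> k / fact (count \<alpha> k)) = R"
      unfolding R_def by (rule prod.cong) auto
    then show ?thesis unfolding taylor_mono_def prod.remove[OF assms] by simp
  qed
  have d: "((\<lambda>t. (t - x i) ^ n / fact n) has_real_derivative (if n = 0 then 0 else (u i - x i) ^ (n - 1) / fact (n - 1))) (at (u i))" for n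
  proof (cases n)
    case (Suc m)
    have "((\<lambda>t. (t - x i) ^ Suc m) has_real_derivative (real (Suc m) * (u i - x i) ^ m)) (at (u i))"
      by (rule DERIV_cong[OF DERIV_power[OF DERIV_diff[OF DERIV_ident DERIV_const]]]) simp
    from DERIV_cdivide[OF this, of "fact (Suc m)"]
    have "((\<lambda>t. (t - x i) ^ Suc m / fact (Suc m)) has_real_derivative (real (Suc m) * (u i - x i) ^ m / fact (Suc m))) (at (u i))" .
    moreover have "real (Suc m) * (u i - x i) ^ m / fact (Suc m) = (u i - x i) ^ m / fact m"
      unfolding fact_Suc by (simp del: of_nat_Suc)
    ultimately show ?thesis using Suc by simp
  qed simp
  have "((\<lambda>t. (t - x i) ^ count \<alpha> i / fact (count \<alpha> i) * R) has_real_derivative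
    ((if count \<alpha> i = 0 then 0 else (u i - x i) ^ (count \<alpha> i - 1) / fact (count \<alpha> i - 1)) * R)) (at (u i))"
    by (rule DERIV_cmult_right[OF d])
  moreover have "(if count \<alpha> i = 0 then 0 else (u i - x i) ^ (count \<alpha> i - 1) / fact (count \<alpha> i - 1)) * R
      = (if i \<in># \<alpha> then taylor_mono I (\<alpha> - {#i#}) x u else 0)"
  proof (cases "i \<in># \<alpha>")
    case True
    have P: "(\<Prod>k\<in>I - {i}. (u k - x k) ^ count (\<alpha> - {#i#}) k / fact (count (\<alpha> - {#i#}) k)) = R"
      unfolding R_def by (rule prod.cong) auto
    obtain n where n: "count \<alpha> i = Suc n" using True by (metis count_eq_zero_iff not0_implies_Suc)
    show ?thesis unfolding taylor_mono_def prod.remove[OF assms] P using True by (simp add: n)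
  next
    case False
    then have "count \<alpha> i = 0" by (metis count_eq_zero_iff)
    with False show ?thesis by simp
  qed
  ultimately show ?thesis unfolding has_pd_def R by simp
qed

text \<open>An identity of functions, not only of values at the centre, since the induction
  differentiates it once more.\<close>

lemma pds_taylor_sum:
  assumes "finite I" "is \<in> lists I"
  shows "pds is (\<lambda>u. \<Sum>\<alpha>\<in>A. k \<alpha> * taylor_mono I \<alpha> x u) =
    (\<lambda>u. \<Sum>\<alpha>\<in>A. k \<alpha> * (if mset is \<subseteq># \<alpha> then taylor_mono I (\<alpha> - mset is) x u else 0))"
  using assms(2)
proof (induction "is")
  case (Cons i "is")
  have i: "i \<in> I" and "is": "is \<in> lists I" using Cons by auto
  have "has_pd i (\<lambda>u. k \<alpha> * (if mset is \<subseteq># \<alpha> then taylor_mono I (\<alpha> - mset is) x u else 0))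
    (k \<alpha> * (if mset (i # is) \<subseteq># \<alpha> then taylor_mono I (\<alpha> - mset (i # is)) x u else 0)) u" for \<alpha> u
  proof (cases "mset is \<subseteq># \<alpha>")
    case True
    then have "mset (i # is) \<subseteq># \<alpha> \<longleftrightarrow> i \<in># \<alpha> - mset is"
      by (auto simp: subseteq_mset_def in_diff_count Suc_le_eq)
    moreover have "\<alpha> - mset (i # is) = \<alpha> - mset is - {#i#}" by simp
    moreover have "has_pd i (\<lambda>u. k \<alpha> * taylor_mono I (\<alpha> - mset is) x u)
      (k \<alpha> * (if i \<in># \<alpha> - mset is then taylor_mono I (\<alpha> - mset is - {#i#}) x u else 0)) u"
    proof -
      have t: "has_pd i (taylor_mono I (\<alpha> - mset is) x)
        (if i \<in># \<alpha> - mset is then taylor_mono I (\<alpha> - mset is - {#i#}) x u else 0) u"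
        by (rule has_pd_taylor_mono[OF assms(1) i])
      from DERIV_cmult[OF t[unfolded has_pd_def], of "k \<alpha>"] show ?thesis unfolding has_pd_def .
    qed
    ultimately show ?thesis using True by (simp only: if_True)
  next
    case False
    then have "\<not> mset (i # is) \<subseteq># \<alpha>" by (metis mset_subset_eq_insertD mset.simps(2) subset_mset.less_imp_le)
    then show ?thesis using False by (simp add: has_pd_const)
  qed
  then have "pd i (\<lambda>u. \<Sum>\<alpha>\<in>A. k \<alpha> * (if mset is \<subseteq># \<alpha> then taylor_mono I (\<alpha> - mset is) x u else 0)) u =
     (\<Sum>\<alpha>\<in>A. k \<alpha> * (if mset (i # is) \<subseteq># \<alpha> then taylor_mono I (\<alpha> - mset (i # is)) x u else 0))" for u
    by (intro pd_eqI has_pd_sum)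
  then show ?case using Cons(3) by auto
qed simp

lemma taylor_mono_base:
  assumes "finite I" "set_mset \<alpha> \<subseteq> I"
  shows "taylor_mono I \<alpha> x x = (if \<alpha> = {#} then 1 else 0)"
proof (cases "\<alpha> = {#}")
  case False
  then obtain i where "i \<in># \<alpha>" by blast
  then have "i \<in> I" "(x i - x i) ^ count \<alpha> i / fact (count \<alpha> i) = 0" using assms(2) by auto
  then show ?thesis using False assms(1) unfolding taylor_mono_def by (simp add: prod_zero_iff) blast
qed (simp add: taylor_mono_def)

text \<open>At the centre every monomial of positive degree vanishes, so only the summand with
  \<open>\<alpha> = mset is\<close> survives: the coefficients are the derivatives.\<close>

lemma pds_taylor_sum_base:
  assumes "finite I" "is \<in> lists I" "finite A" "mset is \<in> A" "\<And>\<alpha>. \<alpha> \<in> A \<Longrightarrow> set_mset \<alpha> \<subseteq> I"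
  shows "pds is (\<lambda>u. \<Sum>\<alpha>\<in>A. k \<alpha> * taylor_mono I \<alpha> x u) x = k (mset is)"
proof -
  have "k \<alpha> * (if mset is \<subseteq># \<alpha> then taylor_mono I (\<alpha> - mset is) x x else 0) = (if \<alpha> = mset is then k \<alpha> else 0)"
    if "\<alpha> \<in> A" for \<alpha>
  proof (cases "mset is \<subseteq># \<alpha>")
    case True
    have "set_mset (\<alpha> - mset is) \<subseteq> I" using assms(5)[OF that] in_diffD by fastforce
    moreover have "\<alpha> - mset is = {#} \<longleftrightarrow> \<alpha> = mset is"
      using True by (metis Diff_eq_empty_iff_mset subset_mset.antisym cancel_comm_monoid_add_class.diff_cancel)
    ultimately show ?thesis using True by (simp add: taylor_mono_base[OF assms(1)])
  qed auto
  then have "pds is (\<lambda>u. \<Sum>\<alpha>\<in>A. k \<alpha> * taylor_mono I \<alpha> x u) x = (\<Sum>\<alpha>\<in>A. if \<alpha> = mset is then k \<alpha> else 0)"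
    unfolding pds_taylor_sum[OF assms(1,2)] by (rule sum.cong[OF refl])
  then show ?thesis using assms(3,4) by (simp add: sum.delta)
qed

lemma finite_bounded_multisets: "finite I \<Longrightarrow> finite {\<alpha>. set_mset \<alpha> \<subseteq> I \<and> size \<alpha> \<le> r}"
proof -
  assume "finite I"
  then have "finite (mset ` {xs. set xs \<subseteq> I \<and> length xs \<le> r})" by (intro finite_imageI finite_lists_length_le)
  moreover have "{\<alpha>. set_mset \<alpha> \<subseteq> I \<and> size \<alpha> \<le> r} \<subseteq> mset ` {xs. set xs \<subseteq> I \<and> length xs \<le> r}"
  proof
    fix \<alpha> assume *: "\<alpha> \<in> {\<alpha>. set_mset \<alpha> \<subseteq> I \<and> size \<alpha> \<le> r}"
    obtain xs where "mset xs = \<alpha>" using ex_mset by blast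
    with * show "\<alpha> \<in> mset ` {xs. set xs \<subseteq> I \<and> length xs \<le> r}" by auto
  qed
  ultimately show ?thesis by (rule finite_subset[rotated])
qed

text \<open>Differentiation in the second group of variables with the first frozen. The first group
  is played by jet coordinates in the transition of jet charts and by time in families of
  sections.\<close>

lemma pds_Inr: "pds (map Inr is) F (case_sum a u) = pds is (\<lambda>u. F (case_sum a u)) u"
proof (induction "is" arbitrary: u)
  case (Cons i "is")
  have "(case_sum a u)(Inr i := t) = case_sum a (u(i := t))" for t
    by (auto simp: fun_eq_iff split: sum.split)
  then have "pds (map Inr (i # is)) F (case_sum a u) = deriv (\<lambda>t. pds (map Inr is) F (case_sum a (u(i := t)))) (u i)"
    by (simp only: list.map pds.simps pd_def sum.case)
  then show ?case unfolding Cons by (simp only: pds.simps pd_def)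
qed simp

subsection \<open>The jet manifold\<close>

locale fibred =
  fixes Y :: "('y, nat) mfd" and Z :: "('z, nat) mfd" and \<pi> :: "'y \<Rightarrow> 'z"
  assumes fib: "fibred_manifold Y Z \<pi>"
begin

lemma Y: "premanifold Y" and Z: "premanifold Z"
  and \<pi>: "smooth_map_on Y Z (mcarrier Y) \<pi>" and \<pi>_onto: "\<pi> ` mcarrier Y = mcarrier Z"
proof -
  obtain m n where "smooth_manifold Y m" "smooth_manifold Z n" using fib by (auto simp: fibred_manifold_def)
  then show "premanifold Y" "premanifold Z" by (simp_all add: smooth_manifold_premanifold(1))
  show "smooth_map_on Y Z (mcarrier Y) \<pi>" "\<pi> ` mcarrier Y = mcarrier Z"
    using fib by (simp_all add: fibred_manifold_def)
qed

lemma finZ: "finite (midx Z)" and finY: "finite (midx Y)"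
  using premanifold_finite Y Z by blast+

lemma fibred_chartD:
  assumes "(c, d) \<in> fibred_charts Y Z \<pi>"
  shows "c \<in> charts Z" "d \<in> charts Y" "\<And>y. y \<in> fst d \<Longrightarrow> \<pi> y \<in> fst c"
    "\<And>y i. y \<in> fst d \<Longrightarrow> i \<in> midx Z \<Longrightarrow> snd d y i = snd c (\<pi> y) i"
  using assms unfolding fibred_charts_def by blast+

lemma fibred_chart_at:
  assumes "y \<in> mcarrier Y"
  obtains c d where "(c, d) \<in> fibred_charts Y Z \<pi>" "y \<in> fst d" "\<pi> y \<in> fst c"
proof -
  have "\<pi> y \<in> mcarrier Z" using assms \<pi>_onto by blast
  then obtain c where c: "c \<in> charts Z" "\<pi> y \<in> fst c" using premanifold_cover[OF Z] by blast
  then show thesis using fibred_chart_exists(2)[OF fib assms c] that by blast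
qed

lemma base_subset: "y \<in> mcarrier Y \<Longrightarrow> midx Z \<subseteq> midx Y"
proof -
  assume y: "y \<in> mcarrier Y"
  then have "\<pi> y \<in> mcarrier Z" using \<pi>_onto by blast
  then obtain c where "c \<in> charts Z" "\<pi> y \<in> fst c" using premanifold_cover[OF Z] by blast
  then show ?thesis using fibred_chart_exists(1)[OF fib y] by blast
qed

text \<open>In a fibred chart the projection keeps just the base coordinates, and these determine
  the point because \<open>c\<close> is injective.\<close>

lemma fibred_chart_proj:
  assumes cd: "(c, d) \<in> fibred_charts Y Z \<pi>" and z: "z \<in> fst c" and v: "v \<in> snd d ` fst d"
    and eq: "\<And>i. i \<in> midx Z \<Longrightarrow> v i = snd c z i"
  shows "\<pi> (chart_inv d v) = z"
proof -
  note D = fibred_chartD[OF cd]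
  let ?y = "chart_inv d v"
  have y: "?y \<in> fst d" "snd d ?y = v" using chart_inv_in[OF v] chart_chart_inv[OF v] by simp_all
  have "snd c (\<pi> ?y) = snd c z"
  proof
    fix i show "snd c (\<pi> ?y) i = snd c z i"
    proof (cases "i \<in> midx Z")
      case True
      then show ?thesis using D(4)[OF y(1) True] y(2) eq by simp
    next
      case False
      then show ?thesis using chart_coord[OF D(1) D(3)[OF y(1)]] chart_coord[OF D(1) z] by (simp add: coord_space_def)
    qed
  qed
  then show ?thesis using inj_onD[OF chart_inj[OF D(1)] _ D(3)[OF y(1)] z] by simp
qed

lemma local_sectionE:
  assumes "local_section Y Z \<pi> z s"
  obtains W where "openin (mtop Z) W" "z \<in> W" "smooth_map_on Z Y W s" "\<And>z'. z' \<in> W \<Longrightarrow> \<pi> (s z') = z'"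
    "s z \<in> mcarrier Y" "z \<in> mcarrier Z" "\<pi> (s z) = z"
proof -
  obtain W where W: "openin (mtop Z) W" "z \<in> W" "smooth_map_on Z Y W s" "\<forall>z'\<in>W. \<pi> (s z') = z'"
    using assms unfolding local_section_def by blast
  then obtain d where "d \<in> charts Y" "s z \<in> fst d" unfolding smooth_map_on_def by blast
  then have "s z \<in> mcarrier Y" using chart_subset by blast
  moreover have "z \<in> mcarrier Z" using W(1,2) unfolding openin_mtop_atlas[OF Z] by blast
  ultimately show thesis using that W by blast
qed

section \<open>Jet coordinates of a section\<close>

definition multi_idx :: "nat \<Rightarrow> nat multiset set" where
  "multi_idx r = {\<alpha>. set_mset \<alpha> \<subseteq> midx Z \<and> size \<alpha> \<le> r}"

lemma finite_multi_idx: "finite (multi_idx r)"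
  unfolding multi_idx_def by (rule finite_bounded_multisets[OF finZ])

lemma jet_idx_eq: "jet_idx Y Z r = midx Z <+> (midx Y - midx Z) \<times> multi_idx r"
  by (simp add: jet_idx_def multi_idx_def)

lemma finite_jet_idx: "finite (jet_idx Y Z r)"
  unfolding jet_idx_eq using finY finZ finite_multi_idx by simp

lemma multi_idx_list: "\<alpha> \<in> multi_idx r \<Longrightarrow> sorted_list_of_multiset \<alpha> \<in> lists (midx Z) \<and> length (sorted_list_of_multiset \<alpha>) \<le> r"
  by (auto simp: multi_idx_def) (metis mset_sorted_list_of_multiset size_mset)

lemma list_multi_idx: "is \<in> lists (midx Z) \<Longrightarrow> length is \<le> r \<Longrightarrow> mset is \<in> multi_idx r"
  by (auto simp: multi_idx_def)

text \<open>The formula of \<open>jet_chart\<close> for an arbitrary section in place of the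
  representative picked by \<open>SOME\<close>; \<open>jet_chart_jet\<close> shows that the two
  agree.\<close>

definition jet_coord ::
  "nat \<Rightarrow> ('z, nat) chart \<Rightarrow> ('y, nat) chart \<Rightarrow> ('z \<Rightarrow> 'y) \<Rightarrow> 'z \<Rightarrow> nat + nat \<times> nat multiset \<Rightarrow> real" where
  "jet_coord r c d s z k = (if k \<in> jet_idx Y Z r then
     (case k of Inl i \<Rightarrow> snd c z i
      | Inr (a, \<alpha>) \<Rightarrow> pds (sorted_list_of_multiset \<alpha>) (\<lambda>x. snd d (s (chart_inv c x)) a) (snd c z)) else 0)"

lemma jet_coord_same_jet:
  assumes sj: "same_jet Y Z r z s s'" and c: "c \<in> charts Z" "z \<in> fst c" and d: "d \<in> charts Y" "s z \<in> fst d"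
  shows "jet_coord r c d s z = jet_coord r c d s' z"
proof
  fix k
  show "jet_coord r c d s z k = jet_coord r c d s' z k"
  proof (cases "k \<in> jet_idx Y Z r")
    case True
    then show ?thesis
    proof (cases k)
      case (Inr p)
      obtain a \<alpha> where p: "p = (a, \<alpha>)" by force
      have a: "a \<in> midx Y" "\<alpha> \<in> multi_idx r" using True Inr p by (auto simp: jet_idx_eq)
      have "jet_eq (midx Z) r (snd c z) (\<lambda>x. snd d (s (chart_inv c x)) a) (\<lambda>x. snd d (s' (chart_inv c x)) a)"
        using sj c d a(1) unfolding same_jet_iff by blast
      then show ?thesis using multi_idx_list[OF a(2)] by (simp add: jet_coord_def Inr p jet_eq_def)
    qed (simp add: jet_coord_def)
  qed (simp add: jet_coord_def)
qed

lemma jet_in_jet_carrier: "local_section Y Z \<pi> z s \<Longrightarrow> jet Y Z \<pi> r s z \<in> jet_carrier Y Z \<pi> r"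
  unfolding jet_carrier_def by (auto elim: local_sectionE)

lemma jet_carrierE:
  assumes "w \<in> jet_carrier Y Z \<pi> r"
  obtains s where "local_section Y Z \<pi> (fst w) s" "w = jet Y Z \<pi> r s (fst w)"
  using assms unfolding jet_carrier_def by auto

lemma jet_rep_value: "local_section Y Z \<pi> z s \<Longrightarrow> jet_rep (jet Y Z \<pi> r s z) z = s z"
  using jet_rep_jet(2)[of Y Z \<pi> z s r] unfolding same_jet_def by simp

lemma jet_in_jet_chart:
  "local_section Y Z \<pi> z s \<Longrightarrow> jet Y Z \<pi> r s z \<in> fst (jet_chart Y Z \<pi> r c d) \<longleftrightarrow> z \<in> fst c \<and> s z \<in> fst d"
  by (simp add: jet_chart_def jet_in_jet_carrier jet_rep_value)

lemma jet_chart_jet: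
  assumes s: "local_section Y Z \<pi> z s" and c: "c \<in> charts Z" "z \<in> fst c" and d: "d \<in> charts Y" "s z \<in> fst d"
  shows "snd (jet_chart Y Z \<pi> r c d) (jet Y Z \<pi> r s z) = jet_coord r c d s z"
proof -
  have "snd (jet_chart Y Z \<pi> r c d) (jet Y Z \<pi> r s z) = jet_coord r c d (jet_rep (jet Y Z \<pi> r s z)) z"
    by (auto simp: jet_chart_def jet_coord_def fun_eq_iff split: sum.split)
  also have "\<dots> = jet_coord r c d s z"
    by (rule jet_coord_same_jet[OF jet_rep_jet(2)[OF s] c d, symmetric])
  finally show ?thesis .
qed

lemma section_coord_smooth:
  assumes s: "smooth_map_on Z Y W s" and c: "c \<in> charts Z" and d: "d \<in> charts Y" and i: "i \<in> midx Y"
  shows "open_coord (midx Z) (snd c ` {x \<in> fst c \<inter> W. s x \<in> fst d})"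
    "smooth_fun (midx Z) (snd c ` {x \<in> fst c \<inter> W. s x \<in> fst d}) (\<lambda>x. snd d (s (chart_inv c x)) i)"
  using smooth_map_on_in_charts[OF Z Y s c d] i by (auto simp: smooth_in_charts_def)

text \<open>In fibred coordinates the base components of a section are the base coordinates themselves, so the
  fibre components determine the jet.\<close>

lemma jet_eq_of_jet_coord:
  assumes s: "local_section Y Z \<pi> z s" and s': "local_section Y Z \<pi> z s'"
    and cd: "(c, d) \<in> fibred_charts Y Z \<pi>" and z: "z \<in> fst c" "s z \<in> fst d" "s' z \<in> fst d"
    and eq: "jet_coord r c d s z = jet_coord r c d s' z" and i: "i \<in> midx Y"
  shows "jet_eq (midx Z) r (snd c z) (\<lambda>x. snd d (s (chart_inv c x)) i) (\<lambda>x. snd d (s' (chart_inv c x)) i)"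
proof -
  note D = fibred_chartD[OF cd]
  obtain W where W: "smooth_map_on Z Y W s" "z \<in> W" "\<And>z'. z' \<in> W \<Longrightarrow> \<pi> (s z') = z'"
    using local_sectionE[OF s] by metis
  obtain W' where W': "smooth_map_on Z Y W' s'" "z \<in> W'" "\<And>z'. z' \<in> W' \<Longrightarrow> \<pi> (s' z') = z'"
    using local_sectionE[OF s'] by metis
  define S where "S = snd c ` {x \<in> fst c \<inter> W. s x \<in> fst d} \<inter> snd c ` {x \<in> fst c \<inter> W'. s' x \<in> fst d}"
  have S: "open_coord (midx Z) S" "snd c z \<in> S"
    unfolding S_def using section_coord_smooth(1)[OF W(1) D(1,2) i] section_coord_smooth(1)[OF W'(1) D(1,2) i] z W W'
    by (auto intro!: open_coord_Int)
  have sm: "smooth_fun (midx Z) S (\<lambda>x. snd d (s (chart_inv c x)) i)" "smooth_fun (midx Z) S (\<lambda>x. snd d (s' (chart_inv c x)) i)"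
    by (rule smooth_fun_subset[OF section_coord_smooth(2)[OF W(1) D(1,2) i]], simp add: S_def)
      (rule smooth_fun_subset[OF section_coord_smooth(2)[OF W'(1) D(1,2) i]], simp add: S_def)
  show ?thesis
  proof (cases "i \<in> midx Z")
    case True
    have "snd d (q (chart_inv c u)) i = u i"
      if u: "u \<in> snd c ` {x \<in> fst c \<inter> V. q x \<in> fst d}" and q: "\<And>z'. z' \<in> V \<Longrightarrow> \<pi> (q z') = z'" for q V u
    proof -
      from u obtain x where x: "x \<in> fst c" "x \<in> V" "q x \<in> fst d" "u = snd c x" by blast
      then show ?thesis using D(4)[OF x(3) True] q[OF x(2)] chart_inv_chart[OF D(1) x(1)] by simp
    qed
    note val = this
    show ?thesis
    proof (rule jet_eq_cong[OF finZ S, where f = "\<lambda>u. u i" and g = "\<lambda>u. u i"])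
      fix u assume u: "u \<in> S"
      show "u i = snd d (s (chart_inv c u)) i" using val[where q = s and V = W] u W(3) by (simp add: S_def)
      show "u i = snd d (s' (chart_inv c u)) i" using val[where q = s' and V = W'] u W'(3) by (simp add: S_def)
    qed (simp add: jet_eq_def)
  next
    case False
    show ?thesis unfolding jet_eq_def
    proof (intro ballI impI)
      fix l assume l: "l \<in> lists (midx Z)" "length l \<le> r"
      \<comment> \<open>Jet coordinates record each derivative in sorted order only; by symmetry
        this determines it for every order of differentiation.\<close>
      let ?l = "sorted_list_of_multiset (mset l)"
      have m: "mset l \<in> multi_idx r" using list_multi_idx l by blast
      have k: "Inr (i, mset l) \<in> jet_idx Y Z r" unfolding jet_idx_eq using False i m by (intro InrI SigmaI DiffI)
      have "pds l f (snd c z) = pds ?l f (snd c z)" if "smooth_fun (midx Z) S f" for f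
        by (rule pds_mset_cong[OF finZ S(1) that S(2)]) (use l in auto)
      then show "pds l (\<lambda>x. snd d (s (chart_inv c x)) i) (snd c z) = pds l (\<lambda>x. snd d (s' (chart_inv c x)) i) (snd c z)"
        using fun_cong[OF eq, of "Inr (i, mset l)"] k sm by (simp add: jet_coord_def)
    qed
  qed
qed

lemma same_jet_of_jet_coord:
  assumes s: "local_section Y Z \<pi> z s" and s': "local_section Y Z \<pi> z s'"
    and cd: "(c, d) \<in> fibred_charts Y Z \<pi>" and z: "z \<in> fst c" "s z \<in> fst d" "s' z \<in> fst d"
    and eq: "jet_coord r c d s z = jet_coord r c d s' z"
  shows "same_jet Y Z r z s s'"
proof -
  note D = fibred_chartD[OF cd]
  obtain W where W: "smooth_map_on Z Y W s" "z \<in> W" using local_sectionE[OF s] by metis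
  obtain W' where W': "smooth_map_on Z Y W' s'" "z \<in> W'" using local_sectionE[OF s'] by metis
  have je: "jet_eq (midx Z) r (snd c z) (\<lambda>x. snd d (s (chart_inv c x)) i) (\<lambda>x. snd d (s' (chart_inv c x)) i)" if "i \<in> midx Y" for i
    by (rule jet_eq_of_jet_coord[OF s s' cd z eq that])
  have "snd d (s z) = snd d (s' z)"
  proof
    fix i show "snd d (s z) i = snd d (s' z) i"
    proof (cases "i \<in> midx Y")
      case True
      then show ?thesis using jet_eq_value[OF je[OF True]] chart_inv_chart[OF D(1) z(1)] by simp
    next
      case False
      then show ?thesis using chart_coord[OF D(2) z(2)] chart_coord[OF D(2) z(3)] by (simp add: coord_space_def)
    qed
  qed
  then have "s z = s' z" using inj_onD[OF chart_inj[OF D(2)] _ z(2,3)] by simp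
  from same_jet_chartI[OF Z Y W W' this D(1) z(1) D(2) z(2) je] show ?thesis .
qed

text \<open>The section that is polynomial in the fibred chart \<open>(c, d)\<close> and has the jet coordinates \<open>\<xi>\<close>.\<close>

definition taylor :: "nat \<Rightarrow> (nat + nat \<times> nat multiset \<Rightarrow> real) \<Rightarrow> (nat \<Rightarrow> real) \<Rightarrow> nat \<Rightarrow> real" where
  "taylor r \<xi> u = (\<lambda>i. if i \<in> midx Z then u i else if i \<in> midx Y then
     (\<Sum>\<alpha>\<in>multi_idx r. \<xi> (Inr (i, \<alpha>)) * taylor_mono (midx Z) \<alpha> (\<xi> \<circ> Inl) u) else 0)"

definition taylor_section ::
  "nat \<Rightarrow> ('z, nat) chart \<Rightarrow> ('y, nat) chart \<Rightarrow> (nat + nat \<times> nat multiset \<Rightarrow> real) \<Rightarrow> 'z \<Rightarrow> 'y" where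
  "taylor_section r c d \<xi> z = chart_inv d (taylor r \<xi> (snd c z))"

section \<open>Polynomial sections with prescribed jets\<close>

lemma taylor_coord_space:
  assumes "u \<in> coord_space (midx Z)" "midx Z \<subseteq> midx Y"
  shows "taylor r \<xi> u \<in> coord_space (midx Y)"
  using assms by (auto simp: taylor_def coord_space_def)

text \<open>Joint smoothness in the coefficients and centre, indexed by \<open>Inl\<close>, and in
  the point, indexed by \<open>Inr\<close>: the transitions of jet charts differentiate in the point
  while the coefficients vary.\<close>

lemma smooth_taylor:
  assumes S: "open_coord (jet_idx Y Z r <+> midx Z) S"
  shows "smooth_fun (jet_idx Y Z r <+> midx Z) S (\<lambda>w. taylor r (w \<circ> Inl) (w \<circ> Inr) i)"
proof -
  have fin: "finite (jet_idx Y Z r <+> midx Z)" using finite_jet_idx finZ by simp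
  have "smooth_fun (jet_idx Y Z r <+> midx Z) S
    (\<lambda>w. \<Sum>\<alpha>\<in>multi_idx r. w (Inl (Inr (i, \<alpha>))) * (\<Prod>k\<in>midx Z. (w (Inr k) - w (Inl (Inl k))) ^ count \<alpha> k * (1 / fact (count \<alpha> k))))"
    by (intro smooth_fun_intros fin S)
  then show ?thesis
    using smooth_fun_proj[OF fin S, of "Inr i"] smooth_fun_const[OF fin S, of 0]
    by (cases "i \<in> midx Z"; cases "i \<in> midx Y") (simp_all add: taylor_def taylor_mono_def)
qed

lemma taylor_base:
  "taylor r \<xi> (\<xi> \<circ> Inl) i = (if i \<in> midx Z then \<xi> (Inl i) else if i \<in> midx Y then \<xi> (Inr (i, {#})) else 0)"
proof -
  have "pds [] (\<lambda>u. \<Sum>\<alpha>\<in>multi_idx r. \<xi> (Inr (i, \<alpha>)) * taylor_mono (midx Z) \<alpha> (\<xi> \<circ> Inl) u) (\<xi> \<circ> Inl) = \<xi> (Inr (i, mset []))"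
    by (rule pds_taylor_sum_base[OF finZ _ finite_multi_idx]) (auto simp: multi_idx_def)
  then show ?thesis by (simp add: taylor_def)
qed

lemma jet_coord_taylor:
  assumes cd: "(c, d) \<in> fibred_charts Y Z \<pi>" and \<xi>: "\<xi> \<in> coord_space (jet_idx Y Z r)"
    and z: "z \<in> fst c" "snd c z = \<xi> \<circ> Inl" and S: "open_coord (midx Z) S" "snd c z \<in> S" "S \<subseteq> snd c ` fst c"
    and im: "\<And>u. u \<in> S \<Longrightarrow> taylor r \<xi> u \<in> snd d ` fst d"
  shows "jet_coord r c d (taylor_section r c d \<xi>) z = \<xi>"
proof
  fix k
  show "jet_coord r c d (taylor_section r c d \<xi>) z k = \<xi> k"
  proof (cases "k \<in> jet_idx Y Z r")
    case True
    show ?thesis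
    proof (cases k)
      case (Inl i)
      then show ?thesis using True z by (simp add: jet_coord_def)
    next
      case (Inr p)
      obtain a \<alpha> where p: "p = (a, \<alpha>)" by force
      have a: "a \<in> midx Y" "a \<notin> midx Z" "\<alpha> \<in> multi_idx r" using True Inr p by (auto simp: jet_idx_eq)
      let ?l = "sorted_list_of_multiset \<alpha>"
      have "pds ?l (\<lambda>x. snd d (taylor_section r c d \<xi> (chart_inv c x)) a) (snd c z) = pds ?l (\<lambda>u. taylor r \<xi> u a) (snd c z)"
      proof (rule pds_cong[OF S(1) finZ S(2)])
        fix u assume u: "u \<in> S"
        then have "snd c (chart_inv c u) = u" using S(3) by (intro chart_chart_inv) blast
        then show "snd d (taylor_section r c d \<xi> (chart_inv c u)) a = taylor r \<xi> u a"
          using chart_chart_inv[OF im[OF u]] by (simp add: taylor_section_def)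
      qed (use multi_idx_list[OF a(3)] in blast)
      also have "\<dots> = pds ?l (\<lambda>u. \<Sum>\<alpha>\<in>multi_idx r. \<xi> (Inr (a, \<alpha>)) * taylor_mono (midx Z) \<alpha> (\<xi> \<circ> Inl) u) (\<xi> \<circ> Inl)"
        unfolding z(2) using a(1,2) by (simp add: taylor_def)
      also have "\<dots> = \<xi> (Inr (a, mset ?l))"
        by (rule pds_taylor_sum_base[OF finZ _ finite_multi_idx]) (use multi_idx_list[OF a(3)] a(3) in \<open>auto simp: multi_idx_def\<close>)
      finally show ?thesis using True by (simp add: jet_coord_def Inr p)
    qed
  next
    case False
    then show ?thesis using \<xi> by (simp add: jet_coord_def coord_space_def)
  qed
qed

lemma fibred_base_subset: "(c, d) \<in> fibred_charts Y Z \<pi> \<Longrightarrow> y \<in> fst d \<Longrightarrow> midx Z \<subseteq> midx Y"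
  using base_subset fibred_chartD(2) chart_subset by blast

text \<open>Every admissible tuple of jet coordinates comes from a section. Admissibility restricts
  only the centre and the value there; by continuity the polynomial then stays in the fibred chart
  near the centre.\<close>

lemma taylor_section_local:
  assumes cd: "(c, d) \<in> fibred_charts Y Z \<pi>" and \<xi>: "\<xi> \<in> coord_space (jet_idx Y Z r)"
    and z: "z \<in> fst c" "snd c z = \<xi> \<circ> Inl" and v: "taylor r \<xi> (\<xi> \<circ> Inl) \<in> snd d ` fst d"
  shows "local_section Y Z \<pi> z (taylor_section r c d \<xi>)" "snd d (taylor_section r c d \<xi> z) = taylor r \<xi> (\<xi> \<circ> Inl)"
    "taylor_section r c d \<xi> z \<in> fst d" "jet_coord r c d (taylor_section r c d \<xi>) z = \<xi>"
proof -
  note D = fibred_chartD[OF cd]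
  let ?s = "taylor_section r c d \<xi>" and ?J = "jet_idx Y Z r <+> midx Z"
  have finJ: "finite ?J" using finite_jet_idx finZ by simp
  have top: "open_coord ?J (coord_space ?J)" by (simp add: open_coord_def)
  define U where "U = {x \<in> fst c. taylor r \<xi> (snd c x) \<in> snd d ` fst d}"
  have Uim: "snd c ` U = {u \<in> snd c ` fst c. taylor r \<xi> u \<in> snd d ` fst d}" by (auto simp: U_def)
  obtain y where "y \<in> fst d" using v by blast
  then have ZY: "midx Z \<subseteq> midx Y" by (rule fibred_base_subset[OF cd])
  have sm: "smooth_fun (midx Z) (snd c ` fst c) (\<lambda>u. taylor r \<xi> u i)" for i
  proof -
    have "smooth_fun (midx Z) (snd c ` fst c) (\<lambda>u. taylor r (case_sum \<xi> u \<circ> Inl) (case_sum \<xi> u \<circ> Inr) i)"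
    proof (rule smooth_fun_compose[OF finZ finJ chart_open[OF D(1)] top _ _ smooth_taylor[OF top]])
      show "case_sum \<xi> ` (snd c ` fst c) \<subseteq> coord_space ?J"
        using \<xi> chart_coord[OF D(1)] by (auto simp: coord_space_Plus case_sum_o_inj)
      show "smooth_fun (midx Z) (snd c ` fst c) (\<lambda>u. case_sum \<xi> u j)" for j
        using smooth_fun_proj[OF finZ chart_open[OF D(1)]] smooth_fun_const[OF finZ chart_open[OF D(1)]]
        by (cases j) simp_all
    qed
    then show ?thesis by (simp add: case_sum_o_inj)
  qed
  have U: "open_coord (midx Z) (snd c ` U)"
    unfolding Uim
  proof (rule open_coord_preimage[OF chart_open[OF D(1)] _ chart_open[OF D(2)]])
    show im: "taylor r \<xi> ` snd c ` fst c \<subseteq> coord_space (midx Y)"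
      using taylor_coord_space[OF chart_coord[OF D(1)] ZY] by blast
    show "continuous_on (snd c ` fst c) (taylor r \<xi>)"
      by (rule continuous_on_into_coord_space[OF smooth_fun_continuous[OF sm] im])
  qed
  have zU: "z \<in> U" using z v by (simp add: U_def)
  have val: "snd d (?s x) = taylor r \<xi> (snd c x)" "?s x \<in> fst d" if "x \<in> U" for x
    using that chart_chart_inv[of "taylor r \<xi> (snd c x)" d] chart_inv_in[of "taylor r \<xi> (snd c x)" d]
    by (simp_all add: U_def taylor_section_def)
  show "snd d (?s z) = taylor r \<xi> (\<xi> \<circ> Inl)" "?s z \<in> fst d" using val[OF zU] z by simp_all
  have opU: "openin (mtop Z) U" by (rule openin_mtop_in_chart[OF Z D(1) _ U]) (simp add: U_def)
  have "smooth_in_charts (midx Z) (midx Y) c d U ?s"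
    unfolding smooth_in_charts_def
  proof (intro conjI ballI U)
    fix i
    show "smooth_fun (midx Z) (snd c ` U) (\<lambda>u. snd d (?s (chart_inv c u)) i)"
    proof (rule smooth_fun_congI[OF finZ U])
      show "smooth_fun (midx Z) (snd c ` U) (\<lambda>u. taylor r \<xi> u i)"
        by (rule smooth_fun_subset[OF sm]) (simp add: Uim)
      fix u assume "u \<in> snd c ` U"
      then obtain x where x: "x \<in> U" "u = snd c x" by blast
      then have "chart_inv c u = x" using chart_inv_chart[OF D(1)] by (simp add: U_def)
      then show "taylor r \<xi> u i = snd d (?s (chart_inv c u)) i" using val(1)[OF x(1)] x(2) by simp
    qed
  qed (use val(2) in \<open>auto simp: U_def\<close>)
  then have "smooth_map_on Z Y U ?s"
    unfolding smooth_map_on_iff[OF Z] using D(1,2) by blast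
  moreover have "\<pi> (?s x) = x" if x: "x \<in> U" for x
    unfolding taylor_section_def
    by (rule fibred_chart_proj[OF cd]) (use x in \<open>simp_all add: U_def taylor_def\<close>)
  ultimately show "local_section Y Z \<pi> z ?s" unfolding local_section_def using opU zU by blast
  show "jet_coord r c d ?s z = \<xi>"
    by (rule jet_coord_taylor[OF cd \<xi> z U]) (use zU in \<open>auto simp: U_def\<close>)
qed

lemma jet_coord_base:
  assumes s: "local_section Y Z \<pi> z s" and cd: "(c, d) \<in> fibred_charts Y Z \<pi>" and z: "z \<in> fst c" "s z \<in> fst d"
  shows "jet_coord r c d s z \<in> coord_space (jet_idx Y Z r)" "jet_coord r c d s z \<circ> Inl = snd c z"
    "taylor r (jet_coord r c d s z) (jet_coord r c d s z \<circ> Inl) = snd d (s z)"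
proof -
  note D = fibred_chartD[OF cd]
  let ?\<xi> = "jet_coord r c d s z"
  show "?\<xi> \<in> coord_space (jet_idx Y Z r)" by (simp add: jet_coord_def coord_space_def)
  have inl: "?\<xi> (Inl i) = snd c z i" for i
    using chart_coord[OF D(1) z(1)] by (auto simp: jet_coord_def jet_idx_eq coord_space_def)
  then show "?\<xi> \<circ> Inl = snd c z" by auto
  show "taylor r ?\<xi> (?\<xi> \<circ> Inl) = snd d (s z)"
  proof
    fix i
    have "\<pi> (s z) = z" using local_sectionE[OF s] by metis
    then have b: "snd d (s z) i = snd c z i" if "i \<in> midx Z" using D(4)[OF z(2) that] by simp
    have f: "?\<xi> (Inr (i, {#})) = snd d (s z) i" if "i \<in> midx Y" "i \<notin> midx Z"
    proof -
      have "Inr (i, {#}) \<in> jet_idx Y Z r" unfolding jet_idx_eq multi_idx_def using that by (intro InrI SigmaI DiffI) auto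
      then show ?thesis using chart_inv_chart[OF D(1) z(1)] by (simp add: jet_coord_def)
    qed
    have o: "snd d (s z) i = 0" if "i \<notin> midx Y" using chart_coord[OF D(2) z(2)] that by (simp add: coord_space_def)
    show "taylor r ?\<xi> (?\<xi> \<circ> Inl) i = snd d (s z) i"
      unfolding taylor_base using inl b f o by (cases "i \<in> midx Z"; cases "i \<in> midx Y") simp_all
  qed
qed

text \<open>The coordinate image of the jets with source in \<open>S\<close> and target in
  \<open>T\<close>, both read in a fibred chart. The coordinates of positive order are
  unrestricted.\<close>

definition taylor_dom :: "nat \<Rightarrow> (nat \<Rightarrow> real) set \<Rightarrow> (nat \<Rightarrow> real) set \<Rightarrow> (nat + nat \<times> nat multiset \<Rightarrow> real) set" where
  "taylor_dom r S T = {\<xi> \<in> coord_space (jet_idx Y Z r). \<xi> \<circ> Inl \<in> S \<and> taylor r \<xi> (\<xi> \<circ> Inl) \<in> T}"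

lemma open_taylor_dom:
  assumes S: "open_coord (midx Z) S" and T: "open_coord (midx Y) T" and ZY: "midx Z \<subseteq> midx Y"
  shows "open_coord (jet_idx Y Z r) (taylor_dom r S T)"
proof -
  let ?I = "jet_idx Y Z r"
  have top: "open_coord ?I (coord_space ?I)" by (simp add: open_coord_def)
  have c1: "(\<lambda>\<xi>. \<xi> \<circ> Inl) ` coord_space ?I \<subseteq> coord_space (midx Z)"
    by (auto simp: coord_space_def jet_idx_eq)
  have o1: "open_coord ?I {\<xi> \<in> coord_space ?I. \<xi> \<circ> Inl \<in> S}"
    by (rule open_coord_preimage[OF top continuous_on_comp_coord S c1])
  have c2: "(\<lambda>\<xi>. taylor r \<xi> (\<xi> \<circ> Inl)) ` {\<xi> \<in> coord_space ?I. \<xi> \<circ> Inl \<in> S} \<subseteq> coord_space (midx Y)"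
    using taylor_coord_space[OF _ ZY] c1 by blast
  have p: "continuous_on R (\<lambda>\<xi>::nat + nat \<times> nat multiset \<Rightarrow> real. \<xi> k)" for R k
    by (rule continuous_on_subset[OF continuous_on_product_coordinates]) simp
  have "continuous_on {\<xi> \<in> coord_space ?I. \<xi> \<circ> Inl \<in> S} (\<lambda>\<xi>. taylor r \<xi> (\<xi> \<circ> Inl))"
  proof (rule continuous_on_into_coord_space[OF _ c2])
    fix j show "continuous_on {\<xi> \<in> coord_space ?I. \<xi> \<circ> Inl \<in> S} (\<lambda>\<xi>. taylor r \<xi> (\<xi> \<circ> Inl) j)"
      unfolding taylor_base by (cases "j \<in> midx Z"; cases "j \<in> midx Y") (simp_all add: p)
  qed
  from open_coord_preimage[OF o1 this T c2]
  show ?thesis by (simp add: taylor_dom_def conj_assoc)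
qed

section \<open>Images, inverses and transitions of jet charts\<close>

lemma jet_chart_image:
  assumes cd: "(c, d) \<in> fibred_charts Y Z \<pi>" and UV: "U \<subseteq> fst c" "V \<subseteq> fst d"
  shows "snd (jet_chart Y Z \<pi> r c d) ` {w \<in> jet_carrier Y Z \<pi> r. fst w \<in> U \<and> jet_rep w (fst w) \<in> V}
    = taylor_dom r (snd c ` U) (snd d ` V)"
proof (intro Set.set_eqI iffI)
  note D = fibred_chartD[OF cd]
  fix \<xi> assume "\<xi> \<in> snd (jet_chart Y Z \<pi> r c d) ` {w \<in> jet_carrier Y Z \<pi> r. fst w \<in> U \<and> jet_rep w (fst w) \<in> V}"
  then obtain w where w: "w \<in> jet_carrier Y Z \<pi> r" "fst w \<in> U" "jet_rep w (fst w) \<in> V"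
    "\<xi> = snd (jet_chart Y Z \<pi> r c d) w" by blast
  obtain s where s: "local_section Y Z \<pi> (fst w) s" "w = jet Y Z \<pi> r s (fst w)" using jet_carrierE[OF w(1)] by metis
  have sv: "s (fst w) \<in> V" using jet_rep_value[OF s(1), of r] s(2) w(3) by simp
  have z: "fst w \<in> fst c" "s (fst w) \<in> fst d" using UV w(2) sv by blast+
  have "\<xi> = jet_coord r c d s (fst w)" using jet_chart_jet[OF s(1) D(1) z(1) D(2) z(2), of r] s(2) w(4) by simp
  then show "\<xi> \<in> taylor_dom r (snd c ` U) (snd d ` V)"
    using jet_coord_base[OF s(1) cd z, of r] w(2) sv by (simp add: taylor_dom_def)
next
  note D = fibred_chartD[OF cd]
  fix \<xi> assume \<xi>: "\<xi> \<in> taylor_dom r (snd c ` U) (snd d ` V)"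
  then obtain z where z: "z \<in> U" "snd c z = \<xi> \<circ> Inl" by (auto simp: taylor_dom_def)
  obtain y where y: "y \<in> V" "taylor r \<xi> (\<xi> \<circ> Inl) = snd d y" using \<xi> by (auto simp: taylor_dom_def)
  let ?s = "taylor_section r c d \<xi>"
  have zc: "z \<in> fst c" using z UV by blast
  have tv: "taylor r \<xi> (\<xi> \<circ> Inl) \<in> snd d ` fst d" using y UV(2) by blast
  have \<xi>c: "\<xi> \<in> coord_space (jet_idx Y Z r)" using \<xi> by (simp add: taylor_dom_def)
  note T = taylor_section_local[OF cd \<xi>c zc z(2) tv]
  have "?s z = y" using T(2,3) y UV(2) inj_onD[OF chart_inj[OF D(2)], of "?s z" y] by auto
  then have "jet_rep (jet Y Z \<pi> r ?s z) z \<in> V" using jet_rep_value[OF T(1)] y(1) by simp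
  then have "jet Y Z \<pi> r ?s z \<in> {w \<in> jet_carrier Y Z \<pi> r. fst w \<in> U \<and> jet_rep w (fst w) \<in> V}"
    using jet_in_jet_carrier[OF T(1)] z(1) by simp
  moreover have "\<xi> = snd (jet_chart Y Z \<pi> r c d) (jet Y Z \<pi> r ?s z)"
    using jet_chart_jet[OF T(1) D(1) zc D(2) T(3), of r] T(4) by simp
  ultimately show "\<xi> \<in> snd (jet_chart Y Z \<pi> r c d) ` {w \<in> jet_carrier Y Z \<pi> r. fst w \<in> U \<and> jet_rep w (fst w) \<in> V}"
    by blast
qed

lemma fst_jet_chart:
  "fst (jet_chart Y Z \<pi> r c d) = {w \<in> jet_carrier Y Z \<pi> r. fst w \<in> fst c \<and> jet_rep w (fst w) \<in> fst d}"
  by (simp add: jet_chart_def)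

text \<open>The base coordinates determine the source, after which
  \<open>same_jet_of_jet_coord\<close> determines the jet.\<close>

lemma inj_on_jet_chart:
  assumes cd: "(c, d) \<in> fibred_charts Y Z \<pi>"
  shows "inj_on (snd (jet_chart Y Z \<pi> r c d)) (fst (jet_chart Y Z \<pi> r c d))"
proof (rule inj_onI)
  note D = fibred_chartD[OF cd]
  fix w w' assume w: "w \<in> fst (jet_chart Y Z \<pi> r c d)" and w': "w' \<in> fst (jet_chart Y Z \<pi> r c d)"
    and eq: "snd (jet_chart Y Z \<pi> r c d) w = snd (jet_chart Y Z \<pi> r c d) w'"
  obtain s where s: "local_section Y Z \<pi> (fst w) s" "w = jet Y Z \<pi> r s (fst w)"
    using w jet_carrierE unfolding fst_jet_chart by blast
  obtain s' where s': "local_section Y Z \<pi> (fst w') s'" "w' = jet Y Z \<pi> r s' (fst w')"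
    using w' jet_carrierE unfolding fst_jet_chart by blast
  have z: "fst w \<in> fst c" "s (fst w) \<in> fst d" using jet_in_jet_chart[OF s(1), of r c d] w s(2) by simp_all
  have z': "fst w' \<in> fst c" "s' (fst w') \<in> fst d" using jet_in_jet_chart[OF s'(1), of r c d] w' s'(2) by simp_all
  have e: "jet_coord r c d s (fst w) = jet_coord r c d s' (fst w')"
    using eq jet_chart_jet[OF s(1) D(1) z(1) D(2) z(2), of r] jet_chart_jet[OF s'(1) D(1) z'(1) D(2) z'(2), of r] s(2) s'(2) by simp
  have "snd c (fst w) = snd c (fst w')"
    using jet_coord_base(2)[OF s(1) cd z, of r] jet_coord_base(2)[OF s'(1) cd z', of r] e by simp
  then have zz: "fst w = fst w'" using inj_onD[OF chart_inj[OF D(1)] _ z(1) z'(1)] by simp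
  have "same_jet Y Z r (fst w) s s'"
    by (rule same_jet_of_jet_coord[OF s(1) _ cd z]) (use s'(1) z' e zz in simp_all)
  then have "jet Y Z \<pi> r s (fst w) = jet Y Z \<pi> r s' (fst w)" by (rule jet_eqI)
  then show "w = w'" using s(2) s'(2) zz by simp
qed

lemma jet_chart_inv:
  assumes cd: "(c, d) \<in> fibred_charts Y Z \<pi>" and \<xi>: "\<xi> \<in> taylor_dom r (snd c ` fst c) (snd d ` fst d)"
  shows "chart_inv (jet_chart Y Z \<pi> r c d) \<xi> = jet Y Z \<pi> r (taylor_section r c d \<xi>) (chart_inv c (\<xi> \<circ> Inl))"
proof -
  note D = fibred_chartD[OF cd]
  let ?z = "chart_inv c (\<xi> \<circ> Inl)" and ?s = "taylor_section r c d \<xi>"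
  have \<xi>': "\<xi> \<in> coord_space (jet_idx Y Z r)" "\<xi> \<circ> Inl \<in> snd c ` fst c" "taylor r \<xi> (\<xi> \<circ> Inl) \<in> snd d ` fst d"
    using \<xi> by (auto simp: taylor_dom_def)
  have z: "?z \<in> fst c" "snd c ?z = \<xi> \<circ> Inl" using chart_inv_in[OF \<xi>'(2)] chart_chart_inv[OF \<xi>'(2)] .
  note T = taylor_section_local[OF cd \<xi>'(1) z \<xi>'(3)]
  have "snd (jet_chart Y Z \<pi> r c d) (jet Y Z \<pi> r ?s ?z) = \<xi>"
    using jet_chart_jet[OF T(1) D(1) z(1) D(2) T(3), of r] T(4) by simp
  then show ?thesis
    using inv_into_f_f[OF inj_on_jet_chart[OF cd], of "jet Y Z \<pi> r ?s ?z" r] jet_in_jet_chart[OF T(1)] z(1) T(3) by simp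
qed

text \<open>The new coordinates of the jet with old coordinates \<open>\<xi>\<close> are
  derivatives, in the new base coordinates, of the new fibre components of the Taylor section of
  \<open>\<xi>\<close>. These components are jointly smooth in \<open>\<xi>\<close> and the base
  point. The derivatives in the base directions are taken first, with \<open>\<xi>\<close> as a
  parameter; substituting the source of the jet afterwards leaves a smooth function of
  \<open>\<xi>\<close>.\<close>

lemma jet_chart_transition:
  assumes cd: "(c, d) \<in> fibred_charts Y Z \<pi>" and cd': "(c', d') \<in> fibred_charts Y Z \<pi>"
  shows "smooth_transition (jet_idx Y Z r) (jet_chart Y Z \<pi> r c d) (jet_chart Y Z \<pi> r c' d')"
proof (cases "fst (jet_chart Y Z \<pi> r c d) \<inter> fst (jet_chart Y Z \<pi> r c' d') = {}")
  \<comment> \<open>Treated apart, because only a jet in the overlap provides a point of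
    \<open>Y\<close> and thereby the inclusion of the base indices among those of
    \<open>Y\<close>.\<close>
  case True
  have e: "open_coord I {}" "smooth_fun I {} f" for I :: "'i set" and f
    by (auto simp: open_coord_def smooth_fun_def)
  show ?thesis unfolding smooth_transition_def True by (simp add: e)
next
  case False
  let ?I = "jet_idx Y Z r" and ?J = "jet_idx Y Z r <+> midx Z" and ?jc = "jet_chart Y Z \<pi> r c d" and ?jc' = "jet_chart Y Z \<pi> r c' d'"
  note D = fibred_chartD[OF cd] and D' = fibred_chartD[OF cd']
  have finJ: "finite ?J" using finite_jet_idx finZ by simp
  have ZY: "midx Z \<subseteq> midx Y" using False fibred_base_subset[OF cd] unfolding fst_jet_chart by blast
  let ?U = "fst c \<inter> fst c'" and ?V = "fst d \<inter> fst d'"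
  have inter: "fst ?jc \<inter> fst ?jc' = {w \<in> jet_carrier Y Z \<pi> r. fst w \<in> ?U \<and> jet_rep w (fst w) \<in> ?V}"
    unfolding fst_jet_chart by auto
  define S where "S = taylor_dom r (snd c ` ?U) (snd d ` ?V)"
  have im: "snd ?jc ` (fst ?jc \<inter> fst ?jc') = S"
    unfolding inter S_def by (rule jet_chart_image[OF cd]) auto
  have tc: "smooth_in_charts (midx Z) (midx Z) c c' ?U id" by (rule charts_transition[OF Z D(1) D'(1)])
  have tc': "smooth_in_charts (midx Z) (midx Z) c' c ?U id"
    using charts_transition[OF Z D'(1) D(1)] by (simp add: Int_commute)
  have td: "smooth_in_charts (midx Y) (midx Y) d d' ?V id" by (rule charts_transition[OF Y D(2) D'(2)])
  have oU: "open_coord (midx Z) (snd c ` ?U)" and oU': "open_coord (midx Z) (snd c' ` ?U)" and oV: "open_coord (midx Y) (snd d ` ?V)"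
    using tc tc' td by (simp_all add: smooth_in_charts_def)
  have S: "open_coord ?I S" unfolding S_def by (rule open_taylor_dom[OF oU oV ZY])
  define \<phi> where "\<phi> u = snd c' (chart_inv c u)" for u
  define \<psi> where "\<psi> u = snd c (chart_inv c' u)" for u
  have \<phi>s: "smooth_fun (midx Z) (snd c ` ?U) (\<lambda>u. \<phi> u i)" and \<psi>s: "smooth_fun (midx Z) (snd c' ` ?U) (\<lambda>u. \<psi> u i)" if "i \<in> midx Z" for i
    using tc tc' that by (simp_all add: smooth_in_charts_def \<phi>_def \<psi>_def)
  have \<phi>: "\<phi> (snd c x) = snd c' x" "\<psi> (snd c' x) = snd c x" if "x \<in> ?U" for x
    using that chart_inv_chart[OF D(1)] chart_inv_chart[OF D'(1)] by (simp_all add: \<phi>_def \<psi>_def)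
  have \<phi>S: "smooth_fun ?I S (\<lambda>\<xi>. \<phi> (\<xi> \<circ> Inl) i)" if "i \<in> midx Z" for i
    by (rule smooth_fun_reindex[OF finZ finite_jet_idx oU S \<phi>s[OF that]]) (simp add: S_def taylor_dom_def)
  have comp: "smooth_fun ?I S (\<lambda>\<xi>. snd ?jc' (chart_inv ?jc \<xi>) k)" if k: "k \<in> ?I" for k
  proof -
    have val: "snd ?jc' (chart_inv ?jc \<xi>) = jet_coord r c' d' (taylor_section r c d \<xi>) (chart_inv c (\<xi> \<circ> Inl))" if \<xi>: "\<xi> \<in> S" for \<xi>
    proof -
      let ?z = "chart_inv c (\<xi> \<circ> Inl)" and ?s = "taylor_section r c d \<xi>"
      obtain x where x: "x \<in> ?U" "\<xi> \<circ> Inl = snd c x" using \<xi> by (auto simp: S_def taylor_dom_def)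
      obtain y where y: "y \<in> ?V" "taylor r \<xi> (\<xi> \<circ> Inl) = snd d y" using \<xi> by (auto simp: S_def taylor_dom_def)
      have zx: "?z = x" using x chart_inv_chart[OF D(1)] by simp
      have \<xi>c: "\<xi> \<in> coord_space ?I" using \<xi> by (simp add: S_def taylor_dom_def)
      have tv: "taylor r \<xi> (\<xi> \<circ> Inl) \<in> snd d ` fst d" using y by auto
      have z: "?z \<in> fst c" "snd c ?z = \<xi> \<circ> Inl" using x zx by auto
      note T = taylor_section_local[OF cd \<xi>c z tv]
      have sy: "?s ?z = y" using T(2,3) y inj_onD[OF chart_inj[OF D(2)], of "?s ?z" y] by auto
      have "\<xi> \<in> taylor_dom r (snd c ` fst c) (snd d ` fst d)" using \<xi>c tv x by (auto simp: taylor_dom_def)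
      from jet_chart_inv[OF cd this]
      have "chart_inv ?jc \<xi> = jet Y Z \<pi> r ?s ?z" .
      then show ?thesis using jet_chart_jet[OF T(1) D'(1) _ D'(2), of r] zx x(1) sy y(1) by simp
    qed
    show ?thesis
    proof (cases k)
      case (Inl i)
      then have i: "i \<in> midx Z" using k by (auto simp: jet_idx_eq)
      show ?thesis
        by (rule smooth_fun_congI[OF finite_jet_idx S \<phi>S[OF i]]) (use k Inl in \<open>simp add: val jet_coord_def \<phi>_def\<close>)
    next
      case (Inr p)
      obtain a \<alpha> where p: "p = (a, \<alpha>)" by force
      have a: "a \<in> midx Y" "\<alpha> \<in> multi_idx r" using k Inr p by (auto simp: jet_idx_eq)
      let ?l = "sorted_list_of_multiset \<alpha>"
      define R where "R = {w. w \<circ> Inl \<in> coord_space ?I \<and> w \<circ> Inr \<in> snd c' ` ?U}"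
      have topI: "open_coord ?I (coord_space ?I)" and topJ: "open_coord ?J (coord_space ?J)" by (simp_all add: open_coord_def)
      have R: "open_coord ?J R" unfolding R_def by (rule open_coord_Plus[OF topI oU'])
      \<comment> \<open>The Taylor polynomial with coefficients \<open>w \<circ> Inl\<close>,
        evaluated at the point whose coordinates in the new base chart \<open>c'\<close> are
        \<open>w \<circ> Inr\<close>.\<close>
      define G where "G w = taylor r (w \<circ> Inl) (\<psi> (w \<circ> Inr))" for w
      have \<psi>c: "\<psi> u \<in> coord_space (midx Z)" if "u \<in> snd c' ` ?U" for u
        using that \<phi>(2) chart_coord[OF D(1)] by auto
      have Gs: "smooth_fun ?J R (\<lambda>w. G w i)" for i
      proof -
        have "smooth_fun ?J R (\<lambda>w. taylor r (case_sum (w \<circ> Inl) (\<psi> (w \<circ> Inr)) \<circ> Inl) (case_sum (w \<circ> Inl) (\<psi> (w \<circ> Inr)) \<circ> Inr) i)"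
        proof (rule smooth_fun_compose[OF finJ finJ R topJ _ _ smooth_taylor[OF topJ]])
          show "(\<lambda>w. case_sum (w \<circ> Inl) (\<psi> (w \<circ> Inr))) ` R \<subseteq> coord_space ?J"
            using \<psi>c by (auto simp: coord_space_Plus case_sum_o_inj R_def)
          fix j assume j: "j \<in> ?J"
          show "smooth_fun ?J R (\<lambda>w. case_sum (w \<circ> Inl) (\<psi> (w \<circ> Inr)) j)"
          proof (cases j)
            case (Inl k)
            then show ?thesis using smooth_fun_proj[OF finJ R] by simp
          next
            case (Inr i)
            then have "i \<in> midx Z" using j by auto
            then have "smooth_fun ?J R (\<lambda>w. \<psi> (w \<circ> Inr) i)"
              by (intro smooth_fun_reindex[OF finZ finJ oU' R \<psi>s]) (simp_all add: R_def)
            then show ?thesis using Inr by simp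
          qed
        qed
        then show ?thesis by (simp add: G_def case_sum_o_inj)
      qed
      have Gim: "G ` R \<subseteq> coord_space (midx Y)"
        using taylor_coord_space[OF \<psi>c ZY] by (auto simp: G_def R_def)
      \<comment> \<open>Here the value of the polynomial lies in the overlap of the old and the new
        fibre chart, so that the change of fibre coordinates applies.\<close>
      define \<Omega> where "\<Omega> = {w \<in> R. G w \<in> snd d ` ?V}"
      have \<Omega>: "open_coord ?J \<Omega>"
        unfolding \<Omega>_def by (rule open_coord_preimage[OF R _ oV Gim])
          (rule continuous_on_into_coord_space[OF smooth_fun_continuous[OF Gs] Gim])
      define F where "F w = snd d' (chart_inv d (G w)) a" for w
      have Fs: "smooth_fun ?J \<Omega> F"
        unfolding F_def[abs_def]
      proof (rule smooth_fun_compose[where g = G and f = "\<lambda>v. snd d' (chart_inv d v) a", OF finJ finY \<Omega> oV])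
        show "G ` \<Omega> \<subseteq> snd d ` ?V" by (auto simp: \<Omega>_def)
        show "smooth_fun ?J \<Omega> (\<lambda>w. G w j)" for j by (rule smooth_fun_subset[OF Gs]) (auto simp: \<Omega>_def)
        show "smooth_fun (midx Y) (snd d ` ?V) (\<lambda>v. snd d' (chart_inv d v) a)"
          using td a(1) by (simp add: smooth_in_charts_def)
      qed
      have l: "map Inr ?l \<in> lists ?J" using multi_idx_list[OF a(2)] by (auto simp: lists_eq_set)
      \<comment> \<open>The base derivatives of the jointly smooth \<open>F\<close> are restricted
        to the graph \<open>x = \<phi> (\<xi> \<circ> Inl)\<close>, that is, evaluated at the source
        of the jet.\<close>
      have "smooth_fun ?I S (\<lambda>\<xi>. pds (map Inr ?l) F (case_sum \<xi> (\<phi> (\<xi> \<circ> Inl))))"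
      proof (rule smooth_fun_compose[OF finite_jet_idx finJ S \<Omega> _ _ smooth_fun_pds[OF Fs l]])
        show "(\<lambda>\<xi>. case_sum \<xi> (\<phi> (\<xi> \<circ> Inl))) ` S \<subseteq> \<Omega>"
        proof (rule image_subsetI)
          fix \<xi> assume \<xi>: "\<xi> \<in> S"
          then obtain x where x: "x \<in> ?U" "\<xi> \<circ> Inl = snd c x" by (auto simp: S_def taylor_dom_def)
          have "\<psi> (\<phi> (\<xi> \<circ> Inl)) = \<xi> \<circ> Inl" using \<phi>[OF x(1)] x(2) by simp
          moreover have "\<phi> (\<xi> \<circ> Inl) \<in> snd c' ` ?U" using \<phi>[OF x(1)] x by auto
          ultimately show "case_sum \<xi> (\<phi> (\<xi> \<circ> Inl)) \<in> \<Omega>"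
            using \<xi> by (simp add: \<Omega>_def R_def G_def case_sum_o_inj S_def taylor_dom_def)
        qed
        fix j assume j: "j \<in> ?J"
        show "smooth_fun ?I S (\<lambda>\<xi>. case_sum \<xi> (\<phi> (\<xi> \<circ> Inl)) j)"
        proof (cases j)
          case (Inr i)
          then show ?thesis using j \<phi>S by auto
        qed (simp add: smooth_fun_proj[OF finite_jet_idx S])
      qed
      then show ?thesis
      proof (rule smooth_fun_congI[OF finite_jet_idx S])
        fix \<xi> assume "\<xi> \<in> S"
        have "F (case_sum \<xi> x) = snd d' (taylor_section r c d \<xi> (chart_inv c' x)) a" for x
          by (simp add: F_def G_def taylor_section_def \<psi>_def case_sum_o_inj)
        then show "pds (map Inr ?l) F (case_sum \<xi> (\<phi> (\<xi> \<circ> Inl))) = snd ?jc' (chart_inv ?jc \<xi>) k"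
          unfolding val[OF \<open>\<xi> \<in> S\<close>] pds_Inr using k by (simp add: jet_coord_def Inr p \<phi>_def)
      qed
    qed
  qed
  show ?thesis unfolding smooth_transition_def im using S comp by blast
qed

lemma midx_jet [simp]: "midx (jet_mfd Y Z \<pi> r) = jet_idx Y Z r"
  and mcarrier_jet [simp]: "mcarrier (jet_mfd Y Z \<pi> r) = jet_carrier Y Z \<pi> r"
  and matlas_jet: "matlas (jet_mfd Y Z \<pi> r) = {jet_chart Y Z \<pi> r c d | c d. (c, d) \<in> fibred_charts Y Z \<pi>}"
  by (simp_all add: jet_mfd_def)

lemma jet_chart_charts:
  assumes cd: "(c, d) \<in> fibred_charts Y Z \<pi>"
  shows "jet_chart Y Z \<pi> r c d \<in> charts (jet_mfd Y Z \<pi> r)"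
proof -
  let ?jc = "jet_chart Y Z \<pi> r c d"
  have "smooth_transition (jet_idx Y Z r) ?jc ?jc" by (rule jet_chart_transition[OF cd cd])
  then have "open_coord (jet_idx Y Z r) (snd ?jc ` fst ?jc)" by (simp add: smooth_transition_def)
  then have "is_chart (jet_mfd Y Z \<pi> r) ?jc"
    unfolding is_chart_def using inj_on_jet_chart[OF cd] by (auto simp: fst_jet_chart)
  moreover have "smooth_transition (jet_idx Y Z r) ?jc e \<and> smooth_transition (jet_idx Y Z r) e ?jc"
    if e: "e \<in> matlas (jet_mfd Y Z \<pi> r)" for e
  proof -
    obtain c' d' where e: "e = jet_chart Y Z \<pi> r c' d'" "(c', d') \<in> fibred_charts Y Z \<pi>" using e unfolding matlas_jet by blast
    show ?thesis unfolding e(1) using jet_chart_transition[OF cd e(2)] jet_chart_transition[OF e(2) cd] by blast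
  qed
  ultimately show ?thesis by (simp add: charts_def)
qed

lemma fibred_chart_section:
  assumes "local_section Y Z \<pi> z s"
  obtains c d where "(c, d) \<in> fibred_charts Y Z \<pi>" "z \<in> fst c" "s z \<in> fst d"
proof -
  have "s z \<in> mcarrier Y" "\<pi> (s z) = z" using local_sectionE[OF assms] by metis+
  then show thesis using fibred_chart_at[of "s z"] that by metis
qed

lemma premanifold_jet: "premanifold (jet_mfd Y Z \<pi> r)"
  unfolding premanifold_def
proof (intro conjI)
  show "finite (midx (jet_mfd Y Z \<pi> r))" by (simp add: finite_jet_idx)
  show "matlas (jet_mfd Y Z \<pi> r) \<subseteq> charts (jet_mfd Y Z \<pi> r)" unfolding matlas_jet using jet_chart_charts by blast
  show "(\<Union>c\<in>matlas (jet_mfd Y Z \<pi> r). fst c) = mcarrier (jet_mfd Y Z \<pi> r)"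
  proof (intro equalityI subsetI)
    fix w assume "w \<in> mcarrier (jet_mfd Y Z \<pi> r)"
    then have "w \<in> jet_carrier Y Z \<pi> r" by simp
    then obtain s where s: "local_section Y Z \<pi> (fst w) s" "w = jet Y Z \<pi> r s (fst w)" using jet_carrierE by blast
    obtain c d where cd: "(c, d) \<in> fibred_charts Y Z \<pi>" "fst w \<in> fst c" "s (fst w) \<in> fst d" using fibred_chart_section[OF s(1)] by metis
    then have "w \<in> fst (jet_chart Y Z \<pi> r c d)" using jet_in_jet_chart[OF s(1), of r c d] s(2) by simp
    then show "w \<in> (\<Union>c\<in>matlas (jet_mfd Y Z \<pi> r). fst c)" unfolding matlas_jet using cd(1) by blast
  next
    fix w assume "w \<in> (\<Union>c\<in>matlas (jet_mfd Y Z \<pi> r). fst c)"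
    then obtain c d where "w \<in> fst (jet_chart Y Z \<pi> r c d)" unfolding matlas_jet by blast
    then show "w \<in> mcarrier (jet_mfd Y Z \<pi> r)" by (simp add: fst_jet_chart)
  qed
qed

end

subsection \<open>Families of sections and their jets\<close>

lemma smooth_Pair_left:
  assumes M: "premanifold M" and N: "premanifold N" and b: "b \<in> mcarrier N"
  shows "smooth_map_on M (prod_mfd M N) (mcarrier M) (\<lambda>a. (a, b))"
  unfolding smooth_map_on_iff[OF M]
proof
  fix a assume "a \<in> mcarrier M"
  then obtain c where c: "c \<in> charts M" "a \<in> fst c" using premanifold_cover[OF M] by blast
  obtain d where d: "d \<in> charts N" "b \<in> fst d" using premanifold_cover[OF N b] by blast
  note fin = premanifold_finite[OF M] and op = chart_open[OF c(1)]
  have "smooth_in_charts (midx M) (midx (prod_mfd M N)) c (prod_chart c d) (fst c) (\<lambda>a. (a, b))"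
    unfolding smooth_in_charts_def
  proof (intro conjI ballI op)
    fix k
    show "smooth_fun (midx M) (snd c ` fst c) (\<lambda>u. snd (prod_chart c d) (chart_inv c u, b) k)"
    proof (cases k)
      case (Inl i)
      have "smooth_fun (midx M) (snd c ` fst c) (\<lambda>u. snd c (chart_inv c u) i)"
        by (rule smooth_fun_congI[OF fin op smooth_fun_proj[OF fin op, of i]]) (simp only: chart_chart_inv)
      then show ?thesis using Inl by simp
    next
      case (Inr j)
      then show ?thesis using smooth_fun_const[OF fin op] by simp
    qed
  qed (use d in auto)
  then show "\<exists>c\<in>charts M. \<exists>e\<in>charts (prod_mfd M N). \<exists>U. a \<in> U \<and> U \<subseteq> mcarrier M \<and>
      smooth_in_charts (midx M) (midx (prod_mfd M N)) c e U (\<lambda>a. (a, b))"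
    using c chart_subset[OF c(1)] prod_chart_charts[OF M N c(1) d(1)] by blast
qed

lemma smooth_Pair_right:
  assumes M: "premanifold M" and N: "premanifold N" and a: "a \<in> mcarrier M"
  shows "smooth_map_on N (prod_mfd M N) (mcarrier N) (\<lambda>b. (a, b))"
  unfolding smooth_map_on_iff[OF N]
proof
  fix b assume "b \<in> mcarrier N"
  then obtain d where d: "d \<in> charts N" "b \<in> fst d" using premanifold_cover[OF N] by blast
  obtain c where c: "c \<in> charts M" "a \<in> fst c" using premanifold_cover[OF M a] by blast
  note fin = premanifold_finite[OF N] and op = chart_open[OF d(1)]
  have "smooth_in_charts (midx N) (midx (prod_mfd M N)) d (prod_chart c d) (fst d) (\<lambda>b. (a, b))"
    unfolding smooth_in_charts_def
  proof (intro conjI ballI op)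
    fix k
    show "smooth_fun (midx N) (snd d ` fst d) (\<lambda>u. snd (prod_chart c d) (a, chart_inv d u) k)"
    proof (cases k)
      case (Inr i)
      have "smooth_fun (midx N) (snd d ` fst d) (\<lambda>u. snd d (chart_inv d u) i)"
        by (rule smooth_fun_congI[OF fin op smooth_fun_proj[OF fin op, of i]]) (simp only: chart_chart_inv)
      then show ?thesis using Inr by simp
    next
      case (Inl j)
      then show ?thesis using smooth_fun_const[OF fin op] by simp
    qed
  qed (use c in auto)
  then show "\<exists>d\<in>charts N. \<exists>e\<in>charts (prod_mfd M N). \<exists>U. b \<in> U \<and> U \<subseteq> mcarrier N \<and>
      smooth_in_charts (midx N) (midx (prod_mfd M N)) d e U (\<lambda>b. (a, b))"
    using d chart_subset[OF d(1)] prod_chart_charts[OF M N c(1) d(1)] by blast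
qed

lemma case_sum_upd_Inl: "(case_sum (\<lambda>_::unit. t) u)(Inl () := s) = case_sum (\<lambda>_. s) u"
  by (auto simp: fun_eq_iff split: sum.split)

text \<open>In the coordinate expression of a family, \<open>Inl ()\<close> is time and \<open>Inr i\<close> are the base coordinates.\<close>

definition fam_dom where
  "fam_dom \<epsilon> W c d \<Upsilon> = {case_sum (\<lambda>_::unit. t) (snd c z) | t z. t \<in> {-\<epsilon><..<(\<epsilon>::real)} \<and> z \<in> W \<and> z \<in> fst c \<and> \<Upsilon> t z \<in> fst d}"

definition fam_rep where
  "fam_rep c d \<Upsilon> i w = snd d (\<Upsilon> (w (Inl ())) (chart_inv c (w \<circ> Inr))) i"

lemma fam_rep_case_sum: "fam_rep c d \<Upsilon> i (case_sum (\<lambda>_. t) u) = snd d (\<Upsilon> t (chart_inv c u)) i"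
  by (simp add: fam_rep_def case_sum_o_inj)

text \<open>Source and target are kept arbitrary because the lemma is applied both to families of
  sections and to the real-valued integrand of the action.\<close>

lemma smooth_fam_rep:
  assumes M: "premanifold M" and N: "premanifold N"
    and f: "smooth_map_on (prod_mfd real_mfd M) N ({-\<epsilon><..<\<epsilon>} \<times> W) (\<lambda>(t, z). \<Upsilon> t z)"
    and c: "c \<in> charts M" and d: "d \<in> charts N"
  shows "open_coord (UNIV <+> midx M) (fam_dom \<epsilon> W c d \<Upsilon>)"
    "i \<in> midx N \<Longrightarrow> smooth_fun (UNIV <+> midx M) (fam_dom \<epsilon> W c d \<Upsilon>) (fam_rep c d \<Upsilon> i)"
proof -
  let ?P = "prod_mfd real_mfd M" and ?pc = "prod_chart real_chart c"
  have P: "premanifold ?P" by (rule premanifold_prod[OF premanifold_real M])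
  have pc: "?pc \<in> charts ?P" by (rule prod_chart_charts[OF premanifold_real M real_chart_charts c])
  define A where "A = {x \<in> fst ?pc \<inter> ({-\<epsilon><..<\<epsilon>} \<times> W). (\<lambda>(t, z). \<Upsilon> t z) x \<in> fst d}"
  have im: "snd ?pc ` A = fam_dom \<epsilon> W c d \<Upsilon>"
    unfolding A_def fam_dom_def by (auto simp: image_iff) (metis)+
  have s: "smooth_in_charts (midx ?P) (midx N) ?pc d A (\<lambda>(t, z). \<Upsilon> t z)"
    unfolding A_def by (rule smooth_map_on_in_charts[OF P N f pc d])
  then show op: "open_coord (UNIV <+> midx M) (fam_dom \<epsilon> W c d \<Upsilon>)" by (simp add: smooth_in_charts_def im)
  assume i: "i \<in> midx N"
  have fin: "finite (UNIV <+> midx M :: (unit + 'b) set)" using premanifold_finite[OF M] by simp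
  have "smooth_fun (UNIV <+> midx M) (fam_dom \<epsilon> W c d \<Upsilon>) (\<lambda>w. snd d ((\<lambda>(t, z). \<Upsilon> t z) (chart_inv ?pc w)) i)"
    using s i unfolding smooth_in_charts_def im midx_prod midx_real by blast
  then show "smooth_fun (UNIV <+> midx M) (fam_dom \<epsilon> W c d \<Upsilon>) (fam_rep c d \<Upsilon> i)"
  proof (rule smooth_fun_congI[OF fin op])
    fix w assume "w \<in> fam_dom \<epsilon> W c d \<Upsilon>"
    then obtain t z where tz: "w = case_sum (\<lambda>_. t) (snd c z)" "z \<in> fst c" by (auto simp: fam_dom_def)
    have "chart_inv ?pc (snd ?pc (t, z)) = (t, z)" by (rule chart_inv_chart[OF pc]) (use tz in simp)
    then have "chart_inv ?pc w = (t, z)" using tz by simp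
    then show "snd d ((\<lambda>(t, z). \<Upsilon> t z) (chart_inv ?pc w)) i = fam_rep c d \<Upsilon> i w"
      unfolding tz(1) fam_rep_case_sum using chart_inv_chart[OF c tz(2)] by simp
  qed
qed

context fibred
begin

abbreviation "P \<equiv> prod_mfd real_mfd Z"

lemma premanifold_P: "premanifold P"
  by (rule premanifold_prod[OF premanifold_real Z])

lemma time_interval_prod_open: "openin (mtop Z) W \<Longrightarrow> openin (mtop P) ({-\<epsilon><..<\<epsilon>} \<times> W)"
  by (rule openin_mtop_prod[OF premanifold_real Z openin_mtop_real]) auto

lemma map_Inr_lists: "\<alpha> \<in> multi_idx r \<Longrightarrow> map Inr (sorted_list_of_multiset \<alpha>) \<in> lists (UNIV <+> midx Z)"
  using multi_idx_list[of \<alpha> r] by (auto simp: lists_eq_set)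

lemma fin_time: "finite (UNIV <+> midx Z :: (unit + nat) set)"
  using finZ by simp

section \<open>Velocities of families and of their jets\<close>

definition fam_vel :: "(real \<Rightarrow> 'z \<Rightarrow> 'y) \<Rightarrow> 'z \<Rightarrow> ('y, nat) tvec" where
  "fam_vel \<Upsilon> z = velocity Y (\<lambda>t. \<Upsilon> t z)"

lemma fst_fam_vel [simp]: "fst (fam_vel \<Upsilon> z) = \<Upsilon> 0 z"
  by (simp add: fam_vel_def)

context
  fixes \<Upsilon> :: "real \<Rightarrow> 'z \<Rightarrow> 'y" and W :: "'z set" and \<epsilon> :: real
  assumes W: "openin (mtop Z) W" and eps: "\<epsilon> > 0"
    and sm: "smooth_map_on P Y ({-\<epsilon><..<\<epsilon>} \<times> W) (\<lambda>(t, z). \<Upsilon> t z)"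
    and sec: "\<And>t z. t \<in> {-\<epsilon><..<\<epsilon>} \<Longrightarrow> z \<in> W \<Longrightarrow> \<pi> (\<Upsilon> t z) = z"
begin

lemma W_sub: "W \<subseteq> mcarrier Z"
  using W openin_mtop_atlas[OF Z] by blast

lemma family_slice: "t \<in> {-\<epsilon><..<\<epsilon>} \<Longrightarrow> smooth_map_on Z Y W (\<Upsilon> t)"
proof -
  assume t: "t \<in> {-\<epsilon><..<\<epsilon>}"
  have "smooth_map_on Z Y {z \<in> mcarrier Z. (t, z) \<in> {-\<epsilon><..<\<epsilon>} \<times> W} ((\<lambda>(t, z). \<Upsilon> t z) \<circ> (\<lambda>z. (t, z)))"
    by (rule smooth_map_on_preimage_compose[OF Z premanifold_P Y smooth_Pair_right[OF premanifold_real Z] sm]) simp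
  moreover have "{z \<in> mcarrier Z. (t, z) \<in> {-\<epsilon><..<\<epsilon>} \<times> W} = W" using t W_sub by auto
  ultimately show ?thesis by (simp add: o_def)
qed

lemma family_local_section: "t \<in> {-\<epsilon><..<\<epsilon>} \<Longrightarrow> z \<in> W \<Longrightarrow> local_section Y Z \<pi> z (\<Upsilon> t)"
  unfolding local_section_def using W family_slice sec by blast

lemma family_local_section_0: "z \<in> W \<Longrightarrow> local_section Y Z \<pi> z (\<Upsilon> 0)"
  using family_local_section[of 0] eps by simp

lemma family_curve: "z \<in> W \<Longrightarrow> smooth_curve Y (\<lambda>t. \<Upsilon> t z)"
proof -
  assume z: "z \<in> W"
  have "smooth_map_on real_mfd Y {t \<in> mcarrier real_mfd. (t, z) \<in> {-\<epsilon><..<\<epsilon>} \<times> W} ((\<lambda>(t, z). \<Upsilon> t z) \<circ> (\<lambda>t. (t, z)))"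
    by (rule smooth_map_on_preimage_compose[OF premanifold_real premanifold_P Y smooth_Pair_left[OF premanifold_real Z] sm])
      (use z W_sub in blast)
  then have "smooth_map_on real_mfd Y {t. -\<epsilon> < t \<and> t < \<epsilon>} (\<lambda>t. \<Upsilon> t z)" using z by (simp add: o_def)
  then show ?thesis unfolding smooth_curve_iff[OF Y] using eps by (intro exI[of _ "{t. -\<epsilon> < t \<and> t < \<epsilon>}"]) simp
qed

lemmas family_rep = smooth_fam_rep[OF Z Y sm]

lemma jet_coord_family:
  assumes k: "Inr (a, \<alpha>) \<in> jet_idx Y Z r"
  shows "jet_coord r c d (\<Upsilon> t) z (Inr (a, \<alpha>)) =
    pds (map Inr (sorted_list_of_multiset \<alpha>)) (fam_rep c d \<Upsilon> a) (case_sum (\<lambda>_. t) (snd c z))"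
  unfolding pds_Inr fam_rep_case_sum using k by (simp add: jet_coord_def)

text \<open>In induced coordinates the jets are iterated base derivatives of the joint expression
  \<open>fam_rep\<close>, hence smooth in time and base point together.\<close>

lemma smooth_jet_family: "smooth_map_on P (jet_mfd Y Z \<pi> r) ({-\<epsilon><..<\<epsilon>} \<times> W) (\<lambda>(t, z). jet Y Z \<pi> r (\<Upsilon> t) z)"
  unfolding smooth_map_on_iff[OF premanifold_P]
proof
  fix x assume "x \<in> {-\<epsilon><..<\<epsilon>} \<times> W"
  then obtain t0 z0 where x: "x = (t0, z0)" "t0 \<in> {-\<epsilon><..<\<epsilon>}" "z0 \<in> W" by blast
  obtain c d where cd: "(c, d) \<in> fibred_charts Y Z \<pi>" "z0 \<in> fst c" "\<Upsilon> t0 z0 \<in> fst d"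
    using fibred_chart_section[OF family_local_section[OF x(2,3)]] by metis
  note D = fibred_chartD[OF cd(1)]
  let ?pc = "prod_chart real_chart c" and ?jc = "jet_chart Y Z \<pi> r c d" and ?\<Omega> = "fam_dom \<epsilon> W c d \<Upsilon>"
  have pc: "?pc \<in> charts P" by (rule prod_chart_charts[OF premanifold_real Z real_chart_charts D(1)])
  define A where "A = {(t, z). t \<in> {-\<epsilon><..<\<epsilon>} \<and> z \<in> W \<and> z \<in> fst c \<and> \<Upsilon> t z \<in> fst d}"
  have im: "snd ?pc ` A = ?\<Omega>"
    unfolding A_def fam_dom_def by (auto simp: image_iff) (metis)+
  have op: "open_coord (UNIV <+> midx Z) ?\<Omega>" by (rule family_rep(1)[OF D(1,2)])
  have "smooth_in_charts (midx P) (midx (jet_mfd Y Z \<pi> r)) ?pc ?jc A (\<lambda>(t, z). jet Y Z \<pi> r (\<Upsilon> t) z)"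
    unfolding smooth_in_charts_def im midx_prod midx_real midx_jet
  proof (intro conjI ballI op)
    show "A \<subseteq> fst ?pc" by (auto simp: A_def)
    show "(\<lambda>(t, z). jet Y Z \<pi> r (\<Upsilon> t) z) ` A \<subseteq> fst ?jc"
    proof (rule image_subsetI)
      fix x assume "x \<in> A"
      then obtain t z where x: "x = (t, z)" "t \<in> {-\<epsilon><..<\<epsilon>}" "z \<in> W" "z \<in> fst c" "\<Upsilon> t z \<in> fst d"
        unfolding A_def by blast
      show "(\<lambda>(t, z). jet Y Z \<pi> r (\<Upsilon> t) z) x \<in> fst ?jc"
        using jet_in_jet_chart[OF family_local_section[OF x(2,3)]] x(1,4,5) by simp
    qed
    fix k assume k: "k \<in> jet_idx Y Z r"
    have val: "snd ?jc ((\<lambda>(t, z). jet Y Z \<pi> r (\<Upsilon> t) z) (chart_inv ?pc (case_sum (\<lambda>_. t) (snd c z)))) = jet_coord r c d (\<Upsilon> t) z"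
      if "(t, z) \<in> A" for t z
    proof -
      have "chart_inv ?pc (snd ?pc (t, z)) = (t, z)" by (rule chart_inv_chart[OF pc]) (use that in \<open>simp add: A_def\<close>)
      then show ?thesis using jet_chart_jet[OF family_local_section D(1) _ D(2), of t z r] that by (simp add: A_def)
    qed
    show "smooth_fun (UNIV <+> midx Z) ?\<Omega> (\<lambda>w. snd ?jc ((\<lambda>(t, z). jet Y Z \<pi> r (\<Upsilon> t) z) (chart_inv ?pc w)) k)"
    proof (cases k)
      case (Inl i)
      show ?thesis
      proof (rule smooth_fun_congI[OF fin_time op smooth_fun_proj[OF fin_time op, of "Inr i"]])
        fix w assume "w \<in> ?\<Omega>"
        then obtain t z where tz: "(t, z) \<in> A" "w = case_sum (\<lambda>_. t) (snd c z)" by (auto simp: fam_dom_def A_def)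
        show "w (Inr i) = snd ?jc ((\<lambda>(t, z). jet Y Z \<pi> r (\<Upsilon> t) z) (chart_inv ?pc w)) k"
          unfolding tz(2) val[OF tz(1)] using k Inl by (simp add: jet_coord_def)
      qed
    next
      case (Inr p)
      obtain a \<alpha> where p: "p = (a, \<alpha>)" by force
      have a: "a \<in> midx Y" "\<alpha> \<in> multi_idx r" using k Inr p by (auto simp: jet_idx_eq)
      show ?thesis
      proof (rule smooth_fun_congI[OF fin_time op smooth_fun_pds[OF family_rep(2)[OF D(1,2) a(1)] map_Inr_lists[OF a(2)]]])
        fix w assume "w \<in> ?\<Omega>"
        then obtain t z where tz: "(t, z) \<in> A" "w = case_sum (\<lambda>_. t) (snd c z)" by (auto simp: fam_dom_def A_def)
        show "pds (map Inr (sorted_list_of_multiset \<alpha>)) (fam_rep c d \<Upsilon> a) w =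
            snd ?jc ((\<lambda>(t, z). jet Y Z \<pi> r (\<Upsilon> t) z) (chart_inv ?pc w)) k"
          unfolding tz(2) val[OF tz(1)] Inr p using k Inr p by (simp add: jet_coord_family)
      qed
    qed
  qed
  moreover have "x \<in> A" "A \<subseteq> {-\<epsilon><..<\<epsilon>} \<times> W" using x cd by (auto simp: A_def)
  ultimately show "\<exists>e\<in>charts P. \<exists>e'\<in>charts (jet_mfd Y Z \<pi> r). \<exists>U. x \<in> U \<and> U \<subseteq> {-\<epsilon><..<\<epsilon>} \<times> W \<and>
      smooth_in_charts (midx P) (midx (jet_mfd Y Z \<pi> r)) e e' U (\<lambda>(t, z). jet Y Z \<pi> r (\<Upsilon> t) z)"
    using pc jet_chart_charts[OF cd(1)] by blast
qed

lemma jet_family_curve: "z \<in> W \<Longrightarrow> smooth_curve (jet_mfd Y Z \<pi> r) (\<lambda>t. jet Y Z \<pi> r (\<Upsilon> t) z)"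
proof -
  assume z: "z \<in> W"
  have "smooth_map_on real_mfd (jet_mfd Y Z \<pi> r) {t \<in> mcarrier real_mfd. (t, z) \<in> {-\<epsilon><..<\<epsilon>} \<times> W}
      ((\<lambda>(t, z). jet Y Z \<pi> r (\<Upsilon> t) z) \<circ> (\<lambda>t. (t, z)))"
    by (rule smooth_map_on_preimage_compose[OF premanifold_real premanifold_P premanifold_jet
          smooth_Pair_left[OF premanifold_real Z] smooth_jet_family]) (use z W_sub in blast)
  then have "smooth_map_on real_mfd (jet_mfd Y Z \<pi> r) {t. -\<epsilon> < t \<and> t < \<epsilon>} (\<lambda>t. jet Y Z \<pi> r (\<Upsilon> t) z)"
    using z by (simp add: o_def)
  then show ?thesis unfolding smooth_curve_iff[OF premanifold_jet] using eps
    by (intro exI[of _ "{t. -\<epsilon> < t \<and> t < \<epsilon>}"]) simp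
qed

lemma fam_vel_rep:
  assumes d: "d \<in> charts Y" "\<Upsilon> 0 z \<in> fst d" and z: "c \<in> charts Z" "z \<in> fst c" and a: "a \<in> midx Y"
  shows "pd (Inl ()) (fam_rep c d \<Upsilon> a) (case_sum (\<lambda>_. 0) (snd c z)) = snd (fam_vel \<Upsilon> z) d a"
  unfolding pd_def case_sum_upd_Inl fam_rep_case_sum chart_inv_chart[OF z]
  using d a by (simp add: fam_vel_def velocity_def)

text \<open>The velocity components are the time derivative of the joint expression
  \<open>fam_rep\<close>, restricted to time 0.\<close>

lemma smooth_fam_vel_rep:
  assumes c: "c \<in> charts Z" and d: "d \<in> charts Y" and a: "a \<in> midx Y"
  shows "open_coord (midx Z) (snd c ` {z \<in> fst c \<inter> W. \<Upsilon> 0 z \<in> fst d})"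
    "smooth_fun (midx Z) (snd c ` {z \<in> fst c \<inter> W. \<Upsilon> 0 z \<in> fst d}) (\<lambda>u. snd d (\<Upsilon> 0 (chart_inv c u)) a)"
    "smooth_fun (midx Z) (snd c ` {z \<in> fst c \<inter> W. \<Upsilon> 0 z \<in> fst d}) (\<lambda>u. snd (fam_vel \<Upsilon> (chart_inv c u)) d a)"
proof -
  let ?S = "snd c ` {z \<in> fst c \<inter> W. \<Upsilon> 0 z \<in> fst d}"
  have s0: "smooth_map_on Z Y W (\<Upsilon> 0)" using family_slice eps by simp
  show S: "open_coord (midx Z) ?S" "smooth_fun (midx Z) ?S (\<lambda>u. snd d (\<Upsilon> 0 (chart_inv c u)) a)"
    by (rule section_coord_smooth[OF s0 c d a])+
  have g: "smooth_fun (UNIV <+> midx Z) (fam_dom \<epsilon> W c d \<Upsilon>) (pd (Inl ()) (fam_rep c d \<Upsilon> a))"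
    by (rule smooth_fun_pd[OF family_rep(2)[OF c d a]]) (rule InlI, simp)
  have "smooth_fun (midx Z) ?S (\<lambda>u. pd (Inl ()) (fam_rep c d \<Upsilon> a) (case_sum (\<lambda>_. 0) u))"
  proof (rule smooth_fun_compose[OF finZ fin_time S(1) family_rep(1)[OF c d] _ _ g])
    show "case_sum (\<lambda>_. 0) ` ?S \<subseteq> fam_dom \<epsilon> W c d \<Upsilon>"
      unfolding fam_dom_def using eps by fastforce
    show "smooth_fun (midx Z) ?S (\<lambda>u. case_sum (\<lambda>_. 0) u j)" for j
      using smooth_fun_const[OF finZ S(1)] smooth_fun_proj[OF finZ S(1)] by (cases j) simp_all
  qed
  then show "smooth_fun (midx Z) ?S (\<lambda>u. snd (fam_vel \<Upsilon> (chart_inv c u)) d a)"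
  proof (rule smooth_fun_congI[OF finZ S(1)])
    fix u assume "u \<in> ?S"
    then obtain z where z: "z \<in> fst c" "\<Upsilon> 0 z \<in> fst d" "u = snd c z" by blast
    show "pd (Inl ()) (fam_rep c d \<Upsilon> a) (case_sum (\<lambda>_. 0) u) = snd (fam_vel \<Upsilon> (chart_inv c u)) d a"
      unfolding z(3) chart_inv_chart[OF c z(1)] by (rule fam_vel_rep[OF d z(2) c z(1) a])
  qed
qed

text \<open>The base coordinates of the jets do not move, as all jets of the curve have source
  \<open>z\<close>. In the other coordinates the velocity is a time derivative taken after the base
  derivatives, and symmetry brings it to the inside, where it produces the components of
  \<open>fam_vel\<close>.\<close>

lemma jet_velocity_coord:
  assumes z: "z \<in> W" and cd: "(c, d) \<in> fibred_charts Y Z \<pi>" "z \<in> fst c" "\<Upsilon> 0 z \<in> fst d" and k: "k \<in> jet_idx Y Z r"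
  shows "snd (velocity (jet_mfd Y Z \<pi> r) (\<lambda>t. jet Y Z \<pi> r (\<Upsilon> t) z)) (jet_chart Y Z \<pi> r c d) k =
    (case k of Inl i \<Rightarrow> 0
     | Inr (a, \<alpha>) \<Rightarrow> pds (sorted_list_of_multiset \<alpha>) (\<lambda>u. snd (fam_vel \<Upsilon> (chart_inv c u)) d a) (snd c z))"
proof -
  note D = fibred_chartD[OF cd(1)]
  let ?\<sigma> = "\<lambda>t. jet Y Z \<pi> r (\<Upsilon> t) z" and ?jc = "jet_chart Y Z \<pi> r c d" and ?M = "jet_mfd Y Z \<pi> r"
  have jc: "?jc \<in> charts ?M" by (rule jet_chart_charts[OF cd(1)])
  have s: "smooth_curve ?M ?\<sigma>" by (rule jet_family_curve[OF z])
  have in0: "?\<sigma> 0 \<in> fst ?jc" using jet_in_jet_chart[OF family_local_section_0[OF z]] cd by simp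
  have der: "((\<lambda>t. snd ?jc (?\<sigma> t) k) has_real_derivative snd (velocity ?M ?\<sigma>) ?jc k) (at 0)"
    by (rule smooth_curve_derivative[OF premanifold_jet s jc in0]) (simp add: k)
  have evd: "eventually (\<lambda>t. \<Upsilon> t z \<in> fst d) (nhds 0)"
    by (rule smooth_curve_eventually[OF Y family_curve[OF z] D(2) cd(3)])
  have "eventually (\<lambda>t. t \<in> {-\<epsilon><..<\<epsilon>}) (nhds 0)" using eps by (intro eventually_nhds_in_open) auto
  with evd have ev: "eventually (\<lambda>t. snd ?jc (?\<sigma> t) k = jet_coord r c d (\<Upsilon> t) z k) (nhds 0)"
  proof eventually_elim
    case (elim t)
    show ?case using jet_chart_jet[OF family_local_section[OF elim(2) z] D(1) cd(2) D(2) elim(1), of r] by simp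
  qed
  have der': "((\<lambda>t. jet_coord r c d (\<Upsilon> t) z k) has_real_derivative snd (velocity ?M ?\<sigma>) ?jc k) (at 0)"
    by (rule DERIV_eventually_cong[OF der ev])
  show ?thesis
  proof (cases k)
    case (Inl i)
    have "((\<lambda>t. jet_coord r c d (\<Upsilon> t) z k) has_real_derivative 0) (at 0)"
      using k Inl by (simp add: jet_coord_def)
    then show ?thesis using DERIV_unique[OF der'] Inl by simp
  next
    case (Inr p)
    obtain a \<alpha> where p: "p = (a, \<alpha>)" by force
    have a: "a \<in> midx Y" "\<alpha> \<in> multi_idx r" using k Inr p by (auto simp: jet_idx_eq)
    let ?l = "sorted_list_of_multiset \<alpha>" and ?G = "fam_rep c d \<Upsilon> a" and ?\<Omega> = "fam_dom \<epsilon> W c d \<Upsilon>"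
    let ?w = "case_sum (\<lambda>_. 0) (snd c z) :: unit + nat \<Rightarrow> real"
    have G: "smooth_fun (UNIV <+> midx Z) ?\<Omega> ?G" by (rule family_rep(2)[OF D(1,2) a(1)])
    have w: "?w \<in> ?\<Omega>" unfolding fam_dom_def using eps z cd by fastforce
    note l = map_Inr_lists[OF a(2)]
    have "has_pd (Inl ()) (pds (map Inr ?l) ?G) (pd (Inl ()) (pds (map Inr ?l) ?G) ?w) ?w"
      by (rule smooth_fun_has_pd[OF smooth_fun_pds[OF G l] _ w]) (rule InlI, simp)
    then have "((\<lambda>t. jet_coord r c d (\<Upsilon> t) z k) has_real_derivative pd (Inl ()) (pds (map Inr ?l) ?G) ?w) (at 0)"
      unfolding has_pd_def case_sum_upd_Inl using jet_coord_family[of a \<alpha> r c d] k Inr p by simp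
    then have "snd (velocity ?M ?\<sigma>) ?jc k = pds (Inl () # map Inr ?l) ?G ?w" using DERIV_unique[OF der'] by simp
    \<comment> \<open>Moves the time derivative from the outermost to the innermost
      position.\<close>
    also have "\<dots> = pds (map Inr ?l @ [Inl ()]) ?G ?w"
      by (rule pds_mset_cong[OF fin_time family_rep(1)[OF D(1,2)] G w]) (use multi_idx_list[OF a(2)] in auto)
    also have "\<dots> = pds ?l (\<lambda>u. pd (Inl ()) ?G (case_sum (\<lambda>_. 0) u)) (snd c z)"
      unfolding pds_append pds_Inr by simp
    also have "\<dots> = pds ?l (\<lambda>u. snd (fam_vel \<Upsilon> (chart_inv c u)) d a) (snd c z)"
    proof (rule pds_cong[OF smooth_fam_vel_rep(1)[OF D(1,2) a(1)] finZ])
      show "snd c z \<in> snd c ` {z \<in> fst c \<inter> W. \<Upsilon> 0 z \<in> fst d}" using z cd by blast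
      show "?l \<in> lists (midx Z)" using multi_idx_list[OF a(2)] by blast
      fix u assume "u \<in> snd c ` {z \<in> fst c \<inter> W. \<Upsilon> 0 z \<in> fst d}"
      then obtain z where z: "z \<in> fst c" "\<Upsilon> 0 z \<in> fst d" "u = snd c z" by blast
      show "pd (Inl ()) ?G (case_sum (\<lambda>_. 0) u) = snd (fam_vel \<Upsilon> (chart_inv c u)) d a"
        unfolding z(3) chart_inv_chart[OF D(1) z(1)] by (rule fam_vel_rep[OF D(2) z(2) D(1) z(1) a(1)])
    qed
    finally show ?thesis using Inr p by simp
  qed
qed

end

lemma smooth_family_onE:
  assumes "smooth_family_on Y Z \<pi> W \<Upsilon>"
  obtains \<epsilon> where "\<epsilon> > 0" "smooth_map_on P Y ({-\<epsilon><..<\<epsilon>} \<times> W) (\<lambda>(t, z). \<Upsilon> t z)"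
    "\<And>t z. t \<in> {-\<epsilon><..<\<epsilon>} \<Longrightarrow> z \<in> W \<Longrightarrow> \<pi> (\<Upsilon> t z) = z"
  using assms unfolding smooth_family_on_def by blast

lemma smooth_fst_jet: "smooth_map_on (jet_mfd Y Z \<pi> r) Z (jet_carrier Y Z \<pi> r) fst"
  unfolding smooth_map_on_iff[OF premanifold_jet]
proof
  fix w assume w: "w \<in> jet_carrier Y Z \<pi> r"
  then obtain s where s: "local_section Y Z \<pi> (fst w) s" "w = jet Y Z \<pi> r s (fst w)" by (rule jet_carrierE)
  obtain c d where cd: "(c, d) \<in> fibred_charts Y Z \<pi>" "fst w \<in> fst c" "s (fst w) \<in> fst d"
    using fibred_chart_section[OF s(1)] by metis
  note D = fibred_chartD[OF cd(1)]
  let ?jc = "jet_chart Y Z \<pi> r c d"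
  have jc: "?jc \<in> charts (jet_mfd Y Z \<pi> r)" by (rule jet_chart_charts[OF cd(1)])
  have op: "open_coord (jet_idx Y Z r) (snd ?jc ` fst ?jc)" using chart_open[OF jc] by simp
  have "smooth_in_charts (midx (jet_mfd Y Z \<pi> r)) (midx Z) ?jc c (fst ?jc) fst"
    unfolding smooth_in_charts_def midx_jet
  proof (intro conjI ballI op)
    show "fst ` fst ?jc \<subseteq> fst c" unfolding fst_jet_chart by blast
    fix i assume i: "i \<in> midx Z"
    show "smooth_fun (jet_idx Y Z r) (snd ?jc ` fst ?jc) (\<lambda>u. snd c (fst (chart_inv ?jc u)) i)"
    proof (rule smooth_fun_congI[OF finite_jet_idx op smooth_fun_proj[OF finite_jet_idx op, of "Inl i"]])
      fix u assume "u \<in> snd ?jc ` fst ?jc"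
      then obtain w where w: "w \<in> fst ?jc" "u = snd ?jc w" by blast
      show "u (Inl i) = snd c (fst (chart_inv ?jc u)) i"
        unfolding w(2) chart_inv_chart[OF jc w(1)] using InlI[OF i, of "(midx Y - midx Z) \<times> multi_idx r"] by (simp add: jet_chart_def jet_idx_eq del: InlI)
    qed
  qed simp
  moreover have "w \<in> fst ?jc" using jet_in_jet_chart[OF s(1), of r c d] s(2) cd by simp
  moreover have "fst ?jc \<subseteq> jet_carrier Y Z \<pi> r" unfolding fst_jet_chart by blast
  ultimately show "\<exists>e\<in>charts (jet_mfd Y Z \<pi> r). \<exists>e'\<in>charts Z. \<exists>U. w \<in> U \<and> U \<subseteq> jet_carrier Y Z \<pi> r \<and>
      smooth_in_charts (midx (jet_mfd Y Z \<pi> r)) (midx Z) e e' U fst"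
    using jc D(1) by blast
qed

subsection \<open>The vertical bundle\<close>

lemma base_velocity:
  assumes cd: "(c, d) \<in> fibred_charts Y Z \<pi>" and \<sigma>: "smooth_curve Y \<sigma>" "\<sigma> 0 \<in> fst d" and i: "i \<in> midx Z"
  shows "snd (velocity Z (\<pi> \<circ> \<sigma>)) c i = snd (velocity Y \<sigma>) d i"
proof -
  note D = fibred_chartD[OF cd]
  have y: "\<sigma> 0 \<in> mcarrier Y" using \<sigma>(2) chart_subset[OF D(2)] by blast
  have iY: "i \<in> midx Y" using fibred_base_subset[OF cd \<sigma>(2)] i by blast
  have "((\<lambda>t. snd d (\<sigma> t) i) has_real_derivative snd (velocity Y \<sigma>) d i) (at 0)"
    by (rule smooth_curve_derivative[OF Y \<sigma>(1) D(2) \<sigma>(2) iY])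
  moreover have "eventually (\<lambda>t. snd d (\<sigma> t) i = snd c ((\<pi> \<circ> \<sigma>) t) i) (nhds 0)"
    by (rule eventually_mono[OF smooth_curve_eventually[OF Y \<sigma>(1) D(2) \<sigma>(2)]]) (simp add: D(4) i)
  ultimately have "((\<lambda>t. snd c ((\<pi> \<circ> \<sigma>) t) i) has_real_derivative snd (velocity Y \<sigma>) d i) (at 0)"
    by (rule DERIV_eventually_cong)
  moreover have "((\<lambda>t. snd c ((\<pi> \<circ> \<sigma>) t) i) has_real_derivative snd (velocity Z (\<pi> \<circ> \<sigma>)) c i) (at 0)"
    by (rule smooth_curve_derivative[OF Z smooth_curve_compose[OF Y Z \<sigma>(1) \<pi> y] D(1) _ i]) (use D(3)[OF \<sigma>(2)] in simp)
  ultimately show ?thesis using DERIV_unique by blast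
qed

lemma verticalE:
  assumes "v \<in> vertical Y Z \<pi>"
  obtains \<sigma> where "smooth_curve Y \<sigma>" "v = velocity Y \<sigma>" "\<sigma> 0 = fst v" "fst v \<in> mcarrier Y"
    "velocity Z (\<pi> \<circ> \<sigma>) = tvec_zero (\<pi> (fst v))"
proof -
  have v: "fst v \<in> mcarrier Y" "v \<in> tangent_space Y (fst v)" "tangent_map Y Z \<pi> v = tvec_zero (\<pi> (fst v))"
    using assms by (simp_all add: vertical_def)
  then obtain \<sigma> where \<sigma>: "v = velocity Y \<sigma>" "smooth_curve Y \<sigma>" "\<sigma> 0 = fst v" unfolding tangent_space_def by auto
  have "tangent_map Y Z \<pi> v = velocity Z (\<pi> \<circ> \<sigma>)"
    unfolding \<sigma>(1) by (rule tangent_map_velocity[OF Y Z \<sigma>(2) \<pi>]) (use v(1) \<sigma>(3) in simp)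
  then show thesis using that[OF \<sigma>(2,1,3) v(1)] v(3) by simp
qed

lemma vertical_base_zero:
  assumes v: "v \<in> vertical Y Z \<pi>" and cd: "(c, d) \<in> fibred_charts Y Z \<pi>" "fst v \<in> fst d" and i: "i \<in> midx Z"
  shows "snd v d i = 0"
proof -
  obtain \<sigma> where \<sigma>: "smooth_curve Y \<sigma>" "v = velocity Y \<sigma>" "\<sigma> 0 = fst v"
    "velocity Z (\<pi> \<circ> \<sigma>) = tvec_zero (\<pi> (fst v))" using verticalE[OF v] by metis
  have "snd (velocity Z (\<pi> \<circ> \<sigma>)) c i = snd (velocity Y \<sigma>) d i"
    by (rule base_velocity[OF cd(1) \<sigma>(1) _ i]) (use \<sigma>(3) cd(2) in simp)
  then show ?thesis using \<sigma>(2,4) by (simp add: tvec_zero_def)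
qed

lemma velocity_verticalI:
  assumes \<sigma>: "smooth_curve Y \<sigma>" and cd: "(c, d) \<in> fibred_charts Y Z \<pi>" "\<sigma> 0 \<in> fst d"
    and zero: "\<And>i. i \<in> midx Z \<Longrightarrow> snd (velocity Y \<sigma>) d i = 0"
  shows "velocity Y \<sigma> \<in> vertical Y Z \<pi>"
proof -
  note D = fibred_chartD[OF cd(1)]
  have y: "\<sigma> 0 \<in> mcarrier Y" using cd(2) chart_subset[OF D(2)] by blast
  have s: "smooth_curve Z (\<pi> \<circ> \<sigma>)" by (rule smooth_curve_compose[OF Y Z \<sigma> \<pi> y])
  have "velocity Z (\<pi> \<circ> \<sigma>) = tvec_lin 0 (velocity Z (\<pi> \<circ> \<sigma>)) 0 (velocity Z (\<pi> \<circ> \<sigma>))"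
  proof (rule velocity_lin[OF Z s s s refl refl D(1)])
    show "(\<pi> \<circ> \<sigma>) 0 \<in> fst c" using D(3)[OF cd(2)] by simp
    show "snd (velocity Z (\<pi> \<circ> \<sigma>)) c i = 0 * snd (velocity Z (\<pi> \<circ> \<sigma>)) c i + 0 * snd (velocity Z (\<pi> \<circ> \<sigma>)) c i" if "i \<in> midx Z" for i
      using base_velocity[OF cd(1) \<sigma> cd(2) that] zero[OF that] by simp
  qed
  then have "velocity Z (\<pi> \<circ> \<sigma>) = tvec_zero (\<pi> (\<sigma> 0))" by (simp add: tvec_lin_def tvec_zero_def)
  then have "tangent_map Y Z \<pi> (velocity Y \<sigma>) = tvec_zero (\<pi> (\<sigma> 0))"
    using tangent_map_velocity[OF Y Z \<sigma> \<pi> y] by simp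
  then show ?thesis using y \<sigma> by (auto simp: vertical_def tangent_space_def)
qed

text \<open>Fibre components are enough, since the base components of a vertical vector vanish in
  any fibred chart.\<close>

lemma vertical_eqI:
  assumes v: "v \<in> vertical Y Z \<pi>" "v' \<in> vertical Y Z \<pi>" and cd: "(c, d) \<in> fibred_charts Y Z \<pi>" "fst v \<in> fst d"
    and eq: "fst v = fst v'" "\<And>a. a \<in> midx Y - midx Z \<Longrightarrow> snd v d a = snd v' d a"
  shows "v = v'"
proof -
  obtain \<sigma> where \<sigma>: "smooth_curve Y \<sigma>" "v = velocity Y \<sigma>" "\<sigma> 0 = fst v" using verticalE[OF v(1)] by metis
  obtain \<sigma>' where \<sigma>': "smooth_curve Y \<sigma>'" "v' = velocity Y \<sigma>'" "\<sigma>' 0 = fst v'" using verticalE[OF v(2)] by metis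
  have "snd v d i = snd v' d i" if "i \<in> midx Y" for i
    using vertical_base_zero[OF v(1) cd] vertical_base_zero[OF v(2) cd(1)] cd(2) eq that by (cases "i \<in> midx Z") auto
  then show ?thesis unfolding \<sigma>(2) \<sigma>'(2)
    by (intro velocity_eqI[OF Y \<sigma>(1) \<sigma>'(1) _ fibred_chartD(2)[OF cd(1)]]) (use \<sigma> \<sigma>' cd eq in simp_all)
qed

lemma vertical_exists:
  assumes cd: "(c, d) \<in> fibred_charts Y Z \<pi>" "y \<in> fst d" and \<beta>: "\<beta> \<in> coord_space (midx Y - midx Z)"
  obtains v where "v \<in> vertical Y Z \<pi>" "fst v = y" "\<And>a. a \<in> midx Y \<Longrightarrow> snd v d a = \<beta> a"
proof -
  note D = fibred_chartD[OF cd(1)]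
  have b: "\<beta> \<in> coord_space (midx Y)" using \<beta> by (auto simp: coord_space_def)
  define \<sigma> where "\<sigma> = (\<lambda>t. chart_inv d (\<lambda>i. snd d y i + t * \<beta> i))"
  have \<sigma>: "smooth_curve Y \<sigma>" "\<sigma> 0 = y" "\<And>i. i \<in> midx Y \<Longrightarrow> snd (velocity Y \<sigma>) d i = \<beta> i"
    unfolding \<sigma>_def using coordinate_line[OF Y D(2) cd(2) b] by blast+
  have "velocity Y \<sigma> \<in> vertical Y Z \<pi>"
  proof (rule velocity_verticalI[OF \<sigma>(1) cd(1)])
    fix i assume "i \<in> midx Z"
    then show "snd (velocity Y \<sigma>) d i = 0"
      using \<sigma>(3)[of i] fibred_base_subset[OF cd] \<beta> by (auto simp: coord_space_def)
  qed (use \<sigma>(2) cd in simp)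
  then show thesis using that[of "velocity Y \<sigma>"] \<sigma> by simp
qed

section \<open>Charts of the vertical bundle\<close>

definition vert_chart :: "('y, nat) chart \<Rightarrow> (('y, nat) tvec, nat + nat) chart" where
  "vert_chart d = ({v \<in> vertical Y Z \<pi>. fst v \<in> fst d},
     \<lambda>v. case_sum (snd d (fst v)) (\<lambda>a. if a \<in> midx Y - midx Z then snd v d a else 0))"

lemma fst_vert_chart: "fst (vert_chart d) = {v \<in> vertical Y Z \<pi>. fst v \<in> fst d}"
  and snd_vert_chart: "snd (vert_chart d) v = case_sum (snd d (fst v)) (\<lambda>a. if a \<in> midx Y - midx Z then snd v d a else 0)"
  by (simp_all add: vert_chart_def)

lemma midx_vert [simp]: "midx (vert_mfd Y Z \<pi>) = midx Y <+> (midx Y - midx Z)"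
  and mcarrier_vert [simp]: "mcarrier (vert_mfd Y Z \<pi>) = vertical Y Z \<pi>"
  and matlas_vert: "matlas (vert_mfd Y Z \<pi>) = {vert_chart d | c d. (c, d) \<in> fibred_charts Y Z \<pi>}"
  by (simp_all add: vert_mfd_def vert_chart_def)

lemma vert_chart_image:
  assumes cd: "(c, d) \<in> fibred_charts Y Z \<pi>" and V: "V \<subseteq> fst d"
  shows "snd (vert_chart d) ` {v \<in> vertical Y Z \<pi>. fst v \<in> V} =
    {\<zeta>. \<zeta> \<circ> Inl \<in> snd d ` V \<and> \<zeta> \<circ> Inr \<in> coord_space (midx Y - midx Z)}"
proof (intro Set.set_eqI iffI)
  fix \<zeta> assume "\<zeta> \<in> snd (vert_chart d) ` {v \<in> vertical Y Z \<pi>. fst v \<in> V}"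
  then obtain v where "fst v \<in> V" "\<zeta> = snd (vert_chart d) v" by blast
  then show "\<zeta> \<in> {\<zeta>. \<zeta> \<circ> Inl \<in> snd d ` V \<and> \<zeta> \<circ> Inr \<in> coord_space (midx Y - midx Z)}"
    unfolding snd_vert_chart by (auto simp: case_sum_o_inj coord_space_def)
next
  fix \<zeta> assume \<zeta>: "\<zeta> \<in> {\<zeta>. \<zeta> \<circ> Inl \<in> snd d ` V \<and> \<zeta> \<circ> Inr \<in> coord_space (midx Y - midx Z)}"
  then obtain y where y: "y \<in> V" "\<zeta> \<circ> Inl = snd d y" by blast
  have yd: "y \<in> fst d" and b: "\<zeta> \<circ> Inr \<in> coord_space (midx Y - midx Z)" using y V \<zeta> by blast+
  obtain v where v: "v \<in> vertical Y Z \<pi>" "fst v = y" "\<And>a. a \<in> midx Y \<Longrightarrow> snd v d a = (\<zeta> \<circ> Inr) a"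
    using vertical_exists[OF cd yd b] by metis
  have "(\<lambda>a. if a \<in> midx Y - midx Z then snd v d a else 0) = \<zeta> \<circ> Inr"
    using v(3) b by (auto simp: coord_space_def fun_eq_iff)
  then have "snd (vert_chart d) v = \<zeta>" unfolding snd_vert_chart v(2) y(2)[symmetric] by (simp add: case_sum_comp)
  then show "\<zeta> \<in> snd (vert_chart d) ` {v \<in> vertical Y Z \<pi>. fst v \<in> V}" using v y by blast
qed

lemma inj_on_vert_chart:
  assumes cd: "(c, d) \<in> fibred_charts Y Z \<pi>"
  shows "inj_on (snd (vert_chart d)) (fst (vert_chart d))"
proof (rule inj_onI)
  fix v v' assume v: "v \<in> fst (vert_chart d)" "v' \<in> fst (vert_chart d)" and eq: "snd (vert_chart d) v = snd (vert_chart d) v'"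
  have v1: "v \<in> vertical Y Z \<pi>" "v' \<in> vertical Y Z \<pi>" "fst v \<in> fst d" "fst v' \<in> fst d"
    using v unfolding fst_vert_chart by blast+
  have "snd d (fst v) = snd d (fst v')"
    and c: "(\<lambda>a. if a \<in> midx Y - midx Z then snd v d a else 0) = (\<lambda>a. if a \<in> midx Y - midx Z then snd v' d a else 0)"
    using eq unfolding snd_vert_chart case_sum_eq_iff by blast+
  then have f: "fst v = fst v'" using inj_onD[OF chart_inj[OF fibred_chartD(2)[OF cd]] _ v1(3,4)] by simp
  show "v = v'"
  proof (rule vertical_eqI[OF v1(1,2) cd v1(3) f])
    fix a assume "a \<in> midx Y - midx Z"
    then show "snd v d a = snd v' d a" using fun_cong[OF c, of a] by simp
  qed
qed

text \<open>Fibre components transform linearly, with Jacobian entries that are smooth functions of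
  the base point of the vector. The sum over all coordinates shrinks to the fibre coordinates
  because the base components are zero.\<close>

lemma vert_chart_transition:
  assumes cd: "(c, d) \<in> fibred_charts Y Z \<pi>" and cd': "(c', d') \<in> fibred_charts Y Z \<pi>"
  shows "smooth_transition (midx Y <+> (midx Y - midx Z)) (vert_chart d) (vert_chart d')"
proof -
  let ?F = "midx Y - midx Z" and ?V = "fst d \<inter> fst d'"
  let ?J = "midx Y <+> ?F" and ?e = "vert_chart d" and ?e' = "vert_chart d'"
  note D = fibred_chartD[OF cd] and D' = fibred_chartD[OF cd']
  have finJ: "finite ?J" using finY by simp
  have td: "smooth_in_charts (midx Y) (midx Y) d d' ?V id" by (rule charts_transition[OF Y D(2) D'(2)])
  then have oV: "open_coord (midx Y) (snd d ` ?V)"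
    and tds: "\<And>i. i \<in> midx Y \<Longrightarrow> smooth_fun (midx Y) (snd d ` ?V) (\<lambda>u. snd d' (chart_inv d u) i)"
    by (simp_all add: smooth_in_charts_def)
  define S where "S = {\<zeta>. \<zeta> \<circ> Inl \<in> snd d ` ?V \<and> \<zeta> \<circ> Inr \<in> coord_space ?F}"
  have inter: "fst ?e \<inter> fst ?e' = {v \<in> vertical Y Z \<pi>. fst v \<in> ?V}" unfolding fst_vert_chart by blast
  have im: "snd ?e ` (fst ?e \<inter> fst ?e') = S" unfolding inter S_def by (rule vert_chart_image[OF cd]) blast
  have topF: "open_coord ?F (coord_space ?F)" by (simp add: open_coord_def)
  have S: "open_coord ?J S" unfolding S_def by (rule open_coord_Plus[OF oV topF])
  have re: "smooth_fun ?J S (\<lambda>\<zeta>. f (\<zeta> \<circ> Inl))" if "smooth_fun (midx Y) (snd d ` ?V) f" for f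
    by (rule smooth_fun_reindex[OF finY finJ oV S that]) (simp add: S_def)
  have "smooth_fun ?J S (\<lambda>\<zeta>. snd ?e' (chart_inv ?e \<zeta>) k)" if k: "k \<in> ?J" for k
  proof -
    have inv: "chart_inv ?e (snd ?e v) = v" if "v \<in> vertical Y Z \<pi>" "fst v \<in> ?V" for v
      by (rule inv_into_f_f[OF inj_on_vert_chart[OF cd]]) (use that in \<open>simp add: fst_vert_chart\<close>)
    have SE: "\<exists>v\<in>vertical Y Z \<pi>. fst v \<in> ?V \<and> \<zeta> = snd ?e v" if "\<zeta> \<in> S" for \<zeta>
      using that unfolding im[symmetric] inter by blast
    show ?thesis
    proof (cases k)
      case (Inl i)
      then have i: "i \<in> midx Y" using k by auto
      show ?thesis
      proof (rule smooth_fun_congI[OF finJ S re[OF tds[OF i]]])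
        fix \<zeta> assume "\<zeta> \<in> S"
        then obtain v where v: "v \<in> vertical Y Z \<pi>" "fst v \<in> ?V" "\<zeta> = snd ?e v" using SE by blast
        have "snd ?e v \<circ> Inl = snd d (fst v)" by (simp add: snd_vert_chart case_sum_o_inj)
        moreover have "chart_inv d (snd d (fst v)) = fst v" using v(2) by (intro chart_inv_chart[OF D(2)]) blast
        ultimately show "snd d' (chart_inv d (\<zeta> \<circ> Inl)) i = snd ?e' (chart_inv ?e \<zeta>) k"
          unfolding v(3) inv[OF v(1,2)] Inl by (simp add: snd_vert_chart)
      qed
    next
      case (Inr a)
      then have a: "a \<in> midx Y" "a \<in> ?F" using k by auto
      let ?D = "\<lambda>b. pd b (\<lambda>u. snd d' (chart_inv d u) a)"
      have "smooth_fun ?J S (\<lambda>\<zeta>. \<Sum>b\<in>?F. ?D b (\<zeta> \<circ> Inl) * \<zeta> (Inr b))"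
      proof (intro smooth_fun_sum[OF finJ S] smooth_fun_mult[OF finJ S] smooth_fun_proj[OF finJ S])
        fix b assume "b \<in> ?F"
        then show "smooth_fun ?J S (\<lambda>\<zeta>. ?D b (\<zeta> \<circ> Inl))" by (intro re smooth_fun_pd tds a(1)) blast
      qed
      then show ?thesis
      proof (rule smooth_fun_congI[OF finJ S])
        fix \<zeta> assume "\<zeta> \<in> S"
        then obtain v where v: "v \<in> vertical Y Z \<pi>" "fst v \<in> ?V" "\<zeta> = snd ?e v" using SE by blast
        obtain \<sigma> where \<sigma>: "smooth_curve Y \<sigma>" "v = velocity Y \<sigma>" "\<sigma> 0 = fst v" using verticalE[OF v(1)] by metis
        have fv: "fst v \<in> fst d" "fst v \<in> fst d'" using v(2) by blast+
        have "snd v d' a = (\<Sum>b\<in>midx Y. ?D b (snd d (fst v)) * snd v d b)"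
        proof -
          have "\<sigma> 0 \<in> fst d" "\<sigma> 0 \<in> fst d'" unfolding \<sigma>(3) by (rule fv)+
          from velocity_transform[OF Y \<sigma>(1) D(2) this(1) D'(2) this(2) a(1)] show ?thesis
            unfolding \<sigma>(2)[symmetric] \<sigma>(3) .
        qed
        also have "\<dots> = (\<Sum>b\<in>?F. ?D b (snd d (fst v)) * snd v d b)"
          by (rule sum.mono_neutral_right[OF finY]) (use vertical_base_zero[OF v(1) cd fv(1)] in auto)
        also have "\<dots> = (\<Sum>b\<in>?F. ?D b (\<zeta> \<circ> Inl) * \<zeta> (Inr b))"
          unfolding v(3) by (rule sum.cong[OF refl]) (simp add: snd_vert_chart case_sum_o_inj)
        finally show "(\<Sum>b\<in>?F. ?D b (\<zeta> \<circ> Inl) * \<zeta> (Inr b)) = snd ?e' (chart_inv ?e \<zeta>) k"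
          unfolding v(3) inv[OF v(1,2)] Inr using a by (simp add: snd_vert_chart)
      qed
    qed
  qed
  then show ?thesis unfolding smooth_transition_def im using S by blast
qed

lemma vert_chart_charts:
  assumes cd: "(c, d) \<in> fibred_charts Y Z \<pi>"
  shows "vert_chart d \<in> charts (vert_mfd Y Z \<pi>)"
proof -
  have "smooth_transition (midx Y <+> (midx Y - midx Z)) (vert_chart d) (vert_chart d)" by (rule vert_chart_transition[OF cd cd])
  then have "open_coord (midx Y <+> (midx Y - midx Z)) (snd (vert_chart d) ` fst (vert_chart d))" by (simp add: smooth_transition_def)
  then have "is_chart (vert_mfd Y Z \<pi>) (vert_chart d)"
    unfolding is_chart_def using inj_on_vert_chart[OF cd] by (auto simp: fst_vert_chart)
  moreover have "smooth_transition (midx (vert_mfd Y Z \<pi>)) (vert_chart d) e \<and> smooth_transition (midx (vert_mfd Y Z \<pi>)) e (vert_chart d)"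
    if e: "e \<in> matlas (vert_mfd Y Z \<pi>)" for e
  proof -
    obtain c' d' where e: "e = vert_chart d'" "(c', d') \<in> fibred_charts Y Z \<pi>" using e unfolding matlas_vert by blast
    show ?thesis unfolding e(1) midx_vert using vert_chart_transition[OF cd e(2)] vert_chart_transition[OF e(2) cd] by blast
  qed
  ultimately show ?thesis by (simp add: charts_def)
qed

lemma premanifold_vert: "premanifold (vert_mfd Y Z \<pi>)"
  unfolding premanifold_def
proof (intro conjI)
  show "finite (midx (vert_mfd Y Z \<pi>))" using finY by simp
  show "matlas (vert_mfd Y Z \<pi>) \<subseteq> charts (vert_mfd Y Z \<pi>)" unfolding matlas_vert using vert_chart_charts by blast
  show "(\<Union>c\<in>matlas (vert_mfd Y Z \<pi>). fst c) = mcarrier (vert_mfd Y Z \<pi>)"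
  proof (intro equalityI subsetI)
    fix v assume "v \<in> mcarrier (vert_mfd Y Z \<pi>)"
    then have v: "v \<in> vertical Y Z \<pi>" by simp
    then have "fst v \<in> mcarrier Y" by (rule verticalE)
    then obtain c d where cd: "(c, d) \<in> fibred_charts Y Z \<pi>" "fst v \<in> fst d" using fibred_chart_at by metis
    then have "v \<in> fst (vert_chart d)" using v by (simp add: fst_vert_chart)
    then show "v \<in> (\<Union>c\<in>matlas (vert_mfd Y Z \<pi>). fst c)" unfolding matlas_vert using cd(1) by blast
  next
    fix v assume "v \<in> (\<Union>c\<in>matlas (vert_mfd Y Z \<pi>). fst c)"
    then obtain d where "v \<in> fst (vert_chart d)" unfolding matlas_vert by blast
    then show "v \<in> mcarrier (vert_mfd Y Z \<pi>)" by (simp add: fst_vert_chart)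
  qed
qed

subsection \<open>The isomorphism between vertical vectors of the jet manifold and jets of vertical vectors\<close>

lemma vert_chart_fam_vel:
  "snd (vert_chart d) (fam_vel \<Upsilon> z) = case_sum (snd d (\<Upsilon> 0 z)) (\<lambda>a. if a \<in> midx Y - midx Z then snd (fam_vel \<Upsilon> z) d a else 0)"
  by (simp add: snd_vert_chart)

context
  fixes \<Upsilon> :: "real \<Rightarrow> 'z \<Rightarrow> 'y" and W :: "'z set" and \<epsilon> :: real
  assumes W: "openin (mtop Z) W" and eps: "\<epsilon> > 0"
    and sm: "smooth_map_on P Y ({-\<epsilon><..<\<epsilon>} \<times> W) (\<lambda>(t, z). \<Upsilon> t z)"
    and sec: "\<And>t z. t \<in> {-\<epsilon><..<\<epsilon>} \<Longrightarrow> z \<in> W \<Longrightarrow> \<pi> (\<Upsilon> t z) = z"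
begin

lemma fam_vel_vertical:
  assumes z: "z \<in> W"
  shows "fam_vel \<Upsilon> z \<in> vertical Y Z \<pi>"
proof -
  obtain c d where cd: "(c, d) \<in> fibred_charts Y Z \<pi>" "z \<in> fst c" "\<Upsilon> 0 z \<in> fst d"
    using fibred_chart_section[OF family_local_section_0[OF W eps sm sec z]] by blast
  note D = fibred_chartD[OF cd(1)]
  have s: "smooth_curve Y (\<lambda>t. \<Upsilon> t z)" by (rule family_curve[OF W eps sm sec z])
  show ?thesis unfolding fam_vel_def
  proof (rule velocity_verticalI[OF s cd(1) cd(3)])
    fix i assume i: "i \<in> midx Z"
    then have iY: "i \<in> midx Y" using fibred_base_subset[OF cd(1,3)] by blast
    have "((\<lambda>t. snd d (\<Upsilon> t z) i) has_real_derivative snd (velocity Y (\<lambda>t. \<Upsilon> t z)) d i) (at 0)"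
      by (rule smooth_curve_derivative[OF Y s D(2) cd(3) iY])
    moreover have "eventually (\<lambda>t. snd d (\<Upsilon> t z) i = snd c z i) (nhds 0)"
    proof -
      have "eventually (\<lambda>t. t \<in> {-\<epsilon><..<\<epsilon>}) (nhds 0)" using eps by (intro eventually_nhds_in_open) auto
      with smooth_curve_eventually[OF Y s D(2) cd(3)] show ?thesis
        by eventually_elim (simp add: D(4) i sec z)
    qed
    ultimately have "((\<lambda>t. snd c z i) has_real_derivative snd (velocity Y (\<lambda>t. \<Upsilon> t z)) d i) (at 0)"
      by (rule DERIV_eventually_cong)
    then show "snd (velocity Y (\<lambda>t. \<Upsilon> t z)) d i = 0" using DERIV_unique DERIV_const by blast
  qed
qed

lemma smooth_fam_vel: "smooth_map_on Z (vert_mfd Y Z \<pi>) W (fam_vel \<Upsilon>)"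
  unfolding smooth_map_on_iff[OF Z]
proof
  fix z assume z: "z \<in> W"
  obtain c d where cd: "(c, d) \<in> fibred_charts Y Z \<pi>" "z \<in> fst c" "\<Upsilon> 0 z \<in> fst d"
    using fibred_chart_section[OF family_local_section_0[OF W eps sm sec z]] by blast
  note D = fibred_chartD[OF cd(1)]
  let ?U = "{z \<in> fst c \<inter> W. \<Upsilon> 0 z \<in> fst d}"
  have s0: "smooth_map_on Z Y W (\<Upsilon> 0)" using family_slice[OF W eps sm sec, of 0] eps by simp
  have op: "open_coord (midx Z) (snd c ` ?U)"
    using smooth_map_on_in_charts[OF Z Y s0 D(1,2)] by (simp add: smooth_in_charts_def)
  note sf = smooth_fam_vel_rep[OF W eps sm sec D(1,2)]
  have "smooth_in_charts (midx Z) (midx (vert_mfd Y Z \<pi>)) c (vert_chart d) ?U (fam_vel \<Upsilon>)"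
    unfolding smooth_in_charts_def midx_vert
  proof (intro conjI ballI op)
    show "fam_vel \<Upsilon> ` ?U \<subseteq> fst (vert_chart d)"
      unfolding fst_vert_chart using fam_vel_vertical by (auto simp: fam_vel_def)
    fix k assume k: "k \<in> midx Y <+> (midx Y - midx Z)"
    show "smooth_fun (midx Z) (snd c ` ?U) (\<lambda>u. snd (vert_chart d) (fam_vel \<Upsilon> (chart_inv c u)) k)"
    proof (cases k)
      case (Inl i)
      then have "i \<in> midx Y" using k by auto
      then show ?thesis unfolding vert_chart_fam_vel Inl using sf(2) by simp
    next
      case (Inr a)
      then have "a \<in> midx Y" "a \<in> midx Y - midx Z" using k by auto
      then show ?thesis unfolding vert_chart_fam_vel Inr using sf(3)[of a] by simp
    qed
  qed auto
  moreover have "z \<in> ?U" using z cd by blast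
  ultimately show "\<exists>c\<in>charts Z. \<exists>e\<in>charts (vert_mfd Y Z \<pi>). \<exists>U. z \<in> U \<and> U \<subseteq> W \<and>
      smooth_in_charts (midx Z) (midx (vert_mfd Y Z \<pi>)) c e U (fam_vel \<Upsilon>)"
    using D(1) vert_chart_charts[OF cd(1)] by (intro bexI[of _ c] bexI[of _ "vert_chart d"] exI[of _ ?U]) auto
qed

lemma fam_vel_local_section: "z \<in> W \<Longrightarrow> local_section (vert_mfd Y Z \<pi>) Z (\<pi> \<circ> fst) z (fam_vel \<Upsilon>)"
  unfolding local_section_def using W smooth_fam_vel sec[of 0] eps
  by (intro exI[of _ W]) (simp add: fam_vel_def)

text \<open>The projected curve is constant, all its jets having source \<open>z\<close>.\<close>

lemma jet_family_vertical:
  assumes z: "z \<in> W"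
  shows "velocity (jet_mfd Y Z \<pi> r) (\<lambda>t. jet Y Z \<pi> r (\<Upsilon> t) z) \<in> jet_vertical Y Z \<pi> r"
proof -
  let ?\<sigma> = "\<lambda>t. jet Y Z \<pi> r (\<Upsilon> t) z" and ?M = "jet_mfd Y Z \<pi> r"
  have s: "smooth_curve ?M ?\<sigma>" by (rule jet_family_curve[OF W eps sm sec z])
  have c: "?\<sigma> 0 \<in> jet_carrier Y Z \<pi> r" using jet_in_jet_carrier[OF family_local_section_0[OF W eps sm sec z]] .
  have "tangent_map ?M Z fst (velocity ?M ?\<sigma>) = velocity Z (fst \<circ> ?\<sigma>)"
    by (rule tangent_map_velocity[OF premanifold_jet Z s smooth_fst_jet c])
  also have "\<dots> = tvec_zero z" by (simp add: velocity_def tvec_zero_def o_def fun_eq_iff)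
  finally show ?thesis using c s by (auto simp: jet_vertical_def vertical_def tangent_space_def)
qed

end

text \<open>
  Both sides compare the same mixed derivatives of the families in fibred coordinates, once in time and up
  to order \<open>r\<close> along the base; only the order of differentiation differs.
\<close>

lemma same_jet_fam_vel_iff:
  assumes f1: "openin (mtop Z) W1" "\<epsilon>1 > 0" "smooth_map_on P Y ({-\<epsilon>1<..<\<epsilon>1} \<times> W1) (\<lambda>(t, z). \<Upsilon>1 t z)"
      "\<And>t z. t \<in> {-\<epsilon>1<..<\<epsilon>1} \<Longrightarrow> z \<in> W1 \<Longrightarrow> \<pi> (\<Upsilon>1 t z) = z" "z \<in> W1"
    and f2: "openin (mtop Z) W2" "\<epsilon>2 > 0" "smooth_map_on P Y ({-\<epsilon>2<..<\<epsilon>2} \<times> W2) (\<lambda>(t, z). \<Upsilon>2 t z)"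
      "\<And>t z. t \<in> {-\<epsilon>2<..<\<epsilon>2} \<Longrightarrow> z \<in> W2 \<Longrightarrow> \<pi> (\<Upsilon>2 t z) = z" "z \<in> W2"
  shows "velocity (jet_mfd Y Z \<pi> r) (\<lambda>t. jet Y Z \<pi> r (\<Upsilon>1 t) z) = velocity (jet_mfd Y Z \<pi> r) (\<lambda>t. jet Y Z \<pi> r (\<Upsilon>2 t) z)
    \<longleftrightarrow> same_jet (vert_mfd Y Z \<pi>) Z r z (fam_vel \<Upsilon>1) (fam_vel \<Upsilon>2)" (is "?v1 = ?v2 \<longleftrightarrow> ?R")
proof -
  have l1: "local_section Y Z \<pi> z (\<Upsilon>1 0)" by (rule family_local_section_0[OF f1])
  have l2: "local_section Y Z \<pi> z (\<Upsilon>2 0)" by (rule family_local_section_0[OF f2])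
  obtain c d where cd: "(c, d) \<in> fibred_charts Y Z \<pi>" "z \<in> fst c" "\<Upsilon>1 0 z \<in> fst d"
    using fibred_chart_section[OF l1] by blast
  note D = fibred_chartD[OF cd(1)]
  let ?jc = "jet_chart Y Z \<pi> r c d" and ?M = "jet_mfd Y Z \<pi> r" and ?V = "vert_mfd Y Z \<pi>"
  have s1: "smooth_map_on Z Y W1 (\<Upsilon>1 0)" using family_slice[OF f1(1-4), of 0] f1(2) by simp
  have s2: "smooth_map_on Z Y W2 (\<Upsilon>2 0)" using family_slice[OF f2(1-4), of 0] f2(2) by simp
  have c1: "snd ?v1 ?jc k = (case k of Inl i \<Rightarrow> 0
     | Inr (a, \<alpha>) \<Rightarrow> pds (sorted_list_of_multiset \<alpha>) (\<lambda>u. snd (fam_vel \<Upsilon>1 (chart_inv c u)) d a) (snd c z))" if "\<Upsilon>1 0 z \<in> fst d" "k \<in> jet_idx Y Z r" for k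
    by (rule jet_velocity_coord[OF f1 cd(1,2) that])
  have c2: "snd ?v2 ?jc k = (case k of Inl i \<Rightarrow> 0
     | Inr (a, \<alpha>) \<Rightarrow> pds (sorted_list_of_multiset \<alpha>) (\<lambda>u. snd (fam_vel \<Upsilon>2 (chart_inv c u)) d a) (snd c z))" if "\<Upsilon>2 0 z \<in> fst d" "k \<in> jet_idx Y Z r" for k
    by (rule jet_velocity_coord[OF f2 cd(1,2) that])
  show ?thesis
  proof
    assume eq: "?v1 = ?v2"
    from arg_cong[OF eq, of fst] have "jet Y Z \<pi> r (\<Upsilon>1 0) z = jet Y Z \<pi> r (\<Upsilon>2 0) z"
      unfolding fst_velocity .
    then have sj: "same_jet Y Z r z (\<Upsilon>1 0) (\<Upsilon>2 0)" by (rule jet_eqD(2)) (rule l2)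
    then have e0: "\<Upsilon>1 0 z = \<Upsilon>2 0 z" by (simp add: same_jet_def)
    have d2: "\<Upsilon>2 0 z \<in> fst d" using e0 cd(3) by simp
    have comp: "pds l (\<lambda>u. snd (fam_vel \<Upsilon>1 (chart_inv c u)) d a) (snd c z) = pds l (\<lambda>u. snd (fam_vel \<Upsilon>2 (chart_inv c u)) d a) (snd c z)"
      if a: "a \<in> midx Y" "a \<notin> midx Z" and l: "l \<in> lists (midx Z)" "length l \<le> r" for a l
    proof -
      let ?l = "sorted_list_of_multiset (mset l)"
      have k: "Inr (a, mset l) \<in> jet_idx Y Z r"
        unfolding jet_idx_eq using a list_multi_idx[OF l] by (intro InrI SigmaI DiffI)
      have p: "pds l f (snd c z) = pds ?l f (snd c z)"
        if "smooth_fun (midx Z) (snd c ` U) f" "open_coord (midx Z) (snd c ` U)" "z \<in> U" for f U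
        by (rule pds_mset_cong[OF finZ that(2,1)]) (use that(3) l in auto)
      have "pds ?l (\<lambda>u. snd (fam_vel \<Upsilon>1 (chart_inv c u)) d a) (snd c z) = pds ?l (\<lambda>u. snd (fam_vel \<Upsilon>2 (chart_inv c u)) d a) (snd c z)"
        using c1[OF cd(3) k] c2[OF d2 k] eq by simp
      then show ?thesis
        using p[OF smooth_fam_vel_rep(3)[OF f1(1-4) D(1,2) a(1)] smooth_fam_vel_rep(1)[OF f1(1-4) D(1,2) a(1)]]
          p[OF smooth_fam_vel_rep(3)[OF f2(1-4) D(1,2) a(1)] smooth_fam_vel_rep(1)[OF f2(1-4) D(1,2) a(1)]]
          cd(2,3) d2 f1(5) f2(5) by simp
    qed
    have e: "fam_vel \<Upsilon>1 z = fam_vel \<Upsilon>2 z"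
    proof (rule vertical_eqI[OF fam_vel_vertical[OF f1] fam_vel_vertical[OF f2] cd(1)])
      show "fst (fam_vel \<Upsilon>1 z) \<in> fst d" "fst (fam_vel \<Upsilon>1 z) = fst (fam_vel \<Upsilon>2 z)"
        using cd(3) e0 by (simp_all add: fam_vel_def)
      fix a assume "a \<in> midx Y - midx Z"
      then show "snd (fam_vel \<Upsilon>1 z) d a = snd (fam_vel \<Upsilon>2 z) d a"
        using comp[of a "[]"] chart_inv_chart[OF D(1) cd(2)] by simp
    qed
    show ?R
    proof (rule same_jet_chartI[OF Z premanifold_vert smooth_fam_vel[OF f1(1-4)] f1(5) smooth_fam_vel[OF f2(1-4)] f2(5) e
          D(1) cd(2) vert_chart_charts[OF cd(1)]])
      show "fam_vel \<Upsilon>1 z \<in> fst (vert_chart d)"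
        using fam_vel_vertical[OF f1] cd(3) by (simp add: fst_vert_chart fam_vel_def)
      fix k assume k: "k \<in> midx ?V"
      show "jet_eq (midx Z) r (snd c z) (\<lambda>x. snd (vert_chart d) (fam_vel \<Upsilon>1 (chart_inv c x)) k)
          (\<lambda>x. snd (vert_chart d) (fam_vel \<Upsilon>2 (chart_inv c x)) k)"
      proof (cases k)
        case (Inl i)
        then have "i \<in> midx Y" using k by auto
        then show ?thesis using sj D(1,2) cd(2,3) Inl unfolding same_jet_iff vert_chart_fam_vel by simp
      next
        case (Inr a)
        then have a: "a \<in> midx Y" "a \<notin> midx Z" using k by auto
        then show ?thesis unfolding vert_chart_fam_vel Inr jet_eq_def using comp[OF a] by simp
      qed
    qed
  next
    assume sj: ?R
    then have "fam_vel \<Upsilon>1 z = fam_vel \<Upsilon>2 z" by (simp add: same_jet_def)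
    from arg_cong[OF this, of fst] have e0: "\<Upsilon>1 0 z = \<Upsilon>2 0 z" unfolding fst_fam_vel .
    have d2: "\<Upsilon>2 0 z \<in> fst d" using e0 cd(3) by simp
    have v1: "fam_vel \<Upsilon>1 z \<in> fst (vert_chart d)"
      using fam_vel_vertical[OF f1] cd(3) by (simp add: fst_vert_chart fam_vel_def)
    have je: "jet_eq (midx Z) r (snd c z) (\<lambda>x. snd (vert_chart d) (fam_vel \<Upsilon>1 (chart_inv c x)) k)
          (\<lambda>x. snd (vert_chart d) (fam_vel \<Upsilon>2 (chart_inv c x)) k)" if "k \<in> midx ?V" for k
      using sj that D(1) cd(2) vert_chart_charts[OF cd(1)] v1 unfolding same_jet_iff by blast
    \<comment> \<open>The \<open>Inl\<close> coordinates of \<open>VY\<close> are those of the base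
      point, so a jet of \<open>fam_vel\<close> contains the jet of the underlying section.\<close>
    have "same_jet Y Z r z (\<Upsilon>1 0) (\<Upsilon>2 0)"
    proof (rule same_jet_chartI[OF Z Y s1 f1(5) s2 f2(5) e0 D(1) cd(2) D(2) cd(3)])
      fix i assume i: "i \<in> midx Y"
      show "jet_eq (midx Z) r (snd c z) (\<lambda>x. snd d (\<Upsilon>1 0 (chart_inv c x)) i) (\<lambda>x. snd d (\<Upsilon>2 0 (chart_inv c x)) i)"
        using je[of "Inl i", unfolded midx_vert, OF InlI[OF i]] unfolding vert_chart_fam_vel by simp
    qed
    \<comment> \<open>Velocities carry their base point; components can be compared only once the
      jets at time 0 are known to coincide.\<close>
    then have j0: "jet Y Z \<pi> r (\<Upsilon>1 0) z = jet Y Z \<pi> r (\<Upsilon>2 0) z" by (rule jet_eqI)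
    show "?v1 = ?v2"
    proof (rule velocity_eqI[OF premanifold_jet jet_family_curve[OF f1] jet_family_curve[OF f2] j0[symmetric] jet_chart_charts[OF cd(1)]])
      show "jet Y Z \<pi> r (\<Upsilon>1 0) z \<in> fst ?jc" using jet_in_jet_chart[OF l1] cd by simp
      fix k assume k: "k \<in> midx ?M"
      then have k': "k \<in> jet_idx Y Z r" by simp
      show "snd ?v1 ?jc k = snd ?v2 ?jc k"
        unfolding c1[OF cd(3) k'] c2[OF d2 k']
      proof (cases k)
        case (Inr p)
        obtain a \<alpha> where p: "p = (a, \<alpha>)" by force
        have a: "a \<in> midx Y" "a \<notin> midx Z" "\<alpha> \<in> multi_idx r" using k' Inr p by (auto simp: jet_idx_eq)
        have "Inr a \<in> midx ?V" unfolding midx_vert using a by (intro InrI DiffI)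
        from je[OF this] show "(case k of Inl i \<Rightarrow> 0 | Inr (a, \<alpha>) \<Rightarrow> pds (sorted_list_of_multiset \<alpha>) (\<lambda>u. snd (fam_vel \<Upsilon>1 (chart_inv c u)) d a) (snd c z)) =
          (case k of Inl i \<Rightarrow> 0 | Inr (a, \<alpha>) \<Rightarrow> pds (sorted_list_of_multiset \<alpha>) (\<lambda>u. snd (fam_vel \<Upsilon>2 (chart_inv c u)) d a) (snd c z))"
          unfolding vert_chart_fam_vel jet_eq_def Inr p using a multi_idx_list[OF a(3)] by simp
      qed simp
    qed
  qed
qed

text \<open>\<open>jet_is\<close> picks some family with the given velocity. By one direction of
  \<open>same_jet_fam_vel_iff\<close> all such families produce the same jet of vertical
  vectors.\<close>

lemma jet_is_family:
  assumes f: "openin (mtop Z) W" "\<epsilon> > 0" "smooth_map_on P Y ({-\<epsilon><..<\<epsilon>} \<times> W) (\<lambda>(t, z). \<Upsilon> t z)"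
      "\<And>t z. t \<in> {-\<epsilon><..<\<epsilon>} \<Longrightarrow> z \<in> W \<Longrightarrow> \<pi> (\<Upsilon> t z) = z" "z \<in> W"
  shows "jet_is Y Z \<pi> r (velocity (jet_mfd Y Z \<pi> r) (\<lambda>t. jet Y Z \<pi> r (\<Upsilon> t) z)) =
    jet (vert_mfd Y Z \<pi>) Z (\<pi> \<circ> fst) r (fam_vel \<Upsilon>) z"
  unfolding jet_is_def fam_vel_def[symmetric]
proof (rule some_equality)
  let ?v = "velocity (jet_mfd Y Z \<pi> r) (\<lambda>t. jet Y Z \<pi> r (\<Upsilon> t) z)" and ?J = "\<lambda>\<Upsilon>. jet (vert_mfd Y Z \<pi>) Z (\<pi> \<circ> fst) r (fam_vel \<Upsilon>)"
  have "smooth_family_on Y Z \<pi> W \<Upsilon>" unfolding smooth_family_on_def using f by blast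
  then show "\<exists>\<Upsilon>' z' W. openin (mtop Z) W \<and> z' \<in> W \<and> smooth_family_on Y Z \<pi> W \<Upsilon>' \<and>
      ?v = velocity (jet_mfd Y Z \<pi> r) (\<lambda>t. jet Y Z \<pi> r (\<Upsilon>' t) z') \<and> ?J \<Upsilon> z = ?J \<Upsilon>' z'"
    using f by blast
  fix \<xi> assume "\<exists>\<Upsilon>' z' W. openin (mtop Z) W \<and> z' \<in> W \<and> smooth_family_on Y Z \<pi> W \<Upsilon>' \<and>
      ?v = velocity (jet_mfd Y Z \<pi> r) (\<lambda>t. jet Y Z \<pi> r (\<Upsilon>' t) z') \<and> \<xi> = ?J \<Upsilon>' z'"
  then obtain \<Upsilon>' z' W' where f': "openin (mtop Z) W'" "z' \<in> W'" "smooth_family_on Y Z \<pi> W' \<Upsilon>'"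
    "?v = velocity (jet_mfd Y Z \<pi> r) (\<lambda>t. jet Y Z \<pi> r (\<Upsilon>' t) z')" "\<xi> = ?J \<Upsilon>' z'" by blast
  obtain \<epsilon>' where e': "\<epsilon>' > 0" "smooth_map_on P Y ({-\<epsilon>'<..<\<epsilon>'} \<times> W') (\<lambda>(t, z). \<Upsilon>' t z)"
    "\<And>t z. t \<in> {-\<epsilon>'<..<\<epsilon>'} \<Longrightarrow> z \<in> W' \<Longrightarrow> \<pi> (\<Upsilon>' t z) = z" using smooth_family_onE[OF f'(3)] by blast
  \<comment> \<open>The vector remembers its base jet, and the jet its source, so the family picked
    lives over the same point.\<close>
  from arg_cong[OF f'(4), of "\<lambda>v. fst (fst v)"] have z': "z' = z" unfolding fst_velocity fst_jet by (rule sym)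
  have zW: "z \<in> W'" using f'(2) z' by simp
  have "same_jet (vert_mfd Y Z \<pi>) Z r z (fam_vel \<Upsilon>) (fam_vel \<Upsilon>')"
    by (rule iffD1[OF same_jet_fam_vel_iff[OF f f'(1) e' zW, of r] f'(4)[unfolded z']])
  from jet_eqI[OF this] show "\<xi> = ?J \<Upsilon> z" unfolding f'(5) z' by simp
qed

text \<open>The witness is a family of sections that are polynomial in a fibred chart.\<close>

lemma jet_vertical_family:
  assumes v: "v \<in> jet_vertical Y Z \<pi> r"
  shows "\<exists>\<Upsilon> W \<epsilon> z. openin (mtop Z) W \<and> \<epsilon> > 0 \<and> smooth_map_on P Y ({-\<epsilon><..<\<epsilon>} \<times> W) (\<lambda>(t, z). \<Upsilon> t z) \<and>
      (\<forall>t\<in>{-\<epsilon><..<\<epsilon>}. \<forall>z\<in>W. \<pi> (\<Upsilon> t z) = z) \<and> z \<in> W \<and>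
      v = velocity (jet_mfd Y Z \<pi> r) (\<lambda>t. jet Y Z \<pi> r (\<Upsilon> t) z)"
proof -
  let ?M = "jet_mfd Y Z \<pi> r" and ?I = "jet_idx Y Z r" and ?J = "jet_idx Y Z r <+> midx Z" and ?T = "UNIV <+> midx Z :: (unit + nat) set"
  have v': "fst v \<in> jet_carrier Y Z \<pi> r" "v \<in> tangent_space ?M (fst v)" "tangent_map ?M Z fst v = tvec_zero (fst (fst v))"
    using v by (simp_all add: jet_vertical_def vertical_def)
  obtain \<sigma> where \<sigma>: "v = velocity ?M \<sigma>" "smooth_curve ?M \<sigma>" "\<sigma> 0 = fst v" using v'(2) unfolding tangent_space_def by auto
  obtain s where s: "local_section Y Z \<pi> (fst (fst v)) s" "fst v = jet Y Z \<pi> r s (fst (fst v))" using jet_carrierE[OF v'(1)] by blast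
  define z where "z = fst (fst v)"
  obtain c d where cd: "(c, d) \<in> fibred_charts Y Z \<pi>" "z \<in> fst c" "s z \<in> fst d" using fibred_chart_section[OF s(1)] unfolding z_def by blast
  note D = fibred_chartD[OF cd(1)]
  have sz: "local_section Y Z \<pi> z s" "fst v = jet Y Z \<pi> r s z" using s by (simp_all add: z_def)
  let ?jc = "jet_chart Y Z \<pi> r c d"
  have jc: "?jc \<in> charts ?M" by (rule jet_chart_charts[OF cd(1)])
  have \<sigma>jc: "\<sigma> 0 \<in> fst ?jc" unfolding \<sigma>(3) sz(2) using jet_in_jet_chart[OF sz(1)] cd by simp
  have ZY: "midx Z \<subseteq> midx Y" by (rule fibred_base_subset[OF cd(1,3)])
  define \<xi>0 where "\<xi>0 = jet_coord r c d s z"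
  note \<xi>0 = jet_coord_base[OF sz(1) cd, of r, folded \<xi>0_def]
  \<comment> \<open>Verticality makes the base components vanish, so that moving along
    \<open>v\<close> in coordinates keeps the source fixed.\<close>
  have lowz: "snd v ?jc (Inl i) = 0" if i: "i \<in> midx Z" for i
  proof -
    have "tangent_map ?M Z fst v = velocity Z (fst \<circ> \<sigma>)"
      unfolding \<sigma>(1) by (rule tangent_map_velocity[OF premanifold_jet Z \<sigma>(2) smooth_fst_jet]) (use v'(1) \<sigma>(3) in simp)
    then have "velocity Z (fst \<circ> \<sigma>) = tvec_zero (fst (fst v))" using v'(3) by simp
    then have t: "snd (velocity Z (fst \<circ> \<sigma>)) c i = 0" by (simp only: tvec_zero_def snd_conv)
    have k: "Inl i \<in> ?I" using i by (simp add: jet_idx_eq InlI)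
    have "((\<lambda>t. snd ?jc (\<sigma> t) (Inl i)) has_real_derivative snd v ?jc (Inl i)) (at 0)"
      unfolding \<sigma>(1) by (rule smooth_curve_derivative[OF premanifold_jet \<sigma>(2) jc \<sigma>jc]) (simp add: k)
    then have "((\<lambda>t. snd c ((fst \<circ> \<sigma>) t) i) has_real_derivative snd v ?jc (Inl i)) (at 0)"
      using k by (simp add: jet_chart_def)
    moreover have "((\<lambda>t. snd c ((fst \<circ> \<sigma>) t) i) has_real_derivative snd (velocity Z (fst \<circ> \<sigma>)) c i) (at 0)"
      by (rule smooth_curve_derivative[OF Z smooth_curve_compose[OF premanifold_jet Z \<sigma>(2) smooth_fst_jet] D(1) _ i])
        (use v'(1) \<sigma>(3) cd(2) in \<open>simp_all add: z_def\<close>)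
    ultimately show ?thesis using t DERIV_unique by metis
  qed
  \<comment> \<open>The components of \<open>v\<close>, cut off to zero outside the index set so
    that the line \<open>\<xi>\<close> below stays in the coordinate space.\<close>
  define \<beta> where "\<beta> k = (if k \<in> ?I then snd v ?jc k else 0)" for k
  have \<beta>inl: "\<beta> (Inl i) = 0" for i using lowz by (auto simp: \<beta>_def jet_idx_eq)
  \<comment> \<open>A straight line in jet coordinates through the base jet of \<open>v\<close>. Its
    Taylor sections form the wanted family: at \<open>z\<close> the section for time
    \<open>t\<close> has the jet coordinates \<open>\<xi> t\<close>.\<close>
  define \<xi> where "\<xi> t = (\<lambda>k. \<xi>0 k + t * \<beta> k)" for t
  have \<xi>c: "\<xi> t \<in> coord_space ?I" for t using \<xi>0(1) by (auto simp: \<xi>_def \<beta>_def coord_space_def)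
  have \<xi>inl: "\<xi> t \<circ> Inl = snd c z" for t using \<xi>0(2) by (auto simp: \<xi>_def \<beta>inl fun_eq_iff)
  define R where "R = {w::unit + nat \<Rightarrow> real. w \<circ> Inl \<in> UNIV \<and> w \<circ> Inr \<in> snd c ` fst c}"
  have R: "open_coord ?T R" unfolding R_def
    by (rule open_coord_Plus[OF _ chart_open[OF D(1)]]) (simp add: open_coord_def coord_space_UNIV)
  define G where "G w = taylor r (\<xi> (w (Inl ()))) (w \<circ> Inr)" for w :: "unit + nat \<Rightarrow> real"
  have finJ: "finite ?J" using finite_jet_idx finZ by simp
  have topJ: "open_coord ?J (coord_space ?J)" by (simp add: open_coord_def)
  have Gs: "smooth_fun ?T R (\<lambda>w. G w i)" for i
  proof -
    have "smooth_fun ?T R (\<lambda>w. taylor r (case_sum (\<xi> (w (Inl ()))) (w \<circ> Inr) \<circ> Inl) (case_sum (\<xi> (w (Inl ()))) (w \<circ> Inr) \<circ> Inr) i)"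
    proof (rule smooth_fun_compose[OF fin_time finJ R topJ _ _ smooth_taylor[OF topJ]])
      show "(\<lambda>w. case_sum (\<xi> (w (Inl ()))) (w \<circ> Inr)) ` R \<subseteq> coord_space ?J"
        using \<xi>c chart_coord[OF D(1)] by (auto simp: coord_space_Plus case_sum_o_inj R_def)
      show "smooth_fun ?T R (\<lambda>w. case_sum (\<xi> (w (Inl ()))) (w \<circ> Inr) j)" for j
        by (cases j) (auto simp: \<xi>_def intro!: smooth_fun_add[OF fin_time R] smooth_fun_mult[OF fin_time R]
            smooth_fun_const[OF fin_time R] smooth_fun_proj[OF fin_time R])
    qed
    then show ?thesis by (simp add: G_def case_sum_o_inj)
  qed
  have Gim: "G ` R \<subseteq> coord_space (midx Y)"
    using taylor_coord_space[OF chart_coord[OF D(1)] ZY] by (auto simp: G_def R_def)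
  define \<Omega> where "\<Omega> = {w \<in> R. G w \<in> snd d ` fst d}"
  have \<Omega>: "open_coord ?T \<Omega>"
    unfolding \<Omega>_def by (rule open_coord_preimage[OF R _ chart_open[OF D(2)] Gim])
      (rule continuous_on_into_coord_space[OF smooth_fun_continuous[OF Gs] Gim])
  let ?w0 = "case_sum (\<lambda>_::unit. 0) (snd c z)"
  have "\<xi> 0 = \<xi>0" by (simp add: \<xi>_def)
  then have "G ?w0 = snd d (s z)" using \<xi>0(2,3) by (simp add: G_def case_sum_o_inj)
  then have w0: "?w0 \<in> \<Omega>" using cd by (simp add: \<Omega>_def R_def case_sum_o_inj)
  \<comment> \<open>One cube around time 0 and the point \<open>z\<close> provides both the time
    interval and the neighbourhood \<open>W\<close>.\<close>
  obtain e where e: "e > 0" "\<And>w. w \<in> coord_space ?T \<Longrightarrow> (\<And>k. k \<in> ?T \<Longrightarrow> \<bar>w k - ?w0 k\<bar> < e) \<Longrightarrow> w \<in> \<Omega>"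
    using open_coordD[OF \<Omega> fin_time w0] by blast
  define W where "W = {x \<in> fst c. \<forall>i\<in>midx Z. \<bar>snd c x i - snd c z i\<bar> < e}"
  have Wim: "snd c ` W = snd c ` fst c \<inter> {u \<in> coord_space (midx Z). \<forall>i\<in>midx Z. \<bar>u i - snd c z i\<bar> < e}"
    using chart_coord[OF D(1)] by (auto simp: W_def)
  have oW: "open_coord (midx Z) (snd c ` W)"
    unfolding Wim by (rule open_coord_Int[OF chart_open[OF D(1)] open_coord_box[OF finZ]])
  have W: "openin (mtop Z) W" by (rule openin_mtop_in_chart[OF Z D(1) _ oW]) (simp add: W_def)
  have zW: "z \<in> W" using cd e(1) by (simp add: W_def)
  define \<Upsilon> where "\<Upsilon> t x = taylor_section r c d (\<xi> t) x" for t x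
  have inO: "case_sum (\<lambda>_. t) (snd c x) \<in> \<Omega>" if "t \<in> {-e<..<e}" "x \<in> W" for t x
  proof (rule e(2))
    show "case_sum (\<lambda>_. t) (snd c x) \<in> coord_space ?T"
      using chart_coord[OF D(1), of x] that(2) by (simp add: coord_space_Plus case_sum_o_inj coord_space_UNIV W_def)
    fix k assume "k \<in> ?T"
    then show "\<bar>case_sum (\<lambda>_. t) (snd c x) k - ?w0 k\<bar> < e" using that by (cases k) (auto simp: W_def)
  qed
  have im: "taylor r (\<xi> t) (snd c x) \<in> snd d ` fst d" if "t \<in> {-e<..<e}" "x \<in> W" for t x
    using inO[OF that] by (simp add: \<Omega>_def G_def case_sum_o_inj)
  have sec: "\<pi> (\<Upsilon> t x) = x" if "t \<in> {-e<..<e}" "x \<in> W" for t x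
    unfolding \<Upsilon>_def taylor_section_def
    by (rule fibred_chart_proj[OF cd(1) _ im[OF that]]) (use that in \<open>simp_all add: W_def taylor_def\<close>)
  have sm: "smooth_map_on P Y ({-e<..<e} \<times> W) (\<lambda>(t, x). \<Upsilon> t x)"
    unfolding smooth_map_on_iff[OF premanifold_P]
  proof
    let ?pc = "prod_chart real_chart c" and ?A = "{-e<..<e} \<times> W"
    have pc: "?pc \<in> charts P" by (rule prod_chart_charts[OF premanifold_real Z real_chart_charts D(1)])
    have oA: "openin (mtop P) ?A" by (rule time_interval_prod_open[OF W])
    have A: "?A \<subseteq> fst ?pc" by (auto simp: W_def)
    have opA: "open_coord ?T (snd ?pc ` ?A)"
      using openin_mtop_chart[OF premanifold_P oA pc] A by (simp add: Int_absorb2)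
    have "smooth_in_charts (midx P) (midx Y) ?pc d ?A (\<lambda>(t, x). \<Upsilon> t x)"
      unfolding smooth_in_charts_def midx_prod midx_real
    proof (intro conjI ballI opA A)
      show "(\<lambda>(t, x). \<Upsilon> t x) ` ?A \<subseteq> fst d" using chart_inv_in[OF im] by (auto simp: \<Upsilon>_def taylor_section_def)
      fix i
      have sub: "snd ?pc ` ?A \<subseteq> R" by (auto simp: R_def case_sum_o_inj W_def)
      show "smooth_fun ?T (snd ?pc ` ?A) (\<lambda>u. snd d ((\<lambda>(t, x). \<Upsilon> t x) (chart_inv ?pc u)) i)"
      proof (rule smooth_fun_congI[OF fin_time opA smooth_fun_subset[OF Gs sub]])
        fix u assume "u \<in> snd ?pc ` ?A"
        then obtain t x where tx: "t \<in> {-e<..<e}" "x \<in> W" "u = snd ?pc (t, x)" by blast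
        have inv: "chart_inv ?pc u = (t, x)" unfolding tx(3) by (rule chart_inv_chart[OF pc]) (use tx(2) in \<open>simp add: W_def\<close>)
        show "G u i = snd d ((\<lambda>(t, x). \<Upsilon> t x) (chart_inv ?pc u)) i"
          unfolding inv using chart_chart_inv[OF im[OF tx(1,2)]] tx(3) by (simp add: G_def \<Upsilon>_def taylor_section_def case_sum_o_inj)
      qed
    qed
    then show "\<exists>e'\<in>charts P. \<exists>d\<in>charts Y. \<exists>U. x \<in> U \<and> U \<subseteq> ?A \<and> smooth_in_charts (midx P) (midx Y) e' d U (\<lambda>(t, x). \<Upsilon> t x)"
      if "x \<in> ?A" for x
      by (intro bexI[OF _ pc] bexI[OF _ D(2)] exI[of _ ?A] conjI that subset_refl)
  qed
  have cu: "smooth_curve ?M (\<lambda>t. jet Y Z \<pi> r (\<Upsilon> t) z)" by (rule jet_family_curve[OF W e(1) sm sec zW])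
  have co: "jet_coord r c d (\<Upsilon> t) z = \<xi> t" "\<Upsilon> t z \<in> fst d" if t: "t \<in> {-e<..<e}" for t
  proof -
    have tv: "taylor r (\<xi> t) (\<xi> t \<circ> Inl) \<in> snd d ` fst d" unfolding \<xi>inl by (rule im[OF t zW])
    show "jet_coord r c d (\<Upsilon> t) z = \<xi> t" "\<Upsilon> t z \<in> fst d"
      unfolding \<Upsilon>_def using taylor_section_local(3,4)[OF cd(1) \<xi>c cd(2) \<xi>inl[symmetric] tv] by simp_all
  qed
  have cj: "snd ?jc (jet Y Z \<pi> r (\<Upsilon> t) z) = \<xi> t" if t: "t \<in> {-e<..<e}" for t
    using jet_chart_jet[OF family_local_section[OF W e(1) sm sec t zW] D(1) cd(2) D(2) co(2)[OF t], of r] co(1)[OF t] by simp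
  have in0: "jet Y Z \<pi> r (\<Upsilon> 0) z \<in> fst ?jc"
    using jet_in_jet_chart[OF family_local_section_0[OF W e(1) sm sec zW]] cd(2) co(2)[of 0] e(1) by simp
  have base: "jet Y Z \<pi> r (\<Upsilon> 0) z = \<sigma> 0"
  proof -
    have "snd ?jc (jet Y Z \<pi> r (\<Upsilon> 0) z) = snd ?jc (\<sigma> 0)"
      using cj[of 0] e(1) jet_chart_jet[OF sz(1) D(1) cd(2) D(2) cd(3), of r] \<open>\<xi> 0 = \<xi>0\<close> unfolding \<sigma>(3) sz(2) by (simp add: \<xi>0_def)
    then show ?thesis using inj_onD[OF inj_on_jet_chart[OF cd(1)] _ in0 \<sigma>jc] by simp
  qed
  have "velocity ?M \<sigma> = velocity ?M (\<lambda>t. jet Y Z \<pi> r (\<Upsilon> t) z)"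
  proof (rule velocity_eqI[OF premanifold_jet \<sigma>(2) cu base jc \<sigma>jc])
    fix k assume "k \<in> midx ?M"
    then have k: "k \<in> ?I" by simp
    have "((\<lambda>t. snd ?jc (jet Y Z \<pi> r (\<Upsilon> t) z) k) has_real_derivative snd (velocity ?M (\<lambda>t. jet Y Z \<pi> r (\<Upsilon> t) z)) ?jc k) (at 0)"
      by (rule smooth_curve_derivative[OF premanifold_jet cu jc in0]) (simp add: k)
    moreover have "eventually (\<lambda>t. snd ?jc (jet Y Z \<pi> r (\<Upsilon> t) z) k = \<xi>0 k + t * \<beta> k) (nhds 0)"
    proof -
      have "eventually (\<lambda>t. t \<in> {-e<..<e}) (nhds 0)" using e(1) by (intro eventually_nhds_in_open) auto
      then show ?thesis by eventually_elim (simp only: cj, simp add: \<xi>_def)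
    qed
    ultimately have "((\<lambda>t. \<xi>0 k + t * \<beta> k) has_real_derivative snd (velocity ?M (\<lambda>t. jet Y Z \<pi> r (\<Upsilon> t) z)) ?jc k) (at 0)"
      by (rule DERIV_eventually_cong)
    moreover have "((\<lambda>t. \<xi>0 k + t * \<beta> k) has_real_derivative \<beta> k) (at 0)" by (auto intro!: derivative_eq_intros)
    ultimately have "snd (velocity ?M (\<lambda>t. jet Y Z \<pi> r (\<Upsilon> t) z)) ?jc k = \<beta> k" by (rule DERIV_unique)
    then show "snd (velocity ?M \<sigma>) ?jc k = snd (velocity ?M (\<lambda>t. jet Y Z \<pi> r (\<Upsilon> t) z)) ?jc k"
      using k \<sigma>(1) by (simp add: \<beta>_def)
  qed
  then have "v = velocity ?M (\<lambda>t. jet Y Z \<pi> r (\<Upsilon> t) z)" using \<sigma>(1) by simp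
  then show ?thesis
    by (intro exI[of _ \<Upsilon>] exI[of _ W] exI[of _ e] exI[of _ z] conjI ballI W e(1) sm sec zW)
qed

text \<open>Both vectors are written as velocities of families, which turns the claim into the other
  direction of \<open>same_jet_fam_vel_iff\<close>.\<close>

lemma inj_on_jet_is: "inj_on (jet_is Y Z \<pi> r) (jet_vertical Y Z \<pi> r)"
proof (rule inj_onI)
  fix v1 v2 assume v1: "v1 \<in> jet_vertical Y Z \<pi> r" and v2: "v2 \<in> jet_vertical Y Z \<pi> r"
    and eq: "jet_is Y Z \<pi> r v1 = jet_is Y Z \<pi> r v2"
  obtain \<Upsilon>1 W1 \<epsilon>1 z1 where F: "openin (mtop Z) W1" "\<epsilon>1 > 0" "smooth_map_on P Y ({-\<epsilon>1<..<\<epsilon>1} \<times> W1) (\<lambda>(t, z). \<Upsilon>1 t z)"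
      "\<forall>t\<in>{-\<epsilon>1<..<\<epsilon>1}. \<forall>z\<in>W1. \<pi> (\<Upsilon>1 t z) = z" "z1 \<in> W1"
      "v1 = velocity (jet_mfd Y Z \<pi> r) (\<lambda>t. jet Y Z \<pi> r (\<Upsilon>1 t) z1)"
    using jet_vertical_family[OF v1] by (elim exE conjE) (rule that)
  note f1 = F(1-3) F(4)[rule_format] F(5,6)
  obtain \<Upsilon>2 W2 \<epsilon>2 z2 where F: "openin (mtop Z) W2" "\<epsilon>2 > 0" "smooth_map_on P Y ({-\<epsilon>2<..<\<epsilon>2} \<times> W2) (\<lambda>(t, z). \<Upsilon>2 t z)"
      "\<forall>t\<in>{-\<epsilon>2<..<\<epsilon>2}. \<forall>z\<in>W2. \<pi> (\<Upsilon>2 t z) = z" "z2 \<in> W2"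
      "v2 = velocity (jet_mfd Y Z \<pi> r) (\<lambda>t. jet Y Z \<pi> r (\<Upsilon>2 t) z2)"
    using jet_vertical_family[OF v2] by (elim exE conjE) (rule that)
  note f2 = F(1-3) F(4)[rule_format] F(5,6)
  have "jet (vert_mfd Y Z \<pi>) Z (\<pi> \<circ> fst) r (fam_vel \<Upsilon>1) z1 = jet (vert_mfd Y Z \<pi>) Z (\<pi> \<circ> fst) r (fam_vel \<Upsilon>2) z2"
    using eq jet_is_family[OF f1(1-5), of r] jet_is_family[OF f2(1-5), of r] f1(6) f2(6) by simp
  note j = jet_eqD[OF this fam_vel_local_section[OF f2(1-5)]]
  have z: "z1 \<in> W2" using f2(5) j(1) by simp
  show "v1 = v2"
    using same_jet_fam_vel_iff[OF f1(1-5) f2(1-4) z, of r] j f1(6) f2(6) by simp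
qed

text \<open>The link to the formula of the theorem: near \<open>z\<close> the field
  \<open>\<eta>\<close> may be replaced by the velocity field of the family, whose jet is a value of
  the injective \<open>jet_is\<close>.\<close>

lemma jet_is_inv_family:
  assumes f: "openin (mtop Z) W" "\<epsilon> > 0" "smooth_map_on P Y ({-\<epsilon><..<\<epsilon>} \<times> W) (\<lambda>(t, z). \<Upsilon> t z)"
      "\<And>t z. t \<in> {-\<epsilon><..<\<epsilon>} \<Longrightarrow> z \<in> W \<Longrightarrow> \<pi> (\<Upsilon> t z) = z" "z \<in> W"
    and \<eta>: "\<And>z'. z' \<in> W \<Longrightarrow> \<eta> z' = velocity Y (\<lambda>t. \<Upsilon> t z')"
  shows "jet_is_inv Y Z \<pi> r (jet (vert_mfd Y Z \<pi>) Z (\<pi> \<circ> fst) r \<eta> z) =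
    velocity (jet_mfd Y Z \<pi> r) (\<lambda>t. jet Y Z \<pi> r (\<Upsilon> t) z)"
proof -
  have "same_jet (vert_mfd Y Z \<pi>) Z r z \<eta> (fam_vel \<Upsilon>)"
    by (rule same_jet_locally_eq[OF Z f(1,5)]) (simp add: \<eta> fam_vel_def)
  from jet_eqI[OF this] have "jet (vert_mfd Y Z \<pi>) Z (\<pi> \<circ> fst) r \<eta> z =
      jet_is Y Z \<pi> r (velocity (jet_mfd Y Z \<pi> r) (\<lambda>t. jet Y Z \<pi> r (\<Upsilon> t) z))"
    using jet_is_family[OF f, of r] by simp
  then show ?thesis unfolding jet_is_inv_def
    using inv_into_f_f[OF inj_on_jet_is jet_family_vertical[OF f]] by simp
qed

end

subsection \<open>Bump functions and partitions of unity\<close>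

text \<open>The powers of \<open>1 / x\<close> are included because the derivative of each function is a combination of the others.\<close>

definition exp_bump :: "nat \<Rightarrow> real \<Rightarrow> real" where
  "exp_bump n x = (if x > 0 then (1 / x) ^ n * exp (- (1 / x)) else 0)"

text \<open>With \<open>y = 1 / x\<close> the claim on the right is that
  \<open>y ^ n / exp y\<close> tends to 0 at infinity; on the left the function is zero.\<close>

lemma exp_bump_tendsto_0: "((\<lambda>x. exp_bump n x) \<longlongrightarrow> 0) (at 0)"
proof -
  have "((\<lambda>x::real. (inverse x) ^ n / exp (inverse x)) \<longlongrightarrow> 0) (at_right 0)"
    by (rule filterlim_compose[OF tendsto_power_div_exp_0 filterlim_inverse_at_top_right])
  moreover have "eventually (\<lambda>x::real. (inverse x) ^ n / exp (inverse x) = exp_bump n x) (at_right 0)"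
    unfolding eventually_at_filter
    by (intro always_eventually) (auto simp: exp_bump_def exp_minus divide_inverse)
  ultimately have r: "(exp_bump n \<longlongrightarrow> 0) (at_right 0)" by (rule Lim_transform_eventually)
  have "eventually (\<lambda>x::real. 0 = exp_bump n x) (at_left 0)"
    unfolding eventually_at_filter by (intro always_eventually) (auto simp: exp_bump_def)
  then have "(exp_bump n \<longlongrightarrow> 0) (at_left 0)" by (rule Lim_transform_eventually[OF tendsto_const])
  with r show ?thesis by (simp add: filterlim_split_at)
qed

lemma exp_bump_derivative:
  "(exp_bump n has_real_derivative (- real n * exp_bump (Suc n) x + exp_bump (Suc (Suc n)) x)) (at x)"
proof (cases x "0::real" rule: linorder_cases)
  case less
  have "eventually (\<lambda>y. y \<in> {..<0}) (nhds x)" using less by (intro eventually_nhds_in_open) auto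
  then have "eventually (\<lambda>y. 0 = exp_bump n y) (nhds x)" by eventually_elim (simp add: exp_bump_def)
  then have "(exp_bump n has_real_derivative 0) (at x)" by (rule DERIV_eventually_cong[OF DERIV_const])
  then show ?thesis using less by (simp add: exp_bump_def)
next
  case greater
  have "eventually (\<lambda>y. y \<in> {0<..}) (nhds x)" using greater by (intro eventually_nhds_in_open) auto
  then have ev: "eventually (\<lambda>y. inverse y ^ n * exp (- inverse y) = exp_bump n y) (nhds x)"
    by eventually_elim (simp add: exp_bump_def divide_inverse)
  have inv: "((\<lambda>y. inverse y) has_real_derivative - (inverse x * inverse x)) (at x)"
    using DERIV_inverse[of x UNIV] greater by (simp add: power2_eq_square)
  have 1: "((\<lambda>y. inverse y ^ n) has_real_derivative - (real n * inverse x ^ Suc n)) (at x)"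
  proof (cases n)
    case (Suc m)
    have "((\<lambda>y. inverse y ^ n) has_real_derivative real n * (inverse x ^ (n - Suc 0) * - (inverse x * inverse x))) (at x)"
      using DERIV_power[OF inv, of n] by (simp add: mult_ac)
    then show ?thesis by (rule DERIV_cong) (simp add: Suc)
  qed simp
  have 2: "((\<lambda>y. exp (- inverse y)) has_real_derivative exp (- inverse x) * (inverse x * inverse x)) (at x)"
    using DERIV_chain2[OF DERIV_exp DERIV_minus[OF inv]] by simp
  have "((\<lambda>y. inverse y ^ n * exp (- inverse y)) has_real_derivative
      (- (real n * inverse x ^ Suc n) * exp (- inverse x) + exp (- inverse x) * (inverse x * inverse x) * inverse x ^ n)) (at x)"
    by (rule DERIV_mult[OF 1 2])
  then have "((\<lambda>y. inverse y ^ n * exp (- inverse y)) has_real_derivative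
      (- real n * exp_bump (Suc n) x + exp_bump (Suc (Suc n)) x)) (at x)"
    by (rule DERIV_cong) (use greater in \<open>simp add: exp_bump_def divide_inverse\<close>)
  then show ?thesis by (rule DERIV_eventually_cong[OF _ ev])
next
  \<comment> \<open>The difference quotient of \<open>exp_bump n\<close> at 0 is
    \<open>exp_bump (Suc n)\<close>, which tends to 0.\<close>
  case equal
  have "((\<lambda>y. (exp_bump n y - exp_bump n 0) / (y - 0)) \<longlongrightarrow> 0) (at 0)"
  proof (rule Lim_transform_eventually[OF exp_bump_tendsto_0[of "Suc n"]])
    show "eventually (\<lambda>y. exp_bump (Suc n) y = (exp_bump n y - exp_bump n 0) / (y - 0)) (at 0)"
      unfolding eventually_at_filter by (intro always_eventually) (auto simp: exp_bump_def field_simps)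
  qed
  then have "(exp_bump n has_real_derivative 0) (at 0)" by (simp add: has_field_derivative_iff)
  then show ?thesis using equal by (simp add: exp_bump_def)
qed

text \<open>The induction on the order leaves \<open>n\<close> free because each derivative raises
  it.\<close>

lemma smooth_fun_exp_bump:
  assumes I: "finite I" "open_coord I S" and f: "smooth_fun I S f"
  shows "smooth_fun I S (\<lambda>x. exp_bump n (f x))"
proof -
  have "Ck k I S (\<lambda>x. exp_bump n (f x))" for k
  proof (induction k arbitrary: n)
    have cont: "continuous_on S (\<lambda>x. exp_bump n (f x))" for n
    proof (rule continuous_on_compose2[OF _ smooth_fun_continuous[OF f] subset_UNIV])
      show "continuous_on UNIV (exp_bump n)"
        using DERIV_isCont[OF exp_bump_derivative] by (simp add: continuous_at_imp_continuous_on)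
    qed
    {
      case 0
      show ?case using cont by simp
    next
      case (Suc k)
      have fk: "Ck k I S f'" if "smooth_fun I S f'" for f' using that smooth_fun_iff_Ck by blast
      show ?case
      proof (rule Ck_SucI[OF I cont])
        fix i x assume ix: "i \<in> I" "x \<in> S"
        have fi: "((\<lambda>t. f (x(i := t))) has_real_derivative pd i f x) (at (x i))"
          using smooth_fun_has_pd[OF f ix] by (simp add: has_pd_def)
        show "has_pd i (\<lambda>x. exp_bump n (f x)) ((- real n * exp_bump (Suc n) (f x) + exp_bump (Suc (Suc n)) (f x)) * pd i f x) x"
          unfolding has_pd_def using DERIV_chain2[OF exp_bump_derivative fi, of n] by simp
      next
        fix i assume i: "i \<in> I"
        show "Ck k I S (\<lambda>x. (- real n * exp_bump (Suc n) (f x) + exp_bump (Suc (Suc n)) (f x)) * pd i f x)"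
          by (rule Ck_mult[OF I Ck_add[OF I Ck_mult[OF I Ck_const[OF I] Suc] Suc] fk[OF smooth_fun_pd[OF f i]]])
      qed
    }
  qed
  then show ?thesis by (simp add: smooth_fun_iff_Ck)
qed

section \<open>Bump functions on manifolds\<close>

lemma smooth_map_real_iff:
  assumes M: "premanifold M"
  shows "smooth_map_on M real_mfd S f \<longleftrightarrow> openin (mtop M) S \<and>
    (\<forall>c\<in>charts M. smooth_fun (midx M) (snd c ` (S \<inter> fst c)) (\<lambda>u. f (chart_inv c u)))"
proof
  assume f: "smooth_map_on M real_mfd S f"
  have "smooth_fun (midx M) (snd c ` (S \<inter> fst c)) (\<lambda>u. f (chart_inv c u))" if c: "c \<in> charts M" for c
    using smooth_map_on_in_charts[OF M premanifold_real f c real_chart_charts]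
    by (simp add: smooth_in_charts_def Int_def conj_commute)
  then show "openin (mtop M) S \<and> (\<forall>c\<in>charts M. smooth_fun (midx M) (snd c ` (S \<inter> fst c)) (\<lambda>u. f (chart_inv c u)))"
    using smooth_map_on_openin[OF M f] by blast
next
  assume R: "openin (mtop M) S \<and> (\<forall>c\<in>charts M. smooth_fun (midx M) (snd c ` (S \<inter> fst c)) (\<lambda>u. f (chart_inv c u)))"
  show "smooth_map_on M real_mfd S f" unfolding smooth_map_on_iff[OF M]
  proof
    fix x assume x: "x \<in> S"
    then have "x \<in> mcarrier M" using R openin_mtop_atlas[OF M] by blast
    then obtain c where c: "c \<in> charts M" "x \<in> fst c" using premanifold_cover[OF M] by blast
    have "smooth_in_charts (midx M) (midx real_mfd) c real_chart (S \<inter> fst c) f"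
      using R c openin_mtop_chart[OF M _ c(1)] by (simp add: smooth_in_charts_def)
    then show "\<exists>c\<in>charts M. \<exists>d\<in>charts real_mfd. \<exists>U. x \<in> U \<and> U \<subseteq> S \<and> smooth_in_charts (midx M) (midx real_mfd) c d U f"
      using x c real_chart_charts by blast
  qed
qed

lemma compact_coord_box: "compact {u \<in> coord_space I. \<forall>i\<in>I. \<bar>u i - a i\<bar> \<le> (e::real)}"
proof -
  \<comment> \<open>The factors off \<open>I\<close> are the singleton of 0, which places the
    product inside the coordinate space; a product of compact sets is compact for any index
    type.\<close>
  have "compactin (product_topology (\<lambda>i. euclidean) UNIV) (\<Pi>\<^sub>E i\<in>UNIV. if i \<in> I then {a i - e..a i + e} else {0::real})"
    by (simp add: compactin_PiE)
  moreover have "(\<Pi>\<^sub>E i\<in>UNIV. if i \<in> I then {a i - e..a i + e} else {0}) = {u \<in> coord_space I. \<forall>i\<in>I. \<bar>u i - a i\<bar> \<le> e}"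
    by (auto simp: coord_space_def PiE_iff abs_le_iff split: if_splits) (smt (verit))+
  ultimately show ?thesis by (simp add: euclidean_product_topology)
qed

lemma chart_inv_compactin:
  assumes M: "premanifold M" and c: "c \<in> charts M" and K: "compact K" "K \<subseteq> snd c ` fst c"
  shows "compactin (mtop M) (chart_inv c ` K)"
proof (rule image_compactin)
  let ?S = "snd c ` fst c"
  show "compactin (top_of_set ?S) K" using K by (simp add: compactin_subtopology)
  show "continuous_map (top_of_set ?S) (mtop M) (chart_inv c)"
    unfolding continuous_map
  proof (intro conjI allI impI)
    show "chart_inv c ` topspace (top_of_set ?S) \<subseteq> topspace (mtop M)"
      using chart_inv_in[of _ c] chart_subset[OF c] topspace_mtop[OF M] by auto
    fix U assume U: "openin (mtop M) U"
    have "{u \<in> ?S. chart_inv c u \<in> U} = snd c ` (U \<inter> fst c)"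
      using chart_inv_chart[OF c] by auto
    then have "openin (top_of_set (coord_space (midx M))) {u \<in> ?S. chart_inv c u \<in> U}"
      using openin_mtop_chart[OF M U c] by (simp add: open_coord_def)
    then show "openin (top_of_set ?S) {u \<in> topspace (top_of_set ?S). chart_inv c u \<in> U}"
      using openin_subset_trans[of "coord_space (midx M)" _ ?S] open_coord_subset[OF chart_open[OF c]] by simp
  qed
qed

text \<open>In the chart the function is a product of one-variable bumps, nonzero only inside the
  cube of half-side \<open>e / 2\<close> around \<open>z\<close>. The closed cube still lies in the
  chart image since its half-side is below \<open>e\<close>; its preimage \<open>K\<close> is
  compact, hence closed in the Hausdorff space, and so contains the support.\<close>

lemma bump_function:
  assumes M: "premanifold M" "Hausdorff_space (mtop M)" and c: "c \<in> charts M" "z \<in> fst c"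
  obtains \<rho> where "smooth_map_on M real_mfd (mcarrier M) \<rho>" "\<And>x. 0 \<le> \<rho> x" "\<rho> z > 0"
    "mtop M closure_of {x \<in> mcarrier M. \<rho> x \<noteq> 0} \<subseteq> fst c"
proof -
  let ?I = "midx M"
  note fin = premanifold_finite[OF M(1)]
  obtain e where e: "e > 0" "\<And>y. y \<in> coord_space ?I \<Longrightarrow> (\<And>i. i \<in> ?I \<Longrightarrow> \<bar>y i - snd c z i\<bar> < e) \<Longrightarrow> y \<in> snd c ` fst c"
    using open_coordD[OF chart_open[OF c(1)] fin, of "snd c z"] c(2) by blast
  define b where "b u = (\<Prod>i\<in>?I. exp_bump 0 ((e / 2) ^ 2 - (u i - snd c z i) ^ 2))" for u
  define \<rho> where "\<rho> x = (if x \<in> fst c then b (snd c x) else 0)" for x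
  define B where "B = {u \<in> coord_space ?I. \<forall>i\<in>?I. \<bar>u i - snd c z i\<bar> \<le> e / 2}"
  define K where "K = chart_inv c ` B"
  have B: "B \<subseteq> snd c ` fst c"
  proof
    fix u assume u: "u \<in> B"
    show "u \<in> snd c ` fst c"
    proof (rule e(2))
      show "u \<in> coord_space ?I" using u by (simp add: B_def)
      show "\<bar>u i - snd c z i\<bar> < e" if "i \<in> ?I" for i
      proof -
        have "\<bar>u i - snd c z i\<bar> \<le> e / 2" using u that unfolding B_def by blast
        then show ?thesis using e(1) by linarith
      qed
    qed
  qed
  have "compactin (mtop M) K" unfolding K_def
    by (rule chart_inv_compactin[OF M(1) c(1) _ B]) (unfold B_def, rule compact_coord_box)
  then have K: "closedin (mtop M) K" by (rule compactin_imp_closedin[OF M(2)])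
  have bB: "u \<in> B" if bu: "b u \<noteq> 0" "u \<in> coord_space ?I" for u
  proof -
    have "\<bar>u i - snd c z i\<bar> \<le> e / 2" if i: "i \<in> ?I" for i
    proof -
      have "exp_bump 0 ((e / 2) ^ 2 - (u i - snd c z i) ^ 2) \<noteq> 0"
        using bu(1) i prod_zero[OF fin, of "\<lambda>i. exp_bump 0 ((e / 2) ^ 2 - (u i - snd c z i) ^ 2)"] unfolding b_def by blast
      then have "(u i - snd c z i) ^ 2 < (e / 2) ^ 2" by (auto simp: exp_bump_def split: if_splits)
      then have "\<bar>u i - snd c z i\<bar> < \<bar>e / 2\<bar>" by (metis power2_less_imp_less power2_abs abs_ge_zero)
      then show ?thesis using e(1) by simp
    qed
    then show ?thesis using bu(2) by (simp add: B_def)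
  qed
  have supp: "x \<in> K" if "\<rho> x \<noteq> 0" for x
  proof -
    have x: "x \<in> fst c" "b (snd c x) \<noteq> 0" using that by (auto simp: \<rho>_def split: if_splits)
    have "snd c x \<in> B" by (rule bB[OF x(2) chart_coord[OF c(1) x(1)]])
    then have "chart_inv c (snd c x) \<in> K" unfolding K_def by blast
    then show ?thesis using chart_inv_chart[OF c(1) x(1)] by simp
  qed
  have Kc: "K \<subseteq> fst c"
  proof
    fix x assume "x \<in> K"
    then obtain u where "u \<in> B" "x = chart_inv c u" unfolding K_def by blast
    then show "x \<in> fst c" using chart_inv_in[of u c] B by blast
  qed
  show thesis
  proof
    show "mtop M closure_of {x \<in> mcarrier M. \<rho> x \<noteq> 0} \<subseteq> fst c"
      using closure_of_minimal[OF _ K, of "{x \<in> mcarrier M. \<rho> x \<noteq> 0}"] supp Kc by blast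
    have "0 \<le> b u" for u unfolding b_def by (rule prod_nonneg) (simp add: exp_bump_def)
    then show "0 \<le> \<rho> x" for x by (simp add: \<rho>_def)
    have "0 < b (snd c z)" unfolding b_def by (rule prod_pos) (use e(1) in \<open>simp add: exp_bump_def\<close>)
    then show "\<rho> z > 0" using c(2) by (simp add: \<rho>_def)
    have "smooth_map_on M real_mfd (fst c) \<rho>"
      unfolding smooth_map_on_iff[OF M(1)] midx_real
    proof
      have op: "open_coord ?I (snd c ` fst c)" by (rule chart_open[OF c(1)])
      have bs: "smooth_fun ?I (snd c ` fst c) b"
        unfolding b_def[abs_def]
        by (intro smooth_fun_prod[OF fin op] smooth_fun_exp_bump[OF fin op] smooth_fun_diff[OF fin op]
            smooth_fun_power[OF fin op] smooth_fun_const[OF fin op] smooth_fun_proj[OF fin op])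
      have "smooth_fun ?I (snd c ` fst c) (\<lambda>u. \<rho> (chart_inv c u))"
        by (rule smooth_fun_congI[OF fin op bs]) (simp add: \<rho>_def chart_inv_in chart_chart_inv)
      then have "smooth_in_charts ?I UNIV c real_chart (fst c) \<rho>" using op by (simp add: smooth_in_charts_def)
      then show "\<exists>c'\<in>charts M. \<exists>d\<in>charts real_mfd. \<exists>U. x \<in> U \<and> U \<subseteq> fst c \<and> smooth_in_charts ?I UNIV c' d U \<rho>"
        if "x \<in> fst c" for x using that c real_chart_charts by blast
    qed
    moreover have "smooth_map_on M real_mfd (mcarrier M - K) \<rho>"
    proof (rule smooth_map_on_cong[OF M(1), of _ "\<lambda>x. 0"])
      have opK: "openin (mtop M) (mcarrier M - K)" using K topspace_mtop[OF M(1)] by (metis closedin_def)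
      show "smooth_map_on M real_mfd (mcarrier M - K) (\<lambda>x. 0)"
        unfolding smooth_map_real_iff[OF M(1)]
        using opK smooth_fun_const[OF fin openin_mtop_chart[OF M(1) opK]] by blast
      show "0 = \<rho> x" if "x \<in> mcarrier M - K" for x using supp[of x] that by auto
    qed
    \<comment> \<open>Since \<open>K\<close> lies in the chart domain, the open sets
      \<open>fst c\<close> and \<open>mcarrier M - K\<close> cover the manifold.\<close>
    ultimately show "smooth_map_on M real_mfd (mcarrier M) \<rho>"
      by (intro smooth_map_on_locally) (metis Diff_iff Diff_subset Kc chart_subset[OF c(1)] subsetD)
  qed
qed

text \<open>By compactness finitely many bump functions have a positive sum, by which each is
  divided. The family \<open>C\<close> is arbitrary because partitions are taken once for the
  orientation atlas and once for charts adapted to a section.\<close>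

lemma partition_of_unity_exists:
  assumes M: "premanifold M" "Hausdorff_space (mtop M)" "compact_space (mtop M)"
    and C: "C \<subseteq> charts M" "\<And>z. z \<in> mcarrier M \<Longrightarrow> \<exists>c\<in>C. z \<in> fst c"
  shows "\<exists>n c \<rho>. partition_of_unity M C n c \<rho>"
proof -
  let ?I = "midx M"
  note fin = premanifold_finite[OF M(1)]
  have "\<exists>c \<rho>. c \<in> C \<and> smooth_map_on M real_mfd (mcarrier M) \<rho> \<and> (\<forall>x. 0 \<le> \<rho> x) \<and> \<rho> z > 0 \<and>
    mtop M closure_of {x \<in> mcarrier M. \<rho> x \<noteq> 0} \<subseteq> fst c" if z: "z \<in> mcarrier M" for z
  proof -
    obtain c where c: "c \<in> C" "z \<in> fst c" using C(2)[OF z] by blast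
    obtain \<rho> where "smooth_map_on M real_mfd (mcarrier M) \<rho>" "\<And>x. 0 \<le> \<rho> x" "\<rho> z > 0"
      "mtop M closure_of {x \<in> mcarrier M. \<rho> x \<noteq> 0} \<subseteq> fst c"
      by (rule bump_function[OF M(1,2), of c z]) (use c C(1) in auto)
    then show ?thesis using c(1) by blast
  qed
  then have "\<forall>z\<in>mcarrier M. \<exists>c \<rho>. c \<in> C \<and> smooth_map_on M real_mfd (mcarrier M) \<rho> \<and> (\<forall>x. 0 \<le> \<rho> x) \<and> \<rho> z > 0 \<and>
    mtop M closure_of {x \<in> mcarrier M. \<rho> x \<noteq> 0} \<subseteq> fst c" by blast
  then obtain c \<rho> where c\<rho>: "\<forall>z\<in>mcarrier M. c z \<in> C \<and> smooth_map_on M real_mfd (mcarrier M) (\<rho> z) \<and> (\<forall>x. 0 \<le> \<rho> z x) \<and> \<rho> z z > 0 \<and>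
    mtop M closure_of {x \<in> mcarrier M. \<rho> z x \<noteq> 0} \<subseteq> fst (c z)"
    unfolding bchoice_iff by blast
  have c: "\<And>z. z \<in> mcarrier M \<Longrightarrow> c z \<in> C"
    and \<rho>: "\<And>z. z \<in> mcarrier M \<Longrightarrow> smooth_map_on M real_mfd (mcarrier M) (\<rho> z)"
      "\<And>z x. z \<in> mcarrier M \<Longrightarrow> 0 \<le> \<rho> z x" "\<And>z. z \<in> mcarrier M \<Longrightarrow> \<rho> z z > 0"
      "\<And>z. z \<in> mcarrier M \<Longrightarrow> mtop M closure_of {x \<in> mcarrier M. \<rho> z x \<noteq> 0} \<subseteq> fst (c z)"
    using c\<rho> by blast+
  define U where "U z = {x \<in> mcarrier M. \<rho> z x \<in> {0<..}}" for z
  have U: "openin (mtop M) (U z)" if "z \<in> mcarrier M" for z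
    unfolding U_def by (rule smooth_map_on_preimage[OF M(1) premanifold_real \<rho>(1)[OF that] openin_mtop_real]) simp
  have "compactin (mtop M) (mcarrier M)" using M(3) topspace_mtop[OF M(1)] by (simp add: compact_space_def)
  then have "\<exists>\<F>. finite \<F> \<and> \<F> \<subseteq> U ` mcarrier M \<and> mcarrier M \<subseteq> \<Union>\<F>"
    unfolding compactin_def using U \<rho>(3) by (elim conjE allE[of _ "U ` mcarrier M"]) (auto simp: U_def)
  then obtain \<F> where F: "finite \<F>" "\<F> \<subseteq> U ` mcarrier M" "mcarrier M \<subseteq> \<Union>\<F>" by blast
  obtain F where F': "F \<subseteq> mcarrier M" "finite F" "\<F> = U ` F" using finite_subset_image[OF F(1,2)] by blast
  obtain h where h: "bij_betw h {..<card F} F"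
    using ex_bij_betw_nat_finite[OF F'(2)] by (auto simp: atLeast0LessThan)
  have hF: "h k \<in> mcarrier M" if "k < card F" for k using h F'(1) that by (auto simp: bij_betw_def)
  define s where "s x = (\<Sum>k<card F. \<rho> (h k) x)" for x
  have spos: "s x > 0" if x: "x \<in> mcarrier M" for x
  proof -
    obtain z where z: "z \<in> F" "x \<in> U z" using F(3) F'(3) x by blast
    from z(1) have "z \<in> h ` {..<card F}" using h by (simp add: bij_betw_def)
    then obtain k where k: "k < card F" "h k = z" by blast
    show ?thesis unfolding s_def
      by (rule sum_pos2[of _ k]) (use k z \<rho>(2) hF in \<open>auto simp: U_def\<close>)
  qed
  have ps: "smooth_fun ?I (snd d ` (mcarrier M \<inter> fst d)) (\<lambda>u. \<rho> (h k) (chart_inv d u))" if "k < card F" "d \<in> charts M" for k d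
    using \<rho>(1)[OF hF[OF that(1)]] that(2) unfolding smooth_map_real_iff[OF M(1)] by blast
  have "partition_of_unity M C (card F) (\<lambda>k. c (h k)) (\<lambda>k x. \<rho> (h k) x / s x)"
    unfolding partition_of_unity_def
  proof (intro conjI allI impI ballI)
    fix k assume k: "k < card F"
    show "c (h k) \<in> C" using c hF[OF k] by blast
    show "smooth_map_on M real_mfd (mcarrier M) (\<lambda>x. \<rho> (h k) x / s x)"
      unfolding smooth_map_real_iff[OF M(1)]
    proof (intro conjI ballI openin_mcarrier[OF M(1)])
      fix d assume d: "d \<in> charts M"
      have op: "open_coord ?I (snd d ` (mcarrier M \<inter> fst d))" by (rule openin_mtop_chart[OF M(1) openin_mcarrier[OF M(1)] d])
      have ss: "smooth_fun ?I (snd d ` (mcarrier M \<inter> fst d)) (\<lambda>u. s (chart_inv d u))"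
        unfolding s_def by (rule smooth_fun_sum[OF fin op]) (use ps d in auto)
      show "smooth_fun ?I (snd d ` (mcarrier M \<inter> fst d)) (\<lambda>u. \<rho> (h k) (chart_inv d u) / s (chart_inv d u))"
      proof (rule smooth_fun_divide[OF fin op ps[OF k d] ss])
        fix u assume "u \<in> snd d ` (mcarrier M \<inter> fst d)"
        then obtain x where x: "x \<in> fst d" "u = snd d x" by blast
        then have "chart_inv d u \<in> mcarrier M" using chart_inv_chart[OF d x(1)] chart_subset[OF d] by auto
        from spos[OF this] show "s (chart_inv d u) \<noteq> 0" by simp
      qed
    qed
    show "0 \<le> \<rho> (h k) z / s z" if "z \<in> mcarrier M" for z
      using \<rho>(2)[OF hF[OF k]] spos[OF that] by simp
    have "{z \<in> mcarrier M. \<rho> (h k) z / s z \<noteq> 0} \<subseteq> {x \<in> mcarrier M. \<rho> (h k) x \<noteq> 0}" by auto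
    then show "mtop M closure_of {z \<in> mcarrier M. \<rho> (h k) z / s z \<noteq> 0} \<subseteq> fst (c (h k))"
      by (rule subset_trans[OF closure_of_mono \<rho>(4)[OF hF[OF k]]])
  next
    fix z assume "z \<in> mcarrier M"
    then show "(\<Sum>k<card F. \<rho> (h k) z / s z) = 1"
      using spos[of z] by (simp add: sum_divide_distrib[symmetric] s_def[symmetric])
  qed
  then show ?thesis by blast
qed

section \<open>Uniformity over compact sets\<close>

lemma zero_outside_support:
  assumes M: "premanifold M" and z: "z \<in> mcarrier M" "z \<notin> mtop M closure_of {z \<in> mcarrier M. \<rho> z \<noteq> 0}"
  shows "\<rho> z = 0"
proof (rule ccontr)
  assume "\<rho> z \<noteq> 0"
  then have "z \<in> {z \<in> mcarrier M. \<rho> z \<noteq> 0}" using z(1) by simp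
  moreover have "{z \<in> mcarrier M. \<rho> z \<noteq> 0} \<subseteq> mtop M closure_of {z \<in> mcarrier M. \<rho> z \<noteq> 0}"
    by (rule closure_of_subset) (use topspace_mtop[OF M] in auto)
  ultimately show False using z(2) by blast
qed

text \<open>Local constants are replaced by their maximum over a finite subcover. A time radius fits
  this pattern when it is written as the reciprocal of \<open>b\<close>, since larger
  \<open>b\<close> then means a weaker condition.\<close>

lemma compactin_uniform:
  assumes K: "compactin X K" and loc: "\<And>z. z \<in> K \<Longrightarrow> \<exists>N b. openin X N \<and> z \<in> N \<and> (\<forall>x\<in>N. Q b x)"
    and mono: "\<And>a b x. a \<le> b \<Longrightarrow> Q a x \<Longrightarrow> Q b x"
  shows "\<exists>b::real. \<forall>x\<in>K. Q b x"
proof -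
  obtain N b where N: "\<And>z. z \<in> K \<Longrightarrow> openin X (N z) \<and> z \<in> N z \<and> (\<forall>x\<in>N z. Q (b z) x)" using loc by metis
  have "\<exists>\<F>. finite \<F> \<and> \<F> \<subseteq> N ` K \<and> K \<subseteq> \<Union>\<F>"
    using K N unfolding compactin_def by (elim conjE allE[of _ "N ` K"]) blast
  then obtain \<F> where F: "finite \<F>" "\<F> \<subseteq> N ` K" "K \<subseteq> \<Union>\<F>" by blast
  obtain F where F': "F \<subseteq> K" "finite F" "\<F> = N ` F" using finite_subset_image[OF F(1,2)] by blast
  \<comment> \<open>The inserted 0 keeps \<open>Max\<close> meaningful when \<open>K\<close> is
    empty.\<close>
  have "Q (Max (insert 0 (b ` F))) x" if x: "x \<in> K" for x
  proof -
    obtain z where z: "z \<in> F" "x \<in> N z" using F(3) F'(3) x by blast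
    have "b z \<le> Max (insert 0 (b ` F))" using z(1) F'(2) by (intro Max_ge) auto
    then show ?thesis using mono N z F'(1) by blast
  qed
  then show ?thesis by blast
qed

text \<open>A cube around time 0 and the coordinates of \<open>z\<close> splits into a time interval
  and a neighbourhood of \<open>z\<close>; its size also bounds how far the coordinates
  vary.\<close>

lemma tube_in_chart:
  assumes M: "premanifold M" and c: "c \<in> charts M" "z \<in> fst c"
    and \<Omega>: "open_coord (UNIV <+> midx M) \<Omega>" "case_sum (\<lambda>_::unit. 0) (snd c z) \<in> \<Omega>"
  obtains e N where "e > 0" "openin (mtop M) N" "z \<in> N" "N \<subseteq> fst c"
    "\<And>t x. \<bar>t\<bar> < e \<Longrightarrow> x \<in> N \<Longrightarrow> case_sum (\<lambda>_. t) (snd c x) \<in> \<Omega>"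
    "\<And>x i. x \<in> N \<Longrightarrow> i \<in> midx M \<Longrightarrow> \<bar>snd c x i - snd c z i\<bar> < e"
proof -
  let ?I = "midx M" and ?T = "UNIV <+> midx M :: (unit + 'b) set" and ?w0 = "case_sum (\<lambda>_::unit. 0) (snd c z)"
  note fin = premanifold_finite[OF M]
  have finT: "finite ?T" using fin by simp
  obtain e where e: "e > 0" "\<And>w. w \<in> coord_space ?T \<Longrightarrow> (\<And>k. k \<in> ?T \<Longrightarrow> \<bar>w k - ?w0 k\<bar> < e) \<Longrightarrow> w \<in> \<Omega>"
    using open_coordD[OF \<Omega>(1) finT \<Omega>(2)] by blast
  define N where "N = {x \<in> fst c. \<forall>i\<in>?I. \<bar>snd c x i - snd c z i\<bar> < e}"
  have im: "snd c ` N = snd c ` fst c \<inter> {u \<in> coord_space ?I. \<forall>i\<in>?I. \<bar>u i - snd c z i\<bar> < e}"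
    using chart_coord[OF c(1)] by (auto simp: N_def)
  have "open_coord ?I (snd c ` N)"
    unfolding im by (rule open_coord_Int[OF chart_open[OF c(1)] open_coord_box[OF fin]])
  then have "openin (mtop M) N" by (intro openin_mtop_in_chart[OF M c(1)]) (auto simp: N_def)
  moreover have "case_sum (\<lambda>_. t) (snd c x) \<in> \<Omega>" if "\<bar>t\<bar> < e" "x \<in> N" for t x
  proof (rule e(2))
    show "case_sum (\<lambda>_. t) (snd c x) \<in> coord_space ?T"
      using chart_coord[OF c(1), of x] that(2) by (simp add: coord_space_Plus case_sum_o_inj coord_space_UNIV N_def)
    fix k assume "k \<in> ?T"
    then show "\<bar>case_sum (\<lambda>_. t) (snd c x) k - ?w0 k\<bar> < e" using that by (cases k) (auto simp: N_def)
  qed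
  ultimately show thesis using e(1) c(2) by (intro that[of e N]) (simp_all add: N_def subset_iff)
qed

subsection \<open>Existence of families with prescribed velocity\<close>

lemma variationD:
  fixes Y :: "('y, nat) mfd" and Z :: "('z, nat) mfd"
  assumes "variation Y Z \<pi> \<upsilon> \<eta>" "z \<in> mcarrier Z"
  shows "fst (\<eta> z) = \<upsilon> z" "\<eta> z \<in> vertical Y Z \<pi>"
proof -
  show "fst (\<eta> z) = \<upsilon> z" using assms by (simp add: variation_def)
  have "smooth_map_on Z (vert_mfd Y Z \<pi>) (mcarrier Z) \<eta>" using assms(1) by (simp add: variation_def)
  from bspec[OF this[unfolded smooth_map_on_def] assms(2)]
  have "\<exists>(c::('z, nat) chart) d. z \<in> fst c \<and> d \<in> charts (vert_mfd Y Z \<pi>) \<and> \<eta> ` fst c \<subseteq> fst d"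
    by (elim bexE conjE) (intro exI conjI, assumption+)
  then obtain c :: "('z, nat) chart" and d where cd: "z \<in> fst c" "d \<in> charts (vert_mfd Y Z \<pi>)" "\<eta> ` fst c \<subseteq> fst d"
    by (elim exE conjE) (rule that)
  have "\<eta> z \<in> mcarrier (vert_mfd Y Z \<pi>)" using chart_subset[OF cd(2)] cd(1,3) by blast
  then show "\<eta> z \<in> vertical Y Z \<pi>" by (simp add: vert_mfd_def)
qed

context fibred
begin

lemma smooth_constant_family:
  assumes s: "smooth_map_on Z Y W s"
  shows "smooth_map_on P Y ({-\<epsilon><..<\<epsilon>} \<times> W) (\<lambda>(t, z). s z)"
  unfolding smooth_map_on_iff[OF premanifold_P]
proof
  fix x assume "x \<in> {-\<epsilon><..<\<epsilon>} \<times> W"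
  then obtain t z where x: "x = (t, z)" "t \<in> {-\<epsilon><..<\<epsilon>}" "z \<in> W" by blast
  obtain c d U where cd: "c \<in> charts Z" "d \<in> charts Y" "z \<in> U" "U \<subseteq> W"
    and U: "smooth_in_charts (midx Z) (midx Y) c d U s"
    using s x(3) unfolding smooth_map_on_iff[OF Z] by blast
  have U': "U \<subseteq> fst c" "s ` U \<subseteq> fst d" "open_coord (midx Z) (snd c ` U)"
    "\<And>j. j \<in> midx Y \<Longrightarrow> smooth_fun (midx Z) (snd c ` U) (\<lambda>u. snd d (s (chart_inv c u)) j)"
    using U unfolding smooth_in_charts_def by blast+
  let ?pc = "prod_chart real_chart c" and ?O = "{-\<epsilon><..<\<epsilon>} \<times> U"
  have pc: "?pc \<in> charts P" by (rule prod_chart_charts[OF premanifold_real Z real_chart_charts cd(1)])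
  have im: "snd ?pc ` ?O = {w. w \<circ> Inl \<in> {u. u () \<in> {-\<epsilon><..<\<epsilon>}} \<and> w \<circ> Inr \<in> snd c ` U}"
    unfolding prod_chart_image snd_conv real_chart_image ..
  have op: "open_coord (UNIV <+> midx Z) (snd ?pc ` ?O)"
    unfolding im by (intro open_coord_Plus open_coord_real U'(3)) simp
  have "smooth_in_charts (UNIV <+> midx Z) (midx Y) ?pc d ?O (\<lambda>(t, z). s z)"
    unfolding smooth_in_charts_def
  proof (intro conjI ballI op)
    show "?O \<subseteq> fst ?pc" "(\<lambda>(t, z). s z) ` ?O \<subseteq> fst d" using U'(1,2) by auto
    fix j assume j: "j \<in> midx Y"
    have "smooth_fun (UNIV <+> midx Z) (snd ?pc ` ?O) (\<lambda>w. snd d (s (chart_inv c (w \<circ> Inr))) j)"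
      by (rule smooth_fun_reindex[OF finZ fin_time U'(3) op U'(4)[OF j]]) (simp add: im)
    then show "smooth_fun (UNIV <+> midx Z) (snd ?pc ` ?O) (\<lambda>w. snd d ((\<lambda>(t, z). s z) (chart_inv ?pc w)) j)"
    proof (rule smooth_fun_congI[OF fin_time op])
      fix w assume "w \<in> snd ?pc ` ?O"
      then have "w \<in> snd ?pc ` (fst real_chart \<times> fst c)"
        by (rule subsetD[OF image_mono, rotated]) (intro Sigma_mono U'(1), simp)
      from prod_chart_inv[OF chart_inj[OF real_chart_charts] chart_inj[OF cd(1)] this]
      show "snd d (s (chart_inv c (w \<circ> Inr))) j = snd d ((\<lambda>(t, z). s z) (chart_inv ?pc w)) j" by simp
    qed
  qed
  moreover have "x \<in> ?O" using x(1,2) cd(3) by simp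
  moreover have "?O \<subseteq> {-\<epsilon><..<\<epsilon>} \<times> W" using cd(4) by (intro Sigma_mono) auto
  ultimately show "\<exists>c\<in>charts P. \<exists>d\<in>charts Y. \<exists>U. x \<in> U \<and> U \<subseteq> {-\<epsilon><..<\<epsilon>} \<times> W \<and>
      smooth_in_charts (midx P) (midx Y) c d U (\<lambda>(t, z). s z)"
    unfolding midx_prod midx_real by (intro bexI[OF _ pc] bexI[OF _ cd(2)] exI[of _ ?O] conjI)
qed

text \<open>The zero vector at \<open>y\<close>, written as a combination with zero coefficients:
  the form in which the successive addition of multiples of \<open>\<eta>\<close> begins.\<close>

lemma velocity_constant: "velocity Y (\<lambda>t. y) = tvec_lin 0 (y, \<beta>) 0 v"
  by (simp add: velocity_def tvec_lin_def fun_eq_iff)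

text \<open>
  In a fibred chart, the family moves with constant speed along the fibre components of \<open>\<rho> \<eta>\<close>;
  outside the support of \<open>\<rho>\<close> it is unchanged.
\<close>

lemma perturb_family:
  assumes f: "\<epsilon> > 0" "smooth_map_on P Y ({-\<epsilon><..<\<epsilon>} \<times> mcarrier Z) (\<lambda>(t, z). \<Upsilon> t z)"
      "\<And>t z. t \<in> {-\<epsilon><..<\<epsilon>} \<Longrightarrow> z \<in> mcarrier Z \<Longrightarrow> \<pi> (\<Upsilon> t z) = z"
    and \<eta>: "variation Y Z \<pi> (\<Upsilon> 0) \<eta>"
    and cd: "(c, d) \<in> fibred_charts Y Z \<pi>"
    and K: "compactin (mtop Z) K" "closedin (mtop Z) K" "K \<subseteq> fst c" "\<Upsilon> 0 ` K \<subseteq> fst d"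
    and \<rho>: "smooth_map_on Z real_mfd (mcarrier Z) \<rho>" "\<And>z. z \<in> mcarrier Z \<Longrightarrow> z \<notin> K \<Longrightarrow> \<rho> z = 0"
  shows "\<exists>\<Upsilon>' \<delta>. \<delta> > 0 \<and> smooth_map_on P Y ({-\<delta><..<\<delta>} \<times> mcarrier Z) (\<lambda>(t, z). \<Upsilon>' t z) \<and>
    (\<forall>t\<in>{-\<delta><..<\<delta>}. \<forall>z\<in>mcarrier Z. \<pi> (\<Upsilon>' t z) = z) \<and>
    (\<forall>z\<in>mcarrier Z. velocity Y (\<lambda>t. \<Upsilon>' t z) = tvec_lin 1 (velocity Y (\<lambda>t. \<Upsilon> t z)) (\<rho> z) (\<eta> z))"
proof -
  let ?J = "midx Z" and ?T = "UNIV <+> midx Z :: (unit + nat) set" and ?F = "midx Y - midx Z"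
  let ?pc = "prod_chart real_chart c"
  note D = fibred_chartD[OF cd]
  note finT = fin_time
  have mZ: "openin (mtop Z) (mcarrier Z)" by (rule openin_mcarrier[OF Z])
  note f' = mZ f(1,2,3)
  have pc: "?pc \<in> charts P" by (rule prod_chart_charts[OF premanifold_real Z real_chart_charts D(1)])
  have v: "\<eta> z \<in> vertical Y Z \<pi>" "fst (\<eta> z) = \<Upsilon> 0 z" if "z \<in> mcarrier Z" for z
    using variationD[OF \<eta> that] by blast+
  define S0 where "S0 = {z \<in> fst c \<inter> mcarrier Z. \<Upsilon> 0 z \<in> fst d}"
  have S0: "{z \<in> fst c \<inter> mcarrier Z. \<eta> z \<in> fst (vert_chart d)} = S0"
    unfolding S0_def fst_vert_chart using v by force
  have s\<eta>: "smooth_map_on Z (vert_mfd Y Z \<pi>) (mcarrier Z) \<eta>" using \<eta> by (simp add: variation_def)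
  have sv: "smooth_in_charts ?J (midx Y <+> ?F) c (vert_chart d) S0 \<eta>"
    using smooth_map_on_in_charts[OF Z premanifold_vert s\<eta> D(1) vert_chart_charts[OF cd]]
    unfolding S0 midx_vert .
  define h where "h a u = snd (\<eta> (chart_inv c u)) d a" for a u
  have op0: "open_coord ?J (snd c ` S0)" using sv unfolding smooth_in_charts_def by blast
  have hs: "smooth_fun ?J (snd c ` S0) (h a)" if a: "a \<in> ?F" for a
  proof -
    have "smooth_fun ?J (snd c ` S0) (\<lambda>u. snd (vert_chart d) (\<eta> (chart_inv c u)) (Inr a))"
      using sv a unfolding smooth_in_charts_def by blast
    then show ?thesis using a by (simp add: snd_vert_chart h_def[abs_def])
  qed
  have \<rho>s: "smooth_fun ?J (snd c ` S0) (\<lambda>u. \<rho> (chart_inv c u))"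
  proof -
    have "smooth_fun ?J (snd c ` (mcarrier Z \<inter> fst c)) (\<lambda>u. \<rho> (chart_inv c u))"
      using \<rho>(1) D(1) unfolding smooth_map_real_iff[OF Z] by blast
    then show ?thesis by (rule smooth_fun_subset) (auto simp: S0_def)
  qed
  \<comment> \<open>The times and points at which the family lies in the chart \<open>d\<close>, and
    at which the components of \<open>\<eta>\<close> in \<open>d\<close> are smooth because the
    section at time 0 lies in \<open>d\<close> as well.\<close>
  define D1 where "D1 = {w \<in> fam_dom \<epsilon> (mcarrier Z) c d \<Upsilon>. w \<circ> Inr \<in> snd c ` S0}"
  note rep = smooth_fam_rep[OF Z Y f(2) D(1,2)]
  have fam_dom: "\<exists>t z. w = case_sum (\<lambda>_. t) (snd c z) \<and> t \<in> {-\<epsilon><..<\<epsilon>} \<and> z \<in> mcarrier Z \<and> z \<in> fst c \<and> \<Upsilon> t z \<in> fst d"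
    if "w \<in> fam_dom \<epsilon> (mcarrier Z) c d \<Upsilon>" for w using that unfolding fam_dom_def by blast
  have op1: "open_coord ?T D1"
    unfolding D1_def
  proof (rule open_coord_preimage[OF rep(1) continuous_on_comp_coord op0])
    show "(\<lambda>w. w \<circ> Inr) ` fam_dom \<epsilon> (mcarrier Z) c d \<Upsilon> \<subseteq> coord_space ?J"
      using open_coord_subset[OF rep(1)] coord_space_Plus by blast
  qed
  \<comment> \<open>Coordinates of the perturbed family. The base components get no addition, so the
    perturbed maps are again sections.\<close>
  define \<Phi> where "\<Phi> w = (\<lambda>i. fam_rep c d \<Upsilon> i w + w (Inl ()) * \<rho> (chart_inv c (w \<circ> Inr)) * (if i \<in> ?F then h i (w \<circ> Inr) else 0))" for w
  have \<Phi>s: "smooth_fun ?T D1 (\<lambda>w. \<Phi> w i)" if i: "i \<in> midx Y" for i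
    unfolding \<Phi>_def
  proof (intro smooth_fun_add[OF finT op1] smooth_fun_mult[OF finT op1] smooth_fun_proj[OF finT op1])
    show "smooth_fun ?T D1 (fam_rep c d \<Upsilon> i)" by (rule smooth_fun_subset[OF rep(2)[OF i]]) (auto simp: D1_def)
    show "smooth_fun ?T D1 (\<lambda>w. \<rho> (chart_inv c (w \<circ> Inr)))"
      by (rule smooth_fun_reindex[OF finZ finT op0 op1 \<rho>s]) (simp add: D1_def)
    show "smooth_fun ?T D1 (\<lambda>w. if i \<in> ?F then h i (w \<circ> Inr) else 0)"
    proof (cases "i \<in> ?F")
      case True
      have "smooth_fun ?T D1 (\<lambda>w. h i (w \<circ> Inr))"
        by (rule smooth_fun_reindex[OF finZ finT op0 op1 hs[OF True]]) (simp add: D1_def)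
      then show ?thesis unfolding if_P[OF True] .
    qed (simp only: if_False smooth_fun_const[OF finT op1])
  qed
  have \<Phi>c: "\<Phi> w \<in> coord_space (midx Y)" if w: "w \<in> D1" for w
  proof -
    have "w \<in> fam_dom \<epsilon> (mcarrier Z) c d \<Upsilon>" using w by (simp add: D1_def)
    from fam_dom[OF this] obtain t z where tz: "w = case_sum (\<lambda>_. t) (snd c z)" "z \<in> fst c" "\<Upsilon> t z \<in> fst d" by blast
    have "fam_rep c d \<Upsilon> i w = snd d (\<Upsilon> t z) i" for i
      unfolding tz(1) fam_rep_case_sum chart_inv_chart[OF D(1) tz(2)] ..
    then show ?thesis using chart_coord[OF D(2) tz(3)] by (simp add: coord_space_def \<Phi>_def)
  qed
  define D2 where "D2 = {w \<in> D1. \<Phi> w \<in> snd d ` fst d}"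
  have \<Phi>cont: "continuous_on D1 \<Phi>"
    by (rule continuous_on_into_coord_space[of "midx Y"]) (use smooth_fun_continuous[OF \<Phi>s] \<Phi>c in auto)
  have op2: "open_coord ?T D2"
    unfolding D2_def by (rule open_coord_preimage[OF op1 \<Phi>cont chart_open[OF D(2)]]) (use \<Phi>c in blast)
  have D2E: "t \<in> {-\<epsilon><..<\<epsilon>}" "z \<in> mcarrier Z" "\<Upsilon> t z \<in> fst d" "z \<in> S0" "\<Phi> (case_sum (\<lambda>_. t) (snd c z)) \<in> snd d ` fst d"
    if w: "case_sum (\<lambda>_. t) (snd c z) \<in> D2" and z: "z \<in> fst c" for t z
  proof -
    have w1: "case_sum (\<lambda>_. t) (snd c z) \<in> fam_dom \<epsilon> (mcarrier Z) c d \<Upsilon>" "snd c z \<in> snd c ` S0"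
      using w by (simp_all add: D2_def D1_def case_sum_o_inj)
    from fam_dom[OF w1(1)] obtain t' z' where tz: "case_sum (\<lambda>_::unit. t) (snd c z) = case_sum (\<lambda>_. t') (snd c z')"
      "t' \<in> {-\<epsilon><..<\<epsilon>}" "z' \<in> mcarrier Z" "z' \<in> fst c" "\<Upsilon> t' z' \<in> fst d" by (elim exE conjE) (rule that)
    have "t' = t" "snd c z = snd c z'" using tz(1) unfolding case_sum_eq_iff by (simp_all add: fun_eq_iff)
    moreover from this(2) have "z = z'" by (rule inj_onD[OF chart_inj[OF D(1)] _ z tz(4)])
    ultimately show "t \<in> {-\<epsilon><..<\<epsilon>}" "z \<in> mcarrier Z" "\<Upsilon> t z \<in> fst d" using tz by simp_all
    obtain z'' where z'': "z'' \<in> S0" "snd c z = snd c z''" using w1(2) by blast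
    have "z = z''" by (rule inj_onD[OF chart_inj[OF D(1)] z''(2) z]) (use z''(1) in \<open>simp add: S0_def\<close>)
    then show "z \<in> S0" using z''(1) by simp
    show "\<Phi> (case_sum (\<lambda>_. t) (snd c z)) \<in> snd d ` fst d" using w by (simp add: D2_def)
  qed
  have \<Phi>eq: "\<Phi> (case_sum (\<lambda>_. t) (snd c z)) = (\<lambda>i. snd d (\<Upsilon> t z) i + t * \<rho> z * (if i \<in> ?F then snd (\<eta> z) d i else 0))"
    if "z \<in> fst c" for t z
    unfolding \<Phi>_def fam_rep_case_sum h_def case_sum_o_inj chart_inv_chart[OF D(1) that] by simp
  have KZ: "K \<subseteq> mcarrier Z" using K(3) chart_subset[OF D(1)] by blast
  have K0: "case_sum (\<lambda>_. 0) (snd c z) \<in> D2" if z: "z \<in> K" for z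
  proof -
    have z': "z \<in> fst c" "z \<in> mcarrier Z" "\<Upsilon> 0 z \<in> fst d" using z K(3,4) KZ by blast+
    have "\<Phi> (case_sum (\<lambda>_. 0) (snd c z)) = snd d (\<Upsilon> 0 z)" unfolding \<Phi>eq[OF z'(1)] by simp
    moreover have "case_sum (\<lambda>_. 0) (snd c z) \<in> fam_dom \<epsilon> (mcarrier Z) c d \<Upsilon>"
      unfolding fam_dom_def using z' f(1) by (intro CollectI exI[of _ 0] exI[of _ z]) simp
    ultimately show ?thesis using z' by (simp add: D2_def D1_def case_sum_o_inj S0_def)
  qed
  \<comment> \<open>Compactness of \<open>K\<close> gives a single time radius \<open>1 / b\<close>
    for which the perturbed coordinates stay in the chart.\<close>
  have "\<exists>b. \<forall>z\<in>K. b > 0 \<and> (\<forall>t. \<bar>t\<bar> < 1 / b \<longrightarrow> case_sum (\<lambda>_. t) (snd c z) \<in> D2)"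
  proof (rule compactin_uniform[OF K(1)])
    fix z assume z: "z \<in> K"
    obtain e N where N: "e > 0" "openin (mtop Z) N" "z \<in> N" "N \<subseteq> fst c"
        "\<And>t x. \<bar>t\<bar> < e \<Longrightarrow> x \<in> N \<Longrightarrow> case_sum (\<lambda>_. t) (snd c x) \<in> D2"
      by (rule tube_in_chart[OF Z D(1) _ op2 K0[OF z]]) (use z K(3) in auto)
    show "\<exists>N b. openin (mtop Z) N \<and> z \<in> N \<and> (\<forall>x\<in>N. b > 0 \<and> (\<forall>t. \<bar>t\<bar> < 1 / b \<longrightarrow> case_sum (\<lambda>_. t) (snd c x) \<in> D2))"
      by (intro exI[of _ N] exI[of _ "1 / e"]) (use N in simp)
  next
    fix a b :: real and x
    assume ab: "a \<le> b" and a: "a > 0 \<and> (\<forall>t. \<bar>t\<bar> < 1 / a \<longrightarrow> case_sum (\<lambda>_. t) (snd c x) \<in> D2)"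
    have "1 / b \<le> 1 / a" using ab a by (intro divide_left_mono mult_pos_pos) auto
    then show "b > 0 \<and> (\<forall>t. \<bar>t\<bar> < 1 / b \<longrightarrow> case_sum (\<lambda>_. t) (snd c x) \<in> D2)"
      using a ab by (meson less_le_trans)
  qed
  then obtain b where b: "\<forall>z\<in>K. b > 0 \<and> (\<forall>t. \<bar>t\<bar> < 1 / b \<longrightarrow> case_sum (\<lambda>_. t) (snd c z) \<in> D2)" by blast
  \<comment> \<open>If \<open>b\<close> is not positive, then \<open>K\<close> is empty and any
    positive radius will do.\<close>
  define \<delta> where "\<delta> = min \<epsilon> (if b > 0 then 1 / b else 1)"
  have \<delta>: "\<delta> > 0" "\<delta> \<le> \<epsilon>" using f(1) by (simp_all add: \<delta>_def)
  have tube: "case_sum (\<lambda>_. t) (snd c z) \<in> D2" if zt: "z \<in> K" "t \<in> {-\<delta><..<\<delta>}" for z t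
  proof -
    have "b > 0" using b zt(1) by blast
    then have "\<bar>t\<bar> < 1 / b" using zt(2) by (auto simp: \<delta>_def)
    then show ?thesis using b zt(1) by blast
  qed
  define \<Psi> where "\<Psi> t z = chart_inv d (\<Phi> (case_sum (\<lambda>_. t) (snd c z)))" for t z
  define \<Upsilon>' where "\<Upsilon>' t z = (if z \<in> K then \<Psi> t z else \<Upsilon> t z)" for t z
  define R where "R = {x. snd x \<in> fst c \<and> case_sum (\<lambda>_. fst x) (snd c (snd x)) \<in> D2}"
  \<comment> \<open>On the open set \<open>R\<close>, which reaches beyond \<open>K\<close>, both
    branches of the definition agree: off \<open>K\<close> the factor \<open>\<rho>\<close> vanishes
    and nothing is added. This gives smoothness across the boundary of \<open>K\<close>.\<close>
  have \<Upsilon>'R: "\<Upsilon>' t z = \<Psi> t z" if tz: "(t, z) \<in> R" for t z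
  proof (cases "z \<in> K")
    case False
    have z: "z \<in> fst c" "case_sum (\<lambda>_. t) (snd c z) \<in> D2" using tz by (simp_all add: R_def)
    note E = D2E[OF z(2,1)]
    have "\<Phi> (case_sum (\<lambda>_. t) (snd c z)) = snd d (\<Upsilon> t z)"
      unfolding \<Phi>eq[OF z(1)] \<rho>(2)[OF E(2) False] by simp
    then show ?thesis using False by (simp add: \<Psi>_def \<Upsilon>'_def chart_inv_chart[OF D(2) E(3)])
  qed (simp add: \<Upsilon>'_def)
  have imR: "snd ?pc ` R = D2"
  proof (intro equalityI subsetI)
    fix w assume w: "w \<in> D2"
    then have "w \<in> fam_dom \<epsilon> (mcarrier Z) c d \<Upsilon>" by (simp add: D2_def D1_def)
    from fam_dom[OF this] obtain t z where tz: "w = case_sum (\<lambda>_. t) (snd c z)" "z \<in> fst c" by blast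
    then have "(t, z) \<in> R" "w = snd ?pc (t, z)" using w by (simp_all add: R_def)
    then show "w \<in> snd ?pc ` R" by blast
  next
    fix w assume "w \<in> snd ?pc ` R"
    then obtain x where "x \<in> R" "w = snd ?pc x" by blast
    then show "w \<in> D2" by (cases x) (simp add: R_def)
  qed
  have sR: "smooth_in_charts ?T (midx Y) ?pc d R (\<lambda>(t, z). \<Psi> t z)"
    unfolding smooth_in_charts_def imR
  proof (intro conjI ballI op2)
    show "R \<subseteq> fst ?pc" by (auto simp: R_def)
    show "(\<lambda>(t, z). \<Psi> t z) ` R \<subseteq> fst d"
    proof (intro image_subsetI)
      fix x assume x: "x \<in> R"
      have "\<Phi> (case_sum (\<lambda>_. fst x) (snd c (snd x))) \<in> snd d ` fst d" by (rule D2E(5)) (use x in \<open>simp_all add: R_def\<close>)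
      from chart_inv_in[OF this] show "(case x of (t, z) \<Rightarrow> \<Psi> t z) \<in> fst d" by (cases x) (simp add: \<Psi>_def)
    qed
    fix j assume j: "j \<in> midx Y"
    show "smooth_fun ?T D2 (\<lambda>w. snd d ((\<lambda>(t, z). \<Psi> t z) (chart_inv ?pc w)) j)"
    proof (rule smooth_fun_congI[OF finT op2])
      show "smooth_fun ?T D2 (\<lambda>w. \<Phi> w j)" by (rule smooth_fun_subset[OF \<Phi>s[OF j]]) (auto simp: D2_def)
      fix w assume w: "w \<in> D2"
      then obtain t z where tz: "(t, z) \<in> R" "w = snd ?pc (t, z)" using imR by force
      have z: "z \<in> fst c" using tz(1) by (simp add: R_def)
      have "chart_inv ?pc w = (t, z)" unfolding tz(2) by (rule chart_inv_chart[OF pc]) (simp add: z)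
      moreover have "\<Phi> w \<in> snd d ` fst d" using w by (simp add: D2_def)
      moreover have "w = case_sum (\<lambda>_. t) (snd c z)" using tz(2) by simp
      ultimately show "\<Phi> w j = snd d ((\<lambda>(t, z). \<Psi> t z) (chart_inv ?pc w)) j"
        by (simp add: \<Psi>_def chart_chart_inv)
    qed
  qed
  have opR: "openin (mtop P) R"
    by (rule smooth_in_charts_openin[OF premanifold_P pc]) (use sR in \<open>simp only: midx_prod midx_real\<close>)
  have smR: "smooth_map_on P Y R (\<lambda>(t, z). \<Psi> t z)"
    unfolding smooth_map_on_iff[OF premanifold_P] midx_prod midx_real using pc D(2) sR by blast
  have smR': "smooth_map_on P Y R (\<lambda>(t, z). \<Upsilon>' t z)"
    by (rule smooth_map_on_cong[OF premanifold_P _ smR]) (auto simp: \<Upsilon>'R)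
  have opI: "openin (mtop P) ({-\<delta><..<\<delta>} \<times> mcarrier Z)" by (rule time_interval_prod_open[OF mZ])
  have opK: "openin (mtop P) ({-\<delta><..<\<delta>} \<times> (mcarrier Z - K))"
    by (rule time_interval_prod_open) (use K(2) topspace_mtop[OF Z] in \<open>simp add: closedin_def\<close>)
  have smK: "smooth_map_on P Y ({-\<delta><..<\<delta>} \<times> (mcarrier Z - K)) (\<lambda>(t, z). \<Upsilon>' t z)"
  proof (rule smooth_map_on_cong[OF premanifold_P])
    show "smooth_map_on P Y ({-\<delta><..<\<delta>} \<times> (mcarrier Z - K)) (\<lambda>(t, z). \<Upsilon> t z)"
      by (rule smooth_map_on_subset[OF premanifold_P Y f(2) opK]) (use \<delta> in auto)
    show "(case x of (t, z) \<Rightarrow> \<Upsilon> t z) = (case x of (t, z) \<Rightarrow> \<Upsilon>' t z)"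
      if "x \<in> {-\<delta><..<\<delta>} \<times> (mcarrier Z - K)" for x using that by (cases x) (simp add: \<Upsilon>'_def)
  qed
  have sm': "smooth_map_on P Y ({-\<delta><..<\<delta>} \<times> mcarrier Z) (\<lambda>(t, z). \<Upsilon>' t z)"
  proof (rule smooth_map_on_locally)
    fix x assume x: "x \<in> {-\<delta><..<\<delta>} \<times> mcarrier Z"
    show "\<exists>T. x \<in> T \<and> T \<subseteq> {-\<delta><..<\<delta>} \<times> mcarrier Z \<and> smooth_map_on P Y T (\<lambda>(t, z). \<Upsilon>' t z)"
    proof (cases "snd x \<in> K")
      case True
      then have "x \<in> R \<inter> ({-\<delta><..<\<delta>} \<times> mcarrier Z)" using x tube K(3) by (auto simp: R_def)
      moreover have "smooth_map_on P Y (R \<inter> ({-\<delta><..<\<delta>} \<times> mcarrier Z)) (\<lambda>(t, z). \<Upsilon>' t z)"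
        by (rule smooth_map_on_subset[OF premanifold_P Y smR' openin_Int[OF opR opI]]) blast
      ultimately show ?thesis by (intro exI[of _ "R \<inter> ({-\<delta><..<\<delta>} \<times> mcarrier Z)"] conjI Int_lower2)
    next
      case False
      then have "x \<in> {-\<delta><..<\<delta>} \<times> (mcarrier Z - K)" using x by auto
      with smK show ?thesis
        by (intro exI[of _ "{-\<delta><..<\<delta>} \<times> (mcarrier Z - K)"] conjI) auto
    qed
  qed
  have sec': "\<pi> (\<Upsilon>' t z) = z" if tz: "t \<in> {-\<delta><..<\<delta>}" "z \<in> mcarrier Z" for t z
  proof (cases "z \<in> K")
    case True
    then have z: "z \<in> fst c" using K(3) by blast
    note E = D2E[OF tube[OF True tz(1)] z]
    have "\<pi> (chart_inv d (\<Phi> (case_sum (\<lambda>_. t) (snd c z)))) = z"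
    proof (rule fibred_chart_proj[OF cd z E(5)])
      fix i assume i: "i \<in> midx Z"
      have "\<pi> (\<Upsilon> t z) = z" using f(3)[OF E(1,2)] .
      then show "\<Phi> (case_sum (\<lambda>_. t) (snd c z)) i = snd c z i"
        unfolding \<Phi>eq[OF z] using D(4)[OF E(3) i] i by simp
    qed
    then show ?thesis using True by (simp add: \<Upsilon>'_def \<Psi>_def)
  next
    case False
    have "t \<in> {-\<epsilon><..<\<epsilon>}" using tz(1) \<delta>(2) by auto
    from f(3)[OF this tz(2)] show ?thesis using False by (simp add: \<Upsilon>'_def)
  qed
  have "velocity Y (\<lambda>t. \<Upsilon>' t z) = tvec_lin 1 (velocity Y (\<lambda>t. \<Upsilon> t z)) (\<rho> z) (\<eta> z)" if z: "z \<in> mcarrier Z" for z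
  proof (cases "z \<in> K")
    case False
    then show ?thesis using \<rho>(2)[OF z False] by (simp add: \<Upsilon>'_def tvec_lin_def prod_eq_iff)
  next
    case True
    then have zc: "z \<in> fst c" using K(3) by blast
    have c1: "smooth_curve Y (\<lambda>t. \<Upsilon>' t z)" by (rule family_curve[OF mZ \<delta>(1) sm' sec' z])
    have c2: "smooth_curve Y (\<lambda>t. \<Upsilon> t z)" by (rule family_curve[OF f' z])
    obtain \<sigma> where \<sigma>: "smooth_curve Y \<sigma>" "\<eta> z = velocity Y \<sigma>" "\<sigma> 0 = fst (\<eta> z)" using verticalE[OF v(1)[OF z]] by metis
    have d0: "\<Upsilon> 0 z \<in> fst d" using K(4) True by blast
    have "\<Phi> (case_sum (\<lambda>_. 0) (snd c z)) = snd d (\<Upsilon> 0 z)" unfolding \<Phi>eq[OF zc] by simp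
    then have base: "\<Upsilon>' 0 z = \<Upsilon> 0 z" using True by (simp add: \<Upsilon>'_def \<Psi>_def chart_inv_chart[OF D(2) d0])
    show ?thesis unfolding \<sigma>(2)
    proof (rule velocity_lin[OF Y c1 c2 \<sigma>(1) _ _ D(2)])
      show "\<Upsilon> 0 z = \<Upsilon>' 0 z" "\<sigma> 0 = \<Upsilon>' 0 z" "\<Upsilon>' 0 z \<in> fst d" using base \<sigma>(3) v(2)[OF z] d0 by simp_all
      fix i assume i: "i \<in> midx Y"
      let ?a = "\<rho> z * (if i \<in> ?F then snd (\<eta> z) d i else 0)"
      have "((\<lambda>t. snd d (\<Upsilon> t z) i) has_real_derivative snd (velocity Y (\<lambda>t. \<Upsilon> t z)) d i) (at 0)"
        by (rule smooth_curve_derivative[OF Y c2 D(2) d0 i])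
      from DERIV_add[OF this DERIV_cmult_right[OF DERIV_ident, of ?a]]
      have "((\<lambda>t. snd d (\<Upsilon> t z) i + t * ?a) has_real_derivative snd (velocity Y (\<lambda>t. \<Upsilon> t z)) d i + ?a) (at 0)" by simp
      then have "((\<lambda>t. snd d (\<Upsilon>' t z) i) has_real_derivative snd (velocity Y (\<lambda>t. \<Upsilon> t z)) d i + ?a) (at 0)"
      proof (rule DERIV_eventually_cong)
        have "eventually (\<lambda>t. t \<in> {-\<delta><..<\<delta>}) (nhds 0)" using \<delta>(1) by (intro eventually_nhds_in_open) auto
        then show "eventually (\<lambda>t. snd d (\<Upsilon> t z) i + t * ?a = snd d (\<Upsilon>' t z) i) (nhds 0)"
        proof eventually_elim
          case (elim t)
          have "snd d (\<Upsilon>' t z) = \<Phi> (case_sum (\<lambda>_. t) (snd c z))"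
            using True chart_chart_inv[OF D2E(5)[OF tube[OF True elim] zc]] by (simp add: \<Upsilon>'_def \<Psi>_def)
          then show ?case unfolding \<Phi>eq[OF zc] by (simp add: mult.assoc)
        qed
      qed
      moreover have "((\<lambda>t. snd d (\<Upsilon>' t z) i) has_real_derivative snd (velocity Y (\<lambda>t. \<Upsilon>' t z)) d i) (at 0)"
        by (rule smooth_curve_derivative[OF Y c1 D(2) _ i]) (simp add: base d0)
      ultimately have "snd (velocity Y (\<lambda>t. \<Upsilon>' t z)) d i = snd (velocity Y (\<lambda>t. \<Upsilon> t z)) d i + ?a"
        by (rule DERIV_unique[rotated])
      moreover have "(if i \<in> ?F then snd (\<eta> z) d i else 0) = snd (\<eta> z) d i"
      proof (cases "i \<in> ?F")
        case False
        have "snd (\<eta> z) d i = 0"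
          by (rule vertical_base_zero[OF v(1)[OF z] cd]) (use False i d0 v(2)[OF z] in auto)
        then show ?thesis by simp
      qed simp
      ultimately show "snd (velocity Y (\<lambda>t. \<Upsilon>' t z)) d i =
          1 * snd (velocity Y (\<lambda>t. \<Upsilon> t z)) d i + \<rho> z * snd (velocity Y \<sigma>) d i"
        using \<sigma>(2) by simp
    qed
  qed
  then show ?thesis using \<delta>(1) sm' sec' by blast
qed

lemma family_tangent_to_exists:
  assumes Zc: "compact_space (mtop Z)" and \<upsilon>: "cross_section Y Z \<pi> \<upsilon>" and \<eta>: "variation Y Z \<pi> \<upsilon> \<eta>"
  shows "\<exists>\<Upsilon>. family_tangent_to Y Z \<pi> \<upsilon> \<eta> \<Upsilon>"
proof -
  have \<upsilon>': "smooth_map_on Z Y (mcarrier Z) \<upsilon>" "\<And>z. z \<in> mcarrier Z \<Longrightarrow> \<pi> (\<upsilon> z) = z"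
    using \<upsilon> by (auto simp: cross_section_def)
  have haus: "Hausdorff_space (mtop Z)" using fib by (auto simp: fibred_manifold_def smooth_manifold_def)
  \<comment> \<open>Charts small enough for the section over them to stay in the domain of one
    fibred chart, as \<open>perturb_family\<close> requires on the support of
    \<open>\<rho>\<close>.\<close>
  define C where "C = {c'. c' \<in> charts Z \<and> (\<exists>c d. (c, d) \<in> fibred_charts Y Z \<pi> \<and> fst c' \<subseteq> fst c \<and> \<upsilon> ` fst c' \<subseteq> fst d)}"
  have "\<exists>c\<in>C. z \<in> fst c" if z: "z \<in> mcarrier Z" for z
  proof -
    have "local_section Y Z \<pi> z \<upsilon>" unfolding local_section_def using \<upsilon>' openin_mcarrier[OF Z] z by blast
    then obtain c d where cd: "(c, d) \<in> fibred_charts Y Z \<pi>" "z \<in> fst c" "\<upsilon> z \<in> fst d"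
      using fibred_chart_section by metis
    note D = fibred_chartD[OF cd(1)]
    let ?U = "{z \<in> fst c \<inter> mcarrier Z. \<upsilon> z \<in> fst d}"
    have "open_coord (midx Z) (snd c ` ?U)"
      using smooth_map_on_in_charts[OF Z Y \<upsilon>'(1) D(1,2)] unfolding smooth_in_charts_def by blast
    then have "(?U, snd c) \<in> charts Z" by (intro restrict_chart[OF Z D(1)]) auto
    moreover have "fst (?U, snd c) \<subseteq> fst c \<and> \<upsilon> ` fst (?U, snd c) \<subseteq> fst d" by auto
    ultimately have "(?U, snd c) \<in> C" unfolding C_def using cd(1) by blast
    then show ?thesis using cd z by (intro bexI[of _ "(?U, snd c)"]) simp_all
  qed
  then obtain n c \<rho> where "partition_of_unity Z C n c \<rho>"
    using partition_of_unity_exists[OF Z haus Zc, of C] C_def by blast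
  then have \<rho>: "\<And>k. k < n \<Longrightarrow> c k \<in> C" "\<And>k. k < n \<Longrightarrow> smooth_map_on Z real_mfd (mcarrier Z) (\<rho> k)"
      "\<And>k. k < n \<Longrightarrow> mtop Z closure_of {z \<in> mcarrier Z. \<rho> k z \<noteq> 0} \<subseteq> fst (c k)"
      "\<And>z. z \<in> mcarrier Z \<Longrightarrow> (\<Sum>k<n. \<rho> k z) = 1"
    unfolding partition_of_unity_def by blast+
  \<comment> \<open>After \<open>k\<close> perturbations the velocity is the partial sum of the
    \<open>\<rho> j\<close> times \<open>\<eta>\<close>; in \<open>tvec_lin a v 0 v\<close> the
    second summand is idle and the value is the multiple of \<open>v\<close> by
    \<open>a\<close>.\<close>
  have "\<exists>\<Upsilon> \<epsilon>. \<epsilon> > 0 \<and> smooth_map_on P Y ({-\<epsilon><..<\<epsilon>} \<times> mcarrier Z) (\<lambda>(t, z). \<Upsilon> t z) \<and>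
      (\<forall>t\<in>{-\<epsilon><..<\<epsilon>}. \<forall>z\<in>mcarrier Z. \<pi> (\<Upsilon> t z) = z) \<and>
      (\<forall>z\<in>mcarrier Z. velocity Y (\<lambda>t. \<Upsilon> t z) = tvec_lin (\<Sum>j<k. \<rho> j z) (\<eta> z) 0 (\<eta> z))" if "k \<le> n" for k
    using that
  proof (induction k)
    case 0
    have "velocity Y (\<lambda>t. \<upsilon> z) = tvec_lin 0 (\<eta> z) 0 (\<eta> z)" if "z \<in> mcarrier Z" for z
      using velocity_constant[of "\<upsilon> z" "snd (\<eta> z)" "\<eta> z"] variationD(1)[OF \<eta> that] by (metis prod.collapse)
    then show ?case
      using smooth_constant_family[OF \<upsilon>'(1)] \<upsilon>'(2) by (intro exI[of _ "\<lambda>t. \<upsilon>"] exI[of _ 1]) simp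
  next
    case (Suc k)
    then have k: "k < n" "k \<le> n" by simp_all
    obtain \<Upsilon> \<epsilon> where f: "\<epsilon> > 0" "smooth_map_on P Y ({-\<epsilon><..<\<epsilon>} \<times> mcarrier Z) (\<lambda>(t, z). \<Upsilon> t z)"
      "\<forall>t\<in>{-\<epsilon><..<\<epsilon>}. \<forall>z\<in>mcarrier Z. \<pi> (\<Upsilon> t z) = z"
      "\<forall>z\<in>mcarrier Z. velocity Y (\<lambda>t. \<Upsilon> t z) = tvec_lin (\<Sum>j<k. \<rho> j z) (\<eta> z) 0 (\<eta> z)"
      using Suc.IH[OF k(2)] by blast
    \<comment> \<open>A velocity includes its base point, so the section at time 0 has not changed
      and \<open>\<eta>\<close> is still a variation along it.\<close>
    have b: "\<Upsilon> 0 z = \<upsilon> z" if "z \<in> mcarrier Z" for z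
      using arg_cong[OF f(4)[rule_format, OF that], of fst] variationD(1)[OF \<eta> that] by (simp add: tvec_lin_def)
    have \<eta>': "variation Y Z \<pi> (\<Upsilon> 0) \<eta>" using \<eta> b by (simp add: variation_def)
    obtain c' d where cd: "(c', d) \<in> fibred_charts Y Z \<pi>" "fst (c k) \<subseteq> fst c'" "\<upsilon> ` fst (c k) \<subseteq> fst d"
      using \<rho>(1)[OF k(1)] unfolding C_def by blast
    let ?K = "mtop Z closure_of {z \<in> mcarrier Z. \<rho> k z \<noteq> 0}"
    have Kc: "?K \<subseteq> fst (c k)" by (rule \<rho>(3)[OF k(1)])
    have KZ: "?K \<subseteq> mcarrier Z" using closure_of_subset_topspace[of "mtop Z"] topspace_mtop[OF Z] by blast
    have "\<Upsilon> 0 ` ?K \<subseteq> fst d"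
    proof (intro image_subsetI)
      fix z assume z: "z \<in> ?K"
      then have "z \<in> mcarrier Z" "z \<in> fst (c k)" using Kc KZ by blast+
      then show "\<Upsilon> 0 z \<in> fst d" using b[of z] cd(3) by auto
    qed
    moreover have "\<rho> k z = 0" if "z \<in> mcarrier Z" "z \<notin> ?K" for z
      by (rule zero_outside_support[OF Z that])
    ultimately have ex: "\<exists>\<Upsilon>' \<delta>. \<delta> > 0 \<and> smooth_map_on P Y ({-\<delta><..<\<delta>} \<times> mcarrier Z) (\<lambda>(t, z). \<Upsilon>' t z) \<and>
        (\<forall>t\<in>{-\<delta><..<\<delta>}. \<forall>z\<in>mcarrier Z. \<pi> (\<Upsilon>' t z) = z) \<and>
        (\<forall>z\<in>mcarrier Z. velocity Y (\<lambda>t. \<Upsilon>' t z) = tvec_lin 1 (velocity Y (\<lambda>t. \<Upsilon> t z)) (\<rho> k z) (\<eta> z))"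
      by (intro perturb_family[OF f(1,2) _ \<eta>' cd(1) _ closedin_closure_of _ _ \<rho>(2)[OF k(1)]])
        (use f(3) Kc cd(2) closedin_compact_space[OF Zc closedin_closure_of] in blast)+
    have lin: "tvec_lin 1 (velocity Y (\<lambda>t. \<Upsilon> t z)) (\<rho> k z) (\<eta> z) = tvec_lin (\<Sum>j<Suc k. \<rho> j z) (\<eta> z) 0 (\<eta> z)"
      if "z \<in> mcarrier Z" for z
      unfolding f(4)[rule_format, OF that] by (simp add: tvec_lin_def distrib_right)
    from ex obtain \<Upsilon>' \<delta> where g: "\<delta> > 0" "smooth_map_on P Y ({-\<delta><..<\<delta>} \<times> mcarrier Z) (\<lambda>(t, z). \<Upsilon>' t z)"
        "\<forall>t\<in>{-\<delta><..<\<delta>}. \<forall>z\<in>mcarrier Z. \<pi> (\<Upsilon>' t z) = z"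
        "\<forall>z\<in>mcarrier Z. velocity Y (\<lambda>t. \<Upsilon>' t z) = tvec_lin 1 (velocity Y (\<lambda>t. \<Upsilon> t z)) (\<rho> k z) (\<eta> z)"
      by (elim exE conjE) (rule that)
    show ?case
    proof (intro exI[of _ \<Upsilon>'] exI[of _ \<delta>] conjI ballI g(1,2))
      show "\<pi> (\<Upsilon>' t z) = z" if "t \<in> {-\<delta><..<\<delta>}" "z \<in> mcarrier Z" for t z using g(3) that by blast
      show "velocity Y (\<lambda>t. \<Upsilon>' t z) = tvec_lin (\<Sum>j<Suc k. \<rho> j z) (\<eta> z) 0 (\<eta> z)" if z: "z \<in> mcarrier Z" for z
        using g(4)[rule_format, OF z] lin[OF z] by (rule trans)
    qed
  qed
  from this[of n] obtain \<Upsilon> \<epsilon> where f: "\<epsilon> > 0" "smooth_map_on P Y ({-\<epsilon><..<\<epsilon>} \<times> mcarrier Z) (\<lambda>(t, z). \<Upsilon> t z)"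
    "\<forall>t\<in>{-\<epsilon><..<\<epsilon>}. \<forall>z\<in>mcarrier Z. \<pi> (\<Upsilon> t z) = z"
    "\<forall>z\<in>mcarrier Z. velocity Y (\<lambda>t. \<Upsilon> t z) = tvec_lin (\<Sum>j<n. \<rho> j z) (\<eta> z) 0 (\<eta> z)" by blast
  have vel: "velocity Y (\<lambda>t. \<Upsilon> t z) = \<eta> z" if z: "z \<in> mcarrier Z" for z
    using f(4)[rule_format, OF z] \<rho>(4)[OF z] by (simp add: tvec_lin_def)
  have "\<Upsilon> 0 z = \<upsilon> z" if z: "z \<in> mcarrier Z" for z
    using arg_cong[OF vel[OF z], of fst] variationD(1)[OF \<eta> z] by simp
  then have "family_tangent_to Y Z \<pi> \<upsilon> \<eta> \<Upsilon>"
    unfolding family_tangent_to_def smooth_family_on_def using f(1-3) vel by blast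
  then show ?thesis by blast
qed

end

subsection \<open>Differentiation under the integral sign\<close>

text \<open>Dominated convergence of the difference quotients. The mean value inequality bounds them
  by \<open>b\<close>, and they vanish off \<open>B\<close>, so \<open>b\<close> times the indicator
  of a set of finite measure dominates them.\<close>

lemma has_derivative_lebesgue_integral:
  fixes F D :: "real \<Rightarrow> 'a \<Rightarrow> real"
  assumes \<delta>: "\<delta> > 0" and B: "B \<in> sets M" "emeasure M B < \<infinity>"
    and meas: "\<And>t. \<bar>t\<bar> < \<delta> \<Longrightarrow> F t \<in> borel_measurable M" "D 0 \<in> borel_measurable M"
    and supp: "\<And>t x. \<bar>t\<bar> < \<delta> \<Longrightarrow> x \<in> space M \<Longrightarrow> x \<notin> B \<Longrightarrow> F t x = 0"
    and bound: "\<And>t x. \<bar>t\<bar> < \<delta> \<Longrightarrow> x \<in> space M \<Longrightarrow> \<bar>F t x\<bar> \<le> b"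
    and deriv: "\<And>t x. \<bar>t\<bar> < \<delta> \<Longrightarrow> x \<in> space M \<Longrightarrow> ((\<lambda>t. F t x) has_real_derivative D t x) (at t)"
    and dbound: "\<And>t x. \<bar>t\<bar> < \<delta> \<Longrightarrow> x \<in> space M \<Longrightarrow> \<bar>D t x\<bar> \<le> b"
  shows "((\<lambda>t. LINT x|M. F t x) has_real_derivative (LINT x|M. D 0 x)) (at 0)"
proof -
  have int: "integrable M (F t)" if t: "\<bar>t\<bar> < \<delta>" for t
    by (rule integrableI_bounded_set[OF B(1) meas(1)[OF t] B(2), of b])
      (use bound[OF t] supp[OF t] in \<open>simp_all add: AE_I2\<close>)
  have intw: "integrable M (\<lambda>x. b * indicator B x)"
    using B by (intro integrable_mult_right integrable_real_indicator)
  have quot: "\<bar>(F t x - F 0 x) / t\<bar> \<le> b * indicator B x" if t: "\<bar>t\<bar> < \<delta>" "t \<noteq> 0" and x: "x \<in> space M" for t x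
  proof (cases "x \<in> B")
    case True
    have "norm (F t x - F 0 x) \<le> b * norm (t - 0)"
    proof (rule field_differentiable_bound[of "{-\<delta><..<\<delta>}" "\<lambda>t. F t x" "\<lambda>t. D t x"])
      show "((\<lambda>t. F t x) has_real_derivative D s x) (at s within {-\<delta><..<\<delta>})" if "s \<in> {-\<delta><..<\<delta>}" for s
        by (rule has_field_derivative_at_within[OF deriv[OF _ x]]) (use that in auto)
      show "norm (D s x) \<le> b" if "s \<in> {-\<delta><..<\<delta>}" for s
        unfolding real_norm_def by (rule dbound[OF _ x]) (use that in auto)
    qed (use t(1) \<delta> in auto)
    then show ?thesis using True t(2) by (simp add: abs_divide divide_le_eq)
  next
    case False
    then show ?thesis using supp[OF t(1) x False] supp[of 0 x] x \<delta> by simp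
  qed
  \<comment> \<open>Dominated convergence concerns sequences, so the limit is tested along sequences
    of times; finitely many terms are dropped to bring the times into the interval.\<close>
  show ?thesis
    unfolding has_field_derivative_iff tendsto_at_iff_sequentially
  proof (intro allI impI)
    fix X :: "nat \<Rightarrow> real" assume X: "\<forall>i. X i \<in> UNIV - {0}" "X \<longlonglongrightarrow> 0"
    obtain k where k: "\<And>n. n \<ge> k \<Longrightarrow> \<bar>X n\<bar> < \<delta>" using LIMSEQ_D[OF X(2) \<delta>] by auto
    let ?X = "\<lambda>n. X (n + k)"
    have X': "\<bar>?X n\<bar> < \<delta>" "?X n \<noteq> 0" for n using k X(1) by auto
    have lim: "?X \<longlonglongrightarrow> 0" by (rule LIMSEQ_ignore_initial_segment[OF X(2)])
    have "(\<lambda>n. LINT x|M. (F (?X n) x - F 0 x) / ?X n) \<longlonglongrightarrow> (LINT x|M. D 0 x)"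
    proof (rule integral_dominated_convergence[OF meas(2) _ intw])
      show "(\<lambda>x. (F (?X n) x - F 0 x) / ?X n) \<in> borel_measurable M" for n
        using meas(1)[OF X'(1)] meas(1)[of 0] \<delta> by (intro borel_measurable_divide borel_measurable_diff) auto
      show "AE x in M. norm ((F (?X n) x - F 0 x) / ?X n) \<le> b * indicator B x" for n
        by (rule AE_I2) (use quot[OF X'] in simp)
      show "AE x in M. (\<lambda>n. (F (?X n) x - F 0 x) / ?X n) \<longlonglongrightarrow> D 0 x"
      proof (rule AE_I2)
        fix x assume x: "x \<in> space M"
        have "((\<lambda>y. (F y x - F 0 x) / (y - 0)) \<longlongrightarrow> D 0 x) (at 0)"
          using deriv[of 0 x] x \<delta> unfolding has_field_derivative_iff by simp
        then have "((\<lambda>y. (F y x - F 0 x) / (y - 0)) \<circ> ?X) \<longlonglongrightarrow> D 0 x"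
          unfolding tendsto_at_iff_sequentially using X'(2) lim by simp
        then show "(\<lambda>n. (F (?X n) x - F 0 x) / ?X n) \<longlonglongrightarrow> D 0 x" by (simp add: o_def)
      qed
    qed
    moreover have "(LINT x|M. (F (?X n) x - F 0 x) / ?X n) = ((LINT x|M. F (?X n) x) - (LINT x|M. F 0 x)) / ?X n" for n
      using int[OF X'(1)] int[of 0] \<delta> by simp
    ultimately have "(\<lambda>n. ((LINT x|M. F (?X n) x) - (LINT x|M. F 0 x)) / ?X n) \<longlonglongrightarrow> (LINT x|M. D 0 x)" by (simp only:)
    then have "(\<lambda>n. ((LINT x|M. F (X n) x) - (LINT x|M. F 0 x)) / X n) \<longlonglongrightarrow> (LINT x|M. D 0 x)" by (rule LIMSEQ_offset)
    then show "((\<lambda>y. ((LINT x|M. F y x) - (LINT x|M. F 0 x)) / (y - 0)) \<circ> X) \<longlonglongrightarrow> (LINT x|M. D 0 x)" by (simp add: o_def)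
  qed
qed

section \<open>Chart integrals of families\<close>

lemma open_coord_real_preimage:
  assumes "open_coord I S" "continuous_on S g" "open T"
  shows "open_coord I {x\<in>S. g x \<in> T}"
proof -
  have "openin (top_of_set S) (S \<inter> g -` T)" by (rule continuous_openin_preimage_gen[OF assms(2,3)])
  moreover have "S \<inter> g -` T = {x\<in>S. g x \<in> T}" by blast
  ultimately show ?thesis using assms(1) unfolding open_coord_def by (metis openin_trans)
qed

text \<open>Points of the product measure are undefined off \<open>I\<close>, so they are first sent
  to their extension by zero. In the space of all functions \<open>S\<close> is Borel, being the
  intersection of an open set with the closed coordinate space.\<close>

lemma borel_measurable_extend_zero:
  fixes H :: "(nat \<Rightarrow> real) \<Rightarrow> real"
  assumes S: "open_coord I S" and H: "continuous_on S H"
  shows "(\<lambda>x. if (\<lambda>i. if i \<in> I then x i else 0) \<in> S then H (\<lambda>i. if i \<in> I then x i else 0) else 0)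
    \<in> borel_measurable (Pi\<^sub>M I (\<lambda>_. lborel))"
proof -
  have emb: "(\<lambda>x i. if i \<in> I then x i else 0) \<in> borel_measurable (Pi\<^sub>M I (\<lambda>_. lborel :: real measure))"
  proof (rule measurable_coordinatewise_then_product)
    fix i show "(\<lambda>x. if i \<in> I then x i else 0) \<in> borel_measurable (Pi\<^sub>M I (\<lambda>_. lborel :: real measure))"
    proof (cases "i \<in> I")
      case True
      then have "(\<lambda>x. x i) \<in> measurable (Pi\<^sub>M I (\<lambda>_. lborel :: real measure)) lborel" by (rule measurable_component_singleton)
      then show ?thesis using True by simp
    qed simp
  qed
  obtain U where U: "open U" "S = coord_space I \<inter> U" using S by (auto simp: open_coord_def openin_open)
  have "coord_space I = (\<Inter>i\<in>-I. {x. x i = (0::real)})" by (auto simp: coord_space_def)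
  moreover have "closed (\<Inter>i\<in>-I. {x. x i = (0::real)})"
    by (intro closed_INT ballI closed_Collect_eq continuous_on_product_coordinates continuous_on_const)
  ultimately have "S \<in> sets borel" unfolding U(2) using U(1) by (simp add: sets.Int borel_closed borel_open)
  then have "(\<lambda>u. if u \<in> S then H u else 0) \<in> borel_measurable borel"
    by (rule borel_measurable_continuous_on_if[OF _ H continuous_on_const])
  from measurable_compose[OF emb this] show ?thesis .
qed

lemma emeasure_lborel_cube_finite:
  assumes "finite I"
  shows "(\<Pi>\<^sub>E i\<in>I. {-b..b::real}) \<in> sets (Pi\<^sub>M I (\<lambda>_. lborel))" "emeasure (Pi\<^sub>M I (\<lambda>_. lborel)) (\<Pi>\<^sub>E i\<in>I. {-b..b::real}) < \<infinity>"
proof -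
  interpret product_sigma_finite "\<lambda>_. lborel :: real measure" ..
  show "(\<Pi>\<^sub>E i\<in>I. {-b..b::real}) \<in> sets (Pi\<^sub>M I (\<lambda>_. lborel))" by (rule sets_PiM_I_finite[OF assms]) simp
  have "emeasure (Pi\<^sub>M I (\<lambda>_. lborel)) (\<Pi>\<^sub>E i\<in>I. {-b..b::real}) = (\<Prod>i\<in>I. emeasure lborel {-b..b::real})"
    by (rule emeasure_PiM[OF assms]) simp
  also have "\<dots> = (\<Prod>i\<in>I. ennreal (if -b \<le> b then b - -b else 0))" by (simp add: emeasure_lborel_Icc_eq)
  also have "\<dots> = ennreal (\<Prod>i\<in>I. if -b \<le> b then b - -b else 0)" by (rule prod_ennreal) simp
  also have "\<dots> < \<infinity>" by simp
  finally show "emeasure (Pi\<^sub>M I (\<lambda>_. lborel)) (\<Pi>\<^sub>E i\<in>I. {-b..b::real}) < \<infinity>" .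
qed

text \<open>The integrand vanishes outside the compact set \<open>K\<close>. Over \<open>K\<close>
  the function and its time derivative are bounded uniformly for short times, and the coordinates
  lie in a cube; these are the hypotheses for differentiation under the integral.\<close>

lemma chart_integral_has_derivative:
  fixes Z :: "('z, nat) mfd" and c :: "('z, nat) chart"
  defines "fr z \<equiv> map (\<lambda>i. coord_vec Z c i z) (sorted_list_of_set (midx Z))"
  assumes Z: "premanifold Z" and c: "c \<in> charts Z" and K: "compactin (mtop Z) K" "K \<subseteq> fst c"
    and \<rho>: "smooth_map_on Z real_mfd (mcarrier Z) \<rho>" "\<And>z. z \<in> mcarrier Z \<Longrightarrow> 0 \<le> \<rho> z \<and> \<rho> z \<le> 1"
      "\<And>z. z \<in> mcarrier Z \<Longrightarrow> z \<notin> K \<Longrightarrow> \<rho> z = 0"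
    and \<epsilon>: "\<epsilon> > 0"
    and g: "smooth_map_on (prod_mfd real_mfd Z) real_mfd ({-\<epsilon><..<\<epsilon>} \<times> fst c) (\<lambda>(t, z). \<omega> t z (fr z))"
    and \<omega>': "\<And>z. z \<in> fst c \<Longrightarrow> \<omega>' z (fr z) = deriv (\<lambda>t. \<omega> t z (fr z)) 0"
  shows "((\<lambda>t. chart_integral Z c \<rho> (\<omega> t)) has_real_derivative chart_integral Z c \<rho> \<omega>') (at 0)"
proof -
  let ?I = "midx Z" and ?T = "UNIV <+> midx Z :: (unit + nat) set" and ?S = "snd c ` fst c"
  let ?M = "Pi\<^sub>M ?I (\<lambda>_. lborel :: real measure)" and ?e = "\<lambda>x i. if i \<in> ?I then x i else (0::real)"
  note fin = premanifold_finite[OF Z]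
  have opS: "open_coord ?I ?S" by (rule chart_open[OF c])
  define \<Omega> where "\<Omega> = fam_dom \<epsilon> (fst c) c real_chart (\<lambda>t z. \<omega> t z (fr z))"
  define f where "f = fam_rep c real_chart (\<lambda>t z. \<omega> t z (fr z)) ()"
  have op: "open_coord ?T \<Omega>" and sf: "smooth_fun ?T \<Omega> f"
    unfolding \<Omega>_def f_def by (rule smooth_fam_rep[OF Z premanifold_real g c real_chart_charts], simp?)+
  have sf': "smooth_fun ?T \<Omega> (pd (Inl ()) f)" by (rule smooth_fun_pd[OF sf]) (rule InlI, simp)
  have \<Omega>: "case_sum (\<lambda>_. t) u \<in> \<Omega>" if "\<bar>t\<bar> < \<epsilon>" "u \<in> ?S" for t u
    using that unfolding \<Omega>_def fam_dom_def by (force simp: abs_less_iff)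
  have fval: "f (case_sum (\<lambda>_. t) u) = \<omega> t (chart_inv c u) (fr (chart_inv c u))" for t u
    unfolding f_def fam_rep_case_sum by simp
  have fder: "((\<lambda>t. f (case_sum (\<lambda>_. t) u)) has_real_derivative pd (Inl ()) f (case_sum (\<lambda>_. t) u)) (at t)"
    if "\<bar>t\<bar> < \<epsilon>" "u \<in> ?S" for t u
    using smooth_fun_has_pd[OF sf InlI[OF UNIV_I[of "()"]] \<Omega>[OF that]] unfolding has_pd_def case_sum_upd_Inl by simp
  have slice: "continuous_on ?S (\<lambda>u. h (case_sum (\<lambda>_. t) u))" if h: "smooth_fun ?T \<Omega> h" and t: "\<bar>t\<bar> < \<epsilon>" for h t
  proof (rule continuous_on_compose2[OF smooth_fun_continuous[OF h]])
    show "continuous_on ?S (case_sum (\<lambda>_. t))"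
    proof (rule continuous_on_coordinatewise_then_product)
      show "continuous_on ?S (\<lambda>u. case_sum (\<lambda>_. t) u j)" for j
        by (cases j) (simp_all add: continuous_on_subset[OF continuous_on_product_coordinates])
    qed
    show "case_sum (\<lambda>_. t) ` ?S \<subseteq> \<Omega>" using \<Omega>[OF t] by blast
  qed
  have \<rho>c: "continuous_on ?S (\<lambda>u. \<rho> (chart_inv c u))"
  proof -
    have "mcarrier Z \<inter> fst c = fst c" using chart_subset[OF c] by blast
    then have "smooth_fun ?I ?S (\<lambda>u. \<rho> (chart_inv c u))"
      using \<rho>(1) c unfolding smooth_map_real_iff[OF Z] by metis
    then show ?thesis by (rule smooth_fun_continuous)
  qed
  \<comment> \<open>One number \<open>b\<close> governs the time radius, as its reciprocal, the
    bounds for the function and its time derivative, and the size of the cube; every clause gets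
    weaker as \<open>b\<close> grows.\<close>
  define Q where "Q b z \<longleftrightarrow> b > 0 \<and> (\<forall>t. \<bar>t\<bar> < 1 / b \<longrightarrow> case_sum (\<lambda>_. t) (snd c z) \<in> \<Omega> \<and>
      \<bar>f (case_sum (\<lambda>_. t) (snd c z))\<bar> \<le> b \<and> \<bar>pd (Inl ()) f (case_sum (\<lambda>_. t) (snd c z))\<bar> \<le> b) \<and>
      (\<forall>i\<in>?I. \<bar>snd c z i\<bar> \<le> b)" for b z
  have Qmono: "Q b z" if ab: "a \<le> b" and a: "Q a z" for a b z
    unfolding Q_def
  proof (intro conjI allI impI ballI)
    have a0: "a > 0" using a by (simp add: Q_def)
    then show "b > 0" using ab by simp
    have ba: "1 / b \<le> 1 / a" using ab a0 by (intro divide_left_mono mult_pos_pos) auto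
    fix t assume "\<bar>t\<bar> < 1 / b"
    then have "\<bar>t\<bar> < 1 / a" using ba by linarith
    with a have "case_sum (\<lambda>_. t) (snd c z) \<in> \<Omega>" "\<bar>f (case_sum (\<lambda>_. t) (snd c z))\<bar> \<le> a"
      "\<bar>pd (Inl ()) f (case_sum (\<lambda>_. t) (snd c z))\<bar> \<le> a" unfolding Q_def by blast+
    then show "case_sum (\<lambda>_. t) (snd c z) \<in> \<Omega>" "\<bar>f (case_sum (\<lambda>_. t) (snd c z))\<bar> \<le> b"
      "\<bar>pd (Inl ()) f (case_sum (\<lambda>_. t) (snd c z))\<bar> \<le> b" using ab by linarith+
  next
    fix i assume "i \<in> ?I"
    then have "\<bar>snd c z i\<bar> \<le> a" using a unfolding Q_def by blast
    then show "\<bar>snd c z i\<bar> \<le> b" using ab by linarith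
  qed
  have "\<exists>b. \<forall>z\<in>K. Q b z"
  proof (rule compactin_uniform[OF K(1) _ Qmono])
    fix z assume "z \<in> K"
    then have z: "z \<in> fst c" using K(2) by blast
    let ?w = "case_sum (\<lambda>_::unit. 0) (snd c z)"
    \<comment> \<open>The added 1 makes the bounds at the point itself strict, so that they persist
      on an open set.\<close>
    define \<beta> where "\<beta> = \<bar>f ?w\<bar> + \<bar>pd (Inl ()) f ?w\<bar> + 1"
    define \<Omega>' where "\<Omega>' = {w\<in>{w\<in>\<Omega>. f w \<in> {-\<beta><..<\<beta>}}. pd (Inl ()) f w \<in> {-\<beta><..<\<beta>}}"
    have op1: "open_coord ?T {w\<in>\<Omega>. f w \<in> {-\<beta><..<\<beta>}}"
      by (rule open_coord_real_preimage[OF op smooth_fun_continuous[OF sf]]) simp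
    have op': "open_coord ?T \<Omega>'" unfolding \<Omega>'_def
      by (rule open_coord_real_preimage[OF op1 continuous_on_subset[OF smooth_fun_continuous[OF sf']]]) auto
    have w: "?w \<in> \<Omega>'"
      unfolding \<Omega>'_def mem_Collect_eq greaterThanLessThan_iff
      using \<Omega>[of 0 "snd c z"] \<epsilon> z by (auto simp: \<beta>_def)
    obtain e N where N: "e > 0" "openin (mtop Z) N" "z \<in> N"
      "\<And>t x. \<bar>t\<bar> < e \<Longrightarrow> x \<in> N \<Longrightarrow> case_sum (\<lambda>_. t) (snd c x) \<in> \<Omega>'"
      "\<And>x i. x \<in> N \<Longrightarrow> i \<in> ?I \<Longrightarrow> \<bar>snd c x i - snd c z i\<bar> < e"
      by (rule tube_in_chart[OF Z c z op' w]) blast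
    \<comment> \<open>The summands serve, in turn, the time radius, the bounds on the function and
      its derivative, and the coordinates near \<open>z\<close>, which differ from those of
      \<open>z\<close> by less than \<open>e\<close>.\<close>
    define b where "b = 1 / e + \<beta> + (\<Sum>i\<in>?I. \<bar>snd c z i\<bar>) + e"
    have s0: "0 \<le> (\<Sum>i\<in>?I. \<bar>snd c z i\<bar>)" by (rule sum_nonneg) simp
    have \<beta>0: "\<beta> > 0" by (simp add: \<beta>_def)
    have e0: "1 / e > 0" using N(1) by simp
    then have b: "1 / e \<le> b" "\<beta> \<le> b" "b > 0" unfolding b_def using N(1) s0 \<beta>0 by linarith+
    have be: "1 / b \<le> e" using b(1,3) N(1) by (simp add: field_simps)
    have "Q b x" if x: "x \<in> N" for x
      unfolding Q_def
    proof (intro conjI allI impI ballI b(3))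
      fix t assume "\<bar>t\<bar> < 1 / b"
      then have "case_sum (\<lambda>_. t) (snd c x) \<in> \<Omega>'" using be x by (intro N(4)) linarith+
      then show "case_sum (\<lambda>_. t) (snd c x) \<in> \<Omega>" "\<bar>f (case_sum (\<lambda>_. t) (snd c x))\<bar> \<le> b"
        "\<bar>pd (Inl ()) f (case_sum (\<lambda>_. t) (snd c x))\<bar> \<le> b"
        using b(2) unfolding \<Omega>'_def mem_Collect_eq greaterThanLessThan_iff by linarith+
    next
      fix i assume i: "i \<in> ?I"
      have "\<bar>snd c z i\<bar> \<le> (\<Sum>i\<in>?I. \<bar>snd c z i\<bar>)" by (rule member_le_sum[OF i]) (simp_all add: fin)
      moreover have "\<bar>snd c x i - snd c z i\<bar> < e" by (rule N(5)[OF x i])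
      moreover have "1 / e > 0" using N(1) by simp
      ultimately show "\<bar>snd c x i\<bar> \<le> b" using \<beta>0 unfolding b_def by linarith
    qed
    then show "\<exists>N b. openin (mtop Z) N \<and> z \<in> N \<and> (\<forall>x\<in>N. Q b x)" using N(2,3) by blast
  qed
  then obtain b' where b': "\<forall>z\<in>K. Q b' z" by blast
  \<comment> \<open>For empty \<open>K\<close> the number \<open>b'\<close> is arbitrary; the
    maximum makes it positive in every case.\<close>
  define b where "b = max b' 1"
  have b: "b > 0" by (simp add: b_def)
  have Qb: "Q b z" if "z \<in> K" for z by (rule Qmono[of b']) (use b' that in \<open>simp_all add: b_def\<close>)
  define \<delta> where "\<delta> = min \<epsilon> (1 / b)"
  have \<delta>: "\<delta> > 0" "\<delta> \<le> \<epsilon>" "\<delta> \<le> 1 / b" using \<epsilon> b by (simp_all add: \<delta>_def)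
  \<comment> \<open>For \<open>h = f\<close> the integrand at time \<open>t\<close>, for
    \<open>h = pd (Inl ()) f\<close> its time derivative, both extended by zero off the chart
    image.\<close>
  define G where "G h t x = (if ?e x \<in> ?S then \<rho> (chart_inv c (?e x)) * h (case_sum (\<lambda>_. t) (?e x)) else 0)"
    for h :: "(unit + nat \<Rightarrow> real) \<Rightarrow> real" and t x
  have Gmeas: "G h t \<in> borel_measurable ?M" if "smooth_fun ?T \<Omega> h" "\<bar>t\<bar> < \<delta>" for h t
    unfolding G_def
    by (rule borel_measurable_extend_zero[OF opS, of "\<lambda>u. \<rho> (chart_inv c u) * h (case_sum (\<lambda>_. t) u)"])
      (intro continuous_on_mult \<rho>c slice that(1), use that(2) \<delta>(2) in linarith)
  have Gcases: "(?e x \<in> ?S \<and> chart_inv c (?e x) \<in> K) \<or> (\<forall>h t. G h t x = 0)" for x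
  proof (cases "?e x \<in> ?S")
    case True
    have "chart_inv c (?e x) \<in> mcarrier Z" using chart_inv_in[OF True] chart_subset[OF c] by blast
    then show ?thesis using True \<rho>(3)[of "chart_inv c (?e x)"] by (auto simp: G_def)
  qed (simp add: G_def)
  have Gbound: "\<bar>G h t x\<bar> \<le> b" if h: "\<And>z. z \<in> K \<Longrightarrow> \<bar>h (case_sum (\<lambda>_. t) (snd c z))\<bar> \<le> b" for h t x
    using Gcases[of x]
  proof
    assume x: "?e x \<in> ?S \<and> chart_inv c (?e x) \<in> K"
    have z: "chart_inv c (?e x) \<in> mcarrier Z" using x K(2) chart_subset[OF c] by blast
    have "\<bar>h (case_sum (\<lambda>_. t) (?e x))\<bar> \<le> b" using h[OF conjunct2[OF x]] unfolding chart_chart_inv[OF conjunct1[OF x]] .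
    then have "\<bar>\<rho> (chart_inv c (?e x))\<bar> * \<bar>h (case_sum (\<lambda>_. t) (?e x))\<bar> \<le> 1 * b"
      using \<rho>(2)[OF z] by (intro mult_mono) simp_all
    then show ?thesis using x by (simp add: G_def abs_mult)
  qed (use b in simp)
  have "((\<lambda>t. LINT x|?M. G f t x) has_real_derivative (LINT x|?M. G (pd (Inl ()) f) 0 x)) (at 0)"
  proof (rule has_derivative_lebesgue_integral[OF \<delta>(1) emeasure_lborel_cube_finite[OF fin, of b]])
    show "G f t \<in> borel_measurable ?M" if "\<bar>t\<bar> < \<delta>" for t by (rule Gmeas[OF sf that])
    show "G (pd (Inl ()) f) 0 \<in> borel_measurable ?M" by (rule Gmeas[OF sf']) (simp add: \<delta>)
    fix t x assume t: "\<bar>t\<bar> < \<delta>" and x: "x \<in> space ?M"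
    have tb: "\<bar>t\<bar> < 1 / b" "\<bar>t\<bar> < \<epsilon>" using t \<delta> by linarith+
    show "\<bar>G f t x\<bar> \<le> b" "\<bar>G (pd (Inl ()) f) t x\<bar> \<le> b"
      by (rule Gbound, use Qb tb(1) in \<open>unfold Q_def, blast\<close>)+
    show "((\<lambda>t. G f t x) has_real_derivative G (pd (Inl ()) f) t x) (at t)"
    proof (cases "?e x \<in> ?S")
      case True
      show ?thesis unfolding G_def if_P[OF True] by (rule DERIV_cmult[OF fder[OF tb(2) True]])
    qed (simp add: G_def)
    assume xb: "x \<notin> (\<Pi>\<^sub>E i\<in>?I. {-b..b})"
    show "G f t x = 0"
    proof (rule ccontr)
      assume "G f t x \<noteq> 0"
      then have xK: "?e x \<in> ?S" "chart_inv c (?e x) \<in> K" using Gcases[of x] by blast+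
      have "\<bar>x i\<bar> \<le> b" if i: "i \<in> ?I" for i
      proof -
        have "\<bar>snd c (chart_inv c (?e x)) i\<bar> \<le> b" using Qb[OF xK(2)] i unfolding Q_def by blast
        then show ?thesis unfolding chart_chart_inv[OF xK(1)] using i by simp
      qed
      then have "x \<in> (\<Pi>\<^sub>E i\<in>?I. {-b..b})" using x by (auto simp: space_PiM PiE_iff abs_le_iff) (smt (verit))+
      then show False using xb by blast
    qed
  qed
  moreover have "(LINT x|?M. G f t x) = chart_integral Z c \<rho> (\<omega> t)" for t
    unfolding chart_integral_def Let_def fr_def[symmetric] G_def fval ..
  moreover have "(LINT x|?M. G (pd (Inl ()) f) 0 x) = chart_integral Z c \<rho> \<omega>'"
    unfolding chart_integral_def Let_def fr_def[symmetric]
  proof (rule Bochner_Integration.integral_cong[OF refl])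
    fix x
    show "G (pd (Inl ()) f) 0 x = (if ?e x \<in> ?S then \<rho> (chart_inv c (?e x)) * \<omega>' (chart_inv c (?e x)) (fr (chart_inv c (?e x))) else 0)"
    proof (cases "?e x \<in> ?S")
      case True
      have "\<omega>' (chart_inv c (?e x)) (fr (chart_inv c (?e x))) = pd (Inl ()) f (case_sum (\<lambda>_. 0) (?e x))"
        unfolding \<omega>'[OF chart_inv_in[OF True]]
        using DERIV_imp_deriv[OF fder[of 0 "?e x"]] \<epsilon> True unfolding fval by simp
      then show ?thesis using True by (simp add: G_def)
    qed (simp add: G_def)
  qed
  ultimately show ?thesis by simp
qed

subsection \<open>The derivative of the action\<close>

text \<open>The choice inside \<open>form_integral\<close> does not depend on the form, so one
  partition of unity can be fixed for all times and for the derivative at once.\<close>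

lemma form_integral_eq_sum:
  assumes Z: "premanifold Z" "Hausdorff_space (mtop Z)" "compact_space (mtop Z)" and A: "oriented_atlas Z A"
  shows "\<exists>n c \<rho>. partition_of_unity Z A n c \<rho> \<and> (\<forall>\<omega>. form_integral Z A \<omega> = (\<Sum>k<n. chart_integral Z (c k) (\<rho> k) \<omega>))"
proof -
  let ?q = "SOME q. case q of (n, c, \<rho>) \<Rightarrow> partition_of_unity Z A n c \<rho>"
  have "\<exists>n c \<rho>. partition_of_unity Z A n c \<rho>"
    using A by (intro partition_of_unity_exists[OF Z]) (auto simp: oriented_atlas_def)
  then have "\<exists>q. case q of (n, c, \<rho>) \<Rightarrow> partition_of_unity Z A n c \<rho>" by auto
  then have q: "case ?q of (n, c, \<rho>) \<Rightarrow> partition_of_unity Z A n c \<rho>" by (rule someI_ex)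
  obtain n c \<rho> where ncr: "?q = (n, c, \<rho>)" by (cases ?q)
  show ?thesis
  proof (intro exI conjI allI)
    show "partition_of_unity Z A n c \<rho>" using q unfolding ncr by simp
    show "form_integral Z A \<omega> = (\<Sum>k<n. chart_integral Z (c k) (\<rho> k) \<omega>)" for \<omega>
      unfolding form_integral_def ncr by simp
  qed
qed

context fibred
begin

text \<open>\<open>fibre_diff\<close> differentiates along a curve of its own choice with the same
  velocity as the curve of jets. On a coordinate frame the Lagrangian is a smooth real function of
  the jet, whose derivative depends on the velocity alone.\<close>

lemma fibre_diff_jet_family:
  assumes f: "\<epsilon> > 0" "smooth_map_on P Y ({-\<epsilon><..<\<epsilon>} \<times> mcarrier Z) (\<lambda>(t, z). \<Upsilon> t z)"
      "\<And>t z. t \<in> {-\<epsilon><..<\<epsilon>} \<Longrightarrow> z \<in> mcarrier Z \<Longrightarrow> \<pi> (\<Upsilon> t z) = z"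
    and L: "L \<in> semibasic_forms Y Z \<pi> r p" and c: "c \<in> charts Z" "z \<in> fst c"
    and ks: "ks \<in> lists (midx Z)" "length ks = p"
  shows "fibre_diff Y Z \<pi> r L (jet Y Z \<pi> r (\<Upsilon> 0) z) (velocity (jet_mfd Y Z \<pi> r) (\<lambda>t. jet Y Z \<pi> r (\<Upsilon> t) z))
      (map (\<lambda>i. coord_vec Z c i z) ks) =
    deriv (\<lambda>t. L (jet Y Z \<pi> r (\<Upsilon> t) z) (map (\<lambda>i. coord_vec Z c i z) ks)) 0"
proof -
  let ?M = "jet_mfd Y Z \<pi> r" and ?\<tau> = "\<lambda>t. jet Y Z \<pi> r (\<Upsilon> t) z" and ?vs = "map (\<lambda>i. coord_vec Z c i z) ks"
  let ?l = "\<lambda>w. L w (map (\<lambda>i. coord_vec Z c i (fst w)) ks)"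
  have z: "z \<in> mcarrier Z" using c chart_subset by blast
  note f' = openin_mcarrier[OF Z] f
  define \<sigma> where "\<sigma> = (SOME \<sigma>. smooth_curve ?M \<sigma> \<and> velocity ?M \<sigma> = velocity ?M ?\<tau> \<and> (\<forall>t. fst (\<sigma> t) = fst (?\<tau> 0)))"
  have \<tau>: "smooth_curve ?M ?\<tau>" by (rule jet_family_curve[OF f' z])
  have "smooth_curve ?M \<sigma> \<and> velocity ?M \<sigma> = velocity ?M ?\<tau> \<and> (\<forall>t. fst (\<sigma> t) = fst (?\<tau> 0))"
    unfolding \<sigma>_def by (rule someI[of _ ?\<tau>]) (simp add: \<tau>)
  then have \<sigma>: "smooth_curve ?M \<sigma>" "velocity ?M \<sigma> = velocity ?M ?\<tau>" "\<And>t. fst (\<sigma> t) = z" by simp_all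
  have "velocity ?M ?\<tau> \<in> jet_vertical Y Z \<pi> r" by (rule jet_family_vertical[OF f' z])
  then have "fibre_diff Y Z \<pi> r L (?\<tau> 0) (velocity ?M ?\<tau>) ?vs = deriv (\<lambda>t. L (\<sigma> t) ?vs) 0"
    unfolding fibre_diff_def \<sigma>_def by (simp add: Let_def)
  \<comment> \<open>\<open>?l\<close> uses the frame at the source of the jet, which stays at
    \<open>z\<close> since the chosen curve lies in one fibre. Fixed arguments may thus be exchanged
    for the smooth coefficient function of the form.\<close>
  also have "\<dots> = deriv (\<lambda>t. ?l (\<sigma> t)) 0" by (simp only: \<sigma>(3))
  also have "\<dots> = deriv (\<lambda>t. ?l (?\<tau> t)) 0"
  proof (rule deriv_compose_cong[OF premanifold_jet \<sigma>(1) \<tau> \<sigma>(2)])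
    show "smooth_map_on ?M real_mfd {w \<in> jet_carrier Y Z \<pi> r. fst w \<in> fst c} ?l"
      using L c(1) ks unfolding semibasic_forms_def by blast
    have "\<sigma> 0 = ?\<tau> 0" using arg_cong[OF \<sigma>(2), of fst] by simp
    then show "\<sigma> 0 \<in> {w \<in> jet_carrier Y Z \<pi> r. fst w \<in> fst c}"
      using jet_in_jet_carrier[OF family_local_section_0[OF f' z]] c(2) by simp
  qed
  also have "\<dots> = deriv (\<lambda>t. L (?\<tau> t) ?vs) 0" by simp
  finally show ?thesis .
qed

text \<open>On coordinate frames the Lagrangian is a smooth function of the jet by the definition of
  semi-basic forms, and the jets of the family are jointly smooth in time and base point.\<close>

lemma smooth_lagrangian_family:
  assumes f: "\<epsilon> > 0" "smooth_map_on P Y ({-\<epsilon><..<\<epsilon>} \<times> mcarrier Z) (\<lambda>(t, z). \<Upsilon> t z)"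
      "\<And>t z. t \<in> {-\<epsilon><..<\<epsilon>} \<Longrightarrow> z \<in> mcarrier Z \<Longrightarrow> \<pi> (\<Upsilon> t z) = z"
    and L: "L \<in> semibasic_forms Y Z \<pi> r p" and c: "c \<in> charts Z"
    and ks: "ks \<in> lists (midx Z)" "length ks = p"
  shows "smooth_map_on P real_mfd ({-\<epsilon><..<\<epsilon>} \<times> fst c)
    (\<lambda>(t, z). L (jet Y Z \<pi> r (\<Upsilon> t) z) (map (\<lambda>i. coord_vec Z c i z) ks))"
proof -
  let ?M = "jet_mfd Y Z \<pi> r" and ?l = "\<lambda>w. L w (map (\<lambda>i. coord_vec Z c i (fst w)) ks)"
  let ?F = "\<lambda>(t, z). jet Y Z \<pi> r (\<Upsilon> t) z" and ?S = "{w \<in> jet_carrier Y Z \<pi> r. fst w \<in> fst c}"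
  note f' = openin_mcarrier[OF Z] f
  have F: "smooth_map_on P ?M ({-\<epsilon><..<\<epsilon>} \<times> mcarrier Z) ?F"
    by (rule smooth_jet_family[OF f'(1-3)]) (rule f(3))
  have "smooth_map_on ?M real_mfd ?S ?l" using L c ks unfolding semibasic_forms_def by blast
  then have "smooth_map_on P real_mfd {x \<in> {-\<epsilon><..<\<epsilon>} \<times> mcarrier Z. ?F x \<in> ?S} (?l \<circ> ?F)"
    by (rule smooth_map_on_preimage_compose[OF premanifold_P premanifold_jet premanifold_real F])
  moreover have "{x \<in> {-\<epsilon><..<\<epsilon>} \<times> mcarrier Z. ?F x \<in> ?S} = {-\<epsilon><..<\<epsilon>} \<times> fst c"
  proof (intro equalityI subsetI)
    fix x assume "x \<in> {-\<epsilon><..<\<epsilon>} \<times> fst c"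
    then obtain t z where x: "x = (t, z)" "t \<in> {-\<epsilon><..<\<epsilon>}" "z \<in> fst c" by blast
    have z: "z \<in> mcarrier Z" using x(3) chart_subset[OF c] by blast
    have "jet Y Z \<pi> r (\<Upsilon> t) z \<in> jet_carrier Y Z \<pi> r"
      by (rule jet_in_jet_carrier[OF family_local_section[OF f' x(2) z]])
    then show "x \<in> {x \<in> {-\<epsilon><..<\<epsilon>} \<times> mcarrier Z. ?F x \<in> ?S}" using x z by simp
  qed auto
  ultimately have "smooth_map_on P real_mfd ({-\<epsilon><..<\<epsilon>} \<times> fst c) (?l \<circ> ?F)" by (simp only:)
  then show ?thesis by (rule smooth_map_on_cong[OF premanifold_P, rotated]) auto
qed

lemma action_has_derivative:
  assumes Zp: "smooth_manifold Z p" and Zc: "compact_space (mtop Z)" and A: "oriented_atlas Z A"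
    and L: "L \<in> semibasic_forms Y Z \<pi> r p" and \<Upsilon>: "family_tangent_to Y Z \<pi> \<upsilon> \<eta> \<Upsilon>"
  shows "((\<lambda>t. action Y Z \<pi> r A L (\<Upsilon> t)) has_real_derivative
    form_integral Z A (\<lambda>z. fibre_diff Y Z \<pi> r L (jet Y Z \<pi> r \<upsilon> z)
         (jet_is_inv Y Z \<pi> r (jet (vert_mfd Y Z \<pi>) Z (\<pi> \<circ> fst) r \<eta> z)))) (at 0)"
proof -
  let ?\<omega> = "\<lambda>t z. L (jet Y Z \<pi> r (\<Upsilon> t) z)"
  let ?\<omega>' = "\<lambda>z. fibre_diff Y Z \<pi> r L (jet Y Z \<pi> r \<upsilon> z) (jet_is_inv Y Z \<pi> r (jet (vert_mfd Y Z \<pi>) Z (\<pi> \<circ> fst) r \<eta> z))"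
  let ?ks = "sorted_list_of_set (midx Z)"
  have haus: "Hausdorff_space (mtop Z)" and midx: "midx Z = {..<p}" using Zp by (simp_all add: smooth_manifold_def)
  have ks: "?ks \<in> lists (midx Z)" "length ?ks = p" using finZ by (simp_all add: lists_eq_set midx)
  obtain \<epsilon> where f: "\<epsilon> > 0" "smooth_map_on P Y ({-\<epsilon><..<\<epsilon>} \<times> mcarrier Z) (\<lambda>(t, z). \<Upsilon> t z)"
      "\<And>t z. t \<in> {-\<epsilon><..<\<epsilon>} \<Longrightarrow> z \<in> mcarrier Z \<Longrightarrow> \<pi> (\<Upsilon> t z) = z"
    by (rule smooth_family_onE[of "mcarrier Z" \<Upsilon>]) (use \<Upsilon> in \<open>simp_all add: family_tangent_to_def\<close>)
  have \<Upsilon>0: "\<And>z. z \<in> mcarrier Z \<Longrightarrow> \<Upsilon> 0 z = \<upsilon> z" and \<Upsilon>v: "\<And>z. z \<in> mcarrier Z \<Longrightarrow> velocity Y (\<lambda>t. \<Upsilon> t z) = \<eta> z"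
    using \<Upsilon> by (simp_all add: family_tangent_to_def)
  \<comment> \<open>Only the values on the frame of the chart enter \<open>chart_integral\<close>,
    so the two forms have to be compared there alone.\<close>
  have frame: "?\<omega>' z (map (\<lambda>i. coord_vec Z c i z) ?ks) = deriv (\<lambda>t. ?\<omega> t z (map (\<lambda>i. coord_vec Z c i z) ?ks)) 0"
    if c: "c \<in> charts Z" "z \<in> fst c" for c z
  proof -
    have z: "z \<in> mcarrier Z" using c chart_subset by blast
    have "jet_is_inv Y Z \<pi> r (jet (vert_mfd Y Z \<pi>) Z (\<pi> \<circ> fst) r \<eta> z) = velocity (jet_mfd Y Z \<pi> r) (\<lambda>t. jet Y Z \<pi> r (\<Upsilon> t) z)"
      by (rule jet_is_inv_family[OF openin_mcarrier[OF Z] f z]) (assumption | rule \<Upsilon>v[symmetric])+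
    moreover have "jet Y Z \<pi> r \<upsilon> z = jet Y Z \<pi> r (\<Upsilon> 0) z"
      \<comment> \<open>The family starts at \<open>\<upsilon>\<close> only on the carrier; locality
        of jets disregards values elsewhere.\<close>
      by (rule jet_eqI[OF same_jet_locally_eq[OF Z openin_mcarrier[OF Z] z]]) (rule \<Upsilon>0[symmetric])
    ultimately show ?thesis using fibre_diff_jet_family[OF f L c ks] by simp
  qed
  obtain n c \<rho> where pou: "partition_of_unity Z A n c \<rho>"
    and int: "\<And>\<omega>. form_integral Z A \<omega> = (\<Sum>k<n. chart_integral Z (c k) (\<rho> k) \<omega>)"
    using form_integral_eq_sum[OF Z haus Zc A] by (elim exE conjE) (rule that, assumption, blast)
  have pou': "\<And>k. k < n \<Longrightarrow> c k \<in> A" "\<And>k. k < n \<Longrightarrow> smooth_map_on Z real_mfd (mcarrier Z) (\<rho> k)"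
      "\<And>k z. k < n \<Longrightarrow> z \<in> mcarrier Z \<Longrightarrow> 0 \<le> \<rho> k z"
      "\<And>k. k < n \<Longrightarrow> mtop Z closure_of {z \<in> mcarrier Z. \<rho> k z \<noteq> 0} \<subseteq> fst (c k)"
      "\<And>z. z \<in> mcarrier Z \<Longrightarrow> (\<Sum>k<n. \<rho> k z) = 1"
    using pou unfolding partition_of_unity_def by blast+
  have "((\<lambda>t. chart_integral Z (c k) (\<rho> k) (?\<omega> t)) has_real_derivative chart_integral Z (c k) (\<rho> k) ?\<omega>') (at 0)"
    if k: "k \<in> {..<n}" for k
  proof -
    have kn: "k < n" using k by simp
    have ck: "c k \<in> charts Z" using pou'(1)[OF kn] A unfolding oriented_atlas_def by blast
    let ?K = "mtop Z closure_of {z \<in> mcarrier Z. \<rho> k z \<noteq> 0}"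
    have K: "compactin (mtop Z) ?K" by (rule closedin_compact_space[OF Zc closedin_closure_of])
    have le1: "0 \<le> \<rho> k z \<and> \<rho> k z \<le> 1" if z: "z \<in> mcarrier Z" for z
    proof -
      have "\<rho> k z \<le> (\<Sum>k<n. \<rho> k z)" by (rule member_le_sum[OF k]) (use pou'(3) z in auto)
      then show ?thesis using pou'(3)[OF kn z] pou'(5)[OF z] by simp
    qed
    have supp: "\<rho> k z = 0" if "z \<in> mcarrier Z" "z \<notin> ?K" for z
      by (rule zero_outside_support[OF Z that])
    show ?thesis
    proof (rule chart_integral_has_derivative[OF Z ck K pou'(4)[OF kn] pou'(2)[OF kn] le1 supp f(1)])
      show "smooth_map_on P real_mfd ({-\<epsilon><..<\<epsilon>} \<times> fst (c k)) (\<lambda>(t, z). ?\<omega> t z (map (\<lambda>i. coord_vec Z (c k) i z) ?ks))"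
        by (rule smooth_lagrangian_family[OF f(1,2) _ L ck ks]) (rule f(3))
    qed (assumption | rule frame[OF ck])+
  qed
  from DERIV_sum[of "{..<n}", OF this] show ?thesis unfolding action_def int .
qed

end

theorem mainTheorem1:
  fixes Y :: "('y, nat) mfd" and Z :: "('z, nat) mfd" and \<pi> :: "'y \<Rightarrow> 'z"
    and p r :: nat and A :: "('z, nat) chart set"
    and L :: "('z, 'y) jet \<Rightarrow> ('z, nat) cform"
    and \<upsilon> :: "'z \<Rightarrow> 'y" and \<eta> :: "'z \<Rightarrow> ('y, nat) tvec"
  assumes "fibred_manifold Y Z \<pi>"
    and "smooth_manifold Z p"
    and "compact_space (mtop Z)"
    and "oriented_atlas Z A"
    and "L \<in> semibasic_forms Y Z \<pi> r p"
    and "cross_section Y Z \<pi> \<upsilon>"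
    and "variation Y Z \<pi> \<upsilon> \<eta>"
  shows "has_frechet_derivative_along Y Z \<pi> (action Y Z \<pi> r A L) \<upsilon> \<eta>
    (form_integral Z A (\<lambda>z.
       fibre_diff Y Z \<pi> r L (jet Y Z \<pi> r \<upsilon> z)
         (jet_is_inv Y Z \<pi> r (jet (vert_mfd Y Z \<pi>) Z (\<pi> \<circ> fst) r \<eta> z))))"
proof -
  interpret fibred Y Z \<pi> by unfold_locales (rule assms(1))
  show ?thesis
    unfolding has_frechet_derivative_along_def
    by (intro conjI allI impI family_tangent_to_exists[OF assms(3,6,7)] action_has_derivative[OF assms(2,3,4,5)])
qed

end
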